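(* Let $f:\mathcal{F}\to\mathcal{E}$ and $f':\mathcal{F}'\to\mathcal{E}$ be geometric morphisms of Grothendieck toposes towards the same base topos $\mathcal{E}$. Then there is an equivalence of categories $$\mathbf{Topos}/\mathcal{E}\,([f],[f'])\;\simeq\;\mathbf{Fib}_{\mathcal{E}}^{\mathrm{cart,cov}}\big(((1_{\mathcal{F}'}\downarrow f'^* ),J_{f'}),\,((1_{\mathcal{F}}\downarrow f^* ),J_f)\big),$$ where the right-hand side is the category of morphisms of fibrations $(1_{\mathcal{F}'}\downarrow f'^* )\to(1_{\mathcal{F}}\downarrow f^* )$ over $\mathcal{E}$ which are cartesian (i.e. finite-limit-preserving) at each fibre and cover-preserving.
   Context: $\mathbf{Topos}$ is the 2-category of Grothendieck toposes, geometric morphisms and geometric transformations. $\mathbf{Topos}/\mathcal{E}$ is the (pseudo-)slice: a morphism $[f:\mathcal{F}\to\mathcal{E}]\to[f':\mathcal{F}'\to\mathcal{E}]$ is a geometric morphism $g:\mathcal{F}\to\mathcal{F}'$ with a natural isomorphism $f'\circ g\cong f$; 2-cells are geometric transformations compatible with these isomorphisms. For a geometric morphism $f:\mathcal{F}\to\mathcal{E}$, $(1_{\mathcal{F}}\downarrow f^* )$ is the comma category with objects $(F,E,\alpha:F\to f^*(E))$, $F\in\mathcal{F}$, $E\in\mathcal{E}$, and the obvious arrows (pairs of an arrow in $\mathcal F$ and one in $\mathcal E$ making the square commute). It is fibred over $\mathcal{E}$ by the projection $(F,E,\alpha)\mapsto E$, with fibre $\mathcal{F}/f^*(E)$ at $E$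 and transition functors given by pullback. The relative topology $J_f$ is the Grothendieck topology on $(1_{\mathcal{F}}\downarrow f^* )$ whose covering families are those sent by the projection $(F,E,\alpha)\mapsto F$ to epimorphic families of $\mathcal{F}$. A morphism of fibrations over $\mathcal{E}$ is a functor over $\mathcal{E}$ (up to isomorphism) sending cartesian arrows to cartesian arrows; arrows between such are natural transformations over $\mathcal{E}$. *)

theory Defs
  imports "HOL-Library.FuncSet" "HOL-Library.Equipollence"
begin

section \<open>Categories, functors, natural transformations\<close>

record ('o, 'a) cat =
  Obj :: "'o set"
  Arr :: "'a set"
  Dom :: "'a \<Rightarrow> 'o"
  Cod :: "'a \<Rightarrow> 'o"
  Id :: "'o \<Rightarrow> 'a"
  Comp :: "'a \<Rightarrow> 'a \<Rightarrow> 'a"  (* Comp C g f is "g after f" *)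

definition hom :: "('o, 'a) cat \<Rightarrow> 'o \<Rightarrow> 'o \<Rightarrow> 'a set" where
  "hom C x y = {f \<in> Arr C. Dom C f = x \<and> Cod C f = y}"

locale category =
  fixes C :: "('o, 'a) cat"
  assumes Dom_in_Obj: "f \<in> Arr C \<Longrightarrow> Dom C f \<in> Obj C"
    and Cod_in_Obj: "f \<in> Arr C \<Longrightarrow> Cod C f \<in> Obj C"
    and Id_in_hom: "x \<in> Obj C \<Longrightarrow> Id C x \<in> hom C x x"
    and Comp_in_hom: "f \<in> hom C x y \<Longrightarrow> g \<in> hom C y z \<Longrightarrow> Comp C g f \<in> hom C x z"
    and Comp_Id: "f \<in> hom C x y \<Longrightarrow> Comp C f (Id C x) = f"
    and Id_Comp: "f \<in> hom C x y \<Longrightarrow> Comp C (Id C y) f = f"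
    and Comp_assoc: "f \<in> hom C w x \<Longrightarrow> g \<in> hom C x y \<Longrightarrow> h \<in> hom C y z \<Longrightarrow>
      Comp C h (Comp C g f) = Comp C (Comp C h g) f"

definition iso_arr :: "('o, 'a) cat \<Rightarrow> 'a \<Rightarrow> bool" where
  "iso_arr C f \<longleftrightarrow> f \<in> Arr C \<and>
     (\<exists>g \<in> hom C (Cod C f) (Dom C f).
        Comp C g f = Id C (Dom C f) \<and> Comp C f g = Id C (Cod C f))"

definition op_cat :: "('o, 'a) cat \<Rightarrow> ('o, 'a) cat" where
  "op_cat C = \<lparr>Obj = Obj C, Arr = Arr C, Dom = Cod C, Cod = Dom C, Id = Id C,
     Comp = (\<lambda>g f. Comp C f g)\<rparr>"

definition full_subcat :: "('o, 'a) cat \<Rightarrow> 'o set \<Rightarrow> ('o, 'a) cat" where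
  "full_subcat C X = \<lparr>Obj = Obj C \<inter> X, Arr = {f \<in> Arr C. Dom C f \<in> X \<and> Cod C f \<in> X},
     Dom = Dom C, Cod = Cod C, Id = Id C, Comp = Comp C\<rparr>"

text \<open>The maps underlying a functor are unconstrained off its source category. Functors
  agreeing on the source but not elsewhere are thus distinct yet canonically isomorphic objects
  of a functor category, which is immaterial up to equivalence of categories. Natural
  transformations, in contrast, are required to be extensional, so that equality of arrows
  between functors is equality of components.\<close>

record ('o1, 'a1, 'o2, 'a2) fctr =
  FObj :: "'o1 \<Rightarrow> 'o2"
  FArr :: "'a1 \<Rightarrow> 'a2"

locale cat_functor = C: category C + D: category D
  for C :: "('o1, 'a1) cat" and D :: "('o2, 'a2) cat" +
  fixes F :: "('o1, 'a1, 'o2, 'a2) fctr"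
  assumes FObj_in: "x \<in> Obj C \<Longrightarrow> FObj F x \<in> Obj D"
    and FArr_in_hom: "f \<in> hom C x y \<Longrightarrow> FArr F f \<in> hom D (FObj F x) (FObj F y)"
    and FArr_Id: "x \<in> Obj C \<Longrightarrow> FArr F (Id C x) = Id D (FObj F x)"
    and FArr_Comp: "f \<in> hom C x y \<Longrightarrow> g \<in> hom C y z \<Longrightarrow>
      FArr F (Comp C g f) = Comp D (FArr F g) (FArr F f)"

definition id_fctr :: "('o, 'a, 'o, 'a) fctr" where
  "id_fctr = \<lparr>FObj = (\<lambda>x. x), FArr = (\<lambda>f. f)\<rparr>"

definition comp_fctr ::
  "('o2, 'a2, 'o3, 'a3) fctr \<Rightarrow> ('o1, 'a1, 'o2, 'a2) fctr \<Rightarrow> ('o1, 'a1, 'o3, 'a3) fctr"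
  (infixl "\<circ>\<^sub>F" 55) where
  "G \<circ>\<^sub>F F = \<lparr>FObj = (\<lambda>x. FObj G (FObj F x)), FArr = (\<lambda>f. FArr G (FArr F f))\<rparr>"

locale nat_trans = F: cat_functor C D F + G: cat_functor C D G
  for C :: "('o1, 'a1) cat" and D :: "('o2, 'a2) cat" and F G +
  fixes \<tau> :: "'o1 \<Rightarrow> 'a2"
  assumes component: "x \<in> Obj C \<Longrightarrow> \<tau> x \<in> hom D (FObj F x) (FObj G x)"
    and natural: "f \<in> hom C x y \<Longrightarrow>
      Comp D (\<tau> y) (FArr F f) = Comp D (FArr G f) (\<tau> x)"
    and extensional: "\<tau> \<in> extensional (Obj C)"

locale nat_iso = nat_trans +
  assumes component_iso: "x \<in> Obj C \<Longrightarrow> iso_arr D (\<tau> x)"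

definition functor_cat :: "('o1, 'a1) cat \<Rightarrow> ('o2, 'a2) cat \<Rightarrow>
    (('o1, 'a1, 'o2, 'a2) fctr,
     ('o1, 'a1, 'o2, 'a2) fctr \<times> ('o1, 'a1, 'o2, 'a2) fctr \<times> ('o1 \<Rightarrow> 'a2)) cat" where
  "functor_cat C D = \<lparr>
     Obj = {F. cat_functor C D F},
     Arr = {(F, G, \<tau>). nat_trans C D F G \<tau>},
     Dom = (\<lambda>(F, G, \<tau>). F),
     Cod = (\<lambda>(F, G, \<tau>). G),
     Id = (\<lambda>F. (F, F, \<lambda>x\<in>Obj C. Id D (FObj F x))),
     Comp = (\<lambda>(G, H, \<sigma>) (F, G', \<tau>). (F, H, \<lambda>x\<in>Obj C. Comp D (\<sigma> x) (\<tau> x)))\<rparr>"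

definition equivalent_cats :: "('o1, 'a1) cat \<Rightarrow> ('o2, 'a2) cat \<Rightarrow> bool" where
  "equivalent_cats C D \<longleftrightarrow>
     (\<exists>F G \<eta> \<epsilon>. cat_functor C D F \<and> cat_functor D C G \<and>
        nat_iso C C id_fctr (G \<circ>\<^sub>F F) \<eta> \<and> nat_iso D D (F \<circ>\<^sub>F G) id_fctr \<epsilon>)"

section \<open>Finite limits\<close>

locale cone = K: cat_functor I C K
  for I :: "('i, 'k) cat" and C :: "('o, 'a) cat" and K +
  fixes v :: 'o and \<pi> :: "'i \<Rightarrow> 'a"
  assumes vertex: "v \<in> Obj C"
    and leg: "i \<in> Obj I \<Longrightarrow> \<pi> i \<in> hom C v (FObj K i)"
    and commutes: "a \<in> hom I i j \<Longrightarrow> Comp C (FArr K a) (\<pi> i) = \<pi> j"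

locale limit_cone = cone +
  assumes universal: "cone I C K w \<rho> \<Longrightarrow>
    \<exists>!h. h \<in> hom C w v \<and> (\<forall>i \<in> Obj I. Comp C (\<pi> i) h = \<rho> i)"

text \<open>Every finite category is isomorphic to one whose objects and arrows are natural numbers,
  so these suffice as shapes of finite diagrams.\<close>

definition preserves_finite_limits ::
  "('o1, 'a1) cat \<Rightarrow> ('o2, 'a2) cat \<Rightarrow> ('o1, 'a1, 'o2, 'a2) fctr \<Rightarrow> bool" where
  "preserves_finite_limits C D F \<longleftrightarrow>
     (\<forall>(I :: (nat, nat) cat) K v \<pi>.
        finite (Obj I) \<and> finite (Arr I) \<and> limit_cone I C K v \<pi> \<longrightarrow>
        limit_cone I D (F \<circ>\<^sub>F K) (FObj F v) (\<lambda>i. FArr F (\<pi> i)))"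

section \<open>Sets and Grothendieck toposes\<close>

text \<open>HOL has no category of all sets. It is played by the sets of elements of a type
  \<open>'u\<close> that are strictly smaller than \<open>'u\<close>, where the cardinality of
  \<open>'u\<close> is an infinite regular strong limit. For uncountable \<open>'u\<close> this says
  that the cardinality is inaccessible, i.e. the small sets are, up to bijection, those of a
  Grothendieck universe; for countable \<open>'u\<close> they are those of the universe of
  hereditarily finite sets.\<close>

definition small :: "'u set \<Rightarrow> bool" where
  "small A \<longleftrightarrow> A \<prec> (UNIV :: 'u set)"

definition universe :: "'u itself \<Rightarrow> bool" where
  "universe (_ :: 'u itself) \<longleftrightarrow>
     infinite (UNIV :: 'u set) \<and>
     (\<forall>A :: 'u set. small A \<longrightarrow> Pow A \<prec> (UNIV :: 'u set)) \<and>
     (\<forall>(I :: 'u set) (A :: 'u \<Rightarrow> 'u set).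
        small I \<and> (\<forall>i \<in> I. small (A i)) \<longrightarrow> small (\<Union>i \<in> I. A i))"

type_synonym 'u fn = "'u set \<times> 'u set \<times> ('u \<Rightarrow> 'u)"

definition set_cat :: "('u set, 'u fn) cat" where
  "set_cat = \<lparr>
     Obj = {A. small A},
     Arr = {(A, B, f). small A \<and> small B \<and> f \<in> A \<rightarrow>\<^sub>E B},
     Dom = (\<lambda>(A, B, f). A),
     Cod = (\<lambda>(A, B, f). B),
     Id = (\<lambda>A. (A, A, \<lambda>a\<in>A. a)),
     Comp = (\<lambda>(B, D, g) (A, B', f). (A, D, compose A g f))\<rparr>"

definition sieve :: "('o, 'a) cat \<Rightarrow> 'o \<Rightarrow> 'a set \<Rightarrow> bool" where
  "sieve C c S \<longleftrightarrow> S \<subseteq> {f \<in> Arr C. Cod C f = c} \<and>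
     (\<forall>f \<in> S. \<forall>g \<in> Arr C. Cod C g = Dom C f \<longrightarrow> Comp C f g \<in> S)"

definition pullback_sieve :: "('o, 'a) cat \<Rightarrow> 'a \<Rightarrow> 'a set \<Rightarrow> 'a set" where
  "pullback_sieve C h S = {g \<in> Arr C. Cod C g = Dom C h \<and> Comp C h g \<in> S}"

locale grothendieck_topology = category C
  for C :: "('o, 'a) cat" +
  fixes J :: "'o \<Rightarrow> 'a set set"
  assumes covering_sieve: "c \<in> Obj C \<Longrightarrow> S \<in> J c \<Longrightarrow> sieve C c S"
    and maximal: "c \<in> Obj C \<Longrightarrow> {f \<in> Arr C. Cod C f = c} \<in> J c"
    and stable: "h \<in> hom C d c \<Longrightarrow> S \<in> J c \<Longrightarrow> pullback_sieve C h S \<in> J d"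
    and transitive: "c \<in> Obj C \<Longrightarrow> S \<in> J c \<Longrightarrow> sieve C c R \<Longrightarrow>
      (\<And>h. h \<in> S \<Longrightarrow> pullback_sieve C h R \<in> J (Dom C h)) \<Longrightarrow> R \<in> J c"

definition restr :: "('o, 'a, 'u set, 'u fn) fctr \<Rightarrow> 'a \<Rightarrow> 'u \<Rightarrow> 'u" where
  "restr P f = snd (snd (FArr P f))"

definition matching_family ::
  "('o, 'a) cat \<Rightarrow> ('o, 'a, 'u set, 'u fn) fctr \<Rightarrow> 'a set \<Rightarrow> ('a \<Rightarrow> 'u) \<Rightarrow> bool" where
  "matching_family C P S s \<longleftrightarrow>
     (\<forall>f \<in> S. s f \<in> FObj P (Dom C f) \<and>
        (\<forall>g \<in> Arr C. Cod C g = Dom C f \<longrightarrow> restr P g (s f) = s (Comp C f g)))"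

definition is_sheaf ::
  "('o, 'a) cat \<Rightarrow> ('o \<Rightarrow> 'a set set) \<Rightarrow> ('o, 'a, 'u set, 'u fn) fctr \<Rightarrow> bool" where
  "is_sheaf C J P \<longleftrightarrow> cat_functor (op_cat C) set_cat P \<and>
     (\<forall>c \<in> Obj C. \<forall>S \<in> J c. \<forall>s. matching_family C P S s \<longrightarrow>
        (\<exists>!y. y \<in> FObj P c \<and> (\<forall>f \<in> S. restr P f y = s f)))"

definition sheaf_cat :: "('o, 'a) cat \<Rightarrow> ('o \<Rightarrow> 'a set set) \<Rightarrow>
    (('o, 'a, 'u set, 'u fn) fctr,
     ('o, 'a, 'u set, 'u fn) fctr \<times> ('o, 'a, 'u set, 'u fn) fctr \<times> ('o \<Rightarrow> 'u fn)) cat" where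
  "sheaf_cat C J = full_subcat (functor_cat (op_cat C) set_cat) {P. is_sheaf C J P}"

definition grothendieck_topos :: "'u itself \<Rightarrow> ('o, 'a) cat \<Rightarrow> bool" where
  "grothendieck_topos (_ :: 'u itself) E \<longleftrightarrow>
     (\<exists>(C :: ('u, 'u) cat) J. small (Obj C) \<and> small (Arr C) \<and> grothendieck_topology C J \<and>
        equivalent_cats E
          (sheaf_cat C J :: (('u, 'u, 'u set, 'u fn) fctr,
             ('u, 'u, 'u set, 'u fn) fctr \<times> ('u, 'u, 'u set, 'u fn) fctr \<times> ('u \<Rightarrow> 'u fn)) cat))"

section \<open>Geometric morphisms and the slice of toposes\<close>

record ('of, 'af, 'oe, 'ae) geom =
  inv_im :: "('oe, 'ae, 'of, 'af) fctr"
  dir_im :: "('of, 'af, 'oe, 'ae) fctr"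
  unit :: "'oe \<Rightarrow> 'ae"
  counit :: "'of \<Rightarrow> 'af"

locale geometric_morphism =
  unit: nat_trans E E id_fctr "dir_im f \<circ>\<^sub>F inv_im f" "unit f" +
  counit: nat_trans F F "inv_im f \<circ>\<^sub>F dir_im f" id_fctr "counit f" +
  inv_im: cat_functor E F "inv_im f" +
  dir_im: cat_functor F E "dir_im f"
  for F :: "('of, 'af) cat" and E :: "('oe, 'ae) cat" and f :: "('of, 'af, 'oe, 'ae) geom" +
  assumes triangle_inv_im: "e \<in> Obj E \<Longrightarrow>
      Comp F (counit f (FObj (inv_im f) e)) (FArr (inv_im f) (unit f e)) =
      Id F (FObj (inv_im f) e)"
    and triangle_dir_im: "x \<in> Obj F \<Longrightarrow>
      Comp E (FArr (dir_im f) (counit f x)) (unit f (FObj (dir_im f) x)) =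
      Id E (FObj (dir_im f) x)"
    and inv_im_lex: "preserves_finite_limits E F (inv_im f)"

text \<open>The composite \<open>f' \<circ> g\<close> of \<open>g : F \<rightarrow> F'\<close> and
  \<open>f' : F' \<rightarrow> E\<close>.\<close>

definition comp_geom :: "('of, 'af) cat \<Rightarrow> ('oe, 'ae) cat \<Rightarrow>
    ('og, 'ag, 'oe, 'ae) geom \<Rightarrow> ('of, 'af, 'og, 'ag) geom \<Rightarrow> ('of, 'af, 'oe, 'ae) geom" where
  "comp_geom F E f' g = \<lparr>
     inv_im = inv_im g \<circ>\<^sub>F inv_im f',
     dir_im = dir_im f' \<circ>\<^sub>F dir_im g,
     unit = (\<lambda>e\<in>Obj E.
       Comp E (FArr (dir_im f') (unit g (FObj (inv_im f') e))) (unit f' e)),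
     counit = (\<lambda>x\<in>Obj F.
       Comp F (counit g x) (FArr (inv_im g) (counit f' (FObj (dir_im g) x))))\<rparr>"

text \<open>Geometric transformations \<open>g \<Rightarrow> h\<close> are natural transformations between the
  inverse image functors, in the same direction.\<close>

definition geom_trans :: "('of, 'af) cat \<Rightarrow> ('oe, 'ae) cat \<Rightarrow>
    ('of, 'af, 'oe, 'ae) geom \<Rightarrow> ('of, 'af, 'oe, 'ae) geom \<Rightarrow> ('oe \<Rightarrow> 'af) \<Rightarrow> bool" where
  "geom_trans F E g h \<tau> \<longleftrightarrow> nat_trans E F (inv_im g) (inv_im h) \<tau>"

definition geom_iso :: "('of, 'af) cat \<Rightarrow> ('oe, 'ae) cat \<Rightarrow>
    ('of, 'af, 'oe, 'ae) geom \<Rightarrow> ('of, 'af, 'oe, 'ae) geom \<Rightarrow> ('oe \<Rightarrow> 'af) \<Rightarrow> bool" where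
  "geom_iso F E g h \<tau> \<longleftrightarrow> nat_iso E F (inv_im g) (inv_im h) \<tau>"

definition slice_obj :: "('of, 'af) cat \<Rightarrow> ('og, 'ag) cat \<Rightarrow> ('oe, 'ae) cat \<Rightarrow>
    ('of, 'af, 'oe, 'ae) geom \<Rightarrow> ('og, 'ag, 'oe, 'ae) geom \<Rightarrow>
    (('of, 'af, 'og, 'ag) geom \<times> ('oe \<Rightarrow> 'af)) set" where
  "slice_obj F F' E f f' =
     {(g, \<phi>). geometric_morphism F F' g \<and> geom_iso F E (comp_geom F E f' g) f \<phi>}"

text \<open>The hom-category of the slice over \<open>E\<close> from
  \<open>f : F \<rightarrow> E\<close> to \<open>f' : F' \<rightarrow> E\<close>. The compatibility
  condition is \<open>\<psi> \<circ> (\<alpha> whiskered with f') = \<phi>\<close> as geometric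
  transformations.\<close>

definition topos_slice_hom :: "('of, 'af) cat \<Rightarrow> ('og, 'ag) cat \<Rightarrow> ('oe, 'ae) cat \<Rightarrow>
    ('of, 'af, 'oe, 'ae) geom \<Rightarrow> ('og, 'ag, 'oe, 'ae) geom \<Rightarrow>
    (('of, 'af, 'og, 'ag) geom \<times> ('oe \<Rightarrow> 'af),
     (('of, 'af, 'og, 'ag) geom \<times> ('oe \<Rightarrow> 'af)) \<times>
     (('of, 'af, 'og, 'ag) geom \<times> ('oe \<Rightarrow> 'af)) \<times> ('og \<Rightarrow> 'af)) cat" where
  "topos_slice_hom F F' E f f' = \<lparr>
     Obj = slice_obj F F' E f f',
     Arr = {((g, \<phi>), (h, \<psi>), \<alpha>).
       (g, \<phi>) \<in> slice_obj F F' E f f' \<and> (h, \<psi>) \<in> slice_obj F F' E f f' \<and>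
       geom_trans F F' g h \<alpha> \<and>
       (\<forall>e \<in> Obj E. Comp F (\<psi> e) (\<alpha> (FObj (inv_im f') e)) = \<phi> e)},
     Dom = (\<lambda>(x, y, \<alpha>). x),
     Cod = (\<lambda>(x, y, \<alpha>). y),
     Id = (\<lambda>(g, \<phi>). ((g, \<phi>), (g, \<phi>), \<lambda>x\<in>Obj F'. Id F (FObj (inv_im g) x))),
     Comp = (\<lambda>(y, z, \<beta>) (x, y', \<alpha>). (x, z, \<lambda>c\<in>Obj F'. Comp F (\<beta> c) (\<alpha> c)))\<rparr>"

section \<open>Fibrations over a base category\<close>

definition cartesian_arr :: "('x, 'b) cat \<Rightarrow> ('o, 'a) cat \<Rightarrow> ('x, 'b, 'o, 'a) fctr \<Rightarrow> 'b \<Rightarrow> bool"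
  where
  "cartesian_arr X E p a \<longleftrightarrow> a \<in> Arr X \<and>
     (\<forall>b e. b \<in> Arr X \<and> Cod X b = Cod X a \<and>
        e \<in> hom E (FObj p (Dom X b)) (FObj p (Dom X a)) \<and>
        Comp E (FArr p a) e = FArr p b \<longrightarrow>
        (\<exists>!c. c \<in> hom X (Dom X b) (Dom X a) \<and> Comp X a c = b \<and> FArr p c = e))"

definition fibre :: "('x, 'b) cat \<Rightarrow> ('o, 'a) cat \<Rightarrow> ('x, 'b, 'o, 'a) fctr \<Rightarrow> 'o \<Rightarrow> ('x, 'b) cat"
  where
  "fibre X E p e = \<lparr>
     Obj = {x \<in> Obj X. FObj p x = e},
     Arr = {u \<in> Arr X. FObj p (Dom X u) = e \<and> FObj p (Cod X u) = e \<and> FArr p u = Id E e},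
     Dom = Dom X, Cod = Cod X, Id = Id X, Comp = Comp X\<rparr>"

text \<open>The fibre up to isomorphism: objects lying over \<open>e\<close> via a specified
  isomorphism, and the arrows compatible with these. For a fibration, the inclusion of the
  fibre (with identities as the isomorphisms) is an equivalence, since objects can be
  reindexed along isomorphisms of the base. It is needed because a morphism of fibrations that
  lies over the base only up to an isomorphism maps the fibre at \<open>e\<close> not into the
  fibre but into the essential fibre.\<close>

definition ess_fibre :: "('x, 'b) cat \<Rightarrow> ('o, 'a) cat \<Rightarrow> ('x, 'b, 'o, 'a) fctr \<Rightarrow> 'o \<Rightarrow>
    ('x \<times> 'a, ('x \<times> 'a) \<times> ('x \<times> 'a) \<times> 'b) cat" where
  "ess_fibre X E p e = \<lparr>
     Obj = {(x, i). x \<in> Obj X \<and> i \<in> hom E (FObj p x) e \<and> iso_arr E i},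
     Arr = {((x, i), (y, j), u). x \<in> Obj X \<and> i \<in> hom E (FObj p x) e \<and> iso_arr E i \<and>
       y \<in> Obj X \<and> j \<in> hom E (FObj p y) e \<and> iso_arr E j \<and>
       u \<in> hom X x y \<and> Comp E j (FArr p u) = i},
     Dom = (\<lambda>(s, t, u). s),
     Cod = (\<lambda>(s, t, u). t),
     Id = (\<lambda>(x, i). ((x, i), (x, i), Id X x)),
     Comp = (\<lambda>(t, r, w) (s, t', u). (s, r, Comp X w u))\<rparr>"

definition fibre_fctr :: "('y, 'c) cat \<Rightarrow> ('y, 'c, 'x, 'b) fctr \<Rightarrow> ('y \<Rightarrow> 'a) \<Rightarrow>
    ('y, 'c, 'x \<times> 'a, ('x \<times> 'a) \<times> ('x \<times> 'a) \<times> 'b) fctr" where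
  "fibre_fctr Y A \<theta> = \<lparr>
     FObj = (\<lambda>y. (FObj A y, \<theta> y)),
     FArr = (\<lambda>u. ((FObj A (Dom Y u), \<theta> (Dom Y u)), (FObj A (Cod Y u), \<theta> (Cod Y u)), FArr A u))\<rparr>"

text \<open>Morphisms from \<open>q : Y \<rightarrow> E\<close> to \<open>p : X \<rightarrow> E\<close> are pairs of a
  functor \<open>A : Y \<rightarrow> X\<close> and an isomorphism
  \<open>\<theta> : p \<circ> A \<cong> q\<close>.\<close>

locale fib_morphism =
  A: cat_functor Y X A + over: nat_iso Y E "p \<circ>\<^sub>F A" q \<theta> +
  p: cat_functor X E p + q: cat_functor Y E q
  for E :: "('o, 'a) cat" and Y :: "('y, 'c) cat" and q and X :: "('x, 'b) cat" and p
    and A :: "('y, 'c, 'x, 'b) fctr" and \<theta> :: "'y \<Rightarrow> 'a" +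
  assumes cartesian: "cartesian_arr Y E q a \<Longrightarrow> cartesian_arr X E p (FArr A a)"

text \<open>Coverings are given as covering families: \<open>J x S\<close> means that the family
  \<open>S\<close> of arrows with codomain \<open>x\<close> is covering.\<close>

definition cover_preserving :: "('y \<Rightarrow> 'c set \<Rightarrow> bool) \<Rightarrow> ('x \<Rightarrow> 'b set \<Rightarrow> bool) \<Rightarrow>
    ('y, 'c, 'x, 'b) fctr \<Rightarrow> bool" where
  "cover_preserving K J A \<longleftrightarrow> (\<forall>y S. K y S \<longrightarrow> J (FObj A y) (FArr A ` S))"

definition fib_cart_cov_obj :: "('o, 'a) cat \<Rightarrow>
    ('y, 'c) cat \<Rightarrow> ('y, 'c, 'o, 'a) fctr \<Rightarrow> ('y \<Rightarrow> 'c set \<Rightarrow> bool) \<Rightarrow>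
    ('x, 'b) cat \<Rightarrow> ('x, 'b, 'o, 'a) fctr \<Rightarrow> ('x \<Rightarrow> 'b set \<Rightarrow> bool) \<Rightarrow>
    (('y, 'c, 'x, 'b) fctr \<times> ('y \<Rightarrow> 'a)) set" where
  "fib_cart_cov_obj E Y q K X p J =
     {(A, \<theta>). fib_morphism E Y q X p A \<theta> \<and>
        (\<forall>e \<in> Obj E. preserves_finite_limits (fibre Y E q e) (ess_fibre X E p e) (fibre_fctr Y A \<theta>)) \<and>
        cover_preserving K J A}"

definition fib_cart_cov :: "('o, 'a) cat \<Rightarrow>
    ('y, 'c) cat \<Rightarrow> ('y, 'c, 'o, 'a) fctr \<Rightarrow> ('y \<Rightarrow> 'c set \<Rightarrow> bool) \<Rightarrow>
    ('x, 'b) cat \<Rightarrow> ('x, 'b, 'o, 'a) fctr \<Rightarrow> ('x \<Rightarrow> 'b set \<Rightarrow> bool) \<Rightarrow>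
    (('y, 'c, 'x, 'b) fctr \<times> ('y \<Rightarrow> 'a),
     (('y, 'c, 'x, 'b) fctr \<times> ('y \<Rightarrow> 'a)) \<times> (('y, 'c, 'x, 'b) fctr \<times> ('y \<Rightarrow> 'a)) \<times>
     ('y \<Rightarrow> 'b)) cat" where
  "fib_cart_cov E Y q K X p J = \<lparr>
     Obj = fib_cart_cov_obj E Y q K X p J,
     Arr = {((A, \<theta>), (B, \<zeta>), \<tau>).
       (A, \<theta>) \<in> fib_cart_cov_obj E Y q K X p J \<and> (B, \<zeta>) \<in> fib_cart_cov_obj E Y q K X p J \<and>
       nat_trans Y X A B \<tau> \<and>
       (\<forall>y \<in> Obj Y. Comp E (\<zeta> y) (FArr p (\<tau> y)) = \<theta> y)},
     Dom = (\<lambda>(s, t, \<tau>). s),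
     Cod = (\<lambda>(s, t, \<tau>). t),
     Id = (\<lambda>(A, \<theta>). ((A, \<theta>), (A, \<theta>), \<lambda>y\<in>Obj Y. Id X (FObj A y))),
     Comp = (\<lambda>(t, r, \<sigma>) (s, t', \<tau>). (s, r, \<lambda>y\<in>Obj Y. Comp X (\<sigma> y) (\<tau> y)))\<rparr>"

section \<open>The comma category and the relative topology\<close>

type_synonym ('of, 'af, 'oe) comma_obj = "'of \<times> 'oe \<times> 'af"
type_synonym ('of, 'af, 'oe, 'ae) comma_arr =
  "('of, 'af, 'oe) comma_obj \<times> ('of, 'af, 'oe) comma_obj \<times> ('af \<times> 'ae)"

definition comma_objs :: "('of, 'af) cat \<Rightarrow> ('oe, 'ae) cat \<Rightarrow> ('oe, 'ae, 'of, 'af) fctr \<Rightarrow>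
    ('of, 'af, 'oe) comma_obj set" where
  "comma_objs F E G = {(x, e, \<alpha>). x \<in> Obj F \<and> e \<in> Obj E \<and> \<alpha> \<in> hom F x (FObj G e)}"

text \<open>The comma category \<open>(1 \<down> G)\<close> for a functor
  \<open>G : E \<rightarrow> F\<close>.\<close>

definition comma_cat :: "('of, 'af) cat \<Rightarrow> ('oe, 'ae) cat \<Rightarrow> ('oe, 'ae, 'of, 'af) fctr \<Rightarrow>
    (('of, 'af, 'oe) comma_obj, ('of, 'af, 'oe, 'ae) comma_arr) cat" where
  "comma_cat F E G = \<lparr>
     Obj = comma_objs F E G,
     Arr = {((x, e, \<alpha>), (y, d, \<beta>), (u, v)).
       (x, e, \<alpha>) \<in> comma_objs F E G \<and> (y, d, \<beta>) \<in> comma_objs F E G \<and>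
       u \<in> hom F x y \<and> v \<in> hom E e d \<and> Comp F \<beta> u = Comp F (FArr G v) \<alpha>},
     Dom = (\<lambda>(s, t, w). s),
     Cod = (\<lambda>(s, t, w). t),
     Id = (\<lambda>(x, e, \<alpha>). ((x, e, \<alpha>), (x, e, \<alpha>), (Id F x, Id E e))),
     Comp = (\<lambda>(t, r, (u', v')) (s, t', (u, v)). (s, r, (Comp F u' u, Comp E v' v)))\<rparr>"

definition comma_left :: "(('of, 'af, 'oe) comma_obj, ('of, 'af, 'oe, 'ae) comma_arr, 'of, 'af) fctr"
  where
  "comma_left = \<lparr>FObj = (\<lambda>(x, e, \<alpha>). x), FArr = (\<lambda>(s, t, (u, v)). u)\<rparr>"

definition comma_right :: "(('of, 'af, 'oe) comma_obj, ('of, 'af, 'oe, 'ae) comma_arr, 'oe, 'ae) fctr"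
  where
  "comma_right = \<lparr>FObj = (\<lambda>(x, e, \<alpha>). e), FArr = (\<lambda>(s, t, (u, v)). v)\<rparr>"

definition epimorphic_family :: "('o, 'a) cat \<Rightarrow> 'o \<Rightarrow> 'a set \<Rightarrow> bool" where
  "epimorphic_family C c S \<longleftrightarrow> c \<in> Obj C \<and> S \<subseteq> {f \<in> Arr C. Cod C f = c} \<and>
     (\<forall>d h k. h \<in> hom C c d \<and> k \<in> hom C c d \<and> (\<forall>f \<in> S. Comp C h f = Comp C k f) \<longrightarrow> h = k)"

definition relative_topology :: "('of, 'af) cat \<Rightarrow> ('oe, 'ae) cat \<Rightarrow> ('of, 'af, 'oe, 'ae) geom \<Rightarrow>
    ('of, 'af, 'oe) comma_obj \<Rightarrow> ('of, 'af, 'oe, 'ae) comma_arr set \<Rightarrow> bool" where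
  "relative_topology F E f x S \<longleftrightarrow>
     x \<in> Obj (comma_cat F E (inv_im f)) \<and>
     S \<subseteq> {a \<in> Arr (comma_cat F E (inv_im f)). Cod (comma_cat F E (inv_im f)) a = x} \<and>
     (let p = comma_left in epimorphic_family F (FObj p x) (FArr p ` S))"

end

(* A geometric morphism over the base, with inverse image g and 2-isomorphism phi, induces the
   morphism of fibrations (x, e, alpha) |-> (g x, e, phi_e o g alpha).  Evaluating at the objects
   (x, 1, !) recovers g, which makes this assignment fully faithful.  For essential surjectivity,
   let A be a cartesian cover-preserving morphism of fibrations and let g x be the left part of
   A(x, 1, !).  The arrow (x, e, alpha) -> (x, 1, !) with identity left part is covering, so its
   image A(x, e, alpha) -> A(x, 1, !) has an epimorphic left part m.  The diagonal of (x, e, alpha)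
   into the pullback (x, e * e, (alpha, alpha)) of this arrow with itself is covering as well, so
   m is also monomorphic, hence an isomorphism because toposes are balanced: A is determined by g
   and by its values on the fibrewise terminal objects.  The functor g is left exact, because it is
   the restriction of A to the fibre over 1, and preserves epimorphic families.  Consequently the
   presheaf Hom(g -, x) is a sheaf; it is representable by its values on sheafified
   representables, which gives the right adjoint of g. *)
theory Submission
  imports Defs
begin

section \<open>Categories and equivalences\<close>

text \<open>The arrow (x, e, \<alpha>) -> (x, 1, !) lies in no fibre, whereas \<open>A\<close>
  preserves finite limits only inside fibres; so its kernel pair cannot simply be carried over by
  \<open>A\<close>. The remedy is to reindex the whole diagram to e * e along cartesian arrows,
  which \<open>A\<close> also respects. The 2-isomorphism attached to g comes from the terminal
  object of the fibre over e: its image is again terminal in the essential fibre, so its structure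
  arrow is invertible. As \<open>A\<close> lies over \<open>E\<close> only up to
  \<open>\<theta>\<close>, every such arrow is corrected by \<open>\<theta>\<close>. A second
  obstacle is size: sheaves take values in subsets of \<open>'u\<close>, but those constructed here
  consist of relations, pairs or arrows of a topos. They are treated over arbitrary types and
  encoded in \<open>'u\<close> once they are known to be small. Exactness properties are proved for
  sheaves on a small site and then moved along fully faithful and essentially surjective
  functors.\<close>

lemma hom_iff: "f \<in> hom C x y \<longleftrightarrow> f \<in> Arr C \<and> Dom C f = x \<and> Cod C f = y"
  by (simp add: hom_def)

context category begin

lemma Comp_arr [simp]:
  assumes "f \<in> Arr C" "g \<in> Arr C" "Cod C f = Dom C g"
  shows "Comp C g f \<in> Arr C" "Dom C (Comp C g f) = Dom C f" "Cod C (Comp C g f) = Cod C g"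
  using Comp_in_hom[of f "Dom C f" "Cod C f" g "Cod C g"] assms by (auto simp: hom_iff)

lemma Id_arr [simp]:
  assumes "x \<in> Obj C"
  shows "Id C x \<in> Arr C" "Dom C (Id C x) = x" "Cod C (Id C x) = x"
  using Id_in_hom[of x] assms by (auto simp: hom_iff)

lemma Comp_Id_arr [simp]: "f \<in> Arr C \<Longrightarrow> Dom C f = x \<Longrightarrow> Comp C f (Id C x) = f"
  using Comp_Id[of f] by (auto simp: hom_iff)

lemma Id_Comp_arr [simp]: "f \<in> Arr C \<Longrightarrow> Cod C f = x \<Longrightarrow> Comp C (Id C x) f = f"
  using Id_Comp[of f] by (auto simp: hom_iff)

lemma assoc:
  assumes "f \<in> Arr C" "g \<in> Arr C" "h \<in> Arr C" "Cod C f = Dom C g" "Cod C g = Dom C h"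
  shows "Comp C (Comp C h g) f = Comp C h (Comp C g f)"
  using Comp_assoc[of f "Dom C f" "Cod C f" g "Cod C g" h "Cod C h"] assms by (auto simp: hom_iff)

lemma Obj_arr [simp]: "f \<in> Arr C \<Longrightarrow> Dom C f \<in> Obj C" "f \<in> Arr C \<Longrightarrow> Cod C f \<in> Obj C"
  using Dom_in_Obj Cod_in_Obj by auto

end

context cat_functor begin

lemma FArr_arr [simp]:
  assumes "f \<in> Arr C"
  shows "FArr F f \<in> Arr D" "Dom D (FArr F f) = FObj F (Dom C f)"
    "Cod D (FArr F f) = FObj F (Cod C f)"
  using FArr_in_hom[of f "Dom C f" "Cod C f"] assms by (auto simp: hom_iff)

lemma FArr_Comp_arr:
  "f \<in> Arr C \<Longrightarrow> g \<in> Arr C \<Longrightarrow> Cod C f = Dom C g \<Longrightarrow>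
    FArr F (Comp C g f) = Comp D (FArr F g) (FArr F f)"
  using FArr_Comp[of f "Dom C f" "Cod C f" g "Cod C g"] by (auto simp: hom_iff)

declare FObj_in [simp] FArr_Id [simp]

end

lemma cat_functor_id: "category C \<Longrightarrow> cat_functor C C id_fctr"
  by (simp add: cat_functor_def cat_functor_axioms_def id_fctr_def)

lemma FObj_id [simp]: "FObj id_fctr x = x" and FArr_id [simp]: "FArr id_fctr a = a"
  by (simp_all add: id_fctr_def)

lemma FObj_comp [simp]: "FObj (G \<circ>\<^sub>F F) x = FObj G (FObj F x)"
  and FArr_comp [simp]: "FArr (G \<circ>\<^sub>F F) a = FArr G (FArr F a)"
  by (simp_all add: comp_fctr_def)

lemma cat_functor_comp:
  assumes "cat_functor C D F" "cat_functor D E G"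
  shows "cat_functor C E (G \<circ>\<^sub>F F)"
proof -
  interpret F: cat_functor C D F by fact
  interpret G: cat_functor D E G by fact
  show ?thesis
    by unfold_locales (auto simp: hom_iff F.FArr_Comp_arr G.FArr_Comp_arr)
qed

definition inverse_arr :: "('o, 'a) cat \<Rightarrow> 'a \<Rightarrow> 'a" where
  "inverse_arr C f = (SOME g. g \<in> hom C (Cod C f) (Dom C f) \<and>
     Comp C g f = Id C (Dom C f) \<and> Comp C f g = Id C (Cod C f))"

lemma inverse_arr:
  assumes "iso_arr C f"
  shows "f \<in> Arr C" "inverse_arr C f \<in> Arr C"
    "Dom C (inverse_arr C f) = Cod C f" "Cod C (inverse_arr C f) = Dom C f"
    "Comp C (inverse_arr C f) f = Id C (Dom C f)" "Comp C f (inverse_arr C f) = Id C (Cod C f)"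
proof -
  have "inverse_arr C f \<in> hom C (Cod C f) (Dom C f) \<and>
     Comp C (inverse_arr C f) f = Id C (Dom C f) \<and> Comp C f (inverse_arr C f) = Id C (Cod C f)"
    unfolding inverse_arr_def using assms
 by - (rule someI_ex, auto simp: iso_arr_def)
  then show "f \<in> Arr C" "inverse_arr C f \<in> Arr C"
    "Dom C (inverse_arr C f) = Cod C f" "Cod C (inverse_arr C f) = Dom C f"
    "Comp C (inverse_arr C f) f = Id C (Dom C f)" "Comp C f (inverse_arr C f) = Id C (Cod C f)"
    using assms by (auto simp: hom_iff iso_arr_def)
qed

lemma iso_arrI:
  assumes "f \<in> hom C x y" "g \<in> hom C y x" "Comp C g f = Id C x" "Comp C f g = Id C y"
  shows "iso_arr C f"
  using assms by (auto simp: iso_arr_def hom_iff)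

lemma iso_inverse_arr: "iso_arr C f \<Longrightarrow> iso_arr C (inverse_arr C f)"
  using inverse_arr[of C f] by (intro iso_arrI[where g = f]) (auto simp: hom_iff)

context category begin

lemma iso_Id: "x \<in> Obj C \<Longrightarrow> iso_arr C (Id C x)"
  by (rule iso_arrI[where g = "Id C x"]) (auto simp: hom_iff)

lemma Comp_inverse_cancel:
  assumes "iso_arr C f" "g \<in> Arr C"
  shows "Cod C g = Dom C f \<Longrightarrow> Comp C (inverse_arr C f) (Comp C f g) = g"
    and "Cod C g = Cod C f \<Longrightarrow> Comp C f (Comp C (inverse_arr C f) g) = g"
    and "Dom C g = Cod C f \<Longrightarrow> Comp C (Comp C g f) (inverse_arr C f) = g"
    and "Dom C g = Dom C f \<Longrightarrow> Comp C (Comp C g (inverse_arr C f)) f = g"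
  using inverse_arr[OF assms(1)] assms(2)
  by (simp_all flip: assoc) (simp_all add: assoc)

lemma iso_Comp:
  assumes "iso_arr C f" "iso_arr C g" "Cod C f = Dom C g"
  shows "iso_arr C (Comp C g f)"
proof -
  note f = inverse_arr[OF assms(1)] and g = inverse_arr[OF assms(2)]
  have "Comp C (Comp C (inverse_arr C f) (inverse_arr C g)) (Comp C g f) = Id C (Dom C f)"
    using f g assms(3) by (simp add: assoc Comp_inverse_cancel[OF assms(2)])
  moreover have "Comp C (Comp C g f) (Comp C (inverse_arr C f) (inverse_arr C g)) = Id C (Cod C g)"
    using f g assms(3) by (simp add: assoc Comp_inverse_cancel[OF assms(1)])
  ultimately show ?thesis
    using f g assms(3)
    by (intro iso_arrI[where g = "Comp C (inverse_arr C f) (inverse_arr C g)"]) (auto simp: hom_iff)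
qed

lemma iso_cancel_left:
  assumes "iso_arr C f" "g \<in> Arr C" "h \<in> Arr C" "Cod C g = Dom C f" "Cod C h = Dom C f"
    "Comp C f g = Comp C f h"
  shows "g = h"
  using Comp_inverse_cancel(1)[OF assms(1)] assms by metis

lemma iso_cancel_right:
  assumes "iso_arr C f" "g \<in> Arr C" "h \<in> Arr C" "Dom C g = Cod C f" "Dom C h = Cod C f"
    "Comp C g f = Comp C h f"
  shows "g = h"
  using Comp_inverse_cancel(3)[OF assms(1)] assms by metis

end

lemma (in cat_functor) iso_FArr:
  assumes "iso_arr C f"
  shows "iso_arr D (FArr F f)" 
    and "Comp D (FArr F (inverse_arr C f)) (FArr F f) = Id D (FObj F (Dom C f))"
    and "Comp D (FArr F f) (FArr F (inverse_arr C f)) = Id D (FObj F (Cod C f))"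
proof -
  note i = inverse_arr[OF assms]
  show 1: "Comp D (FArr F (inverse_arr C f)) (FArr F f) = Id D (FObj F (Dom C f))"
    and 2: "Comp D (FArr F f) (FArr F (inverse_arr C f)) = Id D (FObj F (Cod C f))"
    using i by (simp_all flip: FArr_Comp_arr)
  show "iso_arr D (FArr F f)"
    using i 1 2
 by - (rule iso_arrI[where g = "FArr F (inverse_arr C f)"], auto simp: hom_iff)
qed

text \<open>Fully faithful, essentially surjective functors. Transport arguments need a single
  functor and lifts of arrows, so they are run with this notion; two conversions below relate it to
  \<open>equivalent_cats\<close>.\<close>

definition weak_equivalence :: "('o1, 'a1) cat \<Rightarrow> ('o2, 'a2) cat \<Rightarrow> ('o1, 'a1, 'o2, 'a2) fctr \<Rightarrow> bool"
  where
  "weak_equivalence C D F \<longleftrightarrow> cat_functor C D F \<and>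
     (\<forall>x \<in> Obj C. \<forall>y \<in> Obj C. \<forall>g \<in> hom D (FObj F x) (FObj F y). \<exists>f \<in> hom C x y. FArr F f = g) \<and>
     (\<forall>x y. inj_on (FArr F) (hom C x y)) \<and>
     (\<forall>d \<in> Obj D. \<exists>c \<in> Obj C. \<exists>i \<in> hom D (FObj F c) d. iso_arr D i)"

lemma nat_transI:
  assumes "cat_functor C D F" "cat_functor C D G"
    and "\<And>x. x \<in> Obj C \<Longrightarrow> \<tau> x \<in> hom D (FObj F x) (FObj G x)"
    and "\<And>f. f \<in> Arr C \<Longrightarrow> Comp D (\<tau> (Cod C f)) (FArr F f) = Comp D (FArr G f) (\<tau> (Dom C f))"
    and "\<tau> \<in> extensional (Obj C)"
  shows "nat_trans C D F G \<tau>"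
  using assms by (auto simp: nat_trans_def nat_trans_axioms_def hom_iff)

lemma nat_transD:
  assumes "nat_trans C D F G \<tau>"
  shows "cat_functor C D F" "cat_functor C D G"
    and "\<And>x. x \<in> Obj C \<Longrightarrow> \<tau> x \<in> Arr D"
    and "\<And>x. x \<in> Obj C \<Longrightarrow> Dom D (\<tau> x) = FObj F x"
    and "\<And>x. x \<in> Obj C \<Longrightarrow> Cod D (\<tau> x) = FObj G x"
    and "\<And>f. f \<in> Arr C \<Longrightarrow> Comp D (\<tau> (Cod C f)) (FArr F f) = Comp D (FArr G f) (\<tau> (Dom C f))"
    and "\<tau> \<in> extensional (Obj C)"
  using assms by (auto simp: nat_trans_def nat_trans_axioms_def hom_iff)

lemma nat_isoI:
  "nat_trans C D F G \<tau> \<Longrightarrow> (\<And>x. x \<in> Obj C \<Longrightarrow> iso_arr D (\<tau> x)) \<Longrightarrow> nat_iso C D F G \<tau>"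
  by (simp add: nat_iso_def nat_iso_axioms_def)

lemma nat_isoD:
  assumes "nat_iso C D F G \<tau>"
  shows "nat_trans C D F G \<tau>" "\<And>x. x \<in> Obj C \<Longrightarrow> iso_arr D (\<tau> x)"
  using assms by (simp_all add: nat_iso_def nat_iso_axioms_def)

lemma nat_iso_inverse:
  assumes "nat_iso C D F G \<tau>"
  shows "nat_iso C D G F (\<lambda>x\<in>Obj C. inverse_arr D (\<tau> x))"
proof -
  note t = nat_transD[OF nat_isoD(1)[OF assms]] and i = nat_isoD(2)[OF assms]
  interpret F: cat_functor C D F by (rule t)
  interpret G: cat_functor C D G by (rule t)
  note inv = inverse_arr[OF i]
  show ?thesis
  proof (intro nat_isoI nat_transI)
    fix f assume f: "f \<in> Arr C"
    let ?a = "\<tau> (Dom C f)" and ?b = "\<tau> (Cod C f)"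
    note a = i[of "Dom C f"] and b = i[of "Cod C f"]
    have "Comp D (inverse_arr D ?b) (FArr G f)
      = Comp D (inverse_arr D ?b) (Comp D (Comp D (FArr G f) ?a) (inverse_arr D ?a))"
      using f t inv a by (simp add: F.D.Comp_inverse_cancel)
    also have "\<dots> = Comp D (FArr F f) (inverse_arr D ?a)"
      using f t inv a b by (simp flip: t(6)) (simp add: F.D.assoc F.D.Comp_inverse_cancel)
    finally show "Comp D ((\<lambda>x\<in>Obj C. inverse_arr D (\<tau> x)) (Cod C f)) (FArr G f) =
         Comp D (FArr F f) ((\<lambda>x\<in>Obj C. inverse_arr D (\<tau> x)) (Dom C f))"
      using f by simp
  qed (use t inv i in \<open>auto simp: hom_iff iso_inverse_arr\<close>)
qed

lemma equivalent_cats_sym: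
  assumes "equivalent_cats C D"
  shows "equivalent_cats D C"
proof -
  obtain F G \<eta> \<epsilon> where *: "cat_functor C D F" "cat_functor D C G"
    "nat_iso C C id_fctr (G \<circ>\<^sub>F F) \<eta>" "nat_iso D D (F \<circ>\<^sub>F G) id_fctr \<epsilon>"
    using assms unfolding equivalent_cats_def by blast
  show ?thesis
    unfolding equivalent_cats_def using *(1,2) nat_iso_inverse[OF *(3)] nat_iso_inverse[OF *(4)] by blast
qed

lemma equivalent_cats_weak_equivalence:
  assumes "equivalent_cats C D"
  shows "\<exists>F. weak_equivalence C D F"
proof -
  obtain F G \<eta> \<epsilon> where F: "cat_functor C D F" and G: "cat_functor D C G"
    and \<eta>: "nat_iso C C id_fctr (G \<circ>\<^sub>F F) \<eta>" and \<epsilon>: "nat_iso D D (F \<circ>\<^sub>F G) id_fctr \<epsilon>"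
    using assms unfolding equivalent_cats_def by blast
  interpret F: cat_functor C D F by fact
  interpret G: cat_functor D C G by fact
  note h = nat_transD(3-5)[OF nat_isoD(1)[OF \<eta>]] and hn = nat_transD(6)[OF nat_isoD(1)[OF \<eta>]] and hi = nat_isoD(2)[OF \<eta>]
  note e = nat_transD(3-5)[OF nat_isoD(1)[OF \<epsilon>]] and en = nat_transD(6)[OF nat_isoD(1)[OF \<epsilon>]] and ei = nat_isoD(2)[OF \<epsilon>]
  \<comment> \<open>Naturality of \<eta> recovers \<open>f\<close> from its image under both
    functors; the next claim uses \<epsilon> in the same way for \<open>G\<close>.\<close>
  have faithful: "f = f'" if "f \<in> hom C x y" "f' \<in> hom C x y" "FArr F f = FArr F f'" for f f' x y
  proof -
    have "Comp C (\<eta> y) f = Comp C (\<eta> y) f'"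
      using that hn[of f] hn[of f'] by (auto simp: hom_iff)
    then show ?thesis using that hi[of y] h
 by - (rule F.C.iso_cancel_left[of "\<eta> y"], auto simp: hom_iff)
  qed
  have G_faithful: "f = f'" if "f \<in> hom D x y" "f' \<in> hom D x y" "FArr G f = FArr G f'" for f f' x y
  proof -
    have "Comp D f (\<epsilon> x) = Comp D f' (\<epsilon> x)"
      using that en[of f] en[of f'] by (auto simp: hom_iff)
    then show ?thesis using that ei[of x] e
 by - (rule F.D.iso_cancel_right[of "\<epsilon> x"], auto simp: hom_iff)
  qed
  have full: "\<exists>f \<in> hom C x y. FArr F f = g"
    if x: "x \<in> Obj C" and y: "y \<in> Obj C" and g: "g \<in> hom D (FObj F x) (FObj F y)" for x y g
  proof -
    note i = inverse_arr[OF hi[OF y]]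
    \<comment> \<open>The only candidate: if \<open>F\<close> sends \<open>f\<close> to
      \<open>g\<close>, naturality of \<eta> expresses \<open>\<eta> y\<close> after
      \<open>f\<close> as the image of \<open>g\<close> after \<open>\<eta> x\<close>.\<close>
    define f where "f = Comp C (inverse_arr C (\<eta> y)) (Comp C (FArr G g) (\<eta> x))"
    have f: "f \<in> hom C x y" using x y g i h by (auto simp: hom_iff f_def)
    have "Comp C (FArr G (FArr F f)) (\<eta> x) = Comp C (\<eta> y) f"
      using hn[of f] f by (auto simp: hom_iff)
    also have "\<dots> = Comp C (FArr G g) (\<eta> x)"
      unfolding f_def using x y g i h hi by (auto simp: hom_iff F.C.Comp_inverse_cancel)
    finally have "FArr G (FArr F f) = FArr G g"
      using x y g f hi h
 by - (rule F.C.iso_cancel_right[of "\<eta> x"], auto simp: hom_iff)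
    then have "FArr F f = g" using f g x y
 by - (rule G_faithful, auto simp: hom_iff)
    then show ?thesis using f by blast
  qed
  have "\<exists>c \<in> Obj C. \<exists>i \<in> hom D (FObj F c) d. iso_arr D i" if "d \<in> Obj D" for d
    using that e ei by (intro bexI[of _ "FObj G d"] bexI[of _ "\<epsilon> d"]) (auto simp: hom_iff)
  then show ?thesis
    using F faithful full unfolding weak_equivalence_def inj_on_def by blast
qed

text \<open>The quasi-inverse picks for every object a preimage up to isomorphism and lifts the
  conjugates of arrows by fullness. Its functor laws hold because \<open>F\<close> is faithful and
  they hold after applying \<open>F\<close>.\<close>

lemma weak_equivalence_equivalent_cats:
  assumes "weak_equivalence C D F"
  shows "equivalent_cats C D"
proof -
  interpret F: cat_functor C D F using assms by (simp add: weak_equivalence_def)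
  have full: "\<exists>f \<in> hom C x y. FArr F f = g" if "x \<in> Obj C" "y \<in> Obj C" "g \<in> hom D (FObj F x) (FObj F y)" for x y g
    using assms that by (auto simp: weak_equivalence_def)
  have faithful: "f = f'" if "f \<in> hom C x y" "f' \<in> hom C x y" "FArr F f = FArr F f'" for f f' x y
    using assms that by (auto simp: weak_equivalence_def inj_on_def)
  have "\<forall>d \<in> Obj D. \<exists>c i. c \<in> Obj C \<and> i \<in> hom D (FObj F c) d \<and> iso_arr D i"
    using assms unfolding weak_equivalence_def by blast
  then obtain g i where g: "\<And>d. d \<in> Obj D \<Longrightarrow> g d \<in> Obj C"
    and i: "\<And>d. d \<in> Obj D \<Longrightarrow> i d \<in> hom D (FObj F (g d)) d"
    and iso: "\<And>d. d \<in> Obj D \<Longrightarrow> iso_arr D (i d)" by metis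
  note inv = inverse_arr[OF iso]
  have i': "\<And>d. d \<in> Obj D \<Longrightarrow> i d \<in> Arr D" "\<And>d. d \<in> Obj D \<Longrightarrow> Dom D (i d) = FObj F (g d)"
     "\<And>d. d \<in> Obj D \<Longrightarrow> Cod D (i d) = d" using i by (auto simp: hom_iff)
  have "\<exists>u. u \<in> hom C (g (Dom D v)) (g (Cod D v)) \<and>
    FArr F u = Comp D (inverse_arr D (i (Cod D v))) (Comp D v (i (Dom D v)))" if "v \<in> Arr D" for v
    using that g i' inv full[of "g (Dom D v)" "g (Cod D v)"
      "Comp D (inverse_arr D (i (Cod D v))) (Comp D v (i (Dom D v)))"] by (simp add: hom_iff Bex_def)
  then obtain G where G: "\<And>v. v \<in> Arr D \<Longrightarrow> G v \<in> hom C (g (Dom D v)) (g (Cod D v))"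
    and FG: "\<And>v. v \<in> Arr D \<Longrightarrow> FArr F (G v) = Comp D (inverse_arr D (i (Cod D v))) (Comp D v (i (Dom D v)))"
    by metis
  have G': "\<And>v. v \<in> Arr D \<Longrightarrow> G v \<in> Arr C" "\<And>v. v \<in> Arr D \<Longrightarrow> Dom C (G v) = g (Dom D v)"
     "\<And>v. v \<in> Arr D \<Longrightarrow> Cod C (G v) = g (Cod D v)" using G by (auto simp: hom_iff)
  define GG where "GG = \<lparr>FObj = g, FArr = G\<rparr>"
  have GG: "FObj GG = g" "FArr GG = G" by (auto simp: GG_def)
  have inat: "Comp D (i (Cod D v)) (FArr F (G v)) = Comp D v (i (Dom D v))" if "v \<in> Arr D" for v
    using that i' inv iso by (simp add: FG F.D.Comp_inverse_cancel)
  interpret G: cat_functor D C GG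
  proof
    fix x assume "x \<in> Obj D" then show "FObj GG x \<in> Obj C" by (simp add: GG g)
  next
    fix v x y assume "v \<in> hom D x y" then show "FArr GG v \<in> hom C (FObj GG x) (FObj GG y)"
      using G by (auto simp: GG hom_iff)
  next
    fix x assume x: "x \<in> Obj D"
    have "FArr F (G (Id D x)) = FArr F (Id C (g x))"
      using x i' inv g by (simp add: FG)
    then show "FArr GG (Id D x) = Id C (FObj GG x)"
      using x g G'
 by - (rule faithful[of _ "g x" "g x"], auto simp: GG hom_iff)
  next
    fix u v x y z assume u: "u \<in> hom D x y" and v: "v \<in> hom D y z"
    have xyz: "x \<in> Obj D" "y \<in> Obj D" "z \<in> Obj D" using u v by (auto simp: hom_iff)
    have "Comp D (i z) (FArr F (Comp C (G v) (G u))) = Comp D (Comp D (i z) (FArr F (G v))) (FArr F (G u))"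
      using u v xyz i' G' by (auto simp: hom_iff F.FArr_Comp_arr F.D.assoc)
    also have "\<dots> = Comp D v (Comp D (i y) (FArr F (G u)))"
      using u v xyz i' G' inat[of v] by (auto simp: hom_iff F.D.assoc)
    also have "\<dots> = Comp D (i z) (FArr F (G (Comp D v u)))"
      using u v xyz i' G' inat[of u] inat[of "Comp D v u"] by (auto simp: hom_iff F.D.assoc)
    finally have "FArr F (Comp C (G v) (G u)) = FArr F (G (Comp D v u))"
      using u v xyz i' G'
 by - (rule F.D.iso_cancel_left[OF iso[of z]], auto simp: hom_iff)
    then show "FArr GG (Comp D v u) = Comp C (FArr GG v) (FArr GG u)"
      using u v G'
 by - (rule faithful[of _ "g x" "g z"], auto simp: GG hom_iff)
  qed
  have 1: "nat_iso D D (F \<circ>\<^sub>F GG) id_fctr (\<lambda>d\<in>Obj D. i d)"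
    by (intro nat_isoI nat_transI cat_functor_comp[OF G.cat_functor_axioms F.cat_functor_axioms]
        cat_functor_id F.D.category_axioms) (use i iso inat in \<open>auto simp: GG\<close>)
  \<comment> \<open>The unit at \<open>c\<close> is the lift of the inverse of the chosen
    isomorphism at \<open>FObj F c\<close>.\<close>
  have "\<exists>u. u \<in> hom C c (g (FObj F c)) \<and> FArr F u = inverse_arr D (i (FObj F c))" if "c \<in> Obj C" for c
    using that g full[of c "g (FObj F c)" "inverse_arr D (i (FObj F c))"] inv i' by (auto simp: hom_iff)
  then obtain h where h: "\<And>c. c \<in> Obj C \<Longrightarrow> h c \<in> hom C c (g (FObj F c))"
    and Fh: "\<And>c. c \<in> Obj C \<Longrightarrow> FArr F (h c) = inverse_arr D (i (FObj F c))" by metis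
  have h': "\<And>c. c \<in> Obj C \<Longrightarrow> h c \<in> Arr C" "\<And>c. c \<in> Obj C \<Longrightarrow> Dom C (h c) = c"
    "\<And>c. c \<in> Obj C \<Longrightarrow> Cod C (h c) = g (FObj F c)" using h by (auto simp: hom_iff)
  have hiso: "iso_arr C (h c)" if c: "c \<in> Obj C" for c
  proof -
    obtain k where k: "k \<in> hom C (g (FObj F c)) c" "FArr F k = i (FObj F c)"
      using full[of "g (FObj F c)" c "i (FObj F c)"] c i g by auto
    show ?thesis
    proof (rule iso_arrI[OF h[OF c] k(1)])
      show "Comp C k (h c) = Id C c"
        using k c h' i' inv
 by - (rule faithful[of _ c c], auto simp: hom_iff F.FArr_Comp_arr Fh)
      show "Comp C (h c) k = Id C (g (FObj F c))"
        using k c h' i' inv g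
 by - (rule faithful[of _ "g (FObj F c)" "g (FObj F c)"], auto simp: hom_iff F.FArr_Comp_arr Fh)
    qed
  qed
  have 2: "nat_iso C C id_fctr (GG \<circ>\<^sub>F F) (\<lambda>c\<in>Obj C. h c)"
  proof (intro nat_isoI nat_transI cat_functor_comp[OF F.cat_functor_axioms G.cat_functor_axioms]
        cat_functor_id F.C.category_axioms)
    fix u assume u: "u \<in> Arr C"
    have "FArr F (Comp C (h (Cod C u)) u) = FArr F (Comp C (G (FArr F u)) (h (Dom C u)))"
      using u h' Fh G' FG inv i' by (simp add: F.FArr_Comp_arr F.D.assoc)
    then show "Comp C ((\<lambda>c\<in>Obj C. h c) (Cod C u)) (FArr id_fctr u) =
         Comp C (FArr (GG \<circ>\<^sub>F F) u) ((\<lambda>c\<in>Obj C. h c) (Dom C u))"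
      using u h' G' by - (rule faithful[of _ "Dom C u" "g (FObj F (Cod C u))"], auto simp: hom_iff GG)
  qed (use h' hiso in \<open>auto simp: GG hom_iff\<close>)
  show ?thesis unfolding equivalent_cats_def
    using F.cat_functor_axioms G.cat_functor_axioms 1 2 by blast
qed

section \<open>Terminal objects, pullbacks and finite limits\<close>

definition terminal :: "('o, 'a) cat \<Rightarrow> 'o \<Rightarrow> bool" where
  "terminal C t \<longleftrightarrow> t \<in> Obj C \<and> (\<forall>x \<in> Obj C. \<exists>!u. u \<in> hom C x t)"

definition pullback :: "('o, 'a) cat \<Rightarrow> 'a \<Rightarrow> 'a \<Rightarrow> 'a \<Rightarrow> 'a \<Rightarrow> bool" where
  "pullback C f g p q \<longleftrightarrow> {f, g, p, q} \<subseteq> Arr C \<and> Cod C f = Cod C g \<and> Dom C p = Dom C q \<and>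
     Cod C p = Dom C f \<and> Cod C q = Dom C g \<and> Comp C f p = Comp C g q \<and>
     (\<forall>a b. a \<in> Arr C \<and> b \<in> Arr C \<and> Dom C a = Dom C b \<and> Cod C a = Dom C f \<and> Cod C b = Dom C g \<and>
        Comp C f a = Comp C g b \<longrightarrow>
        (\<exists>!h. h \<in> hom C (Dom C a) (Dom C p) \<and> Comp C p h = a \<and> Comp C q h = b))"

definition has_pullbacks :: "('o, 'a) cat \<Rightarrow> bool" where
  "has_pullbacks C \<longleftrightarrow>
     (\<forall>f \<in> Arr C. \<forall>g \<in> Arr C. Cod C f = Cod C g \<longrightarrow> (\<exists>p q. pullback C f g p q))"

lemma pullbackD:
  assumes "pullback C f g p q"
  shows "f \<in> Arr C" "g \<in> Arr C" "p \<in> Arr C" "q \<in> Arr C" "Cod C f = Cod C g" "Dom C p = Dom C q"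
     "Cod C p = Dom C f" "Cod C q = Dom C g" "Comp C f p = Comp C g q"
  using assms by (auto simp: pullback_def)

lemma pullback_ex1:
  assumes "pullback C f g p q" "a \<in> Arr C" "b \<in> Arr C" "Dom C a = Dom C b" "Cod C a = Dom C f"
    "Cod C b = Dom C g" "Comp C f a = Comp C g b"
  shows "\<exists>!h. h \<in> hom C (Dom C a) (Dom C p) \<and> Comp C p h = a \<and> Comp C q h = b"
proof -
  have *: "\<forall>a b. a \<in> Arr C \<and> b \<in> Arr C \<and> Dom C a = Dom C b \<and> Cod C a = Dom C f \<and> Cod C b = Dom C g \<and>
        Comp C f a = Comp C g b \<longrightarrow>
        (\<exists>!h. h \<in> hom C (Dom C a) (Dom C p) \<and> Comp C p h = a \<and> Comp C q h = b)"
    using assms(1) unfolding pullback_def by (elim conjE)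
  show ?thesis by (rule mp[OF *[THEN spec, THEN spec]]) (intro conjI assms)
qed

lemma pullback_jointly_monic:
  assumes "category C" "pullback C f g p q" "h \<in> Arr C" "k \<in> Arr C" "Dom C h = Dom C k" "Cod C h = Dom C p"
    "Cod C k = Dom C p" "Comp C p h = Comp C p k" "Comp C q h = Comp C q k"
  shows "h = k"
proof -
  interpret category C by fact
  note d = pullbackD[OF assms(2)]
  have "Comp C f (Comp C p h) = Comp C g (Comp C q h)"
    using d assms(3,6) by (simp flip: assoc)
  then have "\<exists>!l. l \<in> hom C (Dom C (Comp C p h)) (Dom C p) \<and> Comp C p l = Comp C p h \<and> Comp C q l = Comp C q h"
    using d assms by (intro pullback_ex1[OF assms(2)]) auto
  then show ?thesis using assms d by (auto simp: hom_iff)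
qed

lemma terminal_unique:
  "terminal C t \<Longrightarrow> u \<in> Arr C \<Longrightarrow> v \<in> Arr C \<Longrightarrow> Dom C u \<in> Obj C \<Longrightarrow> Dom C u = Dom C v \<Longrightarrow>
   Cod C u = t \<Longrightarrow> Cod C v = t \<Longrightarrow> u = v"
  by (auto simp: terminal_def hom_iff)

lemma terminal_ex: "terminal C t \<Longrightarrow> x \<in> Obj C \<Longrightarrow> \<exists>u. u \<in> hom C x t"
  by (auto simp: terminal_def)

lemma limit_cone_iff:
  "limit_cone I C K v \<pi> \<longleftrightarrow> cone I C K v \<pi> \<and>
    (\<forall>w \<rho>. cone I C K w \<rho> \<longrightarrow> (\<exists>!h. h \<in> hom C w v \<and> (\<forall>i \<in> Obj I. Comp C (\<pi> i) h = \<rho> i)))"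
  by (simp add: limit_cone_def limit_cone_axioms_def)

lemma cone_iff:
  "cone I C K v \<pi> \<longleftrightarrow> cat_functor I C K \<and> v \<in> Obj C \<and> (\<forall>i \<in> Obj I. \<pi> i \<in> hom C v (FObj K i)) \<and>
    (\<forall>a \<in> Arr I. Comp C (FArr K a) (\<pi> (Dom I a)) = \<pi> (Cod I a))"
  by (auto simp: cone_def cone_axioms_def hom_iff)

definition empty_cat :: "(nat, nat) cat" where
  "empty_cat = \<lparr>Obj = {}, Arr = {}, Dom = id, Cod = id, Id = id, Comp = (\<lambda>_. id)\<rparr>"

text \<open>A terminal object is a limit over the empty shape, on which arbitrary maps
  \<open>K\<close> and \<pi> form a functor and a cone.\<close>

lemma preserves_terminal:
  assumes "preserves_finite_limits C D F" "category C" "category D" "terminal C t"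
  shows "terminal D (FObj F t)"
proof -
  have fin: "finite (Obj empty_cat)" "finite (Arr empty_cat)" by (simp_all add: empty_cat_def)
  have K: "cat_functor empty_cat B K" if "category B" for B :: "('x, 'y) cat" and K
    using that by (auto simp: cat_functor_def cat_functor_axioms_def category_def empty_cat_def hom_iff)
  have cone: "cone empty_cat B K w \<rho> \<longleftrightarrow> w \<in> Obj B" if "category B" for B :: "('x, 'y) cat" and K w \<rho>
    using K[OF that] by (auto simp: cone_iff empty_cat_def)
  fix K :: "(nat, nat, _, _) fctr" and \<pi>
  have "limit_cone empty_cat C K t \<pi>"
    using assms(4) unfolding limit_cone_iff cone[OF assms(2)] terminal_def
    by (simp add: empty_cat_def)
  then have "limit_cone empty_cat D (F \<circ>\<^sub>F K) (FObj F t) (\<lambda>i. FArr F (\<pi> i))"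
    using assms(1) fin unfolding preserves_finite_limits_def by blast
  then show ?thesis
    unfolding limit_cone_iff cone[OF assms(3)] terminal_def by (simp add: empty_cat_def)
qed

text \<open>The shape of a cospan: the arrows 0, 1, 2 are the identities, 3 goes from 0 to 2 and 4
  from 1 to 2.\<close>

definition cospan_cat :: "(nat, nat) cat" where
  "cospan_cat = \<lparr>Obj = {0, 1, 2}, Arr = {0, 1, 2, 3, 4},
     Dom = (\<lambda>a. if a < 3 then a else a - 3), Cod = (\<lambda>a. if a < 3 then a else 2),
     Id = id, Comp = (\<lambda>b a. if b < 3 then a else b)\<rparr>"

lemma category_cospan: "category cospan_cat"
  by unfold_locales (auto simp: cospan_cat_def hom_iff split: if_splits)

definition cospan_fctr :: "('o, 'a) cat \<Rightarrow> 'a \<Rightarrow> 'a \<Rightarrow> (nat, nat, 'o, 'a) fctr" where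
  "cospan_fctr C f g = (let ob = (\<lambda>i. if i = 0 then Dom C f else if i = 1 then Dom C g else Cod C f) in
     \<lparr>FObj = ob, FArr = (\<lambda>a. if a = 3 then f else if a = 4 then g else Id C (ob a))\<rparr>)"

lemma cat_functor_cospan:
  assumes "category C" "f \<in> Arr C" "g \<in> Arr C" "Cod C f = Cod C g"
  shows "cat_functor cospan_cat C (cospan_fctr C f g)"
proof -
  interpret category C by fact
  show ?thesis
    unfolding cat_functor_def cat_functor_axioms_def
    using assms category_cospan
    by (auto simp: cospan_cat_def cospan_fctr_def hom_iff Let_def split: if_splits)
qed

text \<open>The functor \<open>F\<close> is carried along so that one description serves the cospan
  itself, with \<open>F\<close> the identity, and its image. The leg at the vertex 2 is determined
  by the other two.\<close>

lemma cone_cospan_iff: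
  assumes "category C" "category D" "cat_functor C D F" "f \<in> Arr C" "g \<in> Arr C" "Cod C f = Cod C g"
  shows "cone cospan_cat D (F \<circ>\<^sub>F cospan_fctr C f g) w \<rho> \<longleftrightarrow>
    w \<in> Obj D \<and> \<rho> 0 \<in> hom D w (FObj F (Dom C f)) \<and> \<rho> 1 \<in> hom D w (FObj F (Dom C g)) \<and>
    \<rho> 2 = Comp D (FArr F f) (\<rho> 0) \<and> \<rho> 2 = Comp D (FArr F g) (\<rho> 1)"
proof -
  interpret F: cat_functor C D F by fact
  show ?thesis
    unfolding cone_iff
    using assms cat_functor_comp[OF cat_functor_cospan[OF assms(1,4-6)] assms(3)]
    by (auto simp: cospan_cat_def cospan_fctr_def hom_iff Let_def)
qed

lemma limit_cone_cospan:
  assumes "category C" "category D" "cat_functor C D F" "f \<in> Arr C" "g \<in> Arr C" "Cod C f = Cod C g"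
    and "p \<in> Arr C" "q \<in> Arr C" "Dom C p = Dom C q" "Cod C p = Dom C f" "Cod C q = Dom C g"
    "Comp C f p = Comp C g q"
  shows "limit_cone cospan_cat D (F \<circ>\<^sub>F cospan_fctr C f g) (FObj F (Dom C p))
      (\<lambda>i. FArr F (if i = 0 then p else if i = 1 then q else Comp C f p)) \<longleftrightarrow>
     pullback D (FArr F f) (FArr F g) (FArr F p) (FArr F q)"
proof -
  interpret F: cat_functor C D F by fact
  note cone = cone_cospan_iff[OF assms(1-6)]
  have eq: "Comp D (FArr F f) (FArr F p) = Comp D (FArr F g) (FArr F q)"
    using assms(4-) by (simp flip: F.FArr_Comp_arr)
  have H: "(\<forall>i \<in> Obj cospan_cat. Comp D (FArr F (if i = 0 then p else if i = 1 then q else Comp C f p)) h = \<rho> i)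
    \<longleftrightarrow> Comp D (FArr F p) h = \<rho> 0 \<and> Comp D (FArr F q) h = \<rho> 1"
    if c: "cone cospan_cat D (F \<circ>\<^sub>F cospan_fctr C f g) w \<rho>" and h: "h \<in> hom D w (FObj F (Dom C p))"
    for w \<rho> h
  proof -
    have "FArr F (Comp C f p) = Comp D (FArr F f) (FArr F p)"
      by (rule F.FArr_Comp_arr) (use assms(4-) in auto)
    then have "Comp D (FArr F (Comp C f p)) h = Comp D (FArr F f) (Comp D (FArr F p) h)"
      using h assms(4-11) by (simp add: hom_iff F.D.assoc)
    then show ?thesis using c unfolding cone by (auto simp: cospan_cat_def)
  qed
  have c0: "cone cospan_cat D (F \<circ>\<^sub>F cospan_fctr C f g) (FObj F (Dom C p))
      (\<lambda>i. FArr F (if i = 0 then p else if i = 1 then q else Comp C f p))"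
    unfolding cone using assms(4-) eq by (simp add: hom_iff F.FArr_Comp_arr)
  have "(\<forall>w \<rho>. cone cospan_cat D (F \<circ>\<^sub>F cospan_fctr C f g) w \<rho> \<longrightarrow>
      (\<exists>!h. h \<in> hom D w (FObj F (Dom C p)) \<and> Comp D (FArr F p) h = \<rho> 0 \<and> Comp D (FArr F q) h = \<rho> 1)) \<longleftrightarrow>
     pullback D (FArr F f) (FArr F g) (FArr F p) (FArr F q)" (is "?l \<longleftrightarrow> ?r")
  proof
    assume L: ?l
    show ?r unfolding pullback_def
    proof (intro conjI allI impI; (elim conjE)?)
      fix a b assume ab: "a \<in> Arr D" "b \<in> Arr D" "Dom D a = Dom D b" "Cod D a = Dom D (FArr F f)"
        "Cod D b = Dom D (FArr F g)" "Comp D (FArr F f) a = Comp D (FArr F g) b"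
      have "cone cospan_cat D (F \<circ>\<^sub>F cospan_fctr C f g) (Dom D a)
         (\<lambda>i. if i = 0 then a else if i = 1 then b else Comp D (FArr F f) a)"
        unfolding cone using ab assms(4-) by (simp add: hom_iff)
      from L[rule_format, OF this] show "\<exists>!h. h \<in> hom D (Dom D a) (Dom D (FArr F p)) \<and>
           Comp D (FArr F p) h = a \<and> Comp D (FArr F q) h = b"
        using assms(7) by simp
    qed (use assms(4-) eq in auto)
  next
    assume R: ?r
    show ?l
    proof (intro allI impI)
      fix w \<rho> assume c: "cone cospan_cat D (F \<circ>\<^sub>F cospan_fctr C f g) w \<rho>"
      then have "Comp D (FArr F f) (\<rho> 0) = Comp D (FArr F g) (\<rho> 1)" unfolding cone by metis
      with c show "\<exists>!h. h \<in> hom D w (FObj F (Dom C p)) \<and> Comp D (FArr F p) h = \<rho> 0 \<and> Comp D (FArr F q) h = \<rho> 1"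
        using pullback_ex1[OF R, of "\<rho> 0" "\<rho> 1"] assms(4,5,7-11) unfolding cone by (auto simp: hom_iff)
    qed
  qed
  then show ?thesis
    unfolding limit_cone_iff using c0 H by (simp cong: conj_cong)
qed

lemma preserves_pullback:
  assumes "preserves_finite_limits C D F" "cat_functor C D F" "pullback C f g p q"
  shows "pullback D (FArr F f) (FArr F g) (FArr F p) (FArr F q)"
proof -
  interpret F: cat_functor C D F by fact
  note d = pullbackD[OF assms(3)]
  note id = cat_functor_id[OF F.C.category_axioms]
  have fin: "finite (Obj cospan_cat)" "finite (Arr cospan_cat)" by (simp_all add: cospan_cat_def)
  have *: "id_fctr \<circ>\<^sub>F K = K" for K :: "('x, 'y, 'z, 'w) fctr" by (simp add: comp_fctr_def)
  have "limit_cone cospan_cat C (cospan_fctr C f g) (Dom C p) 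
      (\<lambda>i. if i = 0 then p else if i = 1 then q else Comp C f p)"
    using limit_cone_cospan[OF F.C.category_axioms F.C.category_axioms id d(1,2,5,3,4,6-9)] assms(3)
    by (simp add: *)
  then have "limit_cone cospan_cat D (F \<circ>\<^sub>F cospan_fctr C f g) (FObj F (Dom C p))
      (\<lambda>i. FArr F (if i = 0 then p else if i = 1 then q else Comp C f p))"
    using assms(1) fin unfolding preserves_finite_limits_def by blast
  then show ?thesis
    using limit_cone_cospan[OF F.C.category_axioms F.D.category_axioms assms(2) d(1,2,5,3,4,6-9)] by simp
qed

text \<open>Precomposed with an isomorphism from some \<open>FObj F c\<close>, a cone in
  \<open>D\<close> becomes the image of a cone in \<open>C\<close> with vertex \<open>c\<close>; the
  mediating arrow found there is carried back by the inverse of the isomorphism.\<close>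

lemma weak_equivalence_limit_cone:
  assumes W: "weak_equivalence C D F" and L: "limit_cone I C K v \<pi>"
  shows "limit_cone I D (F \<circ>\<^sub>F K) (FObj F v) (\<lambda>i. FArr F (\<pi> i))"
proof -
  interpret F: cat_functor C D F using W by (simp add: weak_equivalence_def)
  have full: "\<exists>f \<in> hom C x y. FArr F f = g" if "x \<in> Obj C" "y \<in> Obj C" "g \<in> hom D (FObj F x) (FObj F y)" for x y g
    using W that by (auto simp: weak_equivalence_def)
  have faithful: "f = f'" if "FArr F f = FArr F f'" "f \<in> hom C x y" "f' \<in> hom C x y" for f f' x y
    using W that by (auto simp: weak_equivalence_def inj_on_def)
  interpret K: cat_functor I C K using L by (simp add: limit_cone_iff cone_iff)
  have v: "v \<in> Obj C" and \<pi>: "\<And>i. i \<in> Obj I \<Longrightarrow> \<pi> i \<in> Arr C" "\<And>i. i \<in> Obj I \<Longrightarrow> Dom C (\<pi> i) = v"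
    "\<And>i. i \<in> Obj I \<Longrightarrow> Cod C (\<pi> i) = FObj K i"
    and \<pi>n: "\<And>a. a \<in> Arr I \<Longrightarrow> Comp C (FArr K a) (\<pi> (Dom I a)) = \<pi> (Cod I a)"
    using L by (auto simp: limit_cone_iff cone_iff hom_iff)
  show ?thesis
    unfolding limit_cone_iff
  proof (intro conjI allI impI)
    show "cone I D (F \<circ>\<^sub>F K) (FObj F v) (\<lambda>i. FArr F (\<pi> i))"
      unfolding cone_iff
      using cat_functor_comp[OF K.cat_functor_axioms F.cat_functor_axioms] v \<pi>
      by (simp add: hom_iff \<pi>n flip: F.FArr_Comp_arr)
  next
    fix w \<rho> assume "cone I D (F \<circ>\<^sub>F K) w \<rho>"
    then have w: "w \<in> Obj D" and \<rho>: "\<And>i. i \<in> Obj I \<Longrightarrow> \<rho> i \<in> Arr D" "\<And>i. i \<in> Obj I \<Longrightarrow> Dom D (\<rho> i) = w"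
      "\<And>i. i \<in> Obj I \<Longrightarrow> Cod D (\<rho> i) = FObj F (FObj K i)"
      and \<rho>n: "\<And>a. a \<in> Arr I \<Longrightarrow> Comp D (FArr F (FArr K a)) (\<rho> (Dom I a)) = \<rho> (Cod I a)"
      by (auto simp: cone_iff hom_iff)
    obtain c i where c: "c \<in> Obj C" and i0: "i \<in> hom D (FObj F c) w" and iso: "iso_arr D i"
      using W w unfolding weak_equivalence_def by blast
    have i: "i \<in> Arr D" "Dom D i = FObj F c" "Cod D i = w" using i0 by (auto simp: hom_iff)
    note inv = inverse_arr[OF iso]
    have "\<exists>s. s \<in> hom C c (FObj K j) \<and> FArr F s = Comp D (\<rho> j) i" if "j \<in> Obj I" for j
      using full[of c "FObj K j" "Comp D (\<rho> j) i"] that c i \<rho> by (auto simp: hom_iff)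
    then obtain \<sigma> where \<sigma>: "\<And>j. j \<in> Obj I \<Longrightarrow> \<sigma> j \<in> hom C c (FObj K j)"
      and F\<sigma>: "\<And>j. j \<in> Obj I \<Longrightarrow> FArr F (\<sigma> j) = Comp D (\<rho> j) i" by metis
    have "Comp C (FArr K a) (\<sigma> (Dom I a)) = \<sigma> (Cod I a)" if a: "a \<in> Arr I" for a
      using a \<sigma>[of "Dom I a"] \<sigma>[of "Cod I a"] \<rho> i
      by - (rule faithful[of _ _ c "FObj K (Cod I a)"],
          simp_all add: hom_iff F.FArr_Comp_arr F\<sigma> \<rho>n flip: F.D.assoc)
    then have "cone I C K c \<sigma>" using \<sigma> c K.cat_functor_axioms by (simp add: cone_iff)
    then have ex1: "\<exists>!h. h \<in> hom C c v \<and> (\<forall>i \<in> Obj I. Comp C (\<pi> i) h = \<sigma> i)"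
      using L by (simp add: limit_cone_iff)
    then obtain h where h: "h \<in> hom C c v" and h\<pi>: "\<And>i. i \<in> Obj I \<Longrightarrow> Comp C (\<pi> i) h = \<sigma> i" by blast
    show "\<exists>!h. h \<in> hom D w (FObj F v) \<and> (\<forall>i\<in>Obj I. Comp D (FArr F (\<pi> i)) h = \<rho> i)"
    proof (rule ex1I[of _ "Comp D (FArr F h) (inverse_arr D i)"], intro conjI ballI)
      show "Comp D (FArr F h) (inverse_arr D i) \<in> hom D w (FObj F v)"
        using h inv i by (simp add: hom_iff)
    next
      fix j assume j: "j \<in> Obj I"
      have "Comp D (FArr F (\<pi> j)) (Comp D (FArr F h) (inverse_arr D i)) = Comp D (FArr F (\<sigma> j)) (inverse_arr D i)"
        using h inv i j \<pi> by (simp add: hom_iff h\<pi> flip: F.D.assoc F.FArr_Comp_arr)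
      then show "Comp D (FArr F (\<pi> j)) (Comp D (FArr F h) (inverse_arr D i)) = \<rho> j"
        using F\<sigma> j iso \<rho> i by (simp add: F.D.Comp_inverse_cancel)
    next
      fix k assume k: "k \<in> hom D w (FObj F v) \<and> (\<forall>i\<in>Obj I. Comp D (FArr F (\<pi> i)) k = \<rho> i)"
      obtain h' where h': "h' \<in> hom C c v" "FArr F h' = Comp D k i"
        using full[of c v "Comp D k i"] c v k i by (auto simp: hom_iff)
      have "Comp C (\<pi> j) h' = \<sigma> j" if j: "j \<in> Obj I" for j
      proof -
        have "FArr F (Comp C (\<pi> j) h') = Comp D (Comp D (FArr F (\<pi> j)) k) i"
          using h' k i j \<pi> by (simp add: hom_iff F.FArr_Comp_arr flip: F.D.assoc)
        then show ?thesis using j k h' \<sigma>[OF j] \<pi> F\<sigma>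
          by - (rule faithful[of _ _ c "FObj K j"], auto simp: hom_iff)
      qed
      then have "h' = h" using ex1 h' h h\<pi> by blast
      then show "k = Comp D (FArr F h) (inverse_arr D i)"
        using h' k i iso by (simp add: hom_iff F.D.Comp_inverse_cancel)
    qed
  qed
qed

lemma weak_equivalence_preserves_finite_limits:
  "weak_equivalence C D F \<Longrightarrow> preserves_finite_limits C D F"
  unfolding preserves_finite_limits_def by (auto intro: weak_equivalence_limit_cone)

lemma comp_fctr_assoc: "H \<circ>\<^sub>F G \<circ>\<^sub>F F = H \<circ>\<^sub>F (G \<circ>\<^sub>F F)"
  by (simp add: comp_fctr_def)

lemma preserves_finite_limits_comp:
  "preserves_finite_limits C D F \<Longrightarrow> preserves_finite_limits D E G \<Longrightarrow> preserves_finite_limits C E (G \<circ>\<^sub>F F)"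
  unfolding preserves_finite_limits_def by (simp add: comp_fctr_assoc)

section \<open>Small sets\<close>

context
  assumes univ: "universe TYPE('u)"
begin

text \<open>Replaces a small set of any type by a small subset of \<open>'u\<close>, where the
  closure conditions of \<open>universe\<close> apply.\<close>

lemma lesspoll_encode:
  fixes A :: "'v set"
  assumes "A \<prec> (UNIV :: 'u set)"
  shows "\<exists>e :: 'v \<Rightarrow> 'u. inj_on e A \<and> small (e ` A)"
proof -
  obtain e :: "'v \<Rightarrow> 'u" where "inj_on e A"
    using lesspoll_imp_lepoll[OF assms] by (auto simp: lepoll_def)
  then show ?thesis using assms unfolding small_def by (metis inj_on_image_lesspoll_1)
qed

lemma lesspoll_image: "A \<prec> (UNIV :: 'u set) \<Longrightarrow> f ` A \<prec> (UNIV :: 'u set)"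
  by (rule lesspoll_trans1[OF image_lepoll])

lemma lesspoll_subset: "A \<prec> (UNIV :: 'u set) \<Longrightarrow> B \<subseteq> A \<Longrightarrow> B \<prec> (UNIV :: 'u set)"
  by (rule lesspoll_trans1[OF subset_imp_lepoll])

lemma lesspoll_finite: "finite A \<Longrightarrow> A \<prec> (UNIV :: 'u set)"
  using univ by (simp add: universe_def finite_lesspoll_infinite)

lemma lesspoll_Pow:
  fixes A :: "'v set"
  assumes "A \<prec> (UNIV :: 'u set)"
  shows "Pow A \<prec> (UNIV :: 'u set)"
proof -
  obtain e :: "'v \<Rightarrow> 'u" where e: "inj_on e A" "small (e ` A)"
    using lesspoll_encode[OF assms] by blast
  have "Pow (e ` A) \<prec> (UNIV :: 'u set)" using univ e(2) by (simp add: universe_def)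
  moreover have "Pow A \<lesssim> Pow (e ` A)"
    unfolding lepoll_def using e(1)
    by (intro exI[of _ "image e"]) (auto simp: inj_on_image_Pow)
  ultimately show ?thesis by (rule lesspoll_trans1[rotated])
qed

text \<open>Regularity concerns unions of subsets of \<open>'u\<close>, so the summands are first
  encoded there and then kept apart by an injective pairing \<open>b\<close> on
  \<open>'u\<close>.\<close>

lemma lesspoll_Sigma:
  fixes I :: "'i set" and A :: "'i \<Rightarrow> 'v set"
  assumes "I \<prec> (UNIV :: 'u set)" "\<And>i. i \<in> I \<Longrightarrow> A i \<prec> (UNIV :: 'u set)"
  shows "Sigma I A \<prec> (UNIV :: 'u set)"
proof -
  obtain e :: "'i \<Rightarrow> 'u" where e: "inj_on e I" "small (e ` I)"
    using lesspoll_encode[OF assms(1)] by blast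
  have "\<forall>i \<in> I. \<exists>d :: 'v \<Rightarrow> 'u. inj_on d (A i) \<and> small (d ` A i)"
    using lesspoll_encode assms(2) by blast
  then obtain d :: "'i \<Rightarrow> 'v \<Rightarrow> 'u" where d: "\<And>i. i \<in> I \<Longrightarrow> inj_on (d i) (A i)" "\<And>i. i \<in> I \<Longrightarrow> small (d i ` A i)"
    by metis
  have "(UNIV :: 'u set) \<times> (UNIV :: 'u set) \<approx> (UNIV :: 'u set)"
    using univ by (simp add: universe_def card_of_Times_same_infinite eqpoll_iff_card_of_ordIso del: UNIV_Times_UNIV)
  then obtain b :: "'u \<times> 'u \<Rightarrow> 'u" where b: "inj b"
    by (auto simp: eqpoll_def bij_betw_def)
  define B where "B j = (\<lambda>a. b (j, a)) ` (d (inv_into I e j) ` A (inv_into I e j))" for j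
  have "small (B j)" if "j \<in> e ` I" for j
    unfolding B_def small_def using d(2)[of "inv_into I e j"] that inv_into_into[OF that]
    by (intro lesspoll_image[of "d (inv_into I e j) ` A (inv_into I e j)"]) (simp add: small_def)
  then have "small (\<Union>j \<in> e ` I. B j)" using univ e(2) unfolding universe_def by blast
  moreover have "Sigma I A \<lesssim> (\<Union>j \<in> e ` I. B j)"
    unfolding lepoll_def
  proof (intro exI conjI)
    show "inj_on (\<lambda>(i, a). b (e i, d i a)) (Sigma I A)"
      using e(1) d(1) by (auto simp: inj_on_def dest!: injD[OF b])
    show "(\<lambda>(i, a). b (e i, d i a)) ` Sigma I A \<subseteq> (\<Union>j \<in> e ` I. B j)"
      using e(1) by (auto simp: B_def)
  qed
  ultimately show ?thesis unfolding small_def by (rule lesspoll_trans1[rotated])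
qed

end

section \<open>Categories of presheaves and sheaves\<close>

lemma op_cat_simps [simp]: "Obj (op_cat C) = Obj C" "Arr (op_cat C) = Arr C" "Dom (op_cat C) = Cod C"
  "Cod (op_cat C) = Dom C" "Id (op_cat C) = Id C" "Comp (op_cat C) g f = Comp C f g"
  by (simp_all add: op_cat_def)

lemma hom_op [simp]: "hom (op_cat C) x y = hom C y x"
  by (auto simp: hom_iff)

lemma category_op: "category C \<Longrightarrow> category (op_cat C)"
  unfolding category_def by (auto simp: hom_iff)

lemma category_set_cat: "category set_cat"
proof
  show "Comp set_cat h (Comp set_cat g f) = Comp set_cat (Comp set_cat h g) f"
    if "f \<in> hom set_cat w x" "g \<in> hom set_cat x y" "h \<in> hom set_cat y z" for f g h :: "'x fn" and w x y z
    using that by (fastforce simp: set_cat_def hom_iff compose_def PiE_iff)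
qed (auto simp: set_cat_def hom_iff compose_def PiE_iff extensional_def fun_eq_iff, metis)

lemma category_functor_cat:
  assumes "category C" "category D"
  shows "category (functor_cat C D)"
proof -
  interpret C: category C by fact
  interpret D: category D by fact
  show ?thesis
  proof
    fix F assume "F \<in> Obj (functor_cat C D)"
    then have F: "cat_functor C D F" by (simp add: functor_cat_def)
    interpret F: cat_functor C D F by fact
    show "Id (functor_cat C D) F \<in> hom (functor_cat C D) F F"
      by (auto simp: functor_cat_def hom_iff intro!: nat_transI F)
  next
    fix s t F G H assume s: "s \<in> hom (functor_cat C D) F G" and t: "t \<in> hom (functor_cat C D) G H"
    then obtain \<sigma> \<tau> where [simp]: "s = (F, G, \<sigma>)" "t = (G, H, \<tau>)"
      and \<sigma>: "nat_trans C D F G \<sigma>" and \<tau>: "nat_trans C D G H \<tau>"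
      by (auto simp: functor_cat_def hom_iff)
    interpret F: cat_functor C D F by (rule nat_transD[OF \<sigma>])
    interpret G: cat_functor C D G by (rule nat_transD[OF \<tau>])
    interpret H: cat_functor C D H by (rule nat_transD[OF \<tau>])
    note s = nat_transD(3-5)[OF \<sigma>] and t = nat_transD(3-5)[OF \<tau>]
    have "nat_trans C D F H (\<lambda>x\<in>Obj C. Comp D (\<tau> x) (\<sigma> x))"
    proof (intro nat_transI F.cat_functor_axioms H.cat_functor_axioms)
      fix f assume f: "f \<in> Arr C"
      have "Comp D (Comp D (\<tau> (Cod C f)) (\<sigma> (Cod C f))) (FArr F f) =
        Comp D (\<tau> (Cod C f)) (Comp D (FArr G f) (\<sigma> (Dom C f)))"
        using f s t nat_transD(6)[OF \<sigma> f] by (simp add: D.assoc)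
      also have "\<dots> = Comp D (FArr H f) (Comp D (\<tau> (Dom C f)) (\<sigma> (Dom C f)))"
        using f s t nat_transD(6)[OF \<tau> f] by (simp flip: D.assoc)
      finally show "Comp D ((\<lambda>x\<in>Obj C. Comp D (\<tau> x) (\<sigma> x)) (Cod C f)) (FArr F f) =
         Comp D (FArr H f) ((\<lambda>x\<in>Obj C. Comp D (\<tau> x) (\<sigma> x)) (Dom C f))"
        using f by simp
    qed (use s t in \<open>auto simp: hom_iff\<close>)
    then show "Comp (functor_cat C D) t s \<in> hom (functor_cat C D) F H"
      by (simp add: functor_cat_def hom_iff)
  next
    fix r s t F G H K
    assume r: "r \<in> hom (functor_cat C D) F G" and s: "s \<in> hom (functor_cat C D) G H"
      and t: "t \<in> hom (functor_cat C D) H K"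
    then obtain \<rho> \<sigma> \<tau> where [simp]: "r = (F, G, \<rho>)" "s = (G, H, \<sigma>)" "t = (H, K, \<tau>)"
      and *: "nat_trans C D F G \<rho>" "nat_trans C D G H \<sigma>" "nat_trans C D H K \<tau>"
      by (auto simp: functor_cat_def hom_iff)
    show "Comp (functor_cat C D) t (Comp (functor_cat C D) s r) =
      Comp (functor_cat C D) (Comp (functor_cat C D) t s) r"
      using nat_transD(3-5)[OF *(1)] nat_transD(3-5)[OF *(2)] nat_transD(3-5)[OF *(3)]
      by (auto simp: functor_cat_def D.assoc intro!: restrict_ext)
  next
    fix t F G assume "t \<in> hom (functor_cat C D) F G"
    then obtain \<tau> where [simp]: "t = (F, G, \<tau>)" and \<tau>: "nat_trans C D F G \<tau>"
      by (auto simp: functor_cat_def hom_iff)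
    note t = nat_transD[OF \<tau>]
    have "(\<lambda>x\<in>Obj C. Comp D (\<tau> x) ((\<lambda>x\<in>Obj C. Id D (FObj F x)) x)) = \<tau>"
      "(\<lambda>x\<in>Obj C. Comp D ((\<lambda>x\<in>Obj C. Id D (FObj G x)) x) (\<tau> x)) = \<tau>"
      by (rule extensionalityI[of _ "Obj C"]; use t(3-5,7) in simp)+
    then show "Comp (functor_cat C D) t (Id (functor_cat C D) F) = t"
      "Comp (functor_cat C D) (Id (functor_cat C D) G) t = t"
      by (simp_all add: functor_cat_def)
  qed (auto simp: functor_cat_def dest: nat_transD)
qed

lemma category_full_subcat: "category C \<Longrightarrow> category (full_subcat C X)"
  by (auto simp: category_def full_subcat_def hom_iff)

lemma category_sheaf_cat: "category C \<Longrightarrow> category (sheaf_cat C J)"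
  unfolding sheaf_cat_def
  by (intro category_full_subcat category_functor_cat category_op category_set_cat)

locale small_site = grothendieck_topology C J for C :: "('u, 'u) cat" and J +
  assumes univ: "universe TYPE('u)"
    and small_Obj: "small (Obj C)" and small_Arr: "small (Arr C)"
begin

subsection \<open>Covering conditions\<close>

text \<open>Covering sieves as predicates on the arrows into \<open>d\<close>. Closure of
  \<open>P\<close> under precomposition is part of the condition, since members of
  \<open>J d\<close> are sieves.\<close>

definition covers :: "'u \<Rightarrow> ('u \<Rightarrow> bool) \<Rightarrow> bool" where
  "covers d P \<longleftrightarrow> {f \<in> Arr C. Cod C f = d \<and> P f} \<in> J d"

lemma covers_stable:
  assumes "d \<in> Obj C" "covers d P" "f \<in> Arr C" "Cod C f = d" "P f" "k \<in> Arr C" "Cod C k = Dom C f"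
  shows "P (Comp C f k)"
  using covering_sieve[of d "{f \<in> Arr C. Cod C f = d \<and> P f}"] assms by (auto simp: covers_def sieve_def)

lemma covers_cong: "(\<And>f. f \<in> Arr C \<Longrightarrow> Cod C f = d \<Longrightarrow> P f = Q f) \<Longrightarrow> covers d P = covers d Q"
  unfolding covers_def by (rule arg_cong[of _ _ "\<lambda>S. S \<in> J d"]) auto

lemma covers_true: "d \<in> Obj C \<Longrightarrow> (\<And>f. f \<in> Arr C \<Longrightarrow> Cod C f = d \<Longrightarrow> P f) \<Longrightarrow> covers d P"
  using maximal[of d] covers_cong[of d P "\<lambda>_. True"] by (simp add: covers_def)

lemma covers_sieve: "d \<in> Obj C \<Longrightarrow> S \<in> J d \<Longrightarrow> covers d (\<lambda>f. f \<in> S)"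
proof -
  assume "d \<in> Obj C" "S \<in> J d"
  moreover from this have "{f \<in> Arr C. Cod C f = d \<and> f \<in> S} = S"
    using covering_sieve[of d S] unfolding sieve_def by blast
  ultimately show ?thesis by (simp add: covers_def)
qed

lemma covers_pullback:
  assumes "covers d P" "h \<in> Arr C" "Cod C h = d"
  shows "covers (Dom C h) (\<lambda>k. P (Comp C h k))"
proof -
  have "pullback_sieve C h {f \<in> Arr C. Cod C f = d \<and> P f} \<in> J (Dom C h)"
    using grothendieck_topology.stable[OF grothendieck_topology_axioms, of h "Dom C h" d] assms
    by (auto simp: covers_def hom_iff)
  moreover have "pullback_sieve C h {f \<in> Arr C. Cod C f = d \<and> P f} =
    {k \<in> Arr C. Cod C k = Dom C h \<and> P (Comp C h k)}"
    using assms by (auto simp: pullback_sieve_def)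
  ultimately show ?thesis by (simp add: covers_def)
qed

lemma covers_trans:
  assumes "d \<in> Obj C" "covers d P"
    and "\<And>f k. f \<in> Arr C \<Longrightarrow> Cod C f = d \<Longrightarrow> k \<in> Arr C \<Longrightarrow> Cod C k = Dom C f \<Longrightarrow> Q f \<Longrightarrow> Q (Comp C f k)"
    and "\<And>f. f \<in> Arr C \<Longrightarrow> Cod C f = d \<Longrightarrow> P f \<Longrightarrow> covers (Dom C f) (\<lambda>k. Q (Comp C f k))"
  shows "covers d Q"
  unfolding covers_def
proof (rule transitive[OF assms(1)])
  show "{f \<in> Arr C. Cod C f = d \<and> P f} \<in> J d" using assms(2) by (simp add: covers_def)
  show "sieve C d {f \<in> Arr C. Cod C f = d \<and> Q f}" using assms(3) by (auto simp: sieve_def)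
  fix h assume h: "h \<in> {f \<in> Arr C. Cod C f = d \<and> P f}"
  then have "pullback_sieve C h {f \<in> Arr C. Cod C f = d \<and> Q f} =
    {k \<in> Arr C. Cod C k = Dom C h \<and> Q (Comp C h k)}"
    by (auto simp: pullback_sieve_def)
  then show "pullback_sieve C h {f \<in> Arr C. Cod C f = d \<and> Q f} \<in> J (Dom C h)"
    using assms(4)[of h] h by (simp add: covers_def)
qed

lemma covers_mono:
  assumes "d \<in> Obj C" "covers d P"
    and "\<And>f k. f \<in> Arr C \<Longrightarrow> Cod C f = d \<Longrightarrow> k \<in> Arr C \<Longrightarrow> Cod C k = Dom C f \<Longrightarrow> Q f \<Longrightarrow> Q (Comp C f k)"
    and "\<And>f. f \<in> Arr C \<Longrightarrow> Cod C f = d \<Longrightarrow> P f \<Longrightarrow> Q f"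
  shows "covers d Q"
  by (rule covers_trans[OF assms(1,2)]) (use assms(3,4) in \<open>auto intro: covers_true\<close>)

lemma covers_conj:
  assumes "d \<in> Obj C" "covers d P" "covers d Q"
  shows "covers d (\<lambda>f. P f \<and> Q f)"
proof (rule covers_trans[OF assms(1,2)])
  fix f assume f: "f \<in> Arr C" "Cod C f = d" "P f"
  have "covers (Dom C f) (\<lambda>k. Q (Comp C f k))" using covers_pullback[OF assms(3)] f by auto
  moreover have "P (Comp C f k)" if "k \<in> Arr C" "Cod C k = Dom C f" for k
    using covers_stable[OF assms(1,2)] f that by auto
  ultimately show "covers (Dom C f) (\<lambda>k. P (Comp C f k) \<and> Q (Comp C f k))"
    by (subst covers_cong[of _ _ "\<lambda>k. Q (Comp C f k)"]) auto
qed (use covers_stable[OF assms(1,2)] covers_stable[OF assms(1,3)] in auto)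

subsection \<open>Sheaves with values in arbitrary types\<close>

text \<open>Presheaves with values in an arbitrary type, so that sections may be relations, pairs or
  arrows of another category; \<rho> is the restriction.\<close>

definition presheaf :: "('u \<Rightarrow> 'v set) \<Rightarrow> ('u \<Rightarrow> 'v \<Rightarrow> 'v) \<Rightarrow> bool" where
  "presheaf V \<rho> \<longleftrightarrow> (\<forall>f \<in> Arr C. \<forall>a \<in> V (Cod C f). \<rho> f a \<in> V (Dom C f)) \<and>
     (\<forall>x \<in> Obj C. \<forall>a \<in> V x. \<rho> (Id C x) a = a) \<and>
     (\<forall>f \<in> Arr C. \<forall>g \<in> Arr C. Cod C g = Dom C f \<longrightarrow> (\<forall>a \<in> V (Cod C f). \<rho> (Comp C f g) a = \<rho> g (\<rho> f a)))"

definition sheaf :: "('u \<Rightarrow> 'v set) \<Rightarrow> ('u \<Rightarrow> 'v \<Rightarrow> 'v) \<Rightarrow> bool" where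
  "sheaf V \<rho> \<longleftrightarrow> presheaf V \<rho> \<and>
     (\<forall>d \<in> Obj C. \<forall>S \<in> J d. \<forall>s. (\<forall>f \<in> S. s f \<in> V (Dom C f) \<and>
        (\<forall>g \<in> Arr C. Cod C g = Dom C f \<longrightarrow> \<rho> g (s f) = s (Comp C f g))) \<longrightarrow>
        (\<exists>!y. y \<in> V d \<and> (\<forall>f \<in> S. \<rho> f y = s f)))"

lemma presheaf_simps:
  assumes "presheaf V \<rho>"
  shows "f \<in> Arr C \<Longrightarrow> a \<in> V (Cod C f) \<Longrightarrow> \<rho> f a \<in> V (Dom C f)"
    and "x \<in> Obj C \<Longrightarrow> a \<in> V x \<Longrightarrow> \<rho> (Id C x) a = a"
    and "f \<in> Arr C \<Longrightarrow> g \<in> Arr C \<Longrightarrow> Cod C g = Dom C f \<Longrightarrow> a \<in> V (Cod C f) \<Longrightarrow> \<rho> (Comp C f g) a = \<rho> g (\<rho> f a)"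
  using assms by (auto simp: presheaf_def)

lemma sheaf_presheaf: "sheaf V \<rho> \<Longrightarrow> presheaf V \<rho>"
  by (simp add: sheaf_def)

lemma sheaf_glue:
  assumes "sheaf V \<rho>" "d \<in> Obj C" "covers d P"
    and "\<And>f. f \<in> Arr C \<Longrightarrow> Cod C f = d \<Longrightarrow> P f \<Longrightarrow> s f \<in> V (Dom C f)"
    and "\<And>f g. f \<in> Arr C \<Longrightarrow> Cod C f = d \<Longrightarrow> P f \<Longrightarrow> g \<in> Arr C \<Longrightarrow> Cod C g = Dom C f \<Longrightarrow> \<rho> g (s f) = s (Comp C f g)"
  shows "\<exists>y \<in> V d. \<forall>f \<in> Arr C. Cod C f = d \<longrightarrow> P f \<longrightarrow> \<rho> f y = s f"
proof -
  have "\<exists>!y. y \<in> V d \<and> (\<forall>f \<in> {f \<in> Arr C. Cod C f = d \<and> P f}. \<rho> f y = s f)"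
    by (rule assms(1)[unfolded sheaf_def, THEN conjunct2, rule_format, OF assms(2)])
      (use assms(3-5) in \<open>auto simp: covers_def\<close>)
  then show ?thesis by blast
qed

lemma sheaf_separated:
  assumes "sheaf V \<rho>" "d \<in> Obj C" "covers d P" "y \<in> V d" "y' \<in> V d"
    and "\<And>f. f \<in> Arr C \<Longrightarrow> Cod C f = d \<Longrightarrow> P f \<Longrightarrow> \<rho> f y = \<rho> f y'"
  shows "y = y'"
proof -
  let ?S = "{f \<in> Arr C. Cod C f = d \<and> P f}"
  have S: "?S \<in> J d" using assms(3) by (simp add: covers_def)
  have "\<exists>!z. z \<in> V d \<and> (\<forall>f \<in> ?S. \<rho> f z = \<rho> f y)"
  proof (rule assms(1)[unfolded sheaf_def, THEN conjunct2, rule_format, OF assms(2) S], intro ballI conjI impI)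
    fix f g assume *: "f \<in> ?S" "g \<in> Arr C" "Cod C g = Dom C f"
    then show "\<rho> g (\<rho> f y) = \<rho> (Comp C f g) y"
      using presheaf_simps(3)[OF sheaf_presheaf[OF assms(1)], of f g y] assms(4) by auto
  qed (use assms presheaf_simps(1)[OF sheaf_presheaf[OF assms(1)]] in auto)
  then show ?thesis using assms(4-6) by (metis (mono_tags, lifting) mem_Collect_eq)
qed

lemma sheafI:
  assumes "presheaf V \<rho>"
    and "\<And>d P y y'. d \<in> Obj C \<Longrightarrow> covers d P \<Longrightarrow> y \<in> V d \<Longrightarrow> y' \<in> V d \<Longrightarrow>
      (\<And>f. f \<in> Arr C \<Longrightarrow> Cod C f = d \<Longrightarrow> P f \<Longrightarrow> \<rho> f y = \<rho> f y') \<Longrightarrow> y = y'"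
    and "\<And>d P s. d \<in> Obj C \<Longrightarrow> covers d P \<Longrightarrow>
      (\<And>f. f \<in> Arr C \<Longrightarrow> Cod C f = d \<Longrightarrow> P f \<Longrightarrow> s f \<in> V (Dom C f)) \<Longrightarrow>
      (\<And>f g. f \<in> Arr C \<Longrightarrow> Cod C f = d \<Longrightarrow> P f \<Longrightarrow> g \<in> Arr C \<Longrightarrow> Cod C g = Dom C f \<Longrightarrow>
         \<rho> g (s f) = s (Comp C f g)) \<Longrightarrow>
      \<exists>y \<in> V d. \<forall>f \<in> Arr C. Cod C f = d \<longrightarrow> P f \<longrightarrow> \<rho> f y = s f"
  shows "sheaf V \<rho>"
  unfolding sheaf_def
proof (intro conjI assms(1) ballI allI impI)
  fix d S s assume d: "d \<in> Obj C" and S: "S \<in> J d"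
    and s: "\<forall>f \<in> S. s f \<in> V (Dom C f) \<and>
        (\<forall>g \<in> Arr C. Cod C g = Dom C f \<longrightarrow> \<rho> g (s f) = s (Comp C f g))"
  have sub: "S \<subseteq> {f \<in> Arr C. Cod C f = d}" using covering_sieve[OF d S] by (simp add: sieve_def)
  have cov: "covers d (\<lambda>f. f \<in> S)" by (rule covers_sieve[OF d S])
  have "\<exists>y \<in> V d. \<forall>f \<in> Arr C. Cod C f = d \<longrightarrow> f \<in> S \<longrightarrow> \<rho> f y = s f"
    using s by (intro assms(3)[OF d cov]) auto
  then obtain y where "y \<in> V d" "\<forall>f \<in> S. \<rho> f y = s f" using sub by blast
  then show "\<exists>!y. y \<in> V d \<and> (\<forall>f \<in> S. \<rho> f y = s f)"
    by (intro ex1I[of _ y] conjI) (simp_all, rule assms(2)[OF d cov], simp_all)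
qed

text \<open>Transport of structure along injections \<open>e d\<close> into \<open>'u\<close>:
  decode, restrict by \<rho>, encode again. This is the passage from sheaves over arbitrary types to
  objects of the category of sheaves.\<close>

lemma sheaf_encode:
  fixes V :: "'u \<Rightarrow> 'v set"
  assumes V: "sheaf V \<rho>" and small: "\<And>d. d \<in> Obj C \<Longrightarrow> V d \<prec> (UNIV :: 'u set)"
  shows "\<exists>(P :: ('u, 'u, 'u set, 'u fn) fctr) e. is_sheaf C J P \<and> (\<forall>d \<in> Obj C. bij_betw (e d) (V d) (FObj P d)) \<and>
    (\<forall>f \<in> Arr C. \<forall>a \<in> V (Cod C f). restr P f (e (Cod C f) a) = e (Dom C f) (\<rho> f a))"
proof -
  have "\<forall>d \<in> Obj C. \<exists>e :: 'v \<Rightarrow> 'u. inj_on e (V d) \<and> small (e ` V d)"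
    using lesspoll_encode[OF univ] small by blast
  then obtain e :: "'u \<Rightarrow> 'v \<Rightarrow> 'u" where e: "\<And>d. d \<in> Obj C \<Longrightarrow> inj_on (e d) (V d)"
    and sm: "\<And>d. d \<in> Obj C \<Longrightarrow> small (e d ` V d)" by metis
  define P where "P = \<lparr>FObj = (\<lambda>d. e d ` V d), FArr = (\<lambda>f. (e (Cod C f) ` V (Cod C f), e (Dom C f) ` V (Dom C f),
     \<lambda>a\<in>e (Cod C f) ` V (Cod C f). e (Dom C f) (\<rho> f (inv_into (V (Cod C f)) (e (Cod C f)) a))))\<rparr>"
  note ps = presheaf_simps[OF sheaf_presheaf[OF V]]
  have FO: "FObj P d = e d ` V d" for d by (simp add: P_def)
  have r: "restr P f (e (Cod C f) a) = e (Dom C f) (\<rho> f a)" if "f \<in> Arr C" "a \<in> V (Cod C f)" for f a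
    using that e[of "Cod C f"] by (simp add: restr_def P_def)
  have "cat_functor (op_cat C) set_cat P"
  proof (intro cat_functor.intro category_op category_axioms category_set_cat cat_functor_axioms.intro)
    fix f g x y z assume "f \<in> hom (op_cat C) x y" "g \<in> hom (op_cat C) y z"
    then show "FArr P (Comp (op_cat C) g f) = Comp set_cat (FArr P g) (FArr P f)"
      using e ps by (auto simp: hom_iff P_def set_cat_def compose_def intro!: restrict_ext)
  qed (use sm e ps in \<open>auto simp: P_def hom_iff set_cat_def intro!: restrict_ext\<close>)
  moreover have "\<exists>!y. y \<in> FObj P d \<and> (\<forall>f \<in> S. restr P f y = s f)"
    if d: "d \<in> Obj C" and S: "S \<in> J d" and s: "matching_family C P S s" for d S s
  proof -
    have sub: "S \<subseteq> {f \<in> Arr C. Cod C f = d}" and sv: "sieve C d S" using covering_sieve[OF d S] by (auto simp: sieve_def)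
    have cl: "Comp C f g \<in> S" if "f \<in> S" "g \<in> Arr C" "Cod C g = Dom C f" for f g
      using sv that by (auto simp: sieve_def)
    define t where "t f = inv_into (V (Dom C f)) (e (Dom C f)) (s f)" for f
    have sV: "s f \<in> e (Dom C f) ` V (Dom C f)" if "f \<in> S" for f
      using s that by (auto simp: matching_family_def FO)
    have t: "t f \<in> V (Dom C f)" "e (Dom C f) (t f) = s f" if "f \<in> S" for f
      using sV[OF that] by (auto simp: t_def inv_into_into f_inv_into_f)
    have tm: "\<rho> g (t f) = t (Comp C f g)" if "f \<in> S" "g \<in> Arr C" "Cod C g = Dom C f" for f g
    proof -
      have "e (Dom C g) (\<rho> g (t f)) = restr P g (s f)" using r[of g "t f"] t that by simp
      also have "\<dots> = s (Comp C f g)" using s that by (auto simp: matching_family_def)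
      also have "\<dots> = e (Dom C g) (t (Comp C f g))" using t(2)[OF cl[OF that]] that sub by auto
      finally show ?thesis
        using e[of "Dom C g"] t(1)[OF cl[OF that]] ps(1)[of g "t f"] t(1)[OF that(1)] that sub
        by (auto simp: inj_on_eq_iff)
    qed
    have *: "(\<forall>f \<in> S. restr P f (e d y) = s f) \<longleftrightarrow> (\<forall>f \<in> S. \<rho> f y = t f)" if y: "y \<in> V d" for y
    proof (intro ball_cong refl)
      fix f assume f: "f \<in> S"
      then have "f \<in> Arr C" "Cod C f = d" using sub by auto
      then show "restr P f (e d y) = s f \<longleftrightarrow> \<rho> f y = t f"
        using r[of f y] y t[OF f] ps(1)[of f y] e[of "Dom C f"] by (auto simp flip: t(2)[OF f] simp: inj_on_eq_iff)
    qed
    have "\<exists>!y. y \<in> V d \<and> (\<forall>f \<in> S. \<rho> f y = t f)"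
      by (rule V[unfolded sheaf_def, THEN conjunct2, rule_format, OF d S]) (use t tm in auto)
    then obtain y where y: "y \<in> V d" "\<forall>f \<in> S. \<rho> f y = t f" "\<And>z. z \<in> V d \<Longrightarrow> \<forall>f \<in> S. \<rho> f z = t f \<Longrightarrow> z = y" by blast
    show ?thesis
    proof (rule ex1I[of _ "e d y"])
      show "e d y \<in> FObj P d \<and> (\<forall>f\<in>S. restr P f (e d y) = s f)"
        using y(1,2) *[OF y(1)] FO by blast
      fix z assume z: "z \<in> FObj P d \<and> (\<forall>f\<in>S. restr P f z = s f)"
      then obtain z' where z': "z' \<in> V d" "z = e d z'" by (auto simp: FO)
      then show "z = e d y" using z *[of z'] y(3)[of z'] by blast
    qed
  qed
  ultimately have "is_sheaf C J P" by (simp add: is_sheaf_def)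
  moreover have "\<forall>d \<in> Obj C. bij_betw (e d) (V d) (FObj P d)" using e FO by (auto simp: bij_betw_def)
  ultimately show ?thesis by (intro exI[of _ P] exI[of _ e] conjI ballI) (simp_all add: r)
qed

subsection \<open>Arrows of sheaves\<close>

abbreviation Sh :: "(('u, 'u, 'u set, 'u fn) fctr,
     ('u, 'u, 'u set, 'u fn) fctr \<times> ('u, 'u, 'u set, 'u fn) fctr \<times> ('u \<Rightarrow> 'u fn)) cat" where
  "Sh \<equiv> sheaf_cat C J"

sublocale Sh: category Sh
  by (rule category_sheaf_cat[OF category_axioms])

lemma Obj_Sh: "P \<in> Obj Sh \<longleftrightarrow> is_sheaf C J P"
  by (auto simp: sheaf_cat_def full_subcat_def functor_cat_def is_sheaf_def)

lemma is_sheaf_sheaf: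
  fixes P :: "('u, 'u, 'u set, 'u fn) fctr"
  assumes "is_sheaf C J P"
  shows "sheaf (FObj P) (restr P)" "\<And>d. d \<in> Obj C \<Longrightarrow> small (FObj P d)"
    "\<And>f. f \<in> Arr C \<Longrightarrow> FArr P f = (FObj P (Cod C f), FObj P (Dom C f), restr P f)"
    "\<And>f. f \<in> Arr C \<Longrightarrow> restr P f \<in> FObj P (Cod C f) \<rightarrow>\<^sub>E FObj P (Dom C f)"
proof -
  interpret P: cat_functor "op_cat C" set_cat P using assms by (simp add: is_sheaf_def)
  show sm: "small (FObj P d)" if "d \<in> Obj C" for d
    using P.FObj_in[of d] that by (simp add: set_cat_def)
  have 1: "FArr P f = (FObj P (Cod C f), FObj P (Dom C f), restr P f) \<and>
    restr P f \<in> FObj P (Cod C f) \<rightarrow>\<^sub>E FObj P (Dom C f)" if "f \<in> Arr C" for f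
    using P.FArr_in_hom[of f "Cod C f" "Dom C f"] that
    by (cases "FArr P f") (auto simp: hom_iff set_cat_def restr_def)
  then show 2: "\<And>f. f \<in> Arr C \<Longrightarrow> FArr P f = (FObj P (Cod C f), FObj P (Dom C f), restr P f)"
    "\<And>f. f \<in> Arr C \<Longrightarrow> restr P f \<in> FObj P (Cod C f) \<rightarrow>\<^sub>E FObj P (Dom C f)"
    by auto
  have "presheaf (FObj P) (restr P)"
    unfolding presheaf_def
  proof (intro conjI ballI impI)
    fix x a assume "x \<in> Obj C" "a \<in> FObj P x"
    then show "restr P (Id C x) a = a"
      using P.FArr_Id[of x] by (simp add: restr_def set_cat_def)
  next
    fix f g a assume "f \<in> Arr C" "g \<in> Arr C" "Cod C g = Dom C f" "a \<in> FObj P (Cod C f)"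
    then show "restr P (Comp C f g) a = restr P g (restr P f a)"
      using P.FArr_Comp_arr[of f g] 2(1)[of f] 2(1)[of g] 2(1)[of "Comp C f g"]
      by (simp add: set_cat_def compose_def)
  qed (use 1 in auto)
  moreover have "\<And>S s. (\<forall>f \<in> S. s f \<in> FObj P (Dom C f) \<and> (\<forall>g \<in> Arr C. Cod C g = Dom C f \<longrightarrow> restr P g (s f) = s (Comp C f g)))
     = matching_family C P S s"
    by (auto simp: matching_family_def)
  ultimately show "sheaf (FObj P) (restr P)"
    using assms unfolding is_sheaf_def sheaf_def by simp
qed

text \<open>An arrow carries its source and target sheaves, and each component its source and target
  sets; \<open>at\<close> strips these tags and leaves the bare function.\<close>

definition at :: "('u, 'u, 'u set, 'u fn) fctr \<times> ('u, 'u, 'u set, 'u fn) fctr \<times> ('u \<Rightarrow> 'u fn) \<Rightarrow> 'u \<Rightarrow> 'u \<Rightarrow> 'u"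
  where "at t d = snd (snd (snd (snd t) d))"

lemma hom_Sh_iff: "t \<in> hom Sh P Q \<longleftrightarrow> is_sheaf C J P \<and> is_sheaf C J Q \<and>
   fst t = P \<and> fst (snd t) = Q \<and> nat_trans (op_cat C) set_cat P Q (snd (snd t))"
  by (cases t) (auto simp: sheaf_cat_def full_subcat_def functor_cat_def hom_iff)

lemma Sh_hom_at:
  assumes "t \<in> hom Sh P Q"
  shows "d \<in> Obj C \<Longrightarrow> snd (snd t) d = (FObj P d, FObj Q d, at t d)"
    and "d \<in> Obj C \<Longrightarrow> at t d \<in> FObj P d \<rightarrow>\<^sub>E FObj Q d"
    and "d \<in> Obj C \<Longrightarrow> a \<in> FObj P d \<Longrightarrow> at t d a \<in> FObj Q d"
    and "f \<in> Arr C \<Longrightarrow> a \<in> FObj P (Cod C f) \<Longrightarrow> at t (Dom C f) (restr P f a) = restr Q f (at t (Cod C f) a)"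
proof -
  have P: "is_sheaf C J P" and Q: "is_sheaf C J Q" and t: "nat_trans (op_cat C) set_cat P Q (snd (snd t))"
    using assms by (auto simp: hom_Sh_iff)
  have 1: "snd (snd t) d = (FObj P d, FObj Q d, at t d) \<and> at t d \<in> FObj P d \<rightarrow>\<^sub>E FObj Q d" if "d \<in> Obj C" for d
    using nat_transD(3-5)[OF t, of d] that
    by (cases "snd (snd t) d") (auto simp: set_cat_def at_def)
  then show *: "d \<in> Obj C \<Longrightarrow> snd (snd t) d = (FObj P d, FObj Q d, at t d)"
    "d \<in> Obj C \<Longrightarrow> at t d \<in> FObj P d \<rightarrow>\<^sub>E FObj Q d"
    "d \<in> Obj C \<Longrightarrow> a \<in> FObj P d \<Longrightarrow> at t d a \<in> FObj Q d" for d by auto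
  assume f: "f \<in> Arr C" and a: "a \<in> FObj P (Cod C f)"
  have "compose (FObj P (Cod C f)) (at t (Dom C f)) (restr P f) = compose (FObj P (Cod C f)) (restr Q f) (at t (Cod C f))"
    using nat_transD(6)[OF t, of f] f a 1[of "Dom C f"] 1[of "Cod C f"]
      is_sheaf_sheaf(3)[OF P f] is_sheaf_sheaf(3)[OF Q f]
    by (simp add: set_cat_def)
  from fun_cong[OF this, of a] a show "at t (Dom C f) (restr P f a) = restr Q f (at t (Cod C f) a)"
    by (simp add: compose_def)
qed

lemma Sh_hom_eqI:
  assumes "t \<in> hom Sh P Q" "t' \<in> hom Sh P Q" "\<And>d a. d \<in> Obj C \<Longrightarrow> a \<in> FObj P d \<Longrightarrow> at t d a = at t' d a"
  shows "t = t'"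
proof -
  have "snd (snd t) d = snd (snd t') d" for d
  proof (cases "d \<in> Obj C")
    case True
    then have "at t d = at t' d"
      using assms(3) by (intro PiE_ext[OF Sh_hom_at(2)[OF assms(1)] Sh_hom_at(2)[OF assms(2)]]) auto
    then show ?thesis using True Sh_hom_at(1)[OF assms(1)] Sh_hom_at(1)[OF assms(2)] by simp
  next
    case False
    have "snd (snd t) \<in> extensional (Obj C)" "snd (snd t') \<in> extensional (Obj C)"
      using assms(1,2) nat_transD(7)[of "op_cat C" set_cat P Q] by (auto simp: hom_Sh_iff)
    from this[THEN extensional_arb, OF False] show ?thesis by simp
  qed
  then show ?thesis using assms(1,2) by (auto simp: hom_Sh_iff intro!: prod_eqI)
qed

lemma Sh_hom_mk:
  assumes P: "is_sheaf C J P" and Q: "is_sheaf C J Q"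
    and m: "\<And>d a. d \<in> Obj C \<Longrightarrow> a \<in> FObj P d \<Longrightarrow> m d a \<in> FObj Q d"
    and n: "\<And>f a. f \<in> Arr C \<Longrightarrow> a \<in> FObj P (Cod C f) \<Longrightarrow> m (Dom C f) (restr P f a) = restr Q f (m (Cod C f) a)"
  shows "\<exists>t \<in> hom Sh P Q. \<forall>d \<in> Obj C. \<forall>a \<in> FObj P d. at t d a = m d a"
proof -
  let ?t = "\<lambda>d\<in>Obj C. (FObj P d, FObj Q d, restrict (m d) (FObj P d))"
  note sP = is_sheaf_sheaf[OF P] and sQ = is_sheaf_sheaf[OF Q]
  have "nat_trans (op_cat C) set_cat P Q ?t"
  proof (rule nat_transI)
    show "cat_functor (op_cat C) set_cat P" "cat_functor (op_cat C) set_cat Q"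
      using P Q by (auto simp: is_sheaf_def)
    fix f assume "f \<in> Arr (op_cat C)"
    then have f: "f \<in> Arr C" by simp
    have "compose (FObj P (Cod C f)) (restrict (m (Dom C f)) (FObj P (Dom C f))) (restr P f) =
        compose (FObj P (Cod C f)) (restr Q f) (restrict (m (Cod C f)) (FObj P (Cod C f)))"
      using f n presheaf_simps(1)[OF sheaf_presheaf[OF sP(1)], of f]
      by (auto simp: compose_def intro!: restrict_ext)
    then show "Comp set_cat (?t (Cod (op_cat C) f)) (FArr P f) = Comp set_cat (FArr Q f) (?t (Dom (op_cat C) f))"
      using f sP(3) sQ(3) by (simp add: set_cat_def)
  qed (use sP(2) sQ(2) m in \<open>auto simp: set_cat_def hom_iff\<close>)
  then have "(P, Q, ?t) \<in> hom Sh P Q" using P Q by (simp add: hom_Sh_iff)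
  then show ?thesis by (rule bexI[rotated]) (auto simp: at_def)
qed

lemma at_Id: "d \<in> Obj C \<Longrightarrow> a \<in> FObj P d \<Longrightarrow> at (Id Sh P) d a = a"
  by (simp add: at_def sheaf_cat_def full_subcat_def functor_cat_def set_cat_def)

lemma at_Comp:
  assumes "t \<in> hom Sh P Q" "s \<in> hom Sh Q R" "d \<in> Obj C" "a \<in> FObj P d"
  shows "at (Comp Sh s t) d a = at s d (at t d a)"
proof -
  obtain \<tau> \<sigma> where [simp]: "t = (P, Q, \<tau>)" "s = (Q, R, \<sigma>)" using assms(1,2)
    by (cases t, cases s) (auto simp: hom_Sh_iff)
  show ?thesis
    using Sh_hom_at(1)[OF assms(1,3)] Sh_hom_at(1)[OF assms(2,3)] assms(3,4)
    by (subst at_def) (simp add: sheaf_cat_def full_subcat_def functor_cat_def set_cat_def compose_def)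
qed

end

section \<open>Exactness properties of categories of sheaves\<close>

text \<open>The exactness property of toposes on which everything rests: an epimorphic family
  exhibits its target as the colimit of its members and their overlaps. Overlaps are all commuting
  squares over two members, so the definition makes sense without chosen pullbacks.\<close>

definition effective_families :: "('o, 'a) cat \<Rightarrow> bool" where
  "effective_families C \<longleftrightarrow> (\<forall>c S. epimorphic_family C c S \<longrightarrow> (\<forall>x s.
     (\<forall>u \<in> S. s u \<in> hom C (Dom C u) x) \<and>
     (\<forall>u \<in> S. \<forall>v \<in> S. \<forall>a \<in> Arr C. \<forall>b \<in> Arr C. Dom C a = Dom C b \<and> Cod C a = Dom C u \<and> Cod C b = Dom C v \<and>
        Comp C u a = Comp C v b \<longrightarrow> Comp C (s u) a = Comp C (s v) b) \<longrightarrow> x \<in> Obj C \<longrightarrow>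
     (\<exists>h \<in> hom C c x. \<forall>u \<in> S. Comp C h u = s u)))"

definition locally_small :: "'u itself \<Rightarrow> ('o, 'a) cat \<Rightarrow> bool" where
  "locally_small (_ :: 'u itself) C \<longleftrightarrow> (\<forall>x y. hom C x y \<prec> (UNIV :: 'u set))"

context small_site begin

text \<open>A compatible family in \<open>W\<close> is glued in \<open>V\<close>, and the result
  stays in \<open>W\<close> because membership in \<open>W\<close> is local.\<close>

lemma subsheaf:
  assumes V: "sheaf V \<rho>" and W: "\<And>d. d \<in> Obj C \<Longrightarrow> W d \<subseteq> V d"
    and r: "\<And>f a. f \<in> Arr C \<Longrightarrow> a \<in> W (Cod C f) \<Longrightarrow> \<rho> f a \<in> W (Dom C f)"
    and l: "\<And>d P y. d \<in> Obj C \<Longrightarrow> covers d P \<Longrightarrow> y \<in> V d \<Longrightarrow>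
      (\<And>f. f \<in> Arr C \<Longrightarrow> Cod C f = d \<Longrightarrow> P f \<Longrightarrow> \<rho> f y \<in> W (Dom C f)) \<Longrightarrow> y \<in> W d"
  shows "sheaf W \<rho>"
proof (rule sheafI)
  show "presheaf W \<rho>"
    using W r presheaf_simps[OF sheaf_presheaf[OF V]] unfolding presheaf_def
    by (meson Obj_arr subsetD)
  show "y = y'" if "d \<in> Obj C" "covers d P" "y \<in> W d" "y' \<in> W d"
      "\<And>f. f \<in> Arr C \<Longrightarrow> Cod C f = d \<Longrightarrow> P f \<Longrightarrow> \<rho> f y = \<rho> f y'" for d P y y'
    by (rule sheaf_separated[OF V that(1,2)]) (use that W in auto)
  fix d P s assume d: "d \<in> Obj C" and P: "covers d P"
    and s: "\<And>f. f \<in> Arr C \<Longrightarrow> Cod C f = d \<Longrightarrow> P f \<Longrightarrow> s f \<in> W (Dom C f)"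
    and sn: "\<And>f g. f \<in> Arr C \<Longrightarrow> Cod C f = d \<Longrightarrow> P f \<Longrightarrow> g \<in> Arr C \<Longrightarrow> Cod C g = Dom C f \<Longrightarrow>
         \<rho> g (s f) = s (Comp C f g)"
  have "\<exists>y \<in> V d. \<forall>f \<in> Arr C. Cod C f = d \<longrightarrow> P f \<longrightarrow> \<rho> f y = s f"
    by (rule sheaf_glue[OF V d P]) (use s sn subsetD[OF W] in auto)
  then obtain y where y: "y \<in> V d" "\<And>f. f \<in> Arr C \<Longrightarrow> Cod C f = d \<Longrightarrow> P f \<Longrightarrow> \<rho> f y = s f" by blast
  have "y \<in> W d" by (rule l[OF d P y(1)]) (use y(2) s in auto)
  then show "\<exists>y \<in> W d. \<forall>f \<in> Arr C. Cod C f = d \<longrightarrow> P f \<longrightarrow> \<rho> f y = s f" using y(2) by blast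
qed

subsection \<open>The sheaf of closed relations\<close>

text \<open>The closed subpresheaves of the product of the representable presheaf of \<open>d\<close> with a
  presheaf \<open>X\<close>. If \<open>X\<close> is terminal, this is the subobject classifier (closed sieves).\<close>

definition rels :: "('u \<Rightarrow> 'x set) \<Rightarrow> ('u \<Rightarrow> 'x \<Rightarrow> 'x) \<Rightarrow> 'u \<Rightarrow> ('u \<times> 'x) set set" where
  "rels X act d = {R. (\<forall>g h. (g, h) \<in> R \<longrightarrow> g \<in> Arr C \<and> Cod C g = d \<and> h \<in> X (Dom C g)) \<and>
     (\<forall>g h k. (g, h) \<in> R \<longrightarrow> k \<in> Arr C \<longrightarrow> Cod C k = Dom C g \<longrightarrow> (Comp C g k, act k h) \<in> R) \<and>
     (\<forall>g h. g \<in> Arr C \<longrightarrow> Cod C g = d \<longrightarrow> h \<in> X (Dom C g) \<longrightarrow>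
        covers (Dom C g) (\<lambda>k. (Comp C g k, act k h) \<in> R) \<longrightarrow> (g, h) \<in> R)}"

definition rel_restr :: "'u \<Rightarrow> ('u \<times> 'x) set \<Rightarrow> ('u \<times> 'x) set" where
  "rel_restr f R = {(g, h). g \<in> Arr C \<and> Cod C g = Dom C f \<and> (Comp C f g, h) \<in> R}"

lemma relsD:
  assumes "R \<in> rels X act d" "(g, h) \<in> R"
  shows "g \<in> Arr C" "Cod C g = d" "h \<in> X (Dom C g)"
    "k \<in> Arr C \<Longrightarrow> Cod C k = Dom C g \<Longrightarrow> (Comp C g k, act k h) \<in> R"
  using assms unfolding rels_def by blast+

lemma rels_closed:
  assumes "R \<in> rels X act d" "g \<in> Arr C" "Cod C g = d" "h \<in> X (Dom C g)"
    "covers (Dom C g) (\<lambda>k. (Comp C g k, act k h) \<in> R)"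
  shows "(g, h) \<in> R"
  using assms unfolding rels_def by blast

text \<open>This sheaf is the power object of the sheaf associated with \<open>X\<close>. Closedness
  makes a relation determined by its restrictions along a cover: a pair belongs to it as soon as it
  does so locally.\<close>

lemma sheaf_rels:
  fixes X :: "'u \<Rightarrow> 'x set"
  assumes X: "presheaf X act"
  shows "sheaf (rels X act) rel_restr"
proof (rule sheafI)
  note a = presheaf_simps[OF X]
  have r: "rel_restr f R \<in> rels X act (Dom C f)" if f: "f \<in> Arr C" and R: "R \<in> rels X act (Cod C f)" for f R
    unfolding rels_def
  proof (safe)
    fix g h assume gh: "g \<in> Arr C" "Cod C g = Dom C f" "h \<in> X (Dom C g)"
       and c: "covers (Dom C g) (\<lambda>k. (Comp C g k, act k h) \<in> rel_restr f R)"
    have "covers (Dom C g) (\<lambda>k. (Comp C (Comp C f g) k, act k h) \<in> R)"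
      using c gh f by (subst covers_cong[of _ _ "\<lambda>k. (Comp C g k, act k h) \<in> rel_restr f R"])
        (auto simp: rel_restr_def assoc)
    then have "(Comp C f g, h) \<in> R" using gh f by (intro rels_closed[OF R]) auto
    then show "(g, h) \<in> rel_restr f R" using gh by (simp add: rel_restr_def)
  next
    fix g h k assume gh: "(g, h) \<in> rel_restr f R" and k: "k \<in> Arr C" "Cod C k = Dom C g"
    then have "(Comp C (Comp C f g) k, act k h) \<in> R" using f relsD(4)[OF R, of "Comp C f g" h k]
      by (simp add: rel_restr_def)
    then show "(Comp C g k, act k h) \<in> rel_restr f R" using gh k f by (auto simp: rel_restr_def assoc)
  next
    fix g h assume "(g, h) \<in> rel_restr f R"
    then show "h \<in> X (Dom C g)" using relsD(3)[OF R, of "Comp C f g" h] f by (simp add: rel_restr_def)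
  qed (auto simp: rel_restr_def)
  have id: "rel_restr (Id C x) R = R" if "x \<in> Obj C" "R \<in> rels X act x" for x R
    using relsD(1,2)[OF that(2)] by (fastforce simp: rel_restr_def that(1))
  have cp: "rel_restr (Comp C f g) R = rel_restr g (rel_restr f R)" if "f \<in> Arr C" "g \<in> Arr C" "Cod C g = Dom C f" for f g and R :: "('u \<times> 'x) set"
    using that by (auto simp: rel_restr_def assoc)
  show "presheaf (rels X act) rel_restr" unfolding presheaf_def using r id cp by blast
  \<comment> \<open>A Yoneda argument: membership can be read at the identity in a restriction, and
    restrictions are what a compatible family controls.\<close>
  have mem: "(g, h) \<in> R \<longleftrightarrow> (Id C (Dom C g), h) \<in> rel_restr g R" if "g \<in> Arr C" for g h and R :: "('u \<times> 'x) set"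
    using that by (auto simp: rel_restr_def)
  have sub: "R \<subseteq> R'" if d: "d \<in> Obj C" "covers d P" "R \<in> rels X act d" "R' \<in> rels X act d"
      and eq: "\<And>f. f \<in> Arr C \<Longrightarrow> Cod C f = d \<Longrightarrow> P f \<Longrightarrow> rel_restr f R = rel_restr f R'" for d P R R'
  proof (clarify)
    fix g h assume gh: "(g, h) \<in> R"
    note g = relsD(1-3)[OF d(3) gh]
    have "covers (Dom C g) (\<lambda>k. P (Comp C g k))" using covers_pullback[OF d(2)] g by auto
    then have "covers (Dom C g) (\<lambda>k. (Comp C g k, act k h) \<in> R')"
    proof (rule covers_mono[rotated])
      fix f assume f: "f \<in> Arr C" "Cod C f = Dom C g" "P (Comp C g f)"
      show "(Comp C g f, act f h) \<in> R'"
        using eq[of "Comp C g f"] f g relsD(4)[OF d(3) gh f(1,2)] mem[of "Comp C g f"] by simp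
    next
      fix f k assume f: "f \<in> Arr C" "Cod C f = Dom C g" "k \<in> Arr C" "Cod C k = Dom C f"
        "(Comp C g f, act f h) \<in> R'"
      then show "(Comp C g (Comp C f k), act (Comp C f k) h) \<in> R'"
        using relsD(4)[OF d(4) f(5), of k] g by (simp add: a assoc)
    qed (use g in simp)
    then show "(g, h) \<in> R'" using g by (intro rels_closed[OF d(4)]) auto
  qed
  show "R = R'" if d: "d \<in> Obj C" "covers d P" "R \<in> rels X act d" "R' \<in> rels X act d"
      and eq: "\<And>f. f \<in> Arr C \<Longrightarrow> Cod C f = d \<Longrightarrow> P f \<Longrightarrow> rel_restr f R = rel_restr f R'" for d P R R'
    using sub[OF d eq] sub[OF d(1,2,4,3) eq[symmetric]] by blast
  fix d P s assume d: "d \<in> Obj C" and P: "covers d P"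
    and s: "\<And>f. f \<in> Arr C \<Longrightarrow> Cod C f = d \<Longrightarrow> P f \<Longrightarrow> s f \<in> rels X act (Dom C f)"
    and sn: "\<And>f g. f \<in> Arr C \<Longrightarrow> Cod C f = d \<Longrightarrow> P f \<Longrightarrow> g \<in> Arr C \<Longrightarrow> Cod C g = Dom C f \<Longrightarrow>
         rel_restr g (s f) = s (Comp C f g)"
  \<comment> \<open>The largest candidate: a pair belongs to the glued relation when each of its
    restrictions that falls into the cover belongs to the local relation there, read at the
    identity.\<close>
  define R where "R = {(g, h). g \<in> Arr C \<and> Cod C g = d \<and> h \<in> X (Dom C g) \<and>
    (\<forall>k \<in> Arr C. Cod C k = Dom C g \<longrightarrow> P (Comp C g k) \<longrightarrow> (Id C (Dom C k), act k h) \<in> s (Comp C g k))}"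
  have RI: "(g, h) \<in> R" if "g \<in> Arr C" "Cod C g = d" "h \<in> X (Dom C g)"
    "\<And>k. k \<in> Arr C \<Longrightarrow> Cod C k = Dom C g \<Longrightarrow> P (Comp C g k) \<Longrightarrow> (Id C (Dom C k), act k h) \<in> s (Comp C g k)" for g h
    using that by (auto simp: R_def)
  have RD: "g \<in> Arr C" "Cod C g = d" "h \<in> X (Dom C g)"
    "\<And>k. k \<in> Arr C \<Longrightarrow> Cod C k = Dom C g \<Longrightarrow> P (Comp C g k) \<Longrightarrow> (Id C (Dom C k), act k h) \<in> s (Comp C g k)"
    if "(g, h) \<in> R" for g h
    using that by (auto simp: R_def)
  have Rk: "(Comp C g k, act k h) \<in> R" if gh: "(g, h) \<in> R" and k: "k \<in> Arr C" "Cod C k = Dom C g" for g h k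
  proof (rule RI)
    fix l assume "l \<in> Arr C" "Cod C l = Dom C (Comp C g k)" "P (Comp C (Comp C g k) l)"
    then show "(Id C (Dom C l), act l (act k h)) \<in> s (Comp C (Comp C g k) l)"
      using RD(4)[OF gh, of "Comp C k l"] RD(1-3)[OF gh] k by (simp add: a(3) assoc)
  qed (use RD(1-3)[OF gh] k a(1)[of k h] in auto)
  have mem: "(l, h) \<in> s f \<longleftrightarrow> (Id C (Dom C l), h) \<in> s (Comp C f l)"
    if "f \<in> Arr C" "Cod C f = d" "P f" "l \<in> Arr C" "Cod C l = Dom C f" for f l h
    using mem[of l h "s f"] sn[of f l] that by simp
  have R: "R \<in> rels X act d"
    unfolding rels_def
  proof (safe)
    fix g h assume gh: "g \<in> Arr C" "d = Cod C g" "h \<in> X (Dom C g)"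
      and c: "covers (Dom C g) (\<lambda>k. (Comp C g k, act k h) \<in> R)"
    show "(g, h) \<in> R"
    proof (rule RI)
      fix k assume k: "k \<in> Arr C" "Cod C k = Dom C g" and Pk: "P (Comp C g k)"
      have S: "s (Comp C g k) \<in> rels X act (Dom C k)" using s[of "Comp C g k"] gh k Pk by simp
      have hk: "act k h \<in> X (Dom C k)" using a(1)[of k h] gh k by simp
      \<comment> \<open>The local relation at \<open>Comp C g k\<close> is closed, so membership of
        the identity pair may be checked on a cover, namely the given one pulled back along
        \<open>k\<close>.\<close>
      have "covers (Dom C k) (\<lambda>l. (Comp C (Id C (Dom C k)) l, act l (act k h)) \<in> s (Comp C g k))"
      proof (rule covers_mono[OF _ covers_pullback[OF c k]])
        fix l assume l: "l \<in> Arr C" "Cod C l = Dom C k" "(Comp C g (Comp C k l), act (Comp C k l) h) \<in> R"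
        have Pl: "P (Comp C g (Comp C k l))" using covers_stable[OF d P, of "Comp C g k" l] gh k l Pk by (simp add: assoc)
        have "(Id C (Dom C l), act (Id C (Dom C l)) (act (Comp C k l) h)) \<in> s (Comp C g (Comp C k l))"
          using RD(4)[OF l(3), of "Id C (Dom C l)"] Pl l gh k by simp
        then have "(Id C (Dom C l), act l (act k h)) \<in> s (Comp C (Comp C g k) l)"
          using l gh k hk a(1)[of l "act k h"] by (simp add: a(2,3) assoc)
        then show "(Comp C (Id C (Dom C k)) l, act l (act k h)) \<in> s (Comp C g k)"
          using mem[of "Comp C g k" l] l gh k Pk by simp
      next
        fix f l assume f: "f \<in> Arr C" "Cod C f = Dom C k" "l \<in> Arr C" "Cod C l = Dom C f"
          "(Comp C (Id C (Dom C k)) f, act f (act k h)) \<in> s (Comp C g k)"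
        then show "(Comp C (Id C (Dom C k)) (Comp C f l), act (Comp C f l) (act k h)) \<in> s (Comp C g k)"
          using relsD(4)[OF S f(5), of l] hk k by (simp add: a(3))
      qed (use k in auto)
      then show "(Id C (Dom C k), act k h) \<in> s (Comp C g k)"
        using k hk by (intro rels_closed[OF S]) auto
    qed (use gh in auto)
  qed (use Rk RD(1-3) in auto)
  have "rel_restr f R = s f" if f: "f \<in> Arr C" "Cod C f = d" "P f" for f
  proof (intro subset_antisym subrelI)
    fix g h assume gh: "(g, h) \<in> rel_restr f R"
    then have g: "g \<in> Arr C" "Cod C g = Dom C f" and R': "(Comp C f g, h) \<in> R" by (auto simp: rel_restr_def)
    then show "(g, h) \<in> s f"
      using RD(3)[OF R'] RD(4)[OF R', of "Id C (Dom C g)"] covers_stable[OF d P f g] mem[OF f g] f by (simp add: a(2))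
  next
    fix g h assume gh: "(g, h) \<in> s f"
    note g = relsD[OF s[OF f] gh]
    have "(Comp C f g, h) \<in> R"
    proof (rule RI)
      fix k assume k: "k \<in> Arr C" "Cod C k = Dom C (Comp C f g)" "P (Comp C (Comp C f g) k)"
      then show "(Id C (Dom C k), act k h) \<in> s (Comp C (Comp C f g) k)"
        using g(4)[of k] g(1-3) mem[OF f, of "Comp C g k"] f by (simp add: assoc)
    qed (use f g in auto)
    then show "(g, h) \<in> rel_restr f R" using g(1,2) by (simp add: rel_restr_def)
  qed
  then show "\<exists>y \<in> rels X act d. \<forall>f \<in> Arr C. Cod C f = d \<longrightarrow> P f \<longrightarrow> rel_restr f y = s f"
    using R by blast
qed

lemma rels_small:
  assumes "d \<in> Obj C" "\<And>x. x \<in> Obj C \<Longrightarrow> X x \<prec> (UNIV :: 'u set)"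
  shows "rels X act d \<prec> (UNIV :: 'u set)"
proof -
  have "rels X act d \<subseteq> Pow (Sigma (Arr C) (\<lambda>g. X (Dom C g)))" by (auto simp: rels_def)
  moreover have "Sigma (Arr C) (\<lambda>g. X (Dom C g)) \<prec> (UNIV :: 'u set)"
    using small_Arr assms by (intro lesspoll_Sigma[OF univ]) (auto simp: small_def)
  ultimately show ?thesis by (meson lesspoll_Pow lesspoll_subset univ)
qed

subsection \<open>Constructing arrows of sheaves locally\<close>

lemma sh_simps:
  fixes P :: "('u, 'u, 'u set, 'u fn) fctr"
  assumes "is_sheaf C J P"
  shows "f \<in> Arr C \<Longrightarrow> a \<in> FObj P (Cod C f) \<Longrightarrow> restr P f a \<in> FObj P (Dom C f)"
    and "x \<in> Obj C \<Longrightarrow> a \<in> FObj P x \<Longrightarrow> restr P (Id C x) a = a"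
    and "f \<in> Arr C \<Longrightarrow> g \<in> Arr C \<Longrightarrow> Cod C g = Dom C f \<Longrightarrow> a \<in> FObj P (Cod C f) \<Longrightarrow>
      restr P (Comp C f g) a = restr P g (restr P f a)"
  using presheaf_simps[OF sheaf_presheaf[OF is_sheaf_sheaf(1)[OF assms]]] by blast+

lemmas sh_separated = sheaf_separated[OF is_sheaf_sheaf(1)]

lemma Sh_hom_locally_eqI:
  assumes "t \<in> hom Sh P Q" "t' \<in> hom Sh P Q"
    and "\<And>d a. d \<in> Obj C \<Longrightarrow> a \<in> FObj P d \<Longrightarrow>
      covers d (\<lambda>g. at t (Dom C g) (restr P g a) = at t' (Dom C g) (restr P g a))"
  shows "t = t'"
proof (rule Sh_hom_eqI[OF assms(1,2)])
  fix d a assume d: "d \<in> Obj C" "a \<in> FObj P d"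
  have Q: "is_sheaf C J Q" using assms(1) by (simp add: hom_Sh_iff)
  show "at t d a = at t' d a"
    by (rule sh_separated[OF Q d(1) assms(3)[OF d]])
      (use d Sh_hom_at(3,4)[OF assms(1)] Sh_hom_at(3,4)[OF assms(2)] in auto)
qed

text \<open>The value at \<open>p\<close> is glued from the values that \<open>T\<close> provides on
  a cover. Arrows out of sheaves that are known only through local generators are built this
  way.\<close>

lemma Sh_hom_from_relation:
  fixes P Q :: "('u, 'u, 'u set, 'u fn) fctr"
  assumes P: "is_sheaf C J P" and Q: "is_sheaf C J Q"
    and mem: "\<And>d p q. T d p q \<Longrightarrow> d \<in> Obj C \<and> p \<in> FObj P d \<and> q \<in> FObj Q d"
    and fn: "\<And>d p q q'. T d p q \<Longrightarrow> T d p q' \<Longrightarrow> q = q'"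
    and st: "\<And>g p q. g \<in> Arr C \<Longrightarrow> T (Cod C g) p q \<Longrightarrow> T (Dom C g) (restr P g p) (restr Q g q)"
    and tot: "\<And>d p. d \<in> Obj C \<Longrightarrow> p \<in> FObj P d \<Longrightarrow> covers d (\<lambda>g. \<exists>q. T (Dom C g) (restr P g p) q)"
  shows "\<exists>t \<in> hom Sh P Q. \<forall>d p q. T d p q \<longrightarrow> at t d p = q"
proof -
  \<comment> \<open>\<open>K d p y\<close> says that \<open>y\<close> amalgamates all values that
    \<open>T\<close> gives to restrictions of \<open>p\<close>. As it refers to all of them and not
    to a chosen cover, it is stable under restriction.\<close>
  define K where "K d p y \<longleftrightarrow> y \<in> FObj Q d \<and>
    (\<forall>g q. g \<in> Arr C \<longrightarrow> Cod C g = d \<longrightarrow> T (Dom C g) (restr P g p) q \<longrightarrow> restr Q g y = q)" for d p y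
  have uniq: "y = y'" if "d \<in> Obj C" "p \<in> FObj P d" "K d p y" "K d p y'" for d p y y'
    by (rule sh_separated[OF Q that(1) tot[OF that(1,2)]]) (use that in \<open>auto simp: K_def\<close>)
  have ex: "\<exists>y. K d p y" if d: "d \<in> Obj C" and p: "p \<in> FObj P d" for d p
  proof -
    define s where "s g = (THE q. T (Dom C g) (restr P g p) q)" for g
    have s: "s g = q" if "T (Dom C g) (restr P g p) q" for g q
      unfolding s_def using that fn by blast
    have "\<exists>y \<in> FObj Q d. \<forall>f \<in> Arr C. Cod C f = d \<longrightarrow> (\<exists>q. T (Dom C f) (restr P f p) q) \<longrightarrow> restr Q f y = s f"
    proof (rule sheaf_glue[OF is_sheaf_sheaf(1)[OF Q] d tot[OF d p]])
      fix f assume "\<exists>q. T (Dom C f) (restr P f p) q"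
      then show "s f \<in> FObj Q (Dom C f)" using s mem by metis
    next
      fix f g assume fg: "f \<in> Arr C" "Cod C f = d" "g \<in> Arr C" "Cod C g = Dom C f" and "\<exists>q. T (Dom C f) (restr P f p) q"
      then obtain q where q: "T (Dom C f) (restr P f p) q" by blast
      have "T (Dom C (Comp C f g)) (restr P (Comp C f g) p) (restr Q g q)"
        using st[of g "restr P f p" q] fg q p by (simp add: sh_simps[OF P])
      from s[OF this] s[OF q] show "restr Q g (s f) = s (Comp C f g)" by simp
    qed
    then show ?thesis using s unfolding K_def by metis
  qed
  define m where "m d p = (SOME y. K d p y)" for d p
  have m: "K d p (m d p)" if "d \<in> Obj C" "p \<in> FObj P d" for d p
    unfolding m_def using ex[OF that] by (rule someI_ex)
  have "\<exists>t \<in> hom Sh P Q. \<forall>d \<in> Obj C. \<forall>a \<in> FObj P d. at t d a = m d a"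
  proof (rule Sh_hom_mk[OF P Q])
    show "m d a \<in> FObj Q d" if "d \<in> Obj C" "a \<in> FObj P d" for d a using m[OF that] by (simp add: K_def)
    fix f a assume f: "f \<in> Arr C" and a: "a \<in> FObj P (Cod C f)"
    have ra: "restr P f a \<in> FObj P (Dom C f)" using sh_simps(1)[OF P] f a by auto
    have Ka: "K (Cod C f) a (m (Cod C f) a)" using m f a by auto
    have "K (Dom C f) (restr P f a) (restr Q f (m (Cod C f) a))"
      unfolding K_def
    proof (intro conjI allI impI)
      show "restr Q f (m (Cod C f) a) \<in> FObj Q (Dom C f)" using sh_simps(1)[OF Q] f Ka by (auto simp: K_def)
      fix g q assume g: "g \<in> Arr C" "Cod C g = Dom C f" "T (Dom C g) (restr P g (restr P f a)) q"
      then have "T (Dom C (Comp C f g)) (restr P (Comp C f g) a) q" using f a by (simp add: sh_simps[OF P])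
      then have "restr Q (Comp C f g) (m (Cod C f) a) = q"
        using Ka f g(1,2) unfolding K_def by (metis Comp_arr(1,3))
      then show "restr Q g (restr Q f (m (Cod C f) a)) = q"
        using Ka f g by (simp add: sh_simps[OF Q] K_def)
    qed
    then show "m (Dom C f) (restr P f a) = restr Q f (m (Cod C f) a)"
      using uniq[OF _ ra m[OF _ ra]] f by auto
  qed
  then obtain t where t: "t \<in> hom Sh P Q" "\<And>d a. d \<in> Obj C \<Longrightarrow> a \<in> FObj P d \<Longrightarrow> at t d a = m d a" by blast
  have "at t d p = q" if T: "T d p q" for d p q
  proof -
    have d: "d \<in> Obj C" "p \<in> FObj P d" "q \<in> FObj Q d" using mem[OF T] by auto
    have "restr Q (Id C d) (m d p) = q"
      using m[OF d(1,2)] d T sh_simps(2)[OF P d(1,2)] unfolding K_def by (metis Id_arr)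
    moreover have "m d p \<in> FObj Q d" using m[OF d(1,2)] by (simp add: K_def)
    ultimately show ?thesis using t(2)[OF d(1,2)] sh_simps(2)[OF Q d(1)] by simp
  qed
  then show ?thesis using t(1) by blast
qed

subsection \<open>Sheaves associated with representable presheaves\<close>

text \<open>\<open>A\<close> is the sheaf associated with the presheaf represented by
  \<open>c\<close>, and \<eta> is the image of the identity of \<open>c\<close>: the last two
  clauses say that the map from the representable presheaf determined by \<eta> is locally
  surjective and locally injective.\<close>

definition rep :: "'u \<Rightarrow> ('u, 'u, 'u set, 'u fn) fctr \<Rightarrow> 'u \<Rightarrow> bool" where
  "rep c A \<eta> \<longleftrightarrow> c \<in> Obj C \<and> is_sheaf C J A \<and> \<eta> \<in> FObj A c \<and>
    (\<forall>d \<in> Obj C. \<forall>r \<in> FObj A d. covers d (\<lambda>g. \<exists>h \<in> hom C (Dom C g) c. restr A g r = restr A h \<eta>)) \<and>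
    (\<forall>h h'. h \<in> Arr C \<longrightarrow> h' \<in> Arr C \<longrightarrow> Cod C h = c \<longrightarrow> Cod C h' = c \<longrightarrow> Dom C h = Dom C h' \<longrightarrow>
       restr A h \<eta> = restr A h' \<eta> \<longrightarrow> covers (Dom C h) (\<lambda>k. Comp C h k = Comp C h' k))"

lemma repD:
  assumes "rep c A \<eta>"
  shows "c \<in> Obj C" "is_sheaf C J A" "\<eta> \<in> FObj A c"
    "\<And>d r. d \<in> Obj C \<Longrightarrow> r \<in> FObj A d \<Longrightarrow> covers d (\<lambda>g. \<exists>h \<in> hom C (Dom C g) c. restr A g r = restr A h \<eta>)"
    "\<And>h h'. h \<in> Arr C \<Longrightarrow> h' \<in> Arr C \<Longrightarrow> Cod C h = c \<Longrightarrow> Cod C h' = c \<Longrightarrow> Dom C h = Dom C h' \<Longrightarrow>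
       restr A h \<eta> = restr A h' \<eta> \<Longrightarrow> covers (Dom C h) (\<lambda>k. Comp C h k = Comp C h' k)"
  using assms unfolding rep_def by blast+

text \<open>As in the Yoneda lemma, the arrow has to send the restriction of \<eta> along h to the
  restriction of \<open>p\<close> along h. Local injectivity and separatedness of \<open>P\<close>
  make this single-valued, local surjectivity makes it locally total.\<close>

lemma rep_ex:
  assumes r: "rep c A \<eta>" and P: "is_sheaf C J P" and p: "p \<in> FObj P c"
  shows "\<exists>t \<in> hom Sh A P. at t c \<eta> = p"
proof -
  note r = repD[OF r]
  define T where "T d a q \<longleftrightarrow> d \<in> Obj C \<and> (\<exists>h \<in> hom C d c. a = restr A h \<eta> \<and> q = restr P h p)" for d a q
  have "\<exists>t \<in> hom Sh A P. \<forall>d a q. T d a q \<longrightarrow> at t d a = q"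
  proof (rule Sh_hom_from_relation[OF r(2) P])
    show "d \<in> Obj C \<and> a \<in> FObj A d \<and> q \<in> FObj P d" if "T d a q" for d a q
      using that sh_simps(1)[OF r(2)] sh_simps(1)[OF P] r(3) p by (auto simp: T_def hom_iff)
    show "q = q'" if "T d a q" "T d a q'" for d a q q'
    proof -
      from that obtain h h' where h: "h \<in> Arr C" "Dom C h = d" "Cod C h = c" "h' \<in> Arr C" "Dom C h' = d" "Cod C h' = c"
        and eq: "restr A h \<eta> = restr A h' \<eta>" "q = restr P h p" "q' = restr P h' p"
        by (auto simp: T_def hom_iff)
      have c: "covers d (\<lambda>k. Comp C h k = Comp C h' k)" using r(5)[of h h'] h eq by simp
      have "restr P k (restr P h p) = restr P k (restr P h' p)" if "k \<in> Arr C" "Cod C k = d" "Comp C h k = Comp C h' k" for k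
        using sh_simps(3)[OF P, of h k p] sh_simps(3)[OF P, of h' k p] that h p by simp
      then show ?thesis
        unfolding eq using h p sh_simps(1)[OF P h(1), of p] sh_simps(1)[OF P h(4), of p] Obj_arr(1)[OF h(1)]
        by - (rule sh_separated[OF P _ c], auto)
    qed
    show "T (Dom C g) (restr A g a) (restr P g q)" if "g \<in> Arr C" "T (Cod C g) a q" for g a q
    proof -
      from that obtain h where h: "h \<in> Arr C" "Dom C h = Cod C g" "Cod C h = c" "a = restr A h \<eta>" "q = restr P h p"
        by (auto simp: T_def hom_iff)
      then show ?thesis unfolding T_def using that(1) r(3) p
        by (intro conjI bexI[of _ "Comp C h g"]) (auto simp: hom_iff sh_simps[OF P] sh_simps[OF r(2)])
    qed
    show "covers d (\<lambda>g. \<exists>q. T (Dom C g) (restr A g a) q)" if "d \<in> Obj C" "a \<in> FObj A d" for d a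
      unfolding T_def using r(4)[OF that]
      by (subst covers_cong[of _ _ "\<lambda>g. \<exists>h \<in> hom C (Dom C g) c. restr A g a = restr A h \<eta>"]) auto
  qed
  then obtain t where t: "t \<in> hom Sh A P" "\<And>d a q. T d a q \<Longrightarrow> at t d a = q" by blast
  have "T c \<eta> p" unfolding T_def using r(1-3) p
    by (intro conjI bexI[of _ "Id C c"]) (auto simp: sh_simps[OF P] sh_simps[OF r(2)] hom_iff)
  then show ?thesis using t by blast
qed

lemma rep_unique:
  assumes r: "rep c A \<eta>" and t: "t \<in> hom Sh A P" "t' \<in> hom Sh A P" "at t c \<eta> = at t' c \<eta>"
  shows "t = t'"
proof (rule Sh_hom_locally_eqI[OF t(1,2)])
  note r = repD[OF r]
  fix d a assume d: "d \<in> Obj C" "a \<in> FObj A d"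
  have A: "at t (Dom C h) (restr A h \<eta>) = at t' (Dom C h) (restr A h \<eta>)" if "h \<in> Arr C" "Cod C h = c" for h
    using Sh_hom_at(4)[OF t(1), of h \<eta>] Sh_hom_at(4)[OF t(2), of h \<eta>] t(3) that r(3) by simp
  show "covers d (\<lambda>g. at t (Dom C g) (restr A g a) = at t' (Dom C g) (restr A g a))"
  proof (rule covers_mono[OF d(1) r(4)[OF d]])
    fix f assume "f \<in> Arr C" "Cod C f = d" "\<exists>h\<in>hom C (Dom C f) c. restr A f a = restr A h \<eta>"
    then obtain h where "h \<in> Arr C" "Dom C h = Dom C f" "Cod C h = c" "restr A f a = restr A h \<eta>"
      by (auto simp: hom_iff)
    then show "at t (Dom C f) (restr A f a) = at t' (Dom C f) (restr A f a)" using A[of h] by simp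
  next
    fix f k assume f: "f \<in> Arr C" "Cod C f = d" "k \<in> Arr C" "Cod C k = Dom C f"
      "at t (Dom C f) (restr A f a) = at t' (Dom C f) (restr A f a)"
    then show "at t (Dom C (Comp C f k)) (restr A (Comp C f k) a) = at t' (Dom C (Comp C f k)) (restr A (Comp C f k) a)"
      using Sh_hom_at(4)[OF t(1), of k "restr A f a"] Sh_hom_at(4)[OF t(2), of k "restr A f a"] d r
      by (simp add: sh_simps[OF r(2)])
  qed
qed

text \<open>The associated sheaf is realised inside the sheaf of closed relations: a section over
  \<open>d\<close> is a closed relation between arrows into \<open>d\<close> and arrows into
  \<open>c\<close> that is locally functional and locally total, in other words a locally defined
  arrow from \<open>d\<close> to \<open>c\<close>.\<close>

lemma rep_exists:
  assumes c: "c \<in> Obj C"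
  shows "\<exists>A \<eta>. rep c A \<eta>"
proof -
  let ?X = "\<lambda>e. hom C e c"
  let ?act = "\<lambda>k h. Comp C h k"
  have X: "presheaf ?X ?act" by (auto simp: presheaf_def hom_iff assoc)
  note V = sheaf_rels[OF X]
  define W where "W d = {R \<in> rels ?X ?act d.
    (\<forall>g h h'. (g, h) \<in> R \<longrightarrow> (g, h') \<in> R \<longrightarrow> covers (Dom C g) (\<lambda>k. Comp C h k = Comp C h' k)) \<and>
    covers d (\<lambda>g. \<exists>h. (g, h) \<in> R)}" for d
  have WI: "R \<in> W d" if "R \<in> rels ?X ?act d"
     "\<And>g h h'. (g, h) \<in> R \<Longrightarrow> (g, h') \<in> R \<Longrightarrow> covers (Dom C g) (\<lambda>k. Comp C h k = Comp C h' k)"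
     "covers d (\<lambda>g. \<exists>h. (g, h) \<in> R)" for d R
    using that by (simp add: W_def)
  have WD: "R \<in> rels ?X ?act d"
     "\<And>g h h'. (g, h) \<in> R \<Longrightarrow> (g, h') \<in> R \<Longrightarrow> covers (Dom C g) (\<lambda>k. Comp C h k = Comp C h' k)"
     "covers d (\<lambda>g. \<exists>h. (g, h) \<in> R)" if "R \<in> W d" for d R
    using that by (auto simp: W_def)
  have Rt: "rel_restr f R \<in> rels ?X ?act (Dom C f)" if "f \<in> Arr C" "R \<in> rels ?X ?act (Cod C f)" for f R
    using presheaf_simps(1)[OF sheaf_presheaf[OF V] that] .
  have W: "sheaf W rel_restr"
  proof (rule subsheaf[OF V])
    show "W d \<subseteq> rels ?X ?act d" for d by (auto simp: W_def)
    fix f R assume f: "f \<in> Arr C" and R: "R \<in> W (Cod C f)"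
    show "rel_restr f R \<in> W (Dom C f)"
    proof (rule WI[OF Rt[OF f WD(1)[OF R]]])
      show "covers (Dom C g) (\<lambda>k. Comp C h k = Comp C h' k)" if "(g, h) \<in> rel_restr f R" "(g, h') \<in> rel_restr f R" for g h h'
        using WD(2)[OF R, of "Comp C f g" h h'] that f by (simp add: rel_restr_def)
      have "covers (Dom C f) (\<lambda>g. \<exists>h. (Comp C f g, h) \<in> R)"
        using covers_pullback[OF WD(3)[OF R] f] by simp
      then show "covers (Dom C f) (\<lambda>g. \<exists>h. (g, h) \<in> rel_restr f R)"
        by (subst covers_cong[of _ _ "\<lambda>g. \<exists>h. (Comp C f g, h) \<in> R"]) (auto simp: rel_restr_def)
    qed
  next
    fix d P R assume d: "d \<in> Obj C" and P: "covers d P" and R: "R \<in> rels ?X ?act d"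
      and l: "\<And>f. f \<in> Arr C \<Longrightarrow> Cod C f = d \<Longrightarrow> P f \<Longrightarrow> rel_restr f R \<in> W (Dom C f)"
    show "R \<in> W d"
    proof (rule WI[OF R])
      fix g h h' assume gh: "(g, h) \<in> R" and gh': "(g, h') \<in> R"
      note g = relsD(1-3)[OF R gh] and g' = relsD(3)[OF R gh']
      have "covers (Dom C g) (\<lambda>k. P (Comp C g k))" using covers_pullback[OF P] g by auto
      then show "covers (Dom C g) (\<lambda>k. Comp C h k = Comp C h' k)"
      proof (rule covers_trans[rotated])
        fix k assume k: "k \<in> Arr C" "Cod C k = Dom C g" "P (Comp C g k)"
        have "(Id C (Dom C k), Comp C h k) \<in> rel_restr (Comp C g k) R"
          "(Id C (Dom C k), Comp C h' k) \<in> rel_restr (Comp C g k) R"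
          using relsD(4)[OF R gh k(1,2)] relsD(4)[OF R gh' k(1,2)] k g by (simp_all add: rel_restr_def)
        from WD(2)[OF l this] show "covers (Dom C k) (\<lambda>l. Comp C h (Comp C k l) = Comp C h' (Comp C k l))"
          using k g g' by (subst covers_cong[of _ _ "\<lambda>l. Comp C (Comp C h k) l = Comp C (Comp C h' k) l"]) (auto simp: hom_iff assoc)
      next
        fix f k assume "f \<in> Arr C" "Cod C f = Dom C g" "k \<in> Arr C" "Cod C k = Dom C f" "Comp C h f = Comp C h' f"
        then show "Comp C h (Comp C f k) = Comp C h' (Comp C f k)" using g g' by (simp add: hom_iff flip: assoc)
      qed (use g in simp)
    next
      show "covers d (\<lambda>g. \<exists>h. (g, h) \<in> R)"
      proof (rule covers_trans[OF d P])
        fix f assume f: "f \<in> Arr C" "Cod C f = d" "P f"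
        show "covers (Dom C f) (\<lambda>k. \<exists>h. (Comp C f k, h) \<in> R)"
          using WD(3)[OF l[OF f]]
          by (subst covers_cong[of _ _ "\<lambda>g. \<exists>h. (g, h) \<in> rel_restr f R"]) (auto simp: rel_restr_def)
      qed (use relsD(4)[OF R] in blast)
    qed
  qed
  \<comment> \<open>The closure of the graph of the identity of \<open>c\<close>: pairs of arrows
    that agree locally.\<close>
  define \<eta> where "\<eta> = {(g, h). g \<in> Arr C \<and> Cod C g = c \<and> h \<in> hom C (Dom C g) c \<and> covers (Dom C g) (\<lambda>k. Comp C g k = Comp C h k)}"
  have eta_rels: "\<eta> \<in> rels ?X ?act c"
    unfolding rels_def
  proof (safe)
    fix g h k assume gh: "(g, h) \<in> \<eta>" and k: "k \<in> Arr C" "Cod C k = Dom C g"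
    then have "covers (Dom C k) (\<lambda>l. Comp C g (Comp C k l) = Comp C h (Comp C k l))"
      using covers_pullback[of "Dom C g" "\<lambda>k. Comp C g k = Comp C h k" k] by (simp add: \<eta>_def)
    then have "covers (Dom C k) (\<lambda>l. Comp C (Comp C g k) l = Comp C (Comp C h k) l)"
      using gh k by (subst covers_cong[of _ _ "\<lambda>l. Comp C g (Comp C k l) = Comp C h (Comp C k l)"]) (auto simp: \<eta>_def hom_iff assoc)
    then show "(Comp C g k, Comp C h k) \<in> \<eta>" using gh k by (simp add: \<eta>_def hom_iff)
  next
    fix g h assume g: "g \<in> Arr C" "c = Cod C g" "h \<in> hom C (Dom C g) (Cod C g)"
      and cv: "covers (Dom C g) (\<lambda>k. (Comp C g k, Comp C h k) \<in> \<eta>)"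
    have "covers (Dom C g) (\<lambda>k. Comp C g k = Comp C h k)"
    proof (rule covers_trans[OF _ cv])
      fix k assume k: "k \<in> Arr C" "Cod C k = Dom C g" "(Comp C g k, Comp C h k) \<in> \<eta>"
      then show "covers (Dom C k) (\<lambda>l. Comp C g (Comp C k l) = Comp C h (Comp C k l))"
        using g by (subst covers_cong[of _ _ "\<lambda>l. Comp C (Comp C g k) l = Comp C (Comp C h k) l"]) (auto simp: \<eta>_def hom_iff assoc)
    next
      fix f k assume "f \<in> Arr C" "Cod C f = Dom C g" "k \<in> Arr C" "Cod C k = Dom C f" "Comp C g f = Comp C h f"
      then show "Comp C g (Comp C f k) = Comp C h (Comp C f k)" using g by (simp add: hom_iff flip: assoc)
    qed (use g in simp)
    then show "(g, h) \<in> \<eta>" using g by (simp add: \<eta>_def)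
  qed (auto simp: \<eta>_def)
  have eta: "\<eta> \<in> W c"
  proof (rule WI[OF eta_rels])
    fix g h h' assume gh: "(g, h) \<in> \<eta>" "(g, h') \<in> \<eta>"
    then have g: "g \<in> Arr C" "h \<in> Arr C" "h' \<in> Arr C" "Dom C h = Dom C g" "Dom C h' = Dom C g" "Cod C h' = Cod C h"
      by (auto simp: \<eta>_def hom_iff)
    have "covers (Dom C g) (\<lambda>k. Comp C g k = Comp C h k \<and> Comp C g k = Comp C h' k)"
      using gh by (intro covers_conj) (auto simp: \<eta>_def)
    then show "covers (Dom C g) (\<lambda>k. Comp C h k = Comp C h' k)"
    proof (rule covers_mono[rotated])
      fix f k assume "f \<in> Arr C" "Cod C f = Dom C g" "k \<in> Arr C" "Cod C k = Dom C f" "Comp C h f = Comp C h' f"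
      then show "Comp C h (Comp C f k) = Comp C h' (Comp C f k)" using g by (simp flip: assoc)
    qed (use g in auto)
  next
    have "(g, g) \<in> \<eta>" if "g \<in> Arr C" "Cod C g = c" for g
      using that by (auto simp: \<eta>_def hom_iff intro: covers_true)
    then show "covers c (\<lambda>g. \<exists>h. (g, h) \<in> \<eta>)" using c by (intro covers_true) auto
  qed
  \<comment> \<open>Near any of its pairs a section is the closure of the graph of an arrow; hence
    sections are locally restrictions of \<eta>.\<close>
  have L: "rel_restr g R = rel_restr h \<eta>" if d: "d \<in> Obj C" and R: "R \<in> W d" and gh: "(g, h) \<in> R" for d R g h
  proof -
    note g = relsD(1-3)[OF WD(1)[OF R] gh]
    have h: "h \<in> Arr C" "Dom C h = Dom C g" "Cod C h = c" using g by (auto simp: hom_iff)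
    show ?thesis
    proof (intro subset_antisym subrelI)
      fix k l assume "(k, l) \<in> rel_restr g R"
      then have k: "k \<in> Arr C" "Cod C k = Dom C g" and gk: "(Comp C g k, l) \<in> R" by (auto simp: rel_restr_def)
      have "covers (Dom C k) (\<lambda>m. Comp C (Comp C h k) m = Comp C l m)"
        using WD(2)[OF R relsD(4)[OF WD(1)[OF R] gh k] gk] g k by simp
      then show "(k, l) \<in> rel_restr h \<eta>"
        using k h g relsD(3)[OF WD(1)[OF R] gk] by (simp add: rel_restr_def \<eta>_def)
    next
      fix k l assume "(k, l) \<in> rel_restr h \<eta>"
      then have k: "k \<in> Arr C" "Cod C k = Dom C g" "l \<in> Arr C" "Dom C l = Dom C k" "Cod C l = c"
        and cv: "covers (Dom C k) (\<lambda>m. Comp C (Comp C h k) m = Comp C l m)"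
        using h by (auto simp: rel_restr_def \<eta>_def hom_iff)
      have "(Comp C g k, l) \<in> R"
      proof (rule rels_closed[OF WD(1)[OF R]])
        have "covers (Dom C k) (\<lambda>m. (Comp C (Comp C g k) m, Comp C l m) \<in> R)"
        proof (rule covers_mono[OF _ cv])
          fix m assume m: "m \<in> Arr C" "Cod C m = Dom C k" "Comp C (Comp C h k) m = Comp C l m"
          show "(Comp C (Comp C g k) m, Comp C l m) \<in> R"
            using relsD(4)[OF WD(1)[OF R] gh, of "Comp C k m"] m k g h by (simp add: assoc)
        next
          fix m n assume m: "m \<in> Arr C" "Cod C m = Dom C k" "n \<in> Arr C" "Cod C n = Dom C m"
             "(Comp C (Comp C g k) m, Comp C l m) \<in> R"
          show "(Comp C (Comp C g k) (Comp C m n), Comp C l (Comp C m n)) \<in> R"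
            using relsD(4)[OF WD(1)[OF R] m(5), of n] m k g h by (simp add: assoc)
        qed (use k in simp)
        then show "covers (Dom C (Comp C g k)) (\<lambda>m. (Comp C (Comp C g k) m, Comp C l m) \<in> R)"
          using k g by simp
      qed (use k g in \<open>auto simp: hom_iff\<close>)
      then show "(k, l) \<in> rel_restr g R" using k by (simp add: rel_restr_def)
    qed
  qed
  have sm: "W d \<prec> (UNIV :: 'u set)" if "d \<in> Obj C" for d
  proof (rule lesspoll_subset[OF univ rels_small[OF that]])
    show "hom C x c \<prec> (UNIV :: 'u set)" for x
      by (rule lesspoll_subset[OF univ small_Arr[unfolded small_def]]) (auto simp: hom_iff)
  qed (use W_def in auto)
  obtain A :: "('u, 'u, 'u set, 'u fn) fctr" and e where A: "is_sheaf C J A"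
    and e: "\<And>d. d \<in> Obj C \<Longrightarrow> bij_betw (e d) (W d) (FObj A d)"
    and re: "\<And>f a. f \<in> Arr C \<Longrightarrow> a \<in> W (Cod C f) \<Longrightarrow> restr A f (e (Cod C f) a) = e (Dom C f) (rel_restr f a)"
    using sheaf_encode[OF W sm] by blast
  have inj: "e d R = e d R' \<longleftrightarrow> R = R'" if "d \<in> Obj C" "R \<in> W d" "R' \<in> W d" for d R R'
    using e[OF that(1)] that by (auto simp: bij_betw_def inj_on_eq_iff)
  have rW: "rel_restr f R \<in> W (Dom C f)" if "f \<in> Arr C" "R \<in> W (Cod C f)" for f R
    using presheaf_simps(1)[OF sheaf_presheaf[OF W] that] .
  have "rep c A (e c \<eta>)"
    unfolding rep_def
  proof (intro conjI ballI allI impI c A)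
    show "e c \<eta> \<in> FObj A c" using e[OF c] eta by (auto simp: bij_betw_def)
    fix d r assume d: "d \<in> Obj C" and "r \<in> FObj A d"
    then obtain R where R: "R \<in> W d" "r = e d R" using e[OF d] by (auto simp: bij_betw_def)
    show "covers d (\<lambda>g. \<exists>h\<in>hom C (Dom C g) c. restr A g r = restr A h (e c \<eta>))"
    proof (rule covers_mono[OF d WD(3)[OF R(1)]])
      fix f assume f: "f \<in> Arr C" "Cod C f = d" "\<exists>h. (f, h) \<in> R"
      then obtain h where h: "(f, h) \<in> R" by blast
      have h': "h \<in> hom C (Dom C f) c" using relsD(3)[OF WD(1)[OF R(1)] h] .
      then have "restr A f r = restr A h (e c \<eta>)"
        using L[OF d R(1) h] re[of f R] re[of h \<eta>] eta f R by (auto simp: hom_iff)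
      then show "\<exists>h\<in>hom C (Dom C f) c. restr A f r = restr A h (e c \<eta>)" using h' by blast
    next
      fix f k assume f: "f \<in> Arr C" "Cod C f = d" "k \<in> Arr C" "Cod C k = Dom C f"
        and "\<exists>h\<in>hom C (Dom C f) c. restr A f r = restr A h (e c \<eta>)"
      then obtain h where h: "h \<in> Arr C" "Dom C h = Dom C f" "Cod C h = c" "restr A f r = restr A h (e c \<eta>)"
        by (auto simp: hom_iff)
      then have "restr A (Comp C f k) r = restr A (Comp C h k) (e c \<eta>)"
        using f \<open>r \<in> FObj A d\<close> \<open>e c \<eta> \<in> FObj A c\<close> by (simp add: sh_simps[OF A])
      then show "\<exists>h\<in>hom C (Dom C (Comp C f k)) c. restr A (Comp C f k) r = restr A h (e c \<eta>)"
        using f h by (intro bexI[of _ "Comp C h k"]) (auto simp: hom_iff)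
    qed
  next
    fix h h' assume h: "h \<in> Arr C" "h' \<in> Arr C" "Cod C h = c" "Cod C h' = c" "Dom C h = Dom C h'"
      and eq: "restr A h (e c \<eta>) = restr A h' (e c \<eta>)"
    have "e (Dom C h) (rel_restr h \<eta>) = e (Dom C h) (rel_restr h' \<eta>)"
      using re[of h \<eta>] re[of h' \<eta>] eta h eq by simp
    then have eq': "rel_restr h \<eta> = rel_restr h' \<eta>"
      using inj[of "Dom C h"] rW[of h \<eta>] rW[of h' \<eta>] h eta by simp
    \<comment> \<open>Reading the two equal restrictions of \<eta> at the pair of the identity and
      \<open>h'\<close> puts \<open>(h, h')\<close> into \<eta>, which is local equality of
      \<open>h\<close> and \<open>h'\<close>.\<close>
    have "(h', h') \<in> \<eta>" using h by (auto simp: \<eta>_def hom_iff intro: covers_true)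
    then have "(Id C (Dom C h'), h') \<in> rel_restr h \<eta>"
      unfolding eq' using h by (simp add: rel_restr_def)
    then show "covers (Dom C h) (\<lambda>k. Comp C h k = Comp C h' k)"
      using h by (simp add: rel_restr_def \<eta>_def)
  qed
  then show ?thesis by blast
qed

end

section \<open>Limits, local smallness and epimorphic families in the category of sheaves\<close>

context small_site begin

lemma Sh_terminal: "\<exists>t. terminal Sh t"
proof -
  have V: "sheaf (\<lambda>_. {()}) (\<lambda>_ _. ())" by (intro sheafI) (auto simp: presheaf_def)
  obtain P :: "('u, 'u, 'u set, 'u fn) fctr" and e where P: "is_sheaf C J P"
    and e: "\<And>d. d \<in> Obj C \<Longrightarrow> bij_betw (e d) {()} (FObj P d)"
    using sheaf_encode[OF V] lesspoll_finite[OF univ] by blast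
  then have FO: "FObj P d = {e d ()}" if "d \<in> Obj C" for d using that by (auto simp: bij_betw_def)
  have "\<exists>!u. u \<in> hom Sh Q P" if Q: "Q \<in> Obj Sh" for Q
  proof -
    have "\<exists>t \<in> hom Sh Q P. \<forall>d \<in> Obj C. \<forall>a \<in> FObj Q d. at t d a = e d ()"
      using Q P FO sh_simps(1)[OF P] by (intro Sh_hom_mk) (auto simp: Obj_Sh)
    then obtain t where t: "t \<in> hom Sh Q P" by blast
    moreover have "t' = t" if "t' \<in> hom Sh Q P" for t'
      using FO Sh_hom_at(3)[OF that] Sh_hom_at(3)[OF t] by (intro Sh_hom_eqI[OF that t]) fastforce
    ultimately show ?thesis by blast
  qed
  moreover have "P \<in> Obj Sh" using P by (simp add: Obj_Sh)
  ultimately show ?thesis unfolding terminal_def by blast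
qed

lemma Sh_homD:
  assumes "t \<in> Arr Sh"
  shows "t \<in> hom Sh (Dom Sh t) (Cod Sh t)" "is_sheaf C J (Dom Sh t)" "is_sheaf C J (Cod Sh t)"
  using assms Sh.Obj_arr by (auto simp: hom_iff Obj_Sh)

text \<open>Pullbacks are formed sectionwise as sets of pairs; that a glued pair satisfies the
  equation again uses separatedness of the common target.\<close>

lemma Sh_pullbacks: "has_pullbacks Sh"
  unfolding has_pullbacks_def
proof (intro ballI impI)
  fix f g assume fA: "f \<in> Arr Sh" and gA: "g \<in> Arr Sh" and fg: "Cod Sh f = Cod Sh g"
  define A B R where "A = Dom Sh f" and "B = Dom Sh g" and "R = Cod Sh f"
  have A: "is_sheaf C J A" and B: "is_sheaf C J B" and R: "is_sheaf C J R" and f: "f \<in> hom Sh A R" and g: "g \<in> hom Sh B R"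
    using Sh_homD[OF fA] Sh_homD[OF gA] fg by (auto simp: A_def B_def R_def)
  note fa = Sh_hom_at(3,4)[OF f] and ga = Sh_hom_at(3,4)[OF g]
  define V where "V d = {(a, b). a \<in> FObj A d \<and> b \<in> FObj B d \<and> at f d a = at g d b}" for d
  define \<rho> where "\<rho> k = (\<lambda>(a, b). (restr A k a, restr B k b))" for k
  note rA = sh_simps[OF A] and rB = sh_simps[OF B] and rR = sh_simps[OF R]
  have V: "sheaf V \<rho>"
  proof (rule sheafI)
    show "presheaf V \<rho>" unfolding presheaf_def by (auto simp: V_def \<rho>_def rA rB fa ga)
    show "y = y'" if d: "d \<in> Obj C" "covers d P" "y \<in> V d" "y' \<in> V d"
      "\<And>f. f \<in> Arr C \<Longrightarrow> Cod C f = d \<Longrightarrow> P f \<Longrightarrow> \<rho> f y = \<rho> f y'" for d P y y'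
    proof -
      obtain a b a' b' where [simp]: "y = (a, b)" "y' = (a', b')" by (cases y, cases y')
      have "a = a'" by (rule sh_separated[OF A d(1,2)]) (use d(3-) in \<open>auto simp: V_def \<rho>_def\<close>)
      moreover have "b = b'" by (rule sh_separated[OF B d(1,2)]) (use d(3-) in \<open>auto simp: V_def \<rho>_def\<close>)
      ultimately show ?thesis by simp
    qed
    fix d P s assume d: "d \<in> Obj C" and P: "covers d P"
      and s: "\<And>f. f \<in> Arr C \<Longrightarrow> Cod C f = d \<Longrightarrow> P f \<Longrightarrow> s f \<in> V (Dom C f)"
      and sn: "\<And>f g. f \<in> Arr C \<Longrightarrow> Cod C f = d \<Longrightarrow> P f \<Longrightarrow> g \<in> Arr C \<Longrightarrow> Cod C g = Dom C f \<Longrightarrow>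
         \<rho> g (s f) = s (Comp C f g)"
    have s': "fst (s k) \<in> FObj A (Dom C k)" "snd (s k) \<in> FObj B (Dom C k)"
      "at f (Dom C k) (fst (s k)) = at g (Dom C k) (snd (s k))"
      if "k \<in> Arr C" "Cod C k = d" "P k" for k
      using s[OF that] by (auto simp: V_def)
    have sn': "restr A l (fst (s k)) = fst (s (Comp C k l))" "restr B l (snd (s k)) = snd (s (Comp C k l))"
      if "k \<in> Arr C" "Cod C k = d" "P k" "l \<in> Arr C" "Cod C l = Dom C k" for k l
      by (simp_all add: \<rho>_def split_def flip: sn[OF that])
    obtain a where a: "a \<in> FObj A d" "\<forall>k \<in> Arr C. Cod C k = d \<longrightarrow> P k \<longrightarrow> restr A k a = fst (s k)"
      using sheaf_glue[OF is_sheaf_sheaf(1)[OF A] d P, of "\<lambda>k. fst (s k)"] s' sn' by blast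
    obtain b where b: "b \<in> FObj B d" "\<forall>k \<in> Arr C. Cod C k = d \<longrightarrow> P k \<longrightarrow> restr B k b = snd (s k)"
      using sheaf_glue[OF is_sheaf_sheaf(1)[OF B] d P, of "\<lambda>k. snd (s k)"] s' sn' by blast
    have "at f d a = at g d b"
    proof (rule sh_separated[OF R d P])
      fix k assume k: "k \<in> Arr C" "Cod C k = d" "P k"
      then show "restr R k (at f d a) = restr R k (at g d b)"
        using fa(2)[of k a] ga(2)[of k b] a b s'(3)[of k] by simp
    qed (use a b d fa ga in auto)
    then show "\<exists>y \<in> V d. \<forall>f \<in> Arr C. Cod C f = d \<longrightarrow> P f \<longrightarrow> \<rho> f y = s f"
      using a b by (intro bexI[of _ "(a, b)"]) (auto simp: V_def \<rho>_def)
  qed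
  have sm: "V d \<prec> (UNIV :: 'u set)" if "d \<in> Obj C" for d
    using that is_sheaf_sheaf(2)[OF A] is_sheaf_sheaf(2)[OF B]
    by (intro lesspoll_subset[OF univ lesspoll_Sigma[OF univ, of "FObj A d" "\<lambda>_. FObj B d"]]) (auto simp: small_def V_def)
  obtain Q :: "('u, 'u, 'u set, 'u fn) fctr" and e where Q: "is_sheaf C J Q"
    and e: "\<And>d. d \<in> Obj C \<Longrightarrow> bij_betw (e d) (V d) (FObj Q d)"
    and re: "\<And>f a. f \<in> Arr C \<Longrightarrow> a \<in> V (Cod C f) \<Longrightarrow> restr Q f (e (Cod C f) a) = e (Dom C f) (\<rho> f a)"
    using sheaf_encode[OF V sm] by blast
  define e' where "e' d = inv_into (V d) (e d)" for d
  have ee: "e' d (e d y) = y" "e d y \<in> FObj Q d" if "d \<in> Obj C" "y \<in> V d" for d y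
    using e[OF that(1)] that(2) by (auto simp: e'_def bij_betw_def)
  have e'e: "e' d q \<in> V d" "e d (e' d q) = q" if "d \<in> Obj C" "q \<in> FObj Q d" for d q
    using e[OF that(1)] that(2) by (auto simp: e'_def bij_betw_def inv_into_into f_inv_into_f)
  have re': "e' (Dom C k) (restr Q k q) = \<rho> k (e' (Cod C k) q)" if k: "k \<in> Arr C" and q: "q \<in> FObj Q (Cod C k)" for k q
    using re[OF k, of "e' (Cod C k) q"] e'e[OF _ q] k presheaf_simps(1)[OF sheaf_presheaf[OF V] k, of "e' (Cod C k) q"]
      ee(1)[of "Dom C k"] by simp
  have "\<exists>p \<in> hom Sh Q A. \<forall>d \<in> Obj C. \<forall>q \<in> FObj Q d. at p d q = fst (e' d q)"
    by (rule Sh_hom_mk[OF Q A]) (use e'e in \<open>auto simp: re' V_def \<rho>_def split_def\<close>)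
  then obtain p where p: "p \<in> hom Sh Q A" "\<And>d q. d \<in> Obj C \<Longrightarrow> q \<in> FObj Q d \<Longrightarrow> at p d q = fst (e' d q)" by blast
  have "\<exists>p \<in> hom Sh Q B. \<forall>d \<in> Obj C. \<forall>q \<in> FObj Q d. at p d q = snd (e' d q)"
    by (rule Sh_hom_mk[OF Q B]) (use e'e in \<open>auto simp: re' V_def \<rho>_def split_def\<close>)
  then obtain r where r: "r \<in> hom Sh Q B" "\<And>d q. d \<in> Obj C \<Longrightarrow> q \<in> FObj Q d \<Longrightarrow> at r d q = snd (e' d q)" by blast
  have "pullback Sh f g p r"
    unfolding pullback_def
  proof (intro conjI allI impI; (elim conjE)?)
    show "Comp Sh f p = Comp Sh g r"
    proof (rule Sh_hom_eqI)
      show "Comp Sh f p \<in> hom Sh Q R" "Comp Sh g r \<in> hom Sh Q R"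
        using f g p(1) r(1) Sh.Comp_in_hom by blast+
      fix d a assume d: "d \<in> Obj C" "a \<in> FObj Q d"
      show "at (Comp Sh f p) d a = at (Comp Sh g r) d a"
        using at_Comp[OF p(1) f d] at_Comp[OF r(1) g d] p(2)[OF d] r(2)[OF d] e'e(1)[OF d]
        by (auto simp: V_def)
    qed
  next
    fix a b assume ab: "a \<in> Arr Sh" "b \<in> Arr Sh" "Dom Sh a = Dom Sh b" "Cod Sh a = Dom Sh f" "Cod Sh b = Dom Sh g"
      and eq: "Comp Sh f a = Comp Sh g b"
    define X where "X = Dom Sh a"
    have a: "a \<in> hom Sh X A" and b: "b \<in> hom Sh X B" using ab by (auto simp: A_def B_def X_def hom_iff)
    have X: "is_sheaf C J X" using a by (simp add: hom_Sh_iff)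
    have mV: "(at a d x, at b d x) \<in> V d" if "d \<in> Obj C" "x \<in> FObj X d" for d x
      using Sh_hom_at(3)[OF a that] Sh_hom_at(3)[OF b that] at_Comp[OF a f that] at_Comp[OF b g that] eq
      by (simp add: V_def)
    have "\<exists>h \<in> hom Sh X Q. \<forall>d \<in> Obj C. \<forall>x \<in> FObj X d. at h d x = e d (at a d x, at b d x)"
    proof (rule Sh_hom_mk[OF X Q])
      fix k x assume k: "k \<in> Arr C" "x \<in> FObj X (Cod C k)"
      then show "e (Dom C k) (at a (Dom C k) (restr X k x), at b (Dom C k) (restr X k x)) =
        restr Q k (e (Cod C k) (at a (Cod C k) x, at b (Cod C k) x))"
        using re[OF k(1), of "(at a (Cod C k) x, at b (Cod C k) x)"] mV[of "Cod C k" x] Sh_hom_at(4)[OF a k] Sh_hom_at(4)[OF b k]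
        by (simp add: \<rho>_def)
    qed (use ee mV in blast)
    then obtain h where h: "h \<in> hom Sh X Q" "\<And>d x. d \<in> Obj C \<Longrightarrow> x \<in> FObj X d \<Longrightarrow> at h d x = e d (at a d x, at b d x)" by blast
    have ph: "Comp Sh p h' \<in> hom Sh X A" "Comp Sh r h' \<in> hom Sh X B" if "h' \<in> hom Sh X Q" for h'
      using that p(1) r(1) Sh.Comp_in_hom by blast+
    have "Comp Sh p h = a"
      by (rule Sh_hom_eqI[OF ph(1)[OF h(1)] a]) (use h mV ee p(2) at_Comp[OF h(1) p(1)] Sh_hom_at(3)[OF h(1)] in auto)
    moreover have "Comp Sh r h = b"
      by (rule Sh_hom_eqI[OF ph(2)[OF h(1)] b]) (use h mV ee r(2) at_Comp[OF h(1) r(1)] Sh_hom_at(3)[OF h(1)] in auto)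
    moreover have uniq: "h' = h" if h': "h' \<in> hom Sh X Q" and "Comp Sh p h' = a" "Comp Sh r h' = b" for h'
    proof (rule Sh_hom_eqI[OF h' h(1)])
      fix d x assume d: "d \<in> Obj C" "x \<in> FObj X d"
      have q: "at h' d x \<in> FObj Q d" using Sh_hom_at(3)[OF h' d] .
      have "e' d (at h' d x) = (at a d x, at b d x)"
        using that(2,3) at_Comp[OF h' p(1) d] at_Comp[OF h' r(1) d] p(2)[OF d(1) q] r(2)[OF d(1) q] by (auto intro: prod_eqI)
      then show "at h' d x = at h d x" using e'e(2)[OF d(1) q] h(2)[OF d] by simp
    qed
    ultimately show "\<exists>!h. h \<in> hom Sh (Dom Sh a) (Dom Sh p) \<and> Comp Sh p h = a \<and> Comp Sh r h = b"
    proof (intro ex1I[of _ h])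
      have "Dom Sh p = Q" using p(1) by (simp add: hom_iff)
      note * = this X_def[symmetric]
      show "h \<in> hom Sh (Dom Sh a) (Dom Sh p) \<and> Comp Sh p h = a \<and> Comp Sh r h = b"
        unfolding * using h(1) \<open>Comp Sh p h = a\<close> \<open>Comp Sh r h = b\<close> by blast
      show "h' = h" if "h' \<in> hom Sh (Dom Sh a) (Dom Sh p) \<and> Comp Sh p h' = a \<and> Comp Sh r h' = b" for h'
        using that uniq unfolding * by blast
    qed
  qed (use f g p(1) r(1) in \<open>auto simp: hom_iff\<close>)
  then show "\<exists>p q. pullback Sh f g p q" by blast
qed

text \<open>An arrow is determined by its graph, a subset of a small sum of products of sets of
  sections.\<close>

lemma Sh_locally_small: "locally_small TYPE('u) Sh"
  unfolding locally_small_def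
proof (intro allI)
  fix P Q :: "('u, 'u, 'u set, 'u fn) fctr"
  show "hom Sh P Q \<prec> (UNIV :: 'u set)"
  proof (cases "is_sheaf C J P \<and> is_sheaf C J Q")
    case False
    then have "hom Sh P Q = {}" by (auto simp: hom_Sh_iff)
    then show ?thesis by (simp add: lesspoll_finite[OF univ])
  next
    case True
    define S where "S = Sigma (Obj C) (\<lambda>d. FObj P d \<times> FObj Q d)"
    define G where "G t = {(d, a, b). d \<in> Obj C \<and> a \<in> FObj P d \<and> b = at t d a}" for t
    have "S \<prec> (UNIV :: 'u set)" unfolding S_def
      using small_Obj is_sheaf_sheaf(2) True by (intro lesspoll_Sigma[OF univ]) (auto simp: small_def)
    then have "Pow S \<prec> (UNIV :: 'u set)" by (rule lesspoll_Pow[OF univ])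
    moreover have "hom Sh P Q \<lesssim> Pow S"
      unfolding lepoll_def
    proof (intro exI[of _ G] conjI inj_onI)
      fix t t' assume t: "t \<in> hom Sh P Q" "t' \<in> hom Sh P Q" "G t = G t'"
      show "t = t'"
      proof (rule Sh_hom_eqI[OF t(1,2)])
        fix d a assume "d \<in> Obj C" "a \<in> FObj P d"
        then have "(d, a, at t d a) \<in> G t'" unfolding t(3)[symmetric] by (simp add: G_def)
        then show "at t d a = at t' d a" by (simp add: G_def)
      qed
    next
      show "G ` hom Sh P Q \<subseteq> Pow S" using Sh_hom_at(3) by (auto simp: G_def S_def)
    qed
    ultimately show ?thesis by (rule lesspoll_trans1[rotated])
  qed
qed

text \<open>The characteristic map to the subobject classifier of the union of the images is equal to
  the constant map at the maximal closed sieve, since they agree on the members of the family.\<close>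

lemma Sh_epimorphic_locally_surjective:
  assumes epi: "epimorphic_family Sh Q S" and d: "d \<in> Obj C" and q: "q \<in> FObj Q d"
  shows "covers d (\<lambda>k. \<exists>u \<in> S. \<exists>p \<in> FObj (Dom Sh u) (Dom C k). at u (Dom C k) p = restr Q k q)"
proof -
  have QO: "Q \<in> Obj Sh" and SA: "\<And>u. u \<in> S \<Longrightarrow> u \<in> Arr Sh" "\<And>u. u \<in> S \<Longrightarrow> Cod Sh u = Q"
    using epi by (auto simp: epimorphic_family_def)
  have Q: "is_sheaf C J Q" using QO by (simp add: Obj_Sh)
  have u: "u \<in> hom Sh (Dom Sh u) Q" "is_sheaf C J (Dom Sh u)" if "u \<in> S" for u
    using Sh_homD[OF SA(1)[OF that]] SA(2)[OF that] by auto
  note rQ = sh_simps[OF Q]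
  define I where "I e q \<longleftrightarrow> (\<exists>u \<in> S. \<exists>p \<in> FObj (Dom Sh u) e. at u e p = q)" for e q
  have I: "I (Dom C k) (restr Q k q)" if k: "k \<in> Arr C" "I (Cod C k) q" for k q
  proof -
    obtain v p where v: "v \<in> S" "p \<in> FObj (Dom Sh v) (Cod C k)" "at v (Cod C k) p = q" using k by (auto simp: I_def)
    then show ?thesis
      unfolding I_def using k(1) Sh_hom_at(4)[OF u(1)[OF v(1)] k(1) v(2)] sh_simps(1)[OF u(2)[OF v(1)] k(1) v(2)] by blast
  qed
  \<comment> \<open>Over the one-point presheaf closed relations are closed sieves, so the sheaf
    \<open>P\<close> obtained below encodes the subobject classifier.\<close>
  let ?X = "\<lambda>_ :: 'u. {()}" and ?act = "\<lambda>(_ :: 'u) (_ :: unit). ()"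
  have X: "presheaf ?X ?act" by (auto simp: presheaf_def)
  note V = sheaf_rels[OF X]
  have sm: "rels ?X ?act d \<prec> (UNIV :: 'u set)" if "d \<in> Obj C" for d
    by (rule rels_small[OF that]) (simp add: lesspoll_finite[OF univ])
  obtain P :: "('u, 'u, 'u set, 'u fn) fctr" and e where P: "is_sheaf C J P"
    and e: "\<And>d. d \<in> Obj C \<Longrightarrow> bij_betw (e d) (rels ?X ?act d) (FObj P d)"
    and re: "\<And>f a. f \<in> Arr C \<Longrightarrow> a \<in> rels ?X ?act (Cod C f) \<Longrightarrow> restr P f (e (Cod C f) a) = e (Dom C f) (rel_restr f a)"
    using sheaf_encode[OF V sm] by blast
  have eP: "e d r \<in> FObj P d" if "d \<in> Obj C" "r \<in> rels ?X ?act d" for d r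
    using e[OF that(1)] that(2) by (rule bij_betw_apply)
  \<comment> \<open>The characteristic map of the union \<open>I\<close> of the images: the closed
    sieve of those arrows along which \<open>q\<close> lies locally in it. The constant maximal
    sieve is \<open>n\<close>.\<close>
  define m where "m d q = {(g, ()) | g. g \<in> Arr C \<and> Cod C g = d \<and> covers (Dom C g) (\<lambda>k. I (Dom C k) (restr Q (Comp C g k) q))}" for d q
  define n where "n d = {(g, ()) | g. g \<in> Arr C \<and> Cod C g = d}" for d
  have m: "m d q \<in> rels ?X ?act d" if d: "d \<in> Obj C" and q: "q \<in> FObj Q d" for d q
    unfolding rels_def
  proof (safe)
    fix g and h :: unit and k assume gh: "(g, h) \<in> m d q" and k: "k \<in> Arr C" "Cod C k = Dom C g"
    then have g: "g \<in> Arr C" "Cod C g = d" and "covers (Dom C g) (\<lambda>k. I (Dom C k) (restr Q (Comp C g k) q))"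
      by (auto simp: m_def)
    then have "covers (Dom C k) (\<lambda>l. I (Dom C (Comp C k l)) (restr Q (Comp C g (Comp C k l)) q))"
      using k by (intro covers_pullback)
    then have "covers (Dom C k) (\<lambda>l. I (Dom C l) (restr Q (Comp C (Comp C g k) l) q))"
      by (subst covers_cong[of _ _ "\<lambda>l. I (Dom C (Comp C k l)) (restr Q (Comp C g (Comp C k l)) q)"]) (use k g in \<open>auto simp: assoc\<close>)
    then show "(Comp C g k, ()) \<in> m d q" using g k by (simp add: m_def)
  next
    fix g and h :: unit assume g: "g \<in> Arr C" "d = Cod C g"
      and cv: "covers (Dom C g) (\<lambda>k. (Comp C g k, ()) \<in> m (Cod C g) q)"
    have "covers (Dom C g) (\<lambda>k. I (Dom C k) (restr Q (Comp C g k) q))"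
    proof (rule covers_trans[OF _ cv])
      fix k assume k: "k \<in> Arr C" "Cod C k = Dom C g" "(Comp C g k, ()) \<in> m (Cod C g) q"
      then show "covers (Dom C k) (\<lambda>l. I (Dom C (Comp C k l)) (restr Q (Comp C g (Comp C k l)) q))"
        using g by (subst covers_cong[of _ _ "\<lambda>l. I (Dom C l) (restr Q (Comp C (Comp C g k) l) q)"]) (auto simp: m_def assoc)
    next
      fix f k assume f: "f \<in> Arr C" "Cod C f = Dom C g" "k \<in> Arr C" "Cod C k = Dom C f" "I (Dom C f) (restr Q (Comp C g f) q)"
      then show "I (Dom C (Comp C f k)) (restr Q (Comp C g (Comp C f k)) q)"
        using I[of k "restr Q (Comp C g f) q"] g q rQ(3)[of "Comp C g f" k q] by (simp add: assoc)
    qed (use g in simp)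
    then show "(g, ()) \<in> m (Cod C g) q" using g by (simp add: m_def)
  qed (auto simp: m_def)
  have n: "n d \<in> rels ?X ?act d" for d by (auto simp: rels_def n_def)
  have mr: "rel_restr f (m (Cod C f) q) = m (Dom C f) (restr Q f q)" if f: "f \<in> Arr C" and q: "q \<in> FObj Q (Cod C f)" for f q
  proof -
    have "covers (Dom C g) (\<lambda>k. I (Dom C k) (restr Q (Comp C (Comp C f g) k) q)) \<longleftrightarrow>
      covers (Dom C g) (\<lambda>k. I (Dom C k) (restr Q (Comp C g k) (restr Q f q)))" if "g \<in> Arr C" "Cod C g = Dom C f" for g
      using that f q by (intro covers_cong) (simp add: assoc rQ(3))
    then show ?thesis using f by (auto simp: rel_restr_def m_def)
  qed
  have nr: "rel_restr f (n (Cod C f)) = n (Dom C f)" if f: "f \<in> Arr C" for f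
    using f by (auto simp: rel_restr_def n_def)
  have "\<exists>t \<in> hom Sh Q P. \<forall>d \<in> Obj C. \<forall>q \<in> FObj Q d. at t d q = e d (m d q)"
    by (rule Sh_hom_mk[OF Q P]) (use eP m in \<open>simp_all add: re mr\<close>)
  then obtain \<chi> where \<chi>: "\<chi> \<in> hom Sh Q P" "\<And>d q. d \<in> Obj C \<Longrightarrow> q \<in> FObj Q d \<Longrightarrow> at \<chi> d q = e d (m d q)" by blast
  have "\<exists>t \<in> hom Sh Q P. \<forall>d \<in> Obj C. \<forall>q \<in> FObj Q d. at t d q = e d (n d)"
    by (rule Sh_hom_mk[OF Q P]) (use eP n in \<open>simp_all add: re nr\<close>)
  then obtain \<tau> where \<tau>: "\<tau> \<in> hom Sh Q P" "\<And>d q. d \<in> Obj C \<Longrightarrow> q \<in> FObj Q d \<Longrightarrow> at \<tau> d q = e d (n d)" by blast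
  have "Comp Sh \<chi> v = Comp Sh \<tau> v" if v: "v \<in> S" for v
  proof (rule Sh_hom_eqI)
    show "Comp Sh \<chi> v \<in> hom Sh (Dom Sh v) P" "Comp Sh \<tau> v \<in> hom Sh (Dom Sh v) P"
      using u(1)[OF v] \<chi>(1) \<tau>(1) Sh.Comp_in_hom by blast+
    fix d a assume d: "d \<in> Obj C" and a: "a \<in> FObj (Dom Sh v) d"
    have "covers (Dom C g) (\<lambda>k. I (Dom C k) (restr Q (Comp C g k) (at v d a)))" if g: "g \<in> Arr C" "Cod C g = d" for g
    proof (rule covers_true)
      fix k assume k: "k \<in> Arr C" "Cod C k = Dom C g"
      have "I d (at v d a)" using v a by (auto simp: I_def)
      then show "I (Dom C k) (restr Q (Comp C g k) (at v d a))" using I[of "Comp C g k" "at v d a"] g k by simp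
    qed (use g in simp)
    then have "m d (at v d a) = n d" by (auto simp: m_def n_def)
    then show "at (Comp Sh \<chi> v) d a = at (Comp Sh \<tau> v) d a"
      using at_Comp[OF u(1)[OF v] \<chi>(1) d a] at_Comp[OF u(1)[OF v] \<tau>(1) d a] \<chi>(2)[OF d] \<tau>(2)[OF d] Sh_hom_at(3)[OF u(1)[OF v] d a] by simp
  qed
  then have "\<chi> = \<tau>" using epi \<chi>(1) \<tau>(1) unfolding epimorphic_family_def by blast
  then have "e d (m d q) = e d (n d)" using \<chi>(2)[OF d q] \<tau>(2)[OF d q] by simp
  then have "m d q = n d" by (rule inj_onD[OF bij_betw_imp_inj_on[OF e[OF d]] _ m[OF d q] n])
  \<comment> \<open>The identity belongs to the maximal sieve, hence to that of \<open>q\<close>;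
    this puts \<open>q\<close> itself locally into the union of the images.\<close>
  moreover have "(Id C d, ()) \<in> n d" using d by (simp add: n_def)
  ultimately have "(Id C d, ()) \<in> m d q" by simp
  then have "covers d (\<lambda>k. I (Dom C k) (restr Q (Comp C (Id C d) k) q))" using d by (simp add: m_def)
  then have "covers d (\<lambda>k. I (Dom C k) (restr Q k q))"
    by (subst covers_cong[of _ _ "\<lambda>k. I (Dom C k) (restr Q (Comp C (Id C d) k) q)"]) (auto)
  then show ?thesis by (simp add: I_def)
qed

text \<open>The desired arrow is known on elements of the form \<open>at u d p\<close>, where it
  must take the value \<open>at (s u) d p\<close>. Such elements occur locally everywhere, and
  compatibility makes the values single-valued.\<close>

lemma Sh_effective_families: "effective_families Sh"
  unfolding effective_families_def
proof (intro allI impI; elim conjE)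
  fix Q S x s assume epi: "epimorphic_family Sh Q S" and s: "\<forall>u\<in>S. s u \<in> hom Sh (Dom Sh u) x" and x: "x \<in> Obj Sh"
    and cmp: "\<forall>u\<in>S. \<forall>v\<in>S. \<forall>a\<in>Arr Sh. \<forall>b\<in>Arr Sh. Dom Sh a = Dom Sh b \<and> Cod Sh a = Dom Sh u \<and> Cod Sh b = Dom Sh v \<and>
       Comp Sh u a = Comp Sh v b \<longrightarrow> Comp Sh (s u) a = Comp Sh (s v) b"
  have QO: "Q \<in> Obj Sh" and SA: "\<And>u. u \<in> S \<Longrightarrow> u \<in> Arr Sh" "\<And>u. u \<in> S \<Longrightarrow> Cod Sh u = Q"
    using epi by (auto simp: epimorphic_family_def)
  have Q: "is_sheaf C J Q" and X: "is_sheaf C J x" using QO x by (simp_all add: Obj_Sh)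
  have u: "u \<in> hom Sh (Dom Sh u) Q" "is_sheaf C J (Dom Sh u)" if "u \<in> S" for u
    using Sh_homD[OF SA(1)[OF that]] SA(2)[OF that] by auto
  define T where "T d q y \<longleftrightarrow> d \<in> Obj C \<and> (\<exists>u \<in> S. \<exists>p \<in> FObj (Dom Sh u) d. q = at u d p \<and> y = at (s u) d p)" for d q y
  have "\<exists>t \<in> hom Sh Q x. \<forall>d q y. T d q y \<longrightarrow> at t d q = y"
  proof (rule Sh_hom_from_relation[OF Q X])
    show "d \<in> Obj C \<and> q \<in> FObj Q d \<and> y \<in> FObj x d" if "T d q y" for d q y
      using that Sh_hom_at(3) u s unfolding T_def by blast
    show "T (Dom C g) (restr Q g q) (restr x g y)" if g: "g \<in> Arr C" and T: "T (Cod C g) q y" for g q y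
    proof -
      obtain v p where v: "v \<in> S" "p \<in> FObj (Dom Sh v) (Cod C g)" "q = at v (Cod C g) p" "y = at (s v) (Cod C g) p"
        using T by (auto simp: T_def)
      then show ?thesis
        unfolding T_def
        using Sh_hom_at(4)[OF u(1)[OF v(1)] g v(2)] Sh_hom_at(4)[OF s[rule_format, OF v(1)] g v(2)]
          sh_simps(1)[OF u(2)[OF v(1)] g v(2)] g by (metis Obj_arr(1))
    qed
    show "covers d (\<lambda>g. \<exists>y. T (Dom C g) (restr Q g q) y)" if d: "d \<in> Obj C" "q \<in> FObj Q d" for d q
    proof -
      have eq: "(\<exists>u \<in> S. \<exists>p \<in> FObj (Dom Sh u) (Dom C k). at u (Dom C k) p = restr Q k q) \<longleftrightarrow> (\<exists>y. T (Dom C k) (restr Q k q) y)"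
        if "k \<in> Arr C" for k
        unfolding T_def using Obj_arr(1)[OF that] by metis
      have "covers d (\<lambda>k. \<exists>u \<in> S. \<exists>p \<in> FObj (Dom Sh u) (Dom C k). at u (Dom C k) p = restr Q k q) \<longleftrightarrow>
          covers d (\<lambda>k. \<exists>y. T (Dom C k) (restr Q k q) y)"
        by (rule covers_cong) (rule eq)
      then show ?thesis using Sh_epimorphic_locally_surjective[OF epi d] by simp
    qed
    fix d q y y' assume T: "T d q y" "T d q y'"
    then obtain v p w r where d: "d \<in> Obj C" and v: "v \<in> S" "p \<in> FObj (Dom Sh v) d" "q = at v d p" "y = at (s v) d p"
      and w: "w \<in> S" "r \<in> FObj (Dom Sh w) d" "q = at w d r" "y' = at (s w) d r" by (auto simp: T_def)
    \<comment> \<open>Compatibility speaks of arrows of sheaves, not of elements. Two elements with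
      the same image are therefore turned into arrows from the sheaf associated with the
      representable at \<open>d\<close>.\<close>
    obtain A \<eta> where A: "rep d A \<eta>" using rep_exists[OF d] by blast
    note rA = repD(1-3)[OF A]
    obtain a where a: "a \<in> hom Sh A (Dom Sh v)" "at a d \<eta> = p" using rep_ex[OF A u(2)[OF v(1)] v(2)] by blast
    obtain b where b: "b \<in> hom Sh A (Dom Sh w)" "at b d \<eta> = r" using rep_ex[OF A u(2)[OF w(1)] w(2)] by blast
    have "Comp Sh v a = Comp Sh w b"
      by (rule rep_unique[OF A Sh.Comp_in_hom[OF a(1) u(1)[OF v(1)]] Sh.Comp_in_hom[OF b(1) u(1)[OF w(1)]]])
        (use at_Comp[OF a(1) u(1)[OF v(1)] d rA(3)] at_Comp[OF b(1) u(1)[OF w(1)] d rA(3)] a b v w in simp)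
    then have "Comp Sh (s v) a = Comp Sh (s w) b"
      using a(1) b(1) v(1) w(1) by (intro cmp[rule_format]) (auto simp: hom_iff)
    then show "y = y'"
      using at_Comp[OF a(1) s[rule_format, OF v(1)] d rA(3)] at_Comp[OF b(1) s[rule_format, OF w(1)] d rA(3)] a b v w by simp
  qed
  then obtain t where t: "t \<in> hom Sh Q x" "\<And>d q y. T d q y \<Longrightarrow> at t d q = y" by blast
  have "Comp Sh t v = s v" if v: "v \<in> S" for v
  proof (rule Sh_hom_eqI[OF Sh.Comp_in_hom[OF u(1)[OF v] t(1)] s[rule_format, OF v]])
    fix d a assume d: "d \<in> Obj C" "a \<in> FObj (Dom Sh v) d"
    have "T d (at v d a) (at (s v) d a)" using v d by (auto simp: T_def)
    then show "at (Comp Sh t v) d a = at (s v) d a" using t(2) at_Comp[OF u(1)[OF v] t(1) d] by simp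
  qed
  then show "\<exists>h\<in>hom Sh Q x. \<forall>u\<in>S. Comp Sh h u = s u" using t(1) by blast
qed

end

section \<open>Adjoints of cover-preserving functors\<close>

definition preserves_pullbacks :: "('o1, 'a1) cat \<Rightarrow> ('o2, 'a2) cat \<Rightarrow> ('o1, 'a1, 'o2, 'a2) fctr \<Rightarrow> bool" where
  "preserves_pullbacks C D G \<longleftrightarrow> (\<forall>f g p q. pullback C f g p q \<longrightarrow>
     pullback D (FArr G f) (FArr G g) (FArr G p) (FArr G q))"

definition preserves_epimorphic :: "('o1, 'a1) cat \<Rightarrow> ('o2, 'a2) cat \<Rightarrow> ('o1, 'a1, 'o2, 'a2) fctr \<Rightarrow> bool" where
  "preserves_epimorphic C D G \<longleftrightarrow> (\<forall>c S. epimorphic_family C c S \<longrightarrow>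
     epimorphic_family D (FObj G c) (FArr G ` S))"

text \<open>Pointwise form of a right adjoint of \<open>G\<close>: \<open>r\<close> is its value at
  \<open>x\<close> and \<epsilon> the counit there.\<close>

definition has_universal_arrows :: "('o1, 'a1) cat \<Rightarrow> ('o2, 'a2) cat \<Rightarrow> ('o1, 'a1, 'o2, 'a2) fctr \<Rightarrow> bool" where
  "has_universal_arrows C D G \<longleftrightarrow> (\<forall>x \<in> Obj D. \<exists>r \<in> Obj C. \<exists>\<epsilon> \<in> hom D (FObj G r) x.
     \<forall>c \<in> Obj C. \<forall>h \<in> hom D (FObj G c) x. \<exists>!t. t \<in> hom C c r \<and> Comp D \<epsilon> (FArr G t) = h)"

lemma epimorphic_cancel:
  assumes "epimorphic_family C c (u ` I)" "h \<in> hom C c d" "k \<in> hom C c d"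
    "\<And>i. i \<in> I \<Longrightarrow> Comp C h (u i) = Comp C k (u i)"
  shows "h = k"
  using assms unfolding epimorphic_family_def by blast

text \<open>A commuting square over two members in \<open>F\<close> factors through the image of
  their pullback in \<open>T\<close>, because \<open>G\<close> preserves it. Hence the compatibility
  that effectiveness demands in \<open>F\<close> reduces to squares of \<open>T\<close>.\<close>

lemma effective_glue:
  assumes G: "cat_functor T F G" and pb: "has_pullbacks T" "preserves_pullbacks T F G"
    and eff: "effective_families F" and epi: "epimorphic_family F (FObj G c) (FArr G ` u ` I)"
    and u: "\<And>i. i \<in> I \<Longrightarrow> u i \<in> Arr T" "\<And>i. i \<in> I \<Longrightarrow> Cod T (u i) = c" and x: "x \<in> Obj F"
    and s: "\<And>i. i \<in> I \<Longrightarrow> s i \<in> hom F (FObj G (Dom T (u i))) x"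
    and cmp: "\<And>i j a b. i \<in> I \<Longrightarrow> j \<in> I \<Longrightarrow> a \<in> Arr T \<Longrightarrow> b \<in> Arr T \<Longrightarrow> Dom T a = Dom T b \<Longrightarrow>
      Cod T a = Dom T (u i) \<Longrightarrow> Cod T b = Dom T (u j) \<Longrightarrow> Comp T (u i) a = Comp T (u j) b \<Longrightarrow>
      Comp F (s i) (FArr G a) = Comp F (s j) (FArr G b)"
  shows "\<exists>h \<in> hom F (FObj G c) x. \<forall>i \<in> I. Comp F h (FArr G (u i)) = s i"
proof -
  interpret G: cat_functor T F G by fact
  have key: "Comp F (s i) a = Comp F (s j) b"
    if i: "i \<in> I" and j: "j \<in> I" and ab: "a \<in> Arr F" "b \<in> Arr F" "Dom F a = Dom F b"
      "Cod F a = FObj G (Dom T (u i))" "Cod F b = FObj G (Dom T (u j))"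
      "Comp F (FArr G (u i)) a = Comp F (FArr G (u j)) b" for i j a b
  proof -
    obtain p q where pq: "pullback T (u i) (u j) p q"
      using pb(1) u i j unfolding has_pullbacks_def by metis
    note d = pullbackD[OF pq]
    have "pullback F (FArr G (u i)) (FArr G (u j)) (FArr G p) (FArr G q)"
      using pb(2) pq by (simp add: preserves_pullbacks_def)
    from pullback_ex1[OF this ab(1-3) _ _ ab(6)] obtain h where h: "h \<in> hom F (Dom F a) (FObj G (Dom T p))"
      "Comp F (FArr G p) h = a" "Comp F (FArr G q) h = b"
      using ab u i j d by auto
    have "Comp F (s i) a = Comp F (Comp F (s i) (FArr G p)) h"
      unfolding h(2)[symmetric] using s[OF i] h(1) d by (simp add: hom_iff G.D.assoc)
    also have "\<dots> = Comp F (Comp F (s j) (FArr G q)) h"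
      using cmp[OF i j d(3,4,6-9)] by simp
    also have "\<dots> = Comp F (s j) b"
      unfolding h(3)[symmetric] using s[OF j] h(1) d by (simp add: hom_iff G.D.assoc)
    finally show ?thesis .
  qed
  \<comment> \<open>\<open>effective_families\<close> speaks of sets of arrows while the family here
    is indexed, so an index is chosen for every arrow of the image.\<close>
  define \<iota> where "\<iota> w = (SOME i. i \<in> I \<and> FArr G (u i) = w)" for w
  have \<iota>: "\<iota> w \<in> I" "FArr G (u (\<iota> w)) = w" if "w \<in> FArr G ` u ` I" for w
    using that someI_ex[of "\<lambda>i. i \<in> I \<and> FArr G (u i) = w"] unfolding \<iota>_def by auto
  have Dw: "Dom F w = FObj G (Dom T (u (\<iota> w)))" if "w \<in> FArr G ` u ` I" for w
    using \<iota>[OF that] u(1) G.FArr_arr(2) by metis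
  have "\<exists>h \<in> hom F (FObj G c) x. \<forall>w \<in> FArr G ` u ` I. Comp F h w = s (\<iota> w)"
  proof (rule eff[unfolded effective_families_def, rule_format, OF epi _ x], intro conjI ballI impI; (elim conjE)?)
    fix w assume "w \<in> FArr G ` u ` I"
    then show "s (\<iota> w) \<in> hom F (Dom F w) x" using Dw \<iota>(1) s by simp
  next
    fix w w' a b assume w: "w \<in> FArr G ` u ` I" "w' \<in> FArr G ` u ` I" and "a \<in> Arr F" "b \<in> Arr F"
      "Dom F a = Dom F b" "Cod F a = Dom F w" "Cod F b = Dom F w'" "Comp F w a = Comp F w' b"
    then show "Comp F (s (\<iota> w)) a = Comp F (s (\<iota> w')) b"
      using \<iota>[OF w(1)] \<iota>[OF w(2)] Dw by (intro key) auto
  qed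
  then obtain h where h: "h \<in> hom F (FObj G c) x" "\<And>w. w \<in> FArr G ` u ` I \<Longrightarrow> Comp F h w = s (\<iota> w)" by blast
  have "Comp F h (FArr G (u i)) = s i" if i: "i \<in> I" for i
  proof -
    have w: "FArr G (u i) \<in> FArr G ` u ` I" using i by blast
    let ?j = "\<iota> (FArr G (u i))"
    have eq: "FObj G (Dom T (u ?j)) = FObj G (Dom T (u i))"
      using Dw[OF w] u(1)[OF i] by simp
    have o: "Dom T (u i) \<in> Obj T" using u(1)[OF i] by simp
    \<comment> \<open>Two indices with the same image have the same value of \<open>s\<close>, by
      compatibility over a square of identities.\<close>
    have "Comp F (s ?j) (Id F (FObj G (Dom T (u i)))) = Comp F (s i) (Id F (FObj G (Dom T (u i))))"
      using o eq \<iota>[OF w] i by (intro key) auto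
    then show ?thesis using h(2)[OF w] s[OF i] s[OF \<iota>(1)[OF w]] eq by (simp add: hom_iff)
  qed
  then show ?thesis using h(1) by blast
qed

context small_site begin

text \<open>A sheaf \<open>P\<close> is covered by sheaves associated with representables, one for
  each element. An arrow from \<open>FObj G P\<close> to \<open>x\<close> is thus a compatible
  family of arrows from the values of \<open>G\<close> at these, indexed by the elements of
  \<open>P\<close>, and this is the same as an arrow from \<open>P\<close> to the sheaf
  \<open>V\<close> below.\<close>

lemma Sh_universal_arrows:
  fixes F :: "('of, 'af) cat"
  assumes G: "cat_functor Sh F G" and pb: "preserves_pullbacks Sh F G" and pe: "preserves_epimorphic Sh F G"
    and eff: "effective_families F" and ls: "locally_small TYPE('u) F"
  shows "has_universal_arrows Sh F G"
  unfolding has_universal_arrows_def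
proof
  interpret G: cat_functor Sh F G by fact
  fix x assume x: "x \<in> Obj F"
  have "\<forall>c \<in> Obj C. \<exists>A \<eta>. rep c A \<eta>" using rep_exists by blast
  then obtain A \<eta> where rep: "\<And>c. c \<in> Obj C \<Longrightarrow> rep c (A c) (\<eta> c)" by metis
  note A = repD(2)[OF rep] and \<eta> = repD(3)[OF rep]
  \<comment> \<open>The arrow that corresponds to the element \<open>p\<close> under the Yoneda
    correspondence for associated sheaves.\<close>
  define hat where "hat c P p = (SOME t. t \<in> hom Sh (A c) P \<and> at t c (\<eta> c) = p)" for c P p
  have hat: "hat c P p \<in> hom Sh (A c) P" "at (hat c P p) c (\<eta> c) = p"
    if "c \<in> Obj C" "is_sheaf C J P" "p \<in> FObj P c" for c P p
  proof -
    have "\<exists>t. t \<in> hom Sh (A c) P \<and> at t c (\<eta> c) = p" using rep_ex[OF rep[OF that(1)] that(2,3)] by blast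
    from someI_ex[OF this] show "hat c P p \<in> hom Sh (A c) P" "at (hat c P p) c (\<eta> c) = p"
      unfolding hat_def by auto
  qed
  have hat_eq: "t = hat c P p" if "t \<in> hom Sh (A c) P" "at t c (\<eta> c) = p" "c \<in> Obj C" for t c P p
  proof -
    have "is_sheaf C J P" "p \<in> FObj P c" using that Sh_hom_at(3)[OF that(1) that(3) \<eta>[OF that(3)]] by (auto simp: hom_Sh_iff)
    then show ?thesis using rep_unique[OF rep[OF that(3)] that(1) hat(1)] hat(2) that by metis
  qed
  have hat_comp: "Comp Sh t (hat c P p) = hat c Q (at t c p)"
    if "t \<in> hom Sh P Q" "c \<in> Obj C" "p \<in> FObj P c" for t c P p Q
  proof -
    have P: "is_sheaf C J P" using that(1) by (simp add: hom_Sh_iff)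
    show ?thesis
      by (rule hat_eq[OF Sh.Comp_in_hom[OF hat(1)[OF that(2) P that(3)] that(1)] _ that(2)])
        (simp add: at_Comp[OF hat(1)[OF that(2) P that(3)] that(1,2) \<eta>[OF that(2)]] hat(2)[OF that(2) P that(3)])
  qed
  \<comment> \<open>The Yoneda functor followed by sheafification: \<open>f\<close> is sent to the
    arrow that classifies the restriction along \<open>f\<close> of the generic element.\<close>
  define yon where "yon f = hat (Dom C f) (A (Cod C f)) (restr (A (Cod C f)) f (\<eta> (Cod C f)))" for f
  have rAf: "restr (A (Cod C f)) f (\<eta> (Cod C f)) \<in> FObj (A (Cod C f)) (Dom C f)" if "f \<in> Arr C" for f
    using that by (intro sh_simps(1)[OF A]) (auto intro: \<eta>)
  have yon: "yon f \<in> hom Sh (A (Dom C f)) (A (Cod C f))" if "f \<in> Arr C" for f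
    unfolding yon_def using that rAf[OF that] by (intro hat(1) A) auto
  have yon_at: "at (yon f) (Dom C f) (\<eta> (Dom C f)) = restr (A (Cod C f)) f (\<eta> (Cod C f))" if "f \<in> Arr C" for f
    unfolding yon_def using that rAf[OF that] by (intro hat(2) A) auto
  have hat_yon: "Comp Sh (hat (Cod C f) P p) (yon f) = hat (Dom C f) P (restr P f p)"
    if f: "f \<in> Arr C" and P: "is_sheaf C J P" and p: "p \<in> FObj P (Cod C f)" for f P p
  proof -
    have c: "Cod C f \<in> Obj C" "Dom C f \<in> Obj C" using f by auto
    note h = hat[OF c(1) P p]
    show ?thesis
      by (rule hat_eq[OF Sh.Comp_in_hom[OF yon[OF f] h(1)] _ c(2)])
        (simp add: at_Comp[OF yon[OF f] h(1) c(2) \<eta>[OF c(2)]] yon_at[OF f] Sh_hom_at(4)[OF h(1) f \<eta>[OF c(1)]] h(2))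
  qed
  have yon_Id: "yon (Id C c) = Id Sh (A c)" if c: "c \<in> Obj C" for c
  proof -
    have "Id Sh (A c) = hat c (A c) (\<eta> c)"
      using c A[OF c] by (intro hat_eq Sh.Id_in_hom) (auto simp: Obj_Sh at_Id \<eta>)
    then show ?thesis using c by (simp add: yon_def sh_simps(2)[OF A] \<eta>)
  qed
  have yon_Comp: "yon (Comp C f g) = Comp Sh (yon f) (yon g)" if fg: "f \<in> Arr C" "g \<in> Arr C" "Cod C g = Dom C f" for f g
  proof -
    have "Comp Sh (yon f) (yon g) = hat (Dom C g) (A (Cod C f)) (restr (A (Cod C f)) g (restr (A (Cod C f)) f (\<eta> (Cod C f))))"
      unfolding yon_def[of f] fg(3)[symmetric] using fg rAf[OF fg(1)] by (intro hat_yon A) auto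
    then show ?thesis unfolding yon_def[of "Comp C f g"] using fg by (simp add: sh_simps(3)[OF A] \<eta>)
  qed
  have yarr: "yon f \<in> Arr Sh" "Dom Sh (yon f) = A (Dom C f)" "Cod Sh (yon f) = A (Cod C f)" if "f \<in> Arr C" for f
    using yon[OF that] by (auto simp: hom_iff)
  have Gy: "FArr G (yon f) \<in> hom F (FObj G (A (Dom C f))) (FObj G (A (Cod C f)))" if "f \<in> Arr C" for f
    using yarr[OF that] by (simp add: hom_iff)
  \<comment> \<open>The arrows of all elements cover a sheaf, and \<open>G\<close> keeps this cover
    epimorphic.\<close>
  have epi_hat: "epimorphic_family F (FObj G P) (FArr G ` (\<lambda>(c, p). hat c P p) ` Sigma (Obj C) (FObj P))"
    if P: "is_sheaf C J P" for P
  proof -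
    have "epimorphic_family Sh P ((\<lambda>(c, p). hat c P p) ` Sigma (Obj C) (FObj P))"
      unfolding epimorphic_family_def
    proof (intro conjI allI impI)
      show "P \<in> Obj Sh" using P by (simp add: Obj_Sh)
      show "(\<lambda>(c, p). hat c P p) ` Sigma (Obj C) (FObj P) \<subseteq> {f \<in> Arr Sh. Cod Sh f = P}"
        using hat(1)[OF _ P] by (auto simp: hom_iff)
      fix Q h k assume a: "h \<in> hom Sh P Q \<and> k \<in> hom Sh P Q \<and>
        (\<forall>f\<in>(\<lambda>(c, p). hat c P p) ` Sigma (Obj C) (FObj P). Comp Sh h f = Comp Sh k f)"
      show "h = k"
      proof (rule Sh_hom_eqI)
        show "h \<in> hom Sh P Q" "k \<in> hom Sh P Q" using a by auto
        fix d p assume d: "d \<in> Obj C" and p: "p \<in> FObj P d"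
        have "Comp Sh h (hat d P p) = Comp Sh k (hat d P p)" using a d p by force
        then show "at h d p = at k d p"
          using at_Comp[OF hat(1)[OF d P p] _ d \<eta>[OF d], of h Q] at_Comp[OF hat(1)[OF d P p] _ d \<eta>[OF d], of k Q]
             a hat(2)[OF d P p] by simp
      qed
    qed
    then show ?thesis using pe by (simp add: preserves_epimorphic_def)
  qed
  \<comment> \<open>A cover of the site becomes an epimorphic family of sheaves because sheaves are
    separated, and \<open>G\<close> keeps it epimorphic.\<close>
  have epi_yon: "epimorphic_family F (FObj G (A d)) (FArr G ` yon ` {f \<in> Arr C. Cod C f = d \<and> P f})"
    if d: "d \<in> Obj C" and P: "covers d P" for d P
  proof -
    have "epimorphic_family Sh (A d) (yon ` {f \<in> Arr C. Cod C f = d \<and> P f})"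
      unfolding epimorphic_family_def
    proof (intro conjI allI impI)
      show "A d \<in> Obj Sh" using A[OF d] by (simp add: Obj_Sh)
      show "yon ` {f \<in> Arr C. Cod C f = d \<and> P f} \<subseteq> {f \<in> Arr Sh. Cod Sh f = A d}" using yarr by auto
      fix Q h k assume a: "h \<in> hom Sh (A d) Q \<and> k \<in> hom Sh (A d) Q \<and>
        (\<forall>f\<in>yon ` {f \<in> Arr C. Cod C f = d \<and> P f}. Comp Sh h f = Comp Sh k f)"
      then have h: "h \<in> hom Sh (A d) Q" and k: "k \<in> hom Sh (A d) Q" by auto
      have Q: "is_sheaf C J Q" using h by (simp add: hom_Sh_iff)
      show "h = k"
      proof (rule rep_unique[OF rep[OF d] h k], rule sh_separated[OF Q d P])
        show "at h d (\<eta> d) \<in> FObj Q d" "at k d (\<eta> d) \<in> FObj Q d"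
          using Sh_hom_at(3)[OF h d \<eta>[OF d]] Sh_hom_at(3)[OF k d \<eta>[OF d]] by auto
        fix f assume f: "f \<in> Arr C" "Cod C f = d" "P f"
        have o: "Dom C f \<in> Obj C" using f by simp
        have y: "yon f \<in> hom Sh (A (Dom C f)) (A d)" using yon[OF f(1)] f(2) by simp
        have "Comp Sh h (yon f) = Comp Sh k (yon f)" using a f by blast
        then show "restr Q f (at h d (\<eta> d)) = restr Q f (at k d (\<eta> d))"
          using at_Comp[OF y h o \<eta>[OF o]] at_Comp[OF y k o \<eta>[OF o]] yon_at[OF f(1)] f(2)
            Sh_hom_at(4)[OF h f(1), of "\<eta> d"] Sh_hom_at(4)[OF k f(1), of "\<eta> d"] \<eta>[OF d] by simp
      qed
    qed
    then show ?thesis using pe by (simp add: preserves_epimorphic_def)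
  qed
  \<comment> \<open>Compatibility over an arbitrary square of sheaves is reduced to arrows of the
    site: the vertex is covered by its elements, and every element is refined until both sides have
    the form \<open>yon k\<close> and \<open>yon l\<close>.\<close>
  have local: "Comp F s (FArr G a) = Comp F t (FArr G b)"
    if c: "c \<in> Obj C" and d: "d \<in> Obj C" and s: "s \<in> hom F (FObj G (A c)) x" and t: "t \<in> hom F (FObj G (A d)) x"
      and P: "is_sheaf C J P" and a: "a \<in> hom Sh P (A c)" and b: "b \<in> hom Sh P (A d)"
      and u: "u \<in> hom Sh (A c) Q" and v: "v \<in> hom Sh (A d) Q" and uv: "Comp Sh u a = Comp Sh v b"
      and l: "\<And>k l. k \<in> Arr C \<Longrightarrow> l \<in> Arr C \<Longrightarrow> Dom C k = Dom C l \<Longrightarrow> Cod C k = c \<Longrightarrow> Cod C l = d \<Longrightarrow>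
        Comp Sh u (yon k) = Comp Sh v (yon l) \<Longrightarrow> Comp F s (FArr G (yon k)) = Comp F t (FArr G (yon l))"
    for c d s t P a b u v Q
  proof (rule epimorphic_cancel[OF epi_hat[OF P, unfolded image_image]])
    show "Comp F s (FArr G a) \<in> hom F (FObj G P) x" "Comp F t (FArr G b) \<in> hom F (FObj G P) x"
      using s t a b by (auto simp: hom_iff)
    fix i assume "i \<in> Sigma (Obj C) (FObj P)"
    then obtain e p where i: "i = (e, p)" and e: "e \<in> Obj C" and p: "p \<in> FObj P e" by auto
    define a' b' where "a' = Comp Sh a (hat e P p)" and "b' = Comp Sh b (hat e P p)"
    note hp = hat(1)[OF e P p]
    have a': "a' \<in> hom Sh (A e) (A c)" and b': "b' \<in> hom Sh (A e) (A d)"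
      unfolding a'_def b'_def using hp a b Sh.Comp_in_hom by blast+
    have uv': "Comp Sh u a' = Comp Sh v b'"
      unfolding a'_def b'_def using uv u v a b hp by (simp add: hom_iff flip: Sh.assoc)
    define \<alpha> \<beta> where "\<alpha> = at a' e (\<eta> e)" and "\<beta> = at b' e (\<eta> e)"
    have \<alpha>: "\<alpha> \<in> FObj (A c) e" and \<beta>: "\<beta> \<in> FObj (A d) e"
      unfolding \<alpha>_def \<beta>_def using Sh_hom_at(3)[OF a' e \<eta>[OF e]] Sh_hom_at(3)[OF b' e \<eta>[OF e]] by auto
    have a'e: "a' = hat e (A c) \<alpha>" "b' = hat e (A d) \<beta>"
      using hat_eq[OF a' _ e] hat_eq[OF b' _ e] by (auto simp: \<alpha>_def \<beta>_def)
    note cv = covers_conj[OF e repD(4)[OF rep[OF c] e \<alpha>] repD(4)[OF rep[OF d] e \<beta>]]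
    have "Comp F s (FArr G a') = Comp F t (FArr G b')"
    proof (rule epimorphic_cancel[OF epi_yon[OF e cv, unfolded image_image]])
      show "Comp F s (FArr G a') \<in> hom F (FObj G (A e)) x" "Comp F t (FArr G b') \<in> hom F (FObj G (A e)) x"
        using s t a' b' by (auto simp: hom_iff)
      fix g assume "g \<in> {f \<in> Arr C. Cod C f = e \<and> (\<exists>h\<in>hom C (Dom C f) c. restr (A c) f \<alpha> = restr (A c) h (\<eta> c)) \<and>
        (\<exists>h\<in>hom C (Dom C f) d. restr (A d) f \<beta> = restr (A d) h (\<eta> d))}"
      then obtain h h' where g: "g \<in> Arr C" "Cod C g = e" and h: "h \<in> Arr C" "Dom C h = Dom C g" "Cod C h = c"
        "restr (A c) g \<alpha> = restr (A c) h (\<eta> c)" and h': "h' \<in> Arr C" "Dom C h' = Dom C g" "Cod C h' = d"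
        "restr (A d) g \<beta> = restr (A d) h' (\<eta> d)" by (auto simp: hom_iff)
      have 1: "Comp Sh a' (yon g) = yon h" "Comp Sh b' (yon g) = yon h'"
        unfolding a'e using hat_yon[OF g(1) A[OF c], of \<alpha>] hat_yon[OF g(1) A[OF d], of \<beta>] \<alpha> \<beta> g h h'
        by (simp_all add: yon_def)
      have "Comp Sh u (yon h) = Comp Sh v (yon h')"
        unfolding 1[symmetric] using uv' u v a' b' yarr[OF g(1)] g(2) by (simp add: hom_iff flip: Sh.assoc)
      then have "Comp F s (FArr G (yon h)) = Comp F t (FArr G (yon h'))"
        using h h' by (intro l) auto
      then show "Comp F (Comp F s (FArr G a')) (FArr G (yon g)) = Comp F (Comp F t (FArr G b')) (FArr G (yon g))"
        unfolding 1[symmetric] using s t a' b' yarr[OF g(1)] g(2)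
        by (simp add: hom_iff G.FArr_Comp_arr G.D.assoc)
    qed
    then show "Comp F (Comp F s (FArr G a)) (FArr G (case i of (c, p) \<Rightarrow> hat c P p)) =
      Comp F (Comp F t (FArr G b)) (FArr G (case i of (c, p) \<Rightarrow> hat c P p))"
      using s t a b hp unfolding i a'_def b'_def by (simp add: hom_iff G.FArr_Comp_arr G.D.assoc)
  qed
  \<comment> \<open>The value of the right adjoint at \<open>x\<close>, as dictated by Yoneda: an
    element at \<open>c\<close> is an arrow from \<open>FObj G (A c)\<close> to
    \<open>x\<close>.\<close>
  define V where "V c = hom F (FObj G (A c)) x" for c
  define \<rho> where "\<rho> f s = Comp F s (FArr G (yon f))" for f s
  have \<rho>V: "\<rho> f s \<in> V (Dom C f)" if "f \<in> Arr C" "s \<in> V (Cod C f)" for f s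
    using that Gy[OF that(1)] by (auto simp: \<rho>_def V_def hom_iff)
  have \<rho>\<rho>: "\<rho> (Comp C f g) s = \<rho> g (\<rho> f s)" if "f \<in> Arr C" "g \<in> Arr C" "Cod C g = Dom C f" "s \<in> V (Cod C f)" for f g s
    using that yarr[OF that(1)] yarr[OF that(2)]
    by (auto simp: \<rho>_def V_def hom_iff yon_Comp G.FArr_Comp_arr G.D.assoc)
  have sep: "y = y'" if "d \<in> Obj C" "covers d P" "y \<in> V d" "y' \<in> V d"
      "\<And>f. f \<in> Arr C \<Longrightarrow> Cod C f = d \<Longrightarrow> P f \<Longrightarrow> \<rho> f y = \<rho> f y'" for d P y y'
    by (rule epimorphic_cancel[OF epi_yon[OF that(1,2), unfolded image_image]]) (use that in \<open>auto simp: V_def \<rho>_def\<close>)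
  have V: "sheaf V \<rho>"
  proof (rule sheafI[OF _ sep])
    have "\<rho> (Id C c) s = s" if "c \<in> Obj C" "s \<in> V c" for c s
      using that A[OF that(1)] by (auto simp: \<rho>_def V_def yon_Id hom_iff Obj_Sh)
    then show "presheaf V \<rho>" unfolding presheaf_def using \<rho>V \<rho>\<rho> by blast
    fix d P s assume d: "d \<in> Obj C" and P: "covers d P"
      and s: "\<And>f. f \<in> Arr C \<Longrightarrow> Cod C f = d \<Longrightarrow> P f \<Longrightarrow> s f \<in> V (Dom C f)"
      and sn: "\<And>f g. f \<in> Arr C \<Longrightarrow> Cod C f = d \<Longrightarrow> P f \<Longrightarrow> g \<in> Arr C \<Longrightarrow> Cod C g = Dom C f \<Longrightarrow>
         \<rho> g (s f) = s (Comp C f g)"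
    let ?I = "{f \<in> Arr C. Cod C f = d \<and> P f}"
    have "\<exists>h \<in> hom F (FObj G (A d)) x. \<forall>f \<in> ?I. Comp F h (FArr G (yon f)) = s f"
    proof (rule effective_glue[OF G Sh_pullbacks pb eff epi_yon[OF d P] _ _ x])
      show "s i \<in> hom F (FObj G (Dom Sh (yon i))) x" if "i \<in> ?I" for i
        using s[of i] that yarr by (auto simp: V_def)
      fix f g a b assume f: "f \<in> ?I" and g: "g \<in> ?I" and ab: "a \<in> Arr Sh" "b \<in> Arr Sh" "Dom Sh a = Dom Sh b"
        "Cod Sh a = Dom Sh (yon f)" "Cod Sh b = Dom Sh (yon g)" "Comp Sh (yon f) a = Comp Sh (yon g) b"
      show "Comp F (s f) (FArr G a) = Comp F (s g) (FArr G b)"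
      proof (rule local[of "Dom C f" "Dom C g" "s f" "s g" "Dom Sh a" a b "yon f" "A d" "yon g"])
        show "is_sheaf C J (Dom Sh a)" using Sh_homD[OF ab(1)] by simp
        fix k l assume kl: "k \<in> Arr C" "l \<in> Arr C" "Dom C k = Dom C l" "Cod C k = Dom C f" "Cod C l = Dom C g"
          "Comp Sh (yon f) (yon k) = Comp Sh (yon g) (yon l)"
        \<comment> \<open>\<open>yon\<close> may identify distinct arrows, so an equality of its
          values yields equality in \<open>C\<close> only on a cover; separatedness of
          \<open>V\<close> then suffices.\<close>
        have "yon (Comp C f k) = yon (Comp C g l)" using kl f g by (simp add: yon_Comp)
        then have "restr (A d) (Comp C f k) (\<eta> d) = restr (A d) (Comp C g l) (\<eta> d)"
          using yon_at[of "Comp C f k"] yon_at[of "Comp C g l"] kl f g by simp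
        from repD(5)[OF rep[OF d] _ _ _ _ _ this]
        have cv: "covers (Dom C k) (\<lambda>m. Comp C (Comp C f k) m = Comp C (Comp C g l) m)"
          using kl f g by simp
        have "\<rho> k (s f) = \<rho> l (s g)"
        proof (rule sep[OF _ cv])
          fix m assume m: "m \<in> Arr C" "Cod C m = Dom C k" "Comp C (Comp C f k) m = Comp C (Comp C g l) m"
          have "\<rho> m (\<rho> k (s f)) = \<rho> (Comp C k m) (s f)" using m kl f s[of f] by (subst \<rho>\<rho>) auto
          also have "\<dots> = s (Comp C f (Comp C k m))" using m kl f by (intro sn) auto
          also have "\<dots> = s (Comp C g (Comp C l m))" using m kl f g by (simp add: assoc)
          also have "\<dots> = \<rho> (Comp C l m) (s g)" using m kl g by (intro sn[symmetric]) auto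
          also have "\<dots> = \<rho> m (\<rho> l (s g))" using m kl g s[of g] by (subst \<rho>\<rho>) auto
          finally show "\<rho> m (\<rho> k (s f)) = \<rho> m (\<rho> l (s g))" .
        qed (use kl f g s[of f] s[of g] \<rho>V[of k "s f"] \<rho>V[of l "s g"] in auto)
        then show "Comp F (s f) (FArr G (yon k)) = Comp F (s g) (FArr G (yon l))" by (simp add: \<rho>_def)
      qed (use f g ab s yarr yon in \<open>auto simp: V_def hom_iff\<close>)
    qed (use yarr in auto)
    then show "\<exists>y \<in> V d. \<forall>f \<in> Arr C. Cod C f = d \<longrightarrow> P f \<longrightarrow> \<rho> f y = s f"
      by (auto simp: V_def \<rho>_def)
  qed
  have sm: "V d \<prec> (UNIV :: 'u set)" for d using ls by (simp add: locally_small_def V_def)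
  obtain Q :: "('u, 'u, 'u set, 'u fn) fctr" and e where Q: "is_sheaf C J Q"
    and e: "\<And>d. d \<in> Obj C \<Longrightarrow> bij_betw (e d) (V d) (FObj Q d)"
    and re: "\<And>f a. f \<in> Arr C \<Longrightarrow> a \<in> V (Cod C f) \<Longrightarrow> restr Q f (e (Cod C f) a) = e (Dom C f) (\<rho> f a)"
    using sheaf_encode[OF V sm] by blast
  define dec where "dec d = inv_into (V d) (e d)" for d
  have dec_e: "dec d (e d y) = y" "e d y \<in> FObj Q d" if "d \<in> Obj C" "y \<in> V d" for d y
    using e[OF that(1)] that(2) by (auto simp: dec_def bij_betw_def)
  have dec: "dec d q \<in> V d" "e d (dec d q) = q" if "d \<in> Obj C" "q \<in> FObj Q d" for d q
    using e[OF that(1)] that(2) by (auto simp: dec_def bij_betw_def inv_into_into f_inv_into_f)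
  have dec_restr: "dec (Dom C k) (restr Q k q) = \<rho> k (dec (Cod C k) q)" if k: "k \<in> Arr C" and q: "q \<in> FObj Q (Cod C k)" for k q
    using re[OF k, of "dec (Cod C k) q"] dec[OF _ q] k \<rho>V[OF k, of "dec (Cod C k) q"] dec_e(1)[of "Dom C k"] by simp
  note hQ = hat[OF _ Q]
  \<comment> \<open>The counit is glued from the arrows that the elements of \<open>Q\<close>
    encode: on the member \<open>hat c Q q\<close> it is \<open>dec c q\<close>.\<close>
  have "\<exists>\<epsilon> \<in> hom F (FObj G Q) x. \<forall>i \<in> Sigma (Obj C) (FObj Q). Comp F \<epsilon> (FArr G ((\<lambda>(c, q). hat c Q q) i)) = (\<lambda>(c, q). dec c q) i"
  proof (rule effective_glue[OF G Sh_pullbacks pb eff epi_hat[OF Q] _ _ x])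
    fix i assume "i \<in> Sigma (Obj C) (FObj Q)"
    then show "(\<lambda>(c, q). dec c q) i \<in> hom F (FObj G (Dom Sh ((\<lambda>(c, q). hat c Q q) i))) x"
      using hQ(1) dec(1) by (auto simp: V_def hom_iff)
  next
    fix i j a b assume i: "i \<in> Sigma (Obj C) (FObj Q)" and j: "j \<in> Sigma (Obj C) (FObj Q)" and ab: "a \<in> Arr Sh" "b \<in> Arr Sh" "Dom Sh a = Dom Sh b"
        "Cod Sh a = Dom Sh ((\<lambda>(c, q). hat c Q q) i)" "Cod Sh b = Dom Sh ((\<lambda>(c, q). hat c Q q) j)"
        "Comp Sh ((\<lambda>(c, q). hat c Q q) i) a = Comp Sh ((\<lambda>(c, q). hat c Q q) j) b"
    obtain c q d r where [simp]: "i = (c, q)" "j = (d, r)" by (cases i, cases j)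
    have c: "c \<in> Obj C" "q \<in> FObj Q c" and d: "d \<in> Obj C" "r \<in> FObj Q d" using i j by auto
    note hq = hQ[OF c] and hr = hQ[OF d]
    have "Comp F (dec c q) (FArr G a) = Comp F (dec d r) (FArr G b)"
    proof (rule local[OF c(1) d(1) _ _ _ _ _ hq(1) hr(1)])
      show "is_sheaf C J (Dom Sh a)" using Sh_homD[OF ab(1)] by simp
      fix k l assume kl: "k \<in> Arr C" "l \<in> Arr C" "Dom C k = Dom C l" "Cod C k = c" "Cod C l = d"
          "Comp Sh (hat c Q q) (yon k) = Comp Sh (hat d Q r) (yon l)"
      have "hat (Dom C k) Q (restr Q k q) = hat (Dom C k) Q (restr Q l r)"
        using hat_yon[OF kl(1) Q, of q] hat_yon[OF kl(2) Q, of r] c d kl by simp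
      then have "restr Q k q = restr Q l r"
        using hQ(2)[of "Dom C k" "restr Q k q"] hQ(2)[of "Dom C k" "restr Q l r"]
          sh_simps(1)[OF Q kl(1), of q] sh_simps(1)[OF Q kl(2), of r] kl c d by (metis Obj_arr(1))
      then have "\<rho> k (dec c q) = \<rho> l (dec d r)"
        using dec_restr[OF kl(1), of q] dec_restr[OF kl(2), of r] kl c d by simp
      then show "Comp F (dec c q) (FArr G (yon k)) = Comp F (dec d r) (FArr G (yon l))" by (simp add: \<rho>_def)
    qed (use ab hq hr dec(1)[OF c] dec(1)[OF d] in \<open>auto simp: V_def hom_iff\<close>)
    then show "Comp F ((\<lambda>(c, q). dec c q) i) (FArr G a) = Comp F ((\<lambda>(c, q). dec c q) j) (FArr G b)" by simp
  qed (use hQ(1) in \<open>auto simp: hom_iff\<close>)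
  then obtain \<epsilon> where \<epsilon>: "\<epsilon> \<in> hom F (FObj G Q) x"
    and \<epsilon>h: "\<And>c q. c \<in> Obj C \<Longrightarrow> q \<in> FObj Q c \<Longrightarrow> Comp F \<epsilon> (FArr G (hat c Q q)) = dec c q" by force
  show "\<exists>r\<in>Obj Sh. \<exists>\<epsilon>\<in>hom F (FObj G r) x. \<forall>c\<in>Obj Sh. \<forall>h\<in>hom F (FObj G c) x.
      \<exists>!t. t \<in> hom Sh c r \<and> Comp F \<epsilon> (FArr G t) = h"
  proof (intro bexI[of _ Q] bexI[OF _ \<epsilon>] ballI)
    show "Q \<in> Obj Sh" using Q by (simp add: Obj_Sh)
    fix P h assume "P \<in> Obj Sh" and h: "h \<in> hom F (FObj G P) x"
    then have P: "is_sheaf C J P" by (simp add: Obj_Sh)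
    note hP = hat[OF _ P]
    have hV: "Comp F h (FArr G (hat c P p)) \<in> V c" if "c \<in> Obj C" "p \<in> FObj P c" for c p
      using hP(1)[OF that] h by (auto simp: V_def hom_iff)
    \<comment> \<open>The transpose of \<open>h\<close> sends an element to the code of
      \<open>h\<close> composed with the image under \<open>G\<close> of the arrow of that
      element.\<close>
    have "\<exists>t \<in> hom Sh P Q. \<forall>d \<in> Obj C. \<forall>a \<in> FObj P d. at t d a = e d (Comp F h (FArr G (hat d P a)))"
    proof (rule Sh_hom_mk[OF P Q])
      fix f a assume f: "f \<in> Arr C" and a: "a \<in> FObj P (Cod C f)"
      have "Comp F h (FArr G (hat (Dom C f) P (restr P f a))) = \<rho> f (Comp F h (FArr G (hat (Cod C f) P a)))"
        unfolding \<rho>_def hat_yon[OF f P a, symmetric] using h hP(1)[of "Cod C f" a] f a yarr[OF f]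
        by (auto simp: hom_iff G.FArr_Comp_arr G.D.assoc)
      then show "e (Dom C f) (Comp F h (FArr G (hat (Dom C f) P (restr P f a)))) =
         restr Q f (e (Cod C f) (Comp F h (FArr G (hat (Cod C f) P a))))"
        using re[OF f hV[of "Cod C f" a]] f a by simp
    qed (use dec_e hV in blast)
    then obtain t where t: "t \<in> hom Sh P Q"
      and ta: "\<And>d a. d \<in> Obj C \<Longrightarrow> a \<in> FObj P d \<Longrightarrow> at t d a = e d (Comp F h (FArr G (hat d P a)))" by blast
    \<comment> \<open>On the member given by an element, \<epsilon> after the image of
      \<open>t'\<close> decodes the value of \<open>t'\<close> there. Both existence and uniqueness
      of the transpose follow from this.\<close>
    have pre: "Comp F (Comp F \<epsilon> (FArr G t')) (FArr G (hat c P p)) = dec c (at t' c p)"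
      if t': "t' \<in> hom Sh P Q" and c: "c \<in> Obj C" "p \<in> FObj P c" for t' c p
    proof -
      have "Comp F (Comp F \<epsilon> (FArr G t')) (FArr G (hat c P p)) = Comp F \<epsilon> (FArr G (Comp Sh t' (hat c P p)))"
        using \<epsilon> t' hP(1)[OF c] by (simp add: hom_iff G.FArr_Comp_arr G.D.assoc)
      then show ?thesis using hat_comp[OF t' c] \<epsilon>h[OF c(1) Sh_hom_at(3)[OF t' c]] by simp
    qed
    show "\<exists>!t. t \<in> hom Sh P Q \<and> Comp F \<epsilon> (FArr G t) = h"
    proof (rule ex1I[of _ t], intro conjI t)
      show "Comp F \<epsilon> (FArr G t) = h"
      proof (rule epimorphic_cancel[OF epi_hat[OF P, unfolded image_image]])
        show "Comp F \<epsilon> (FArr G t) \<in> hom F (FObj G P) x" "h \<in> hom F (FObj G P) x"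
          using \<epsilon> t h by (auto simp: hom_iff)
        fix i assume "i \<in> Sigma (Obj C) (FObj P)"
        then show "Comp F (Comp F \<epsilon> (FArr G t)) (FArr G (case i of (c, p) \<Rightarrow> hat c P p)) =
          Comp F h (FArr G (case i of (c, p) \<Rightarrow> hat c P p))"
          using pre[OF t] ta dec_e(1) hV by auto
      qed
      fix t' assume t': "t' \<in> hom Sh P Q \<and> Comp F \<epsilon> (FArr G t') = h"
      show "t' = t"
      proof (rule Sh_hom_eqI[OF conjunct1[OF t'] t])
        fix d a assume d: "d \<in> Obj C" "a \<in> FObj P d"
        have "e d (Comp F h (FArr G (hat d P a))) = e d (dec d (at t' d a))" using pre[OF conjunct1[OF t'] d] t' by simp
        then show "at t' d a = at t d a"
          using ta[OF d] dec(2)[OF d(1) Sh_hom_at(3)[OF conjunct1[OF t'] d]] by simp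
      qed
    qed
  qed
qed

end

section \<open>Grothendieck toposes\<close>

lemma weak_equivalenceD:
  assumes "weak_equivalence C D F"
  shows "cat_functor C D F"
    "\<And>x y g. x \<in> Obj C \<Longrightarrow> y \<in> Obj C \<Longrightarrow> g \<in> hom D (FObj F x) (FObj F y) \<Longrightarrow> \<exists>f \<in> hom C x y. FArr F f = g"
    "\<And>x y f f'. f \<in> hom C x y \<Longrightarrow> f' \<in> hom C x y \<Longrightarrow> FArr F f = FArr F f' \<Longrightarrow> f = f'"
    "\<And>d. d \<in> Obj D \<Longrightarrow> \<exists>c \<in> Obj C. \<exists>i \<in> hom D (FObj F c) d. iso_arr D i"
  using assms unfolding weak_equivalence_def inj_on_def by blast+

text \<open>The common target of two arrows to be compared is isomorphic to an object in the image
  of \<open>F\<close>, and towards such an object both arrows lift to \<open>C\<close>.\<close>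

lemma weak_equivalence_preserves_epimorphic:
  assumes W: "weak_equivalence C D F"
  shows "preserves_epimorphic C D F"
  unfolding preserves_epimorphic_def
proof (intro allI impI)
  note w = weak_equivalenceD[OF W]
  interpret F: cat_functor C D F by (rule w)
  fix c S assume epi: "epimorphic_family C c S"
  then have c: "c \<in> Obj C" and S: "\<And>u. u \<in> S \<Longrightarrow> u \<in> Arr C" "\<And>u. u \<in> S \<Longrightarrow> Cod C u = c"
    by (auto simp: epimorphic_family_def)
  show "epimorphic_family D (FObj F c) (FArr F ` S)"
    unfolding epimorphic_family_def
  proof (intro conjI allI impI; (elim conjE)?)
    fix d h k assume h: "h \<in> hom D (FObj F c) d" and k: "k \<in> hom D (FObj F c) d"
      and eq: "\<forall>f\<in>FArr F ` S. Comp D h f = Comp D k f"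
    have d: "d \<in> Obj D" using h by (auto simp: hom_iff)
    obtain d' i where d': "d' \<in> Obj C" and i: "i \<in> hom D (FObj F d') d" and iso: "iso_arr D i" using w(4)[OF d] by blast
    note j = inverse_arr[OF iso]
    obtain h' where h': "h' \<in> hom C c d'" "FArr F h' = Comp D (inverse_arr D i) h"
      using w(2)[OF c d', of "Comp D (inverse_arr D i) h"] h j i by (auto simp: hom_iff)
    obtain k' where k': "k' \<in> hom C c d'" "FArr F k' = Comp D (inverse_arr D i) k"
      using w(2)[OF c d', of "Comp D (inverse_arr D i) k"] k j i by (auto simp: hom_iff)
    have "Comp C h' u = Comp C k' u" if u: "u \<in> S" for u
    proof (rule w(3))
      show "Comp C h' u \<in> hom C (Dom C u) d'" "Comp C k' u \<in> hom C (Dom C u) d'"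
        using h' k' S[OF u] by (auto simp: hom_iff)
      have "Comp D h (FArr F u) = Comp D k (FArr F u)" using eq u by blast
      then show "FArr F (Comp C h' u) = FArr F (Comp C k' u)"
        using h' k' S[OF u] h k i j by (simp add: hom_iff F.FArr_Comp_arr F.D.assoc)
    qed
    then have "h' = k'" using epi h' k' unfolding epimorphic_family_def by blast
    then have "Comp D (inverse_arr D i) h = Comp D (inverse_arr D i) k" using h' k' by simp
    then show "h = k"
      using h k i j by - (rule F.D.iso_cancel_left[OF iso_inverse_arr[OF iso]], auto simp: hom_iff)
  qed (use c S in auto)
qed

text \<open>The vertex of a pullback in \<open>D\<close> is moved by an isomorphism \<open>i\<close>
  into the image of \<open>F\<close>; the legs and the mediating arrows then lift, and equations are
  compared by faithfulness.\<close>

lemma weak_equivalence_has_pullbacks: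
  assumes W: "weak_equivalence C D F" and D: "has_pullbacks D"
  shows "has_pullbacks C"
  unfolding has_pullbacks_def
proof (intro ballI impI)
  note w = weak_equivalenceD[OF W]
  interpret F: cat_functor C D F by (rule w)
  fix f g assume f: "f \<in> Arr C" and g: "g \<in> Arr C" and fg: "Cod C f = Cod C g"
  obtain p q where pq: "pullback D (FArr F f) (FArr F g) p q"
    using D f g fg unfolding has_pullbacks_def by (metis F.FArr_arr(1,3))
  note d = pullbackD[OF pq]
  obtain v i where v: "v \<in> Obj C" and i: "i \<in> hom D (FObj F v) (Dom D p)" and iso: "iso_arr D i"
    using w(4)[of "Dom D p"] d by auto
  note j = inverse_arr[OF iso]
  obtain p' where p': "p' \<in> hom C v (Dom C f)" "FArr F p' = Comp D p i"
    using w(2)[OF v, of "Dom C f" "Comp D p i"] f i d by (auto simp: hom_iff)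
  obtain q' where q': "q' \<in> hom C v (Dom C g)" "FArr F q' = Comp D q i"
    using w(2)[OF v, of "Dom C g" "Comp D q i"] g i d by (auto simp: hom_iff)
  have "pullback C f g p' q'"
    unfolding pullback_def
  proof (intro conjI allI impI; (elim conjE)?)
    show "Comp C f p' = Comp C g q'"
    proof (rule w(3))
      show "Comp C f p' \<in> hom C v (Cod C f)" "Comp C g q' \<in> hom C v (Cod C f)"
        using p' q' f g fg by (auto simp: hom_iff)
      have "Comp D (FArr F f) (Comp D p i) = Comp D (FArr F g) (Comp D q i)"
        using d i f g by (simp add: hom_iff flip: F.D.assoc)
      then show "FArr F (Comp C f p') = FArr F (Comp C g q')"
        using p' q' f g by (simp add: hom_iff F.FArr_Comp_arr)
    qed
  next
    fix a b assume a: "a \<in> Arr C" and b: "b \<in> Arr C" and ab: "Dom C a = Dom C b" "Cod C a = Dom C f" "Cod C b = Dom C g"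
      "Comp C f a = Comp C g b"
    have "Comp D (FArr F f) (FArr F a) = Comp D (FArr F g) (FArr F b)"
      using a b f g ab by (simp flip: F.FArr_Comp_arr)
    then have "\<exists>!h. h \<in> hom D (Dom D (FArr F a)) (Dom D p) \<and> Comp D p h = FArr F a \<and> Comp D q h = FArr F b"
      using a b ab f g by (intro pullback_ex1[OF pq]) auto
    then obtain h where h: "h \<in> hom D (FObj F (Dom C a)) (Dom D p)" "Comp D p h = FArr F a" "Comp D q h = FArr F b"
      using a by auto
    obtain h' where h': "h' \<in> hom C (Dom C a) v" "FArr F h' = Comp D (inverse_arr D i) h"
      using w(2)[OF _ v, of "Dom C a" "Comp D (inverse_arr D i) h"] a h i j by (auto simp: hom_iff)
    have char: "Comp C p' k = a \<and> Comp C q' k = b \<longleftrightarrow> Comp D p (Comp D i (FArr F k)) = FArr F a \<and> Comp D q (Comp D i (FArr F k)) = FArr F b"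
      if k: "k \<in> hom C (Dom C a) v" for k
    proof -
      have "FArr F (Comp C p' k) = Comp D p (Comp D i (FArr F k))" "FArr F (Comp C q' k) = Comp D q (Comp D i (FArr F k))"
        using k p' q' i d by (simp_all add: hom_iff F.FArr_Comp_arr F.D.assoc)
      moreover have "Comp C p' k = a \<longleftrightarrow> FArr F (Comp C p' k) = FArr F a"
        using w(3)[of "Comp C p' k" "Dom C a" "Dom C f" a] k p' a ab by (auto simp: hom_iff)
      moreover have "Comp C q' k = b \<longleftrightarrow> FArr F (Comp C q' k) = FArr F b"
        using w(3)[of "Comp C q' k" "Dom C a" "Dom C g" b] k q' b ab by (auto simp: hom_iff)
      ultimately show ?thesis by simp
    qed
    have dp: "Dom C p' = v" using p' by (simp add: hom_iff)
    show "\<exists>!h. h \<in> hom C (Dom C a) (Dom C p') \<and> Comp C p' h = a \<and> Comp C q' h = b"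
      unfolding dp
    proof (rule ex1I[of _ h'])
      show "h' \<in> hom C (Dom C a) v \<and> Comp C p' h' = a \<and> Comp C q' h' = b"
        using h' char[OF h'(1)] h iso i by (simp add: hom_iff F.D.Comp_inverse_cancel)
      fix k assume k: "k \<in> hom C (Dom C a) v \<and> Comp C p' k = a \<and> Comp C q' k = b"
      then have "Comp D i (FArr F k) = h"
        using char[of k] h d i
        by - (rule pullback_jointly_monic[OF F.D.category_axioms pq], auto simp: hom_iff)
      then have "FArr F k = FArr F h'"
        using h' k iso i by (auto simp: hom_iff F.D.Comp_inverse_cancel)
      then show "k = h'" using w(3) k h'(1) by blast
    qed
  qed (use f g fg p' q' in \<open>auto simp: hom_iff\<close>)
  then show "\<exists>p q. pullback C f g p q" by blast
qed

text \<open>To apply effectiveness in \<open>D\<close>, compatibility has to be verified on squares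
  with arbitrary vertex; an isomorphism from an object in the image of \<open>F\<close> brings such
  a square back to \<open>C\<close>.\<close>

lemma weak_equivalence_effective_families:
  assumes W: "weak_equivalence C D F" and D: "effective_families D"
  shows "effective_families C"
  unfolding effective_families_def
proof (intro allI impI; elim conjE)
  note w = weak_equivalenceD[OF W]
  interpret F: cat_functor C D F by (rule w)
  fix c S x s assume epi: "epimorphic_family C c S" and s: "\<forall>u\<in>S. s u \<in> hom C (Dom C u) x" and x: "x \<in> Obj C"
    and cmp: "\<forall>u\<in>S. \<forall>v\<in>S. \<forall>a\<in>Arr C. \<forall>b\<in>Arr C. Dom C a = Dom C b \<and> Cod C a = Dom C u \<and> Cod C b = Dom C v \<and>
       Comp C u a = Comp C v b \<longrightarrow> Comp C (s u) a = Comp C (s v) b"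
  have c: "c \<in> Obj C" and S: "\<And>u. u \<in> S \<Longrightarrow> u \<in> Arr C" "\<And>u. u \<in> S \<Longrightarrow> Cod C u = c"
    using epi by (auto simp: epimorphic_family_def)
  have epiF: "epimorphic_family D (FObj F c) (FArr F ` S)"
    using weak_equivalence_preserves_epimorphic[OF W] epi by (simp add: preserves_epimorphic_def)
  have s': "s u \<in> Arr C" "Dom C (s u) = Dom C u" "Cod C (s u) = x" if "u \<in> S" for u
    using s that by (auto simp: hom_iff)
  have key: "Comp D (FArr F (s u)) a = Comp D (FArr F (s v)) b"
    if u: "u \<in> S" and v: "v \<in> S" and a: "a \<in> Arr D" and b: "b \<in> Arr D" and ab: "Dom D a = Dom D b"
      "Cod D a = FObj F (Dom C u)" "Cod D b = FObj F (Dom C v)" "Comp D (FArr F u) a = Comp D (FArr F v) b" for u v a b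
  proof -
    obtain z i where z: "z \<in> Obj C" and i: "i \<in> hom D (FObj F z) (Dom D a)" and iso: "iso_arr D i"
      using w(4)[of "Dom D a"] a by auto
    obtain a' where a': "a' \<in> hom C z (Dom C u)" "FArr F a' = Comp D a i"
      using w(2)[OF z, of "Dom C u" "Comp D a i"] S[OF u] i a ab by (auto simp: hom_iff)
    obtain b' where b': "b' \<in> hom C z (Dom C v)" "FArr F b' = Comp D b i"
      using w(2)[OF z, of "Dom C v" "Comp D b i"] S[OF v] i b ab by (auto simp: hom_iff)
    have "Comp C u a' = Comp C v b'"
    proof (rule w(3))
      show "Comp C u a' \<in> hom C z c" "Comp C v b' \<in> hom C z c" using a' b' S u v by (auto simp: hom_iff)
      have "Comp D (FArr F u) (Comp D a i) = Comp D (FArr F v) (Comp D b i)"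
        using a b ab i S u v by (simp add: hom_iff flip: F.D.assoc)
      then show "FArr F (Comp C u a') = FArr F (Comp C v b')" using a' b' S u v by (simp add: hom_iff F.FArr_Comp_arr)
    qed
    then have "Comp C (s u) a' = Comp C (s v) b'"
      using a' b' u v by (intro cmp[rule_format]) (auto simp: hom_iff)
    then have "FArr F (Comp C (s u) a') = FArr F (Comp C (s v) b')" by simp
    then have "Comp D (Comp D (FArr F (s u)) a) i = Comp D (Comp D (FArr F (s v)) b) i"
      using a' b' s'[OF u] s'[OF v] a b ab i by (simp add: hom_iff F.FArr_Comp_arr F.D.assoc)
    then show ?thesis
      using a b ab i s'[OF u] s'[OF v] by - (rule F.D.iso_cancel_right[OF iso], auto simp: hom_iff)
  qed
  define \<iota> where "\<iota> w = (SOME u. u \<in> S \<and> FArr F u = w)" for w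
  have \<iota>: "\<iota> w \<in> S" "FArr F (\<iota> w) = w" if "w \<in> FArr F ` S" for w
    using that someI_ex[of "\<lambda>i. i \<in> S \<and> FArr F i = w"] unfolding \<iota>_def by auto
  have Dw: "Dom D w = FObj F (Dom C (\<iota> w))" if "w \<in> FArr F ` S" for w
    using \<iota>[OF that] S(1) F.FArr_arr(2) by metis
  have "\<exists>h \<in> hom D (FObj F c) (FObj F x). \<forall>w \<in> FArr F ` S. Comp D h w = FArr F (s (\<iota> w))"
  proof (rule D[unfolded effective_families_def, rule_format, OF epiF], intro conjI ballI impI; (elim conjE)?)
    fix w assume "w \<in> FArr F ` S"
    then show "FArr F (s (\<iota> w)) \<in> hom D (Dom D w) (FObj F x)" using Dw \<iota>(1) s' by (simp add: hom_iff)
  next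
    fix w w' a b assume w: "w \<in> FArr F ` S" "w' \<in> FArr F ` S" and "a \<in> Arr D" "b \<in> Arr D"
      "Dom D a = Dom D b" "Cod D a = Dom D w" "Cod D b = Dom D w'" "Comp D w a = Comp D w' b"
    then show "Comp D (FArr F (s (\<iota> w))) a = Comp D (FArr F (s (\<iota> w'))) b"
      using \<iota>[OF w(1)] \<iota>[OF w(2)] Dw by (intro key) auto
  qed (use x in simp)
  then obtain h where h: "h \<in> hom D (FObj F c) (FObj F x)" "\<And>w. w \<in> FArr F ` S \<Longrightarrow> Comp D h w = FArr F (s (\<iota> w))" by blast
  obtain h' where h': "h' \<in> hom C c x" "FArr F h' = h" using w(2)[OF c x h(1)] by blast
  have "Comp C h' u = s u" if u: "u \<in> S" for u
  proof (rule w(3))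
    show "Comp C h' u \<in> hom C (Dom C u) x" "s u \<in> hom C (Dom C u) x" using h' S[OF u] s'[OF u] by (auto simp: hom_iff)
    have w: "FArr F u \<in> FArr F ` S" using u by blast
    let ?v = "\<iota> (FArr F u)"
    have eq: "FObj F (Dom C ?v) = FObj F (Dom C u)" using Dw[OF w] S[OF u] by simp
    have "Comp D (FArr F (s ?v)) (Id D (FObj F (Dom C u))) = Comp D (FArr F (s u)) (Id D (FObj F (Dom C u)))"
      using eq \<iota>[OF w] u S[OF u] by (intro key) auto
    then have "FArr F (s ?v) = FArr F (s u)" using s'[OF u] s'[OF \<iota>(1)[OF w]] eq by simp
    then show "FArr F (Comp C h' u) = FArr F (s u)"
      using h(2)[OF w] h' S[OF u] by (simp add: hom_iff F.FArr_Comp_arr)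
  qed
  then show "\<exists>h\<in>hom C c x. \<forall>u\<in>S. Comp C h u = s u" using h' by blast
qed

lemma weak_equivalence_locally_small:
  assumes W: "weak_equivalence C D F" and D: "locally_small TYPE('u) D"
  shows "locally_small TYPE('u) C"
  unfolding locally_small_def
proof (intro allI)
  note w = weak_equivalenceD[OF W]
  interpret F: cat_functor C D F by (rule w)
  fix x y
  have "hom C x y \<lesssim> hom D (FObj F x) (FObj F y)"
    unfolding lepoll_def using w(3) F.FArr_in_hom by (intro exI[of _ "FArr F"]) (auto intro!: inj_onI)
  then show "hom C x y \<prec> (UNIV :: 'u set)"
    using D unfolding locally_small_def by (blast intro: lesspoll_trans1)
qed

text \<open>A universal arrow for the composite serves for \<open>G\<close> too: its property at an
  object \<open>d\<close> is the one at some \<open>c\<close> whose image is isomorphic to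
  \<open>d\<close>.\<close>

lemma weak_equivalence_universal_arrows:
  assumes W: "weak_equivalence C D F" and G: "cat_functor D E G" and u: "has_universal_arrows C E (G \<circ>\<^sub>F F)"
  shows "has_universal_arrows D E G"
  unfolding has_universal_arrows_def
proof
  note w = weak_equivalenceD[OF W]
  interpret F: cat_functor C D F by (rule w)
  interpret G: cat_functor D E G by fact
  fix x assume x: "x \<in> Obj E"
  obtain r \<epsilon> where r: "r \<in> Obj C" and \<epsilon>: "\<epsilon> \<in> hom E (FObj G (FObj F r)) x"
    and univ: "\<And>c h. c \<in> Obj C \<Longrightarrow> h \<in> hom E (FObj G (FObj F c)) x \<Longrightarrow>
      \<exists>!t. t \<in> hom C c r \<and> Comp E \<epsilon> (FArr G (FArr F t)) = h"
    using bspec[OF u[unfolded has_universal_arrows_def FObj_comp FArr_comp] x]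
    by (elim bexE) (rule that, assumption, assumption, rule bspec, rule bspec)
  show "\<exists>r\<in>Obj D. \<exists>\<epsilon>\<in>hom E (FObj G r) x. \<forall>c\<in>Obj D. \<forall>h\<in>hom E (FObj G c) x.
      \<exists>!t. t \<in> hom D c r \<and> Comp E \<epsilon> (FArr G t) = h"
  proof (intro bexI[of _ "FObj F r"] bexI[OF _ \<epsilon>] ballI)
    show "FObj F r \<in> Obj D" using r by simp
    fix d h assume d: "d \<in> Obj D" and h: "h \<in> hom E (FObj G d) x"
    obtain c i where c: "c \<in> Obj C" and i: "i \<in> hom D (FObj F c) d" and iso: "iso_arr D i" using w(4)[OF d] by blast
    note j = inverse_arr[OF iso]
    have hi: "Comp E h (FArr G i) \<in> hom E (FObj G (FObj F c)) x" using h i by (auto simp: hom_iff)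
    obtain t where t: "t \<in> hom C c r" "Comp E \<epsilon> (FArr G (FArr F t)) = Comp E h (FArr G i)" using univ[OF c hi] by blast
    show "\<exists>!t. t \<in> hom D d (FObj F r) \<and> Comp E \<epsilon> (FArr G t) = h"
    proof (rule ex1I[of _ "Comp D (FArr F t) (inverse_arr D i)"], intro conjI)
      show "Comp D (FArr F t) (inverse_arr D i) \<in> hom D d (FObj F r)" using t i j by (auto simp: hom_iff)
      have "Comp E \<epsilon> (FArr G (Comp D (FArr F t) (inverse_arr D i))) = Comp E (Comp E \<epsilon> (FArr G (FArr F t))) (FArr G (inverse_arr D i))"
        using t(1) i j \<epsilon> by (simp add: hom_iff G.FArr_Comp_arr G.D.assoc)
      also have "\<dots> = Comp E h (Comp E (FArr G i) (FArr G (inverse_arr D i)))"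
        unfolding t(2) using h i j by (simp add: hom_iff G.D.assoc)
      also have "\<dots> = h" using h i G.iso_FArr(3)[OF iso] by (simp add: hom_iff)
      finally show "Comp E \<epsilon> (FArr G (Comp D (FArr F t) (inverse_arr D i))) = h" .
      fix s assume s: "s \<in> hom D d (FObj F r) \<and> Comp E \<epsilon> (FArr G s) = h"
      obtain s' where s': "s' \<in> hom C c r" "FArr F s' = Comp D s i"
        using w(2)[OF c r, of "Comp D s i"] s i by (auto simp: hom_iff)
      have "Comp E \<epsilon> (FArr G (FArr F s')) = Comp E (Comp E \<epsilon> (FArr G s)) (FArr G i)"
        unfolding s'(2) using conjunct1[OF s] i \<epsilon> by (simp add: hom_iff G.FArr_Comp_arr G.D.assoc)
      then have "s' = t" using univ[OF c hi] s' t s by (metis (no_types, lifting))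
      then show "s = Comp D (FArr F t) (inverse_arr D i)"
        using s s' i iso by (simp add: hom_iff F.D.Comp_inverse_cancel)
    qed
  qed
qed

section \<open>Exactness and adjoints for Grothendieck toposes\<close>

lemma grothendieck_topos_site:
  assumes "universe TYPE('u)" "grothendieck_topos TYPE('u) E"
  shows "\<exists>(C :: ('u, 'u) cat) J. small_site C J \<and> equivalent_cats E
    (sheaf_cat C J :: (('u, 'u, 'u set, 'u fn) fctr,
             ('u, 'u, 'u set, 'u fn) fctr \<times> ('u, 'u, 'u set, 'u fn) fctr \<times> ('u \<Rightarrow> 'u fn)) cat)"
  using assms unfolding grothendieck_topos_def small_site_def small_site_axioms_def by blast

lemma grothendieck_topos_exact:
  assumes "universe TYPE('u)" "grothendieck_topos TYPE('u) E"
  shows "category E" "\<exists>t. terminal E t" "has_pullbacks E" "effective_families E" "locally_small TYPE('u) E"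
proof -
  obtain C :: "('u, 'u) cat" and J where S: "small_site C J" and eq: "equivalent_cats E
    (sheaf_cat C J :: (('u, 'u, 'u set, 'u fn) fctr,
             ('u, 'u, 'u set, 'u fn) fctr \<times> ('u, 'u, 'u set, 'u fn) fctr \<times> ('u \<Rightarrow> 'u fn)) cat)"
    using grothendieck_topos_site[OF assms] by blast
  interpret small_site C J by fact
  obtain \<Phi> where \<Phi>: "weak_equivalence E Sh \<Phi>" using equivalent_cats_weak_equivalence[OF eq] by blast
  obtain \<Psi> where \<Psi>: "weak_equivalence Sh E \<Psi>"
    using equivalent_cats_weak_equivalence[OF equivalent_cats_sym[OF eq]] by blast
  show E: "category E" using weak_equivalenceD(1)[OF \<Phi>] by (simp add: cat_functor_def)
  show "\<exists>t. terminal E t"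
    using Sh_terminal preserves_terminal[OF weak_equivalence_preserves_finite_limits[OF \<Psi>] Sh.category_axioms E] by blast
  show "has_pullbacks E" by (rule weak_equivalence_has_pullbacks[OF \<Phi> Sh_pullbacks])
  show "effective_families E" by (rule weak_equivalence_effective_families[OF \<Phi> Sh_effective_families])
  show "locally_small TYPE('u) E" by (rule weak_equivalence_locally_small[OF \<Phi> Sh_locally_small])
qed

text \<open>The source is replaced by sheaves on a small site, where the universal arrows have been
  constructed, and they are moved back along the equivalence.\<close>

lemma grothendieck_topos_universal_arrows:
  assumes u: "universe TYPE('u)" and E: "grothendieck_topos TYPE('u) E" and F: "grothendieck_topos TYPE('u) F"
    and G: "cat_functor E F G" and lex: "preserves_finite_limits E F G" and epi: "preserves_epimorphic E F G"
  shows "has_universal_arrows E F G"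
proof -
  obtain C :: "('u, 'u) cat" and J where S: "small_site C J" and eq: "equivalent_cats E
    (sheaf_cat C J :: (('u, 'u, 'u set, 'u fn) fctr,
             ('u, 'u, 'u set, 'u fn) fctr \<times> ('u, 'u, 'u set, 'u fn) fctr \<times> ('u \<Rightarrow> 'u fn)) cat)"
    using grothendieck_topos_site[OF u E] by blast
  interpret small_site C J by fact
  obtain \<Psi> where \<Psi>: "weak_equivalence Sh E \<Psi>"
    using equivalent_cats_weak_equivalence[OF equivalent_cats_sym[OF eq]] by blast
  note P = weak_equivalenceD(1)[OF \<Psi>]
  have pb: "preserves_pullbacks Sh F (G \<circ>\<^sub>F \<Psi>)"
    unfolding preserves_pullbacks_def
    using preserves_pullback[OF preserves_finite_limits_comp[OF weak_equivalence_preserves_finite_limits[OF \<Psi>] lex]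
        cat_functor_comp[OF P G]] by blast
  have "preserves_epimorphic Sh F (G \<circ>\<^sub>F \<Psi>)"
  proof -
    have "FArr (G \<circ>\<^sub>F \<Psi>) ` S = FArr G ` FArr \<Psi> ` S" for S by (simp add: image_image)
    then show ?thesis
      using weak_equivalence_preserves_epimorphic[OF \<Psi>] epi by (simp add: preserves_epimorphic_def)
  qed
  then have "has_universal_arrows Sh F (G \<circ>\<^sub>F \<Psi>)"
    using grothendieck_topos_exact[OF u F] by (intro Sh_universal_arrows cat_functor_comp[OF P G] pb)
  then show ?thesis by (rule weak_equivalence_universal_arrows[OF \<Psi> G])
qed

text \<open>Balancedness from effectiveness: if \<open>m\<close> is monic, the identity is
  compatible with the one-member family \<open>{m}\<close>, so it extends along \<open>m\<close> to
  a retraction; as \<open>m\<close> is epimorphic, the retraction is an inverse.\<close>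

lemma effective_mono_epi_iso:
  assumes "category C" "effective_families C" and m: "m \<in> Arr C" and epi: "epimorphic_family C (Cod C m) {m}"
    and mono: "\<And>a b. a \<in> Arr C \<Longrightarrow> b \<in> Arr C \<Longrightarrow> Dom C a = Dom C b \<Longrightarrow> Cod C a = Dom C m \<Longrightarrow> Cod C b = Dom C m \<Longrightarrow>
      Comp C m a = Comp C m b \<Longrightarrow> a = b"
  shows "iso_arr C m"
proof -
  interpret category C by fact
  have "\<exists>h \<in> hom C (Cod C m) (Dom C m). \<forall>u \<in> {m}. Comp C h u = Id C (Dom C m)"
    by (rule assms(2)[unfolded effective_families_def, rule_format, OF epi])
      (use m mono in \<open>auto simp: hom_iff\<close>)
  then obtain h where h: "h \<in> hom C (Cod C m) (Dom C m)" "Comp C h m = Id C (Dom C m)" by blast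
  have "Comp C m h = Id C (Cod C m)"
  proof (rule epimorphic_cancel[of C "Cod C m" id "{m}" _ "Cod C m"])
    show "Comp C (Comp C m h) (id i) = Comp C (Id C (Cod C m)) (id i)" if "i \<in> {m}" for i
      using that h m by (simp add: hom_iff assoc)
  qed (use epi m h in \<open>auto simp: hom_iff\<close>)
  then show ?thesis using h m by (intro iso_arrI[of m C "Dom C m" "Cod C m" h]) (auto simp: hom_iff)
qed

section \<open>Geometric morphisms from universal arrows\<close>

text \<open>The chosen universal arrows form the counit, and the unit is the transpose of the
  identity. Equations between arrows into values of the right adjoint are checked after applying
  \<open>G\<close> and composing with \<epsilon>, which is the cancellation law
  \<open>eq\<close>.\<close>

lemma geometric_morphism_from_universal_arrows:
  assumes G: "cat_functor E F G" and lex: "preserves_finite_limits E F G" and u: "has_universal_arrows E F G"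
  shows "\<exists>g. geometric_morphism F E g \<and> inv_im g = G"
proof -
  interpret G: cat_functor E F G by fact
  have "\<forall>x \<in> Obj F. \<exists>r \<epsilon>. r \<in> Obj E \<and> \<epsilon> \<in> hom F (FObj G r) x \<and> (\<forall>c \<in> Obj E. \<forall>h \<in> hom F (FObj G c) x.
     \<exists>!t. t \<in> hom E c r \<and> Comp F \<epsilon> (FArr G t) = h)"
    using u unfolding has_universal_arrows_def by blast
  then obtain r \<epsilon> where r: "\<And>x. x \<in> Obj F \<Longrightarrow> r x \<in> Obj E" and eh: "\<And>x. x \<in> Obj F \<Longrightarrow> \<epsilon> x \<in> hom F (FObj G (r x)) x"
    and univ: "\<And>x c h. x \<in> Obj F \<Longrightarrow> c \<in> Obj E \<Longrightarrow> h \<in> hom F (FObj G c) x \<Longrightarrow> \<exists>!t. t \<in> hom E c (r x) \<and> Comp F (\<epsilon> x) (FArr G t) = h"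
    by metis
  have \<epsilon>: "\<epsilon> x \<in> Arr F" "Dom F (\<epsilon> x) = FObj G (r x)" "Cod F (\<epsilon> x) = x" if "x \<in> Obj F" for x
    using eh[OF that] by (auto simp: hom_iff)
  define tr where "tr c x h = (THE t. t \<in> hom E c (r x) \<and> Comp F (\<epsilon> x) (FArr G t) = h)" for c x h
  have tr: "tr c x h \<in> Arr E" "Dom E (tr c x h) = c" "Cod E (tr c x h) = r x" "Comp F (\<epsilon> x) (FArr G (tr c x h)) = h"
    if "x \<in> Obj F" "c \<in> Obj E" "h \<in> hom F (FObj G c) x" for c x h
    using theI'[OF univ[OF that]] unfolding tr_def by (auto simp: hom_iff)
  have eq: "t = t'" if "x \<in> Obj F" "t \<in> Arr E" "t' \<in> Arr E" "Dom E t = Dom E t'" "Cod E t = r x" "Cod E t' = r x"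
    "Comp F (\<epsilon> x) (FArr G t) = Comp F (\<epsilon> x) (FArr G t')" for x t t'
    using univ[OF that(1), of "Dom E t" "Comp F (\<epsilon> x) (FArr G t)"] \<epsilon>[OF that(1)] that by (auto simp: hom_iff)
  define R where "R = \<lparr>FObj = r, FArr = (\<lambda>v. tr (r (Dom F v)) (Cod F v) (Comp F v (\<epsilon> (Dom F v))))\<rparr>"
  have RO: "FObj R x = r x" for x by (simp add: R_def)
  have R: "FArr R v \<in> Arr E" "Dom E (FArr R v) = r (Dom F v)" "Cod E (FArr R v) = r (Cod F v)"
    "Comp F (\<epsilon> (Cod F v)) (FArr G (FArr R v)) = Comp F v (\<epsilon> (Dom F v))" if "v \<in> Arr F" for v
    using tr[of "Cod F v" "r (Dom F v)" "Comp F v (\<epsilon> (Dom F v))"] that \<epsilon> r by (auto simp: R_def hom_iff)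
  interpret R: cat_functor F E R
  proof
    fix x assume "x \<in> Obj F"
    then show "FArr R (Id F x) = Id E (FObj R x)"
      using R[of "Id F x"] \<epsilon> r by (intro eq[of x]) (auto simp: RO)
  next
    fix u v x y z assume "u \<in> hom F x y" "v \<in> hom F y z"
    then have uv: "u \<in> Arr F" "v \<in> Arr F" "Cod F u = Dom F v" by (auto simp: hom_iff)
    have "Comp F (\<epsilon> (Cod F v)) (FArr G (Comp E (FArr R v) (FArr R u))) = Comp F (Comp F (\<epsilon> (Cod F v)) (FArr G (FArr R v))) (FArr G (FArr R u))"
      using uv R(1-3) \<epsilon> by (simp add: G.FArr_Comp_arr G.D.assoc)
    also have "\<dots> = Comp F v (Comp F (\<epsilon> (Cod F u)) (FArr G (FArr R u)))"
      using uv R \<epsilon> by (simp add: G.D.assoc)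
    also have "\<dots> = Comp F (\<epsilon> (Cod F v)) (FArr G (FArr R (Comp F v u)))"
      using uv R(4)[OF uv(1)] R(4)[of "Comp F v u"] \<epsilon> by (simp add: G.D.assoc)
    finally show "FArr R (Comp F v u) = Comp E (FArr R v) (FArr R u)"
      using uv R by - (rule eq[of "Cod F v"], auto)
  qed (use r R in \<open>auto simp: RO hom_iff\<close>)
  define \<eta> where "\<eta> c = tr c (FObj G c) (Id F (FObj G c))" for c
  have \<eta>: "\<eta> c \<in> Arr E" "Dom E (\<eta> c) = c" "Cod E (\<eta> c) = r (FObj G c)"
    "Comp F (\<epsilon> (FObj G c)) (FArr G (\<eta> c)) = Id F (FObj G c)" if "c \<in> Obj E" for c
    using tr[of "FObj G c" c "Id F (FObj G c)"] that by (auto simp: \<eta>_def hom_iff)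
  define g where "g = \<lparr>inv_im = G, dir_im = R, unit = (\<lambda>c\<in>Obj E. \<eta> c), counit = (\<lambda>x\<in>Obj F. \<epsilon> x)\<rparr>"
  have 1: "nat_trans E E id_fctr (R \<circ>\<^sub>F G) (\<lambda>c\<in>Obj E. \<eta> c)"
  proof (intro nat_transI cat_functor_id G.C.category_axioms cat_functor_comp[OF G.cat_functor_axioms R.cat_functor_axioms])
    fix f assume f: "f \<in> Arr E"
    let ?c = "Dom E f" and ?d = "Cod E f"
    have "Comp F (\<epsilon> (FObj G ?d)) (FArr G (Comp E (\<eta> ?d) f)) = Comp F (Comp F (\<epsilon> (FObj G ?d)) (FArr G (\<eta> ?d))) (FArr G f)"
      using f \<eta>(1-3) \<epsilon> by (simp add: G.FArr_Comp_arr G.D.assoc)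
    also have "\<dots> = Comp F (FArr G f) (Comp F (\<epsilon> (FObj G ?c)) (FArr G (\<eta> ?c)))"
      using f \<eta>(4) by simp
    also have "\<dots> = Comp F (\<epsilon> (FObj G ?d)) (FArr G (Comp E (FArr R (FArr G f)) (\<eta> ?c)))"
      using f \<eta>(1-3) \<epsilon> R(1-3)[of "FArr G f"] R(4)[of "FArr G f"] by (simp add: G.FArr_Comp_arr flip: G.D.assoc)
    finally have "Comp E (\<eta> ?d) f = Comp E (FArr R (FArr G f)) (\<eta> ?c)"
      using f \<eta>(1-3) R(1-3)[of "FArr G f"] by - (rule eq[of "FObj G ?d"], auto simp: RO)
    then show "Comp E ((\<lambda>c\<in>Obj E. \<eta> c) (Cod E f)) (FArr id_fctr f) =
         Comp E (FArr (R \<circ>\<^sub>F G) f) ((\<lambda>c\<in>Obj E. \<eta> c) (Dom E f))" using f by simp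
  qed (use \<eta> in \<open>auto simp: hom_iff RO\<close>)
  have 2: "nat_trans F F (G \<circ>\<^sub>F R) id_fctr (\<lambda>x\<in>Obj F. \<epsilon> x)"
    by (intro nat_transI cat_functor_id G.D.category_axioms cat_functor_comp[OF R.cat_functor_axioms G.cat_functor_axioms])
      (use \<epsilon> R(4) in \<open>auto simp: hom_iff RO\<close>)
  have "geometric_morphism F E g"
    unfolding geometric_morphism_def geometric_morphism_axioms_def
  proof (intro conjI allI impI)
    fix x assume x: "x \<in> Obj F"
    have Gr: "FObj G (r x) \<in> Obj F" using x r by simp
    have "Comp F (\<epsilon> x) (FArr G (Comp E (FArr R (\<epsilon> x)) (\<eta> (r x)))) = Comp F (Comp F (\<epsilon> x) (FArr G (FArr R (\<epsilon> x)))) (FArr G (\<eta> (r x)))"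
      using x r \<epsilon>[OF x] \<eta>(1-3)[OF r[OF x]] R(1-3)[OF \<epsilon>(1)[OF x]] by (simp add: G.FArr_Comp_arr G.D.assoc)
    also have "\<dots> = Comp F (\<epsilon> x) (Comp F (\<epsilon> (FObj G (r x))) (FArr G (\<eta> (r x))))"
      using x r \<epsilon>[OF x] \<eta>(1-3)[OF r[OF x]] \<epsilon>[OF Gr] R(4)[OF \<epsilon>(1)[OF x]] by (simp add: G.D.assoc)
    finally have "Comp E (FArr R (\<epsilon> x)) (\<eta> (r x)) = Id E (r x)"
      using x r \<epsilon>[OF x] \<eta>[OF r[OF x]] R(1-3)[OF \<epsilon>(1)[OF x]] by - (rule eq[OF x], auto)
    then show "Comp E (FArr (dir_im g) (counit g x)) (unit g (FObj (dir_im g) x)) = Id E (FObj (dir_im g) x)"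
      using x r by (simp add: g_def RO)
  qed (use 1 2 G.cat_functor_axioms R.cat_functor_axioms lex \<eta>(4) in \<open>auto simp: g_def\<close>)
  then show ?thesis by (intro exI[of _ g]) (simp add: g_def)
qed

lemma geometric_morphismD:
  assumes "geometric_morphism F E g"
  shows "cat_functor E F (inv_im g)" "cat_functor F E (dir_im g)" "category E" "category F"
    "nat_trans E E id_fctr (dir_im g \<circ>\<^sub>F inv_im g) (unit g)"
    "nat_trans F F (inv_im g \<circ>\<^sub>F dir_im g) id_fctr (counit g)"
    "preserves_finite_limits E F (inv_im g)"
    "\<And>e. e \<in> Obj E \<Longrightarrow> Comp F (counit g (FObj (inv_im g) e)) (FArr (inv_im g) (unit g e)) =
      Id F (FObj (inv_im g) e)"
  using assms unfolding geometric_morphism_def geometric_morphism_axioms_def cat_functor_def by blast+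

text \<open>Inverse images are left adjoints: the transposition \<open>T\<close> is injective by a
  triangle identity and natural in the source, so arrows that agree on the image of the family have
  transposes that agree on the family.\<close>

lemma geometric_morphism_preserves_epimorphic:
  assumes "geometric_morphism F E g"
  shows "preserves_epimorphic E F (inv_im g)"
  unfolding preserves_epimorphic_def
proof (intro allI impI)
  note g = geometric_morphismD[OF assms]
  interpret inv: cat_functor E F "inv_im g" by (rule g)
  interpret dir: cat_functor F E "dir_im g" by (rule g)
  let ?L = "inv_im g" and ?R = "dir_im g"
  note n = nat_transD(3-5)[OF g(5)] and e = nat_transD(3-5)[OF g(6)]
  note nn = nat_transD(6)[OF g(5)] and en = nat_transD(6)[OF g(6)]
  fix c S assume epi: "epimorphic_family E c S"
  then have c: "c \<in> Obj E" and S: "\<And>u. u \<in> S \<Longrightarrow> u \<in> Arr E" "\<And>u. u \<in> S \<Longrightarrow> Cod E u = c"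
    by (auto simp: epimorphic_family_def)
  show "epimorphic_family F (FObj ?L c) (FArr ?L ` S)"
    unfolding epimorphic_family_def
  proof (intro conjI allI impI; (elim conjE)?)
    fix d h k assume h: "h \<in> hom F (FObj ?L c) d" and k: "k \<in> hom F (FObj ?L c) d"
      and eq: "\<forall>f\<in>FArr ?L ` S. Comp F h f = Comp F k f"
    define T where "T l = Comp E (FArr ?R l) (unit g c)" for l
    have T: "T l \<in> hom E c (FObj ?R d)" if "l \<in> hom F (FObj ?L c) d" for l
      using that c n[of c] by (auto simp: T_def hom_iff)
    have Tu: "Comp E (T l) u = Comp E (FArr ?R (Comp F l (FArr ?L u))) (unit g (Dom E u))"
      if l: "l \<in> hom F (FObj ?L c) d" and u: "u \<in> S" for l u
      using l c n[of c] n[of "Dom E u"] S[OF u] nn[of u] by (simp add: T_def hom_iff dir.FArr_Comp_arr inv.C.assoc)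
    have untr: "Comp F (counit g d) (FArr ?L (T l)) = l" if l: "l \<in> hom F (FObj ?L c) d" for l
    proof -
      have d: "d \<in> Obj F" using l by (auto simp: hom_iff)
      have "Comp F (counit g d) (FArr ?L (T l)) = Comp F (Comp F (counit g d) (FArr ?L (FArr ?R l))) (FArr ?L (unit g c))"
        using l c d n[of c] e[of d] by (simp add: T_def hom_iff inv.FArr_Comp_arr inv.D.assoc)
      also have "\<dots> = Comp F l (Comp F (counit g (FObj ?L c)) (FArr ?L (unit g c)))"
        using l c d n[of c] e[of "FObj ?L c"] en[of l] by (simp add: hom_iff inv.D.assoc)
      also have "\<dots> = l" using l c by (simp add: g(8) hom_iff)
      finally show ?thesis .
    qed
    have "T h = T k"
    proof (rule epimorphic_cancel[of E c id S])
      show "Comp E (T h) (id u) = Comp E (T k) (id u)" if "u \<in> S" for u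
        using Tu[OF h that] Tu[OF k that] eq that by simp
    qed (use epi T h k in auto)
    then show "h = k" using untr[OF h] untr[OF k] by metis
  qed (use c S in auto)
qed

section \<open>Comma categories as fibrations\<close>

lemma ex1_obtain: "\<exists>!x. P x \<Longrightarrow> (\<And>x. P x \<Longrightarrow> (\<And>y. P y \<Longrightarrow> y = x) \<Longrightarrow> thesis) \<Longrightarrow> thesis"
  by blast

lemma comma_fctr_simps [simp]: "FObj comma_left x = fst x" "FArr comma_left a = fst (snd (snd a))"
  "FObj comma_right x = fst (snd x)" "FArr comma_right a = snd (snd (snd a))"
  by (simp_all add: comma_left_def comma_right_def split_def)

lemma comma_cat_simps [simp]: "Dom (comma_cat F E G) a = fst a" "Cod (comma_cat F E G) a = fst (snd a)"
  "Id (comma_cat F E G) x = (x, x, (Id F (fst x), Id E (fst (snd x))))"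
  "Comp (comma_cat F E G) b a = (fst a, fst (snd b),
     (Comp F (fst (snd (snd b))) (fst (snd (snd a))), Comp E (snd (snd (snd b))) (snd (snd (snd a)))))"
  by (simp_all add: comma_cat_def split_def)

lemma Obj_comma: "x \<in> Obj (comma_cat F E G) \<longleftrightarrow>
  fst x \<in> Obj F \<and> fst (snd x) \<in> Obj E \<and> snd (snd x) \<in> hom F (fst x) (FObj G (fst (snd x)))"
  by (auto simp: comma_cat_def comma_objs_def)

lemma Arr_comma: "a \<in> Arr (comma_cat F E G) \<longleftrightarrow>
  fst a \<in> Obj (comma_cat F E G) \<and> fst (snd a) \<in> Obj (comma_cat F E G) \<and>
  fst (snd (snd a)) \<in> hom F (fst (fst a)) (fst (fst (snd a))) \<and>
  snd (snd (snd a)) \<in> hom E (fst (snd (fst a))) (fst (snd (fst (snd a)))) \<and>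
  Comp F (snd (snd (fst (snd a)))) (fst (snd (snd a))) = Comp F (FArr G (snd (snd (snd a)))) (snd (snd (fst a)))"
  by (auto simp: comma_cat_def)

lemma hom_comma: "a \<in> hom (comma_cat F E G) x y \<longleftrightarrow>
  x \<in> Obj (comma_cat F E G) \<and> y \<in> Obj (comma_cat F E G) \<and> fst a = x \<and> fst (snd a) = y \<and>
  fst (snd (snd a)) \<in> hom F (fst x) (fst y) \<and> snd (snd (snd a)) \<in> hom E (fst (snd x)) (fst (snd y)) \<and>
  Comp F (snd (snd y)) (fst (snd (snd a))) = Comp F (FArr G (snd (snd (snd a)))) (snd (snd x))"
  by (auto simp: hom_iff Arr_comma)

lemma comma_arr_eqI:
  "fst a = fst b \<Longrightarrow> fst (snd a) = fst (snd b) \<Longrightarrow> fst (snd (snd a)) = fst (snd (snd b)) \<Longrightarrow>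
   snd (snd (snd a)) = snd (snd (snd b)) \<Longrightarrow> a = b"
  by (simp add: prod_eq_iff)

locale comma = cat_functor E F G for E :: "('oe, 'ae) cat" and F :: "('of, 'af) cat" and G
begin

lemmas hE = hom_iff[where C = E] and hF = hom_iff[where C = F]

abbreviation X where "X \<equiv> comma_cat F E G"

lemma category_comma: "category X"
proof
  fix f g x y z assume f: "f \<in> hom X x y" and g: "g \<in> hom X y z"
  let ?u = "fst (snd (snd f))" and ?v = "snd (snd (snd f))" and ?u' = "fst (snd (snd g))" and ?v' = "snd (snd (snd g))"
  note fD = f[unfolded hom_comma Obj_comma hE hF] and gD = g[unfolded hom_comma Obj_comma hE hF]
  have "Comp F (snd (snd z)) (Comp F ?u' ?u) = Comp F (Comp F (FArr G ?v') (snd (snd y))) ?u"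
    using fD gD by (simp flip: D.assoc)
  also have "\<dots> = Comp F (FArr G ?v') (Comp F (FArr G ?v) (snd (snd x)))"
    using fD gD by (simp add: D.assoc)
  also have "\<dots> = Comp F (FArr G (Comp E ?v' ?v)) (snd (snd x))"
    using fD gD by (simp add: FArr_Comp_arr D.assoc)
  finally show "Comp X g f \<in> hom X x z"
    using fD gD by (simp add: hom_comma Obj_comma hE hF)
qed (auto simp: Arr_comma Obj_comma hom_comma hE hF C.assoc D.assoc prod_eq_iff)

sublocale X: category X by (rule category_comma)

lemma cat_functor_right: "cat_functor X E comma_right"
  by (intro cat_functor.intro category_comma C.category_axioms cat_functor_axioms.intro)
    (auto simp: Obj_comma hom_comma hE hF)

text \<open>Reindexing along v is pullback along \<open>FArr G v\<close>. The universal property of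
  the pullback is that of a cartesian arrow tested at the identity of the base; conversely, a
  factorisation over \<open>e\<close> is obtained from the pullback by composing the structure arrow
  with \<open>FArr G e\<close>.\<close>

lemma cartesian_comma_iff:
  "cartesian_arr X E comma_right a \<longleftrightarrow> a \<in> Arr X \<and>
     pullback F (FArr G (snd (snd (snd a)))) (snd (snd (fst (snd a)))) (snd (snd (fst a))) (fst (snd (snd a)))"
  (is "?l \<longleftrightarrow> _ \<and> ?r")
proof (intro iffI conjI)
  assume l: ?l
  then show aA: "a \<in> Arr X" by (simp add: cartesian_arr_def)
  note aD = aA[unfolded Arr_comma Obj_comma hE hF]
  show ?r unfolding pullback_def
  proof (intro conjI allI impI; (elim conjE)?)
    fix p q assume pq: "p \<in> Arr F" "q \<in> Arr F" "Dom F p = Dom F q" "Cod F p = Dom F (FArr G (snd (snd (snd a))))"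
      "Cod F q = Dom F (snd (snd (fst (snd a))))" "Comp F (FArr G (snd (snd (snd a)))) p = Comp F (snd (snd (fst (snd a)))) q"
    \<comment> \<open>A pair to be factored through the square is the same as an object in the fibre
      of the domain of \<open>a\<close> together with an arrow from it to the codomain of
      \<open>a\<close>.\<close>
    define z where "z = (Dom F p, fst (snd (fst a)), p)"
    define b where "b = (z, fst (snd a), (q, snd (snd (snd a))))"
    have zO: "z \<in> Obj X" using pq aD by (simp add: z_def Obj_comma hE hF)
    have b: "b \<in> hom X z (fst (snd a))"
      using pq aD zO aA by (auto simp: b_def z_def hom_comma hE hF Arr_comma)
    have "\<exists>!c. c \<in> hom X (Dom X b) (Dom X a) \<and> Comp X a c = b \<and> FArr comma_right c = Id E (fst (snd (fst a)))"
      by (rule l[unfolded cartesian_arr_def, THEN conjunct2, rule_format])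
        (use b aA in \<open>auto simp: hom_comma Arr_comma hE hF b_def z_def Obj_comma\<close>)
    then have "\<exists>!c. c \<in> hom X z (fst a) \<and> Comp X a c = b \<and> snd (snd (snd c)) = Id E (fst (snd (fst a)))"
      by (simp add: b_def)
    then obtain c where c: "c \<in> hom X z (fst a)" "Comp X a c = b" "snd (snd (snd c)) = Id E (fst (snd (fst a)))"
      and uniq: "\<And>c'. c' \<in> hom X z (fst a) \<Longrightarrow> Comp X a c' = b \<Longrightarrow> snd (snd (snd c')) = Id E (fst (snd (fst a))) \<Longrightarrow> c' = c"
      by (rule ex1_obtain) blast
    show "\<exists>!h. h \<in> hom F (Dom F p) (Dom F (snd (snd (fst a)))) \<and> Comp F (snd (snd (fst a))) h = p \<and>
      Comp F (fst (snd (snd a))) h = q"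
    proof (rule ex1I[of _ "fst (snd (snd c))"])
      show "fst (snd (snd c)) \<in> hom F (Dom F p) (Dom F (snd (snd (fst a)))) \<and> Comp F (snd (snd (fst a))) (fst (snd (snd c))) = p \<and>
        Comp F (fst (snd (snd a))) (fst (snd (snd c))) = q"
        using c aD pq by (auto simp: hom_comma z_def hE hF b_def)
      fix h assume h: "h \<in> hom F (Dom F p) (Dom F (snd (snd (fst a)))) \<and> Comp F (snd (snd (fst a))) h = p \<and>
        Comp F (fst (snd (snd a))) h = q"
      have "(z, fst a, (h, Id E (fst (snd (fst a))))) = c"
        using h aD pq zO by (intro uniq) (auto simp: hom_comma hE hF z_def b_def Obj_comma)
      then show "h = fst (snd (snd c))" by auto
    qed
  qed (use aD in auto)
next
  assume r: "a \<in> Arr X \<and> ?r"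
  then have aA: "a \<in> Arr X" and pb: ?r by auto
  note aD = aA[unfolded Arr_comma Obj_comma hE hF]
  show ?l unfolding cartesian_arr_def
  proof (intro conjI aA allI impI; elim conjE)
    fix b e assume bA: "b \<in> Arr X" and cod: "Cod X b = Cod X a"
      and e: "e \<in> hom E (FObj comma_right (Dom X b)) (FObj comma_right (Dom X a))"
      and eq: "Comp E (FArr comma_right a) e = FArr comma_right b"
    note bD = bA[unfolded Arr_comma Obj_comma hE hF]
    let ?p = "Comp F (FArr G e) (snd (snd (fst b)))"
    have p: "?p \<in> Arr F" "Dom F ?p = fst (fst b)" "Cod F ?p = FObj G (fst (snd (fst a)))"
      using bD e by (auto simp: hE hF)
    have "Comp F (FArr G (snd (snd (snd a)))) ?p = Comp F (FArr G (Comp E (snd (snd (snd a))) e)) (snd (snd (fst b)))"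
      using aD bD e by (simp add: FArr_Comp_arr D.assoc hE hF)
    also have "\<dots> = Comp F (snd (snd (fst (snd a)))) (fst (snd (snd b)))"
      using eq bD cod by simp
    finally have "\<exists>!h. h \<in> hom F (Dom F ?p) (Dom F (snd (snd (fst a)))) \<and> Comp F (snd (snd (fst a))) h = ?p \<and>
        Comp F (fst (snd (snd a))) h = fst (snd (snd b))"
      using p bD aD cod by (intro pullback_ex1[OF pb]) auto
    then have "\<exists>!h. h \<in> hom F (fst (fst b)) (fst (fst a)) \<and> Comp F (snd (snd (fst a))) h = ?p \<and>
        Comp F (fst (snd (snd a))) h = fst (snd (snd b))"
      using p aD by simp
    then obtain h where h: "h \<in> hom F (fst (fst b)) (fst (fst a))" "Comp F (snd (snd (fst a))) h = ?p"
        "Comp F (fst (snd (snd a))) h = fst (snd (snd b))"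
      and uniq: "\<And>h'. h' \<in> hom F (fst (fst b)) (fst (fst a)) \<Longrightarrow> Comp F (snd (snd (fst a))) h' = ?p \<Longrightarrow>
        Comp F (fst (snd (snd a))) h' = fst (snd (snd b)) \<Longrightarrow> h' = h"
      by (rule ex1_obtain) blast
    show "\<exists>!c. c \<in> hom X (Dom X b) (Dom X a) \<and> Comp X a c = b \<and> FArr comma_right c = e"
    proof (rule ex1I[of _ "(fst b, fst a, (h, e))"])
      show "(fst b, fst a, (h, e)) \<in> hom X (Dom X b) (Dom X a) \<and> Comp X a (fst b, fst a, (h, e)) = b \<and>
        FArr comma_right (fst b, fst a, (h, e)) = e"
        using h e eq cod aA bA by (auto simp: hom_comma Arr_comma prod_eq_iff)
      fix c assume c: "c \<in> hom X (Dom X b) (Dom X a) \<and> Comp X a c = b \<and> FArr comma_right c = e"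
      then have "fst (snd (snd c)) = h" by (intro uniq) (auto simp: hom_comma)
      then show "c = (fst b, fst a, (h, e))" using c by (auto simp: hom_comma prod_eq_iff)
    qed
  qed
qed

end

section \<open>Fibres and essential fibres\<close>

lemma category_fibre:
  assumes "cat_functor X E p" "e \<in> Obj E"
  shows "category (fibre X E p e)"
proof -
  interpret p: cat_functor X E p by fact
  show ?thesis
    by unfold_locales (use assms(2) in \<open>auto simp: fibre_def hom_iff p.FArr_Comp_arr p.C.assoc\<close>)
qed

lemma hom_fibre: "u \<in> hom (fibre X E p e) x y \<longleftrightarrow> u \<in> hom X x y \<and> FObj p x = e \<and> FObj p y = e \<and> FArr p u = Id E e"
  by (auto simp: fibre_def hom_iff)

lemma fibre_simps [simp]: "Dom (fibre X E p e) = Dom X" "Cod (fibre X E p e) = Cod X" "Id (fibre X E p e) = Id X"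
  "Comp (fibre X E p e) = Comp X"
  by (simp_all add: fibre_def)

lemma Obj_fibre: "x \<in> Obj (fibre X E p e) \<longleftrightarrow> x \<in> Obj X \<and> FObj p x = e"
  by (auto simp: fibre_def)

lemma Arr_fibre: "u \<in> Arr (fibre X E p e) \<longleftrightarrow> u \<in> Arr X \<and> FObj p (Dom X u) = e \<and> FObj p (Cod X u) = e \<and> FArr p u = Id E e"
  by (auto simp: fibre_def)

lemma ess_fibre_simps [simp]: "Dom (ess_fibre X E p e) a = fst a" "Cod (ess_fibre X E p e) a = fst (snd a)"
  "Id (ess_fibre X E p e) x = (x, x, Id X (fst x))"
  "Comp (ess_fibre X E p e) b a = (fst a, fst (snd b), Comp X (snd (snd b)) (snd (snd a)))"
  by (simp_all add: ess_fibre_def split_def)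

lemma Obj_ess_fibre: "x \<in> Obj (ess_fibre X E p e) \<longleftrightarrow>
    fst x \<in> Obj X \<and> snd x \<in> hom E (FObj p (fst x)) e \<and> iso_arr E (snd x)"
  by (auto simp: ess_fibre_def)

lemma hom_ess_fibre: "a \<in> hom (ess_fibre X E p e) x y \<longleftrightarrow>
    x \<in> Obj (ess_fibre X E p e) \<and> y \<in> Obj (ess_fibre X E p e) \<and> fst a = x \<and> fst (snd a) = y \<and>
    snd (snd a) \<in> hom X (fst x) (fst y) \<and> Comp E (snd y) (FArr p (snd (snd a))) = snd x"
  by (auto simp: ess_fibre_def hom_iff split_def)

lemma Arr_ess_fibre: "a \<in> Arr (ess_fibre X E p e) \<longleftrightarrow> a \<in> hom (ess_fibre X E p e) (fst a) (fst (snd a))"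
  by (auto simp: hom_iff)

lemma category_ess_fibre:
  assumes "cat_functor X E p"
  shows "category (ess_fibre X E p e)"
proof -
  interpret p: cat_functor X E p by fact
  show ?thesis
  proof
    fix f g x y z assume f: "f \<in> hom (ess_fibre X E p e) x y" and g: "g \<in> hom (ess_fibre X E p e) y z"
    then show "Comp (ess_fibre X E p e) g f \<in> hom (ess_fibre X E p e) x z"
      by (auto simp: hom_ess_fibre Obj_ess_fibre hom_iff[of _ X] hom_iff[of _ E] p.FArr_Comp_arr simp flip: p.D.assoc)
  qed (auto simp: Arr_ess_fibre hom_ess_fibre Obj_ess_fibre hom_iff[of _ X] hom_iff[of _ E] p.C.assoc prod_eq_iff)
qed

lemma fibre_fctr_simps [simp]: "FObj (fibre_fctr Y A \<theta>) y = (FObj A y, \<theta> y)"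
  "FArr (fibre_fctr Y A \<theta>) u = ((FObj A (Dom Y u), \<theta> (Dom Y u)), (FObj A (Cod Y u), \<theta> (Cod Y u)), FArr A u)"
  by (simp_all add: fibre_fctr_def)

lemma cat_functor_fibre_fctr:
  assumes A: "cat_functor Y X A" and q: "cat_functor Y E q" and p: "cat_functor X E p"
    and \<theta>: "nat_iso Y E (p \<circ>\<^sub>F A) q \<theta>" and e: "e \<in> Obj E"
  shows "cat_functor (fibre Y E q e) (ess_fibre X E p e) (fibre_fctr Y A \<theta>)"
proof -
  interpret A: cat_functor Y X A by fact
  interpret q: cat_functor Y E q by fact
  interpret p: cat_functor X E p by fact
  note t = nat_transD(3-5)[OF nat_isoD(1)[OF \<theta>]] and i = nat_isoD(2)[OF \<theta>] and n = nat_transD(6)[OF nat_isoD(1)[OF \<theta>]]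
  show ?thesis
  proof (intro cat_functor.intro category_fibre[OF q e] category_ess_fibre[OF p] cat_functor_axioms.intro)
    fix f x y assume "f \<in> hom (fibre Y E q e) x y"
    then show "FArr (fibre_fctr Y A \<theta>) f \<in> hom (ess_fibre X E p e) (FObj (fibre_fctr Y A \<theta>) x) (FObj (fibre_fctr Y A \<theta>) y)"
      using t i n[of f] by (auto simp: hom_fibre hom_ess_fibre Obj_ess_fibre hom_iff[of _ X] hom_iff[of _ Y] hom_iff[of _ E])
  qed (use t i in \<open>auto simp: Obj_fibre Obj_ess_fibre hom_fibre hom_iff[of _ X] hom_iff[of _ Y] hom_iff[of _ E] A.FArr_Comp_arr\<close>)
qed

section \<open>Morphisms of fibrations induced by inverse images\<close>

text \<open>The shape \<open>I\<close> with a terminal object 0 adjoined: the arrow \<open>a\<close> of \<open>I\<close> is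
  encoded by \<open>2 a + 1\<close> and the arrow from \<open>i\<close> to 0 by \<open>2 i + 2\<close>.  A diagram in a slice is a
  diagram of this shape.\<close>

definition with_terminal :: "(nat, nat) cat \<Rightarrow> (nat, nat) cat" where
  "with_terminal I = \<lparr>Obj = insert 0 (Suc ` Obj I),
     Arr = insert 0 ((\<lambda>a. 2 * a + 1) ` Arr I \<union> (\<lambda>i. 2 * i + 2) ` Obj I),
     Dom = (\<lambda>a. if odd a then Suc (Dom I (a div 2)) else a div 2),
     Cod = (\<lambda>a. if odd a then Suc (Cod I (a div 2)) else 0),
     Id = (\<lambda>i. if i = 0 then 0 else 2 * Id I (i - 1) + 1),
     Comp = (\<lambda>b a. if b = 0 then a else if odd b then 2 * Comp I (b div 2) (a div 2) + 1
       else 2 * Dom I (a div 2) + 2)\<rparr>"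

lemma category_with_terminal:
  assumes "category I"
  shows "category (with_terminal I)"
proof -
  interpret category I by fact
  show ?thesis
    by unfold_locales (auto simp: with_terminal_def hom_iff assoc)
qed

text \<open>Decoding of arrows: \<open>a div 2\<close> recovers an arrow of \<open>I\<close> from an
  odd number, and \<open>a div 2 - 1\<close> recovers from 2 i + 2 the object i whose arrow to the
  terminal node goes to \<open>l i\<close>.\<close>

definition with_terminal_fctr :: "('o, 'a) cat \<Rightarrow> (nat, nat, 'o, 'a) fctr \<Rightarrow> 'o \<Rightarrow> (nat \<Rightarrow> 'a) \<Rightarrow> (nat, nat, 'o, 'a) fctr"
  where "with_terminal_fctr C K t l = \<lparr>FObj = (\<lambda>i. if i = 0 then t else FObj K (i - 1)),
     FArr = (\<lambda>a. if a = 0 then Id C t else if odd a then FArr K (a div 2) else l (a div 2 - 1))\<rparr>"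

lemma cat_functor_with_terminal:
  assumes "cat_functor I C K" "t \<in> Obj C" "\<And>i. i \<in> Obj I \<Longrightarrow> l i \<in> hom C (FObj K i) t"
    "\<And>a. a \<in> Arr I \<Longrightarrow> Comp C (l (Cod I a)) (FArr K a) = l (Dom I a)"
  shows "cat_functor (with_terminal I) C (with_terminal_fctr C K t l)"
proof -
  interpret K: cat_functor I C K by fact
  have l: "l i \<in> Arr C" "Dom C (l i) = FObj K i" "Cod C (l i) = t" if "i \<in> Obj I" for i
    using assms(3)[OF that] by (auto simp: hom_iff)
  show ?thesis
    by (intro cat_functor.intro category_with_terminal K.C.category_axioms K.D.category_axioms cat_functor_axioms.intro)
      (use assms(2,4) l in \<open>auto simp: with_terminal_def with_terminal_fctr_def hom_iff K.FArr_Comp_arr\<close>)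
qed

lemma cone_with_terminal_iff:
  assumes "cat_functor I C K" "t \<in> Obj C" "\<And>i. i \<in> Obj I \<Longrightarrow> l i \<in> hom C (FObj K i) t"
    "\<And>a. a \<in> Arr I \<Longrightarrow> Comp C (l (Cod I a)) (FArr K a) = l (Dom I a)"
  shows "cone (with_terminal I) C (with_terminal_fctr C K t l) w \<rho> \<longleftrightarrow>
    cone I C K w (\<lambda>i. \<rho> (Suc i)) \<and> \<rho> 0 \<in> hom C w t \<and> (\<forall>i \<in> Obj I. Comp C (l i) (\<rho> (Suc i)) = \<rho> 0)"
proof -
  interpret K: cat_functor I C K by fact
  show ?thesis
  proof -
    have "cat_functor (with_terminal I) C (with_terminal_fctr C K t l)"
      by (rule cat_functor_with_terminal) (use assms in auto)
    then show ?thesis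
      unfolding cone_iff using assms(1,2)
      by (simp add: with_terminal_def with_terminal_fctr_def ball_Un) (auto simp: hom_iff)
  qed
qed

lemma with_terminal_fctr_comp:
  assumes "cat_functor C D H" "t \<in> Obj C"
  shows "H \<circ>\<^sub>F with_terminal_fctr C K t l = with_terminal_fctr D (H \<circ>\<^sub>F K) (FObj H t) (\<lambda>i. FArr H (l i))"
proof -
  interpret H: cat_functor C D H by fact
  show ?thesis using assms(2) by (auto simp: comp_fctr_def with_terminal_fctr_def fun_eq_iff)
qed

text \<open>Serves to absorb the isomorphism \<phi> that enters the structure arrows of induced
  objects.\<close>

lemma pullback_iso_cospan:
  assumes "category C" and pb: "pullback C f g p q" and i: "iso_arr C i" and j: "iso_arr C j"
    and "Dom C i = Dom C f" "Dom C j = Cod C f" "f' \<in> Arr C" "Dom C f' = Cod C i" "Cod C f' = Cod C j"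
    and eq: "Comp C f' i = Comp C j f"
  shows "pullback C f' (Comp C j g) (Comp C i p) q"
proof -
  interpret category C by fact
  note d = pullbackD[OF pb]
  note ii = inverse_arr[OF i] and jj = inverse_arr[OF j]
  show ?thesis
    unfolding pullback_def
  proof (intro conjI allI impI; (elim conjE)?)
    have "Comp C f' (Comp C i p) = Comp C (Comp C j f) p"
      unfolding eq[symmetric] using assms(5-9) d ii(1) by (simp add: assoc)
    then show "Comp C f' (Comp C i p) = Comp C (Comp C j g) q"
      using d assms(5-9) jj(1) by (simp add: assoc)
  next
    fix a b assume ab: "a \<in> Arr C" "b \<in> Arr C" "Dom C a = Dom C b" "Cod C a = Dom C f'" "Cod C b = Dom C (Comp C j g)"
      "Comp C f' a = Comp C (Comp C j g) b"
    let ?a = "Comp C (inverse_arr C i) a"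
    have "Comp C j (Comp C f ?a) = Comp C (Comp C f' i) ?a"
      unfolding eq using ab ii jj d assms(5-9) by (simp add: assoc)
    also have "\<dots> = Comp C f' a" using ab ii assms(5-9) i by (simp add: assoc Comp_inverse_cancel)
    also have "\<dots> = Comp C j (Comp C g b)" using ab d jj assms(5-9) by (simp add: assoc)
    finally have "Comp C f ?a = Comp C g b"
      using ab ii jj d assms(5-9) by - (rule iso_cancel_left[OF j], auto)
    then have ex: "\<exists>!h. h \<in> hom C (Dom C ?a) (Dom C p) \<and> Comp C p h = ?a \<and> Comp C q h = b"
      using ab ii jj d assms(5-9) by (intro pullback_ex1[OF pb]) auto
    have "Comp C (Comp C i p) h = a \<longleftrightarrow> Comp C p h = ?a" if "h \<in> hom C (Dom C a) (Dom C p)" for h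
      using that ab ii d i assms(5-9) Comp_inverse_cancel(1)[OF i, of "Comp C p h"] Comp_inverse_cancel(2)[OF i, of a]
      by (auto simp: hom_iff assoc)
    then show "\<exists>!h. h \<in> hom C (Dom C a) (Dom C (Comp C i p)) \<and> Comp C (Comp C i p) h = a \<and> Comp C q h = b"
      using ex ab ii d i assms(5-9) by (simp cong: conj_cong)
  qed (use d ii jj assms in auto)
qed

definition induced :: "('og, 'ag) cat \<Rightarrow> ('of, 'af) cat \<Rightarrow> ('og, 'ag, 'of, 'af) fctr \<Rightarrow> ('oe \<Rightarrow> 'af) \<Rightarrow>
    (('og, 'ag, 'oe) comma_obj, ('og, 'ag, 'oe, 'ae) comma_arr,
     ('of, 'af, 'oe) comma_obj, ('of, 'af, 'oe, 'ae) comma_arr) fctr" where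
  "induced F' F H \<phi> = (let ob = (\<lambda>x. (FObj H (fst x), fst (snd x), Comp F (\<phi> (fst (snd x))) (FArr H (snd (snd x))))) in
     \<lparr>FObj = ob, FArr = (\<lambda>a. (ob (fst a), ob (fst (snd a)), (FArr H (fst (snd (snd a))), snd (snd (snd a)))))\<rparr>)"

lemma induced_simps [simp]:
  "FObj (induced F' F H \<phi>) x = (FObj H (fst x), fst (snd x), Comp F (\<phi> (fst (snd x))) (FArr H (snd (snd x))))"
  "FArr (induced F' F H \<phi>) a =
    ((FObj H (fst (fst a)), fst (snd (fst a)), Comp F (\<phi> (fst (snd (fst a)))) (FArr H (snd (snd (fst a))))),
     (FObj H (fst (fst (snd a))), fst (snd (fst (snd a))),
       Comp F (\<phi> (fst (snd (fst (snd a))))) (FArr H (snd (snd (fst (snd a)))))),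
     (FArr H (fst (snd (snd a))), snd (snd (snd a))))"
  by (simp_all add: induced_def Let_def)

locale two_commas = Y: comma E F' G' + X: comma E F G
  for E :: "('oe, 'ae) cat" and F' :: "('og, 'ag) cat" and G' and F :: "('of, 'af) cat" and G
begin

lemmas hE = hom_iff[where C = E] and hF = hom_iff[where C = F] and hF' = hom_iff[where C = F']

lemma cat_functor_induced:
  assumes H: "cat_functor F' F H" and \<phi>: "nat_trans E F (H \<circ>\<^sub>F G') G \<phi>"
  shows "cat_functor Y.X X.X (induced F' F H \<phi>)"
proof -
  interpret H: cat_functor F' F H by fact
  note p = nat_transD(3-5)[OF \<phi>] and n = nat_transD(6)[OF \<phi>]
  have ob: "FObj (induced F' F H \<phi>) x \<in> Obj X.X" if "x \<in> Obj Y.X" for x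
    using that p by (auto simp: Obj_comma hF hF')
  show ?thesis
  proof (intro cat_functor.intro Y.category_comma X.category_comma cat_functor_axioms.intro ob)
    fix f x y assume f: "f \<in> hom Y.X x y"
    note fD = f[unfolded hom_comma Obj_comma hE hF']
    let ?u = "fst (snd (snd f))" and ?v = "snd (snd (snd f))"
    have "Comp F (\<phi> (fst (snd y))) (Comp F (FArr H (snd (snd y))) (FArr H ?u)) =
      Comp F (\<phi> (fst (snd y))) (FArr H (Comp F' (snd (snd y)) ?u))"
    proof -
      have "FArr H (Comp F' (snd (snd y)) ?u) = Comp F (FArr H (snd (snd y))) (FArr H ?u)"
        by (rule H.FArr_Comp_arr) (use fD in auto)
      then show ?thesis by simp
    qed
    also have "\<dots> = Comp F (Comp F (\<phi> (fst (snd y))) (FArr H (FArr G' ?v))) (FArr H (snd (snd x)))"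
      using fD p by (simp add: H.FArr_Comp_arr X.D.assoc)
    also have "\<dots> = Comp F (FArr G ?v) (Comp F (\<phi> (fst (snd x))) (FArr H (snd (snd x))))"
      using fD p n[of ?v] by (simp add: X.D.assoc)
    finally show "FArr (induced F' F H \<phi>) f \<in> hom X.X (FObj (induced F' F H \<phi>) x) (FObj (induced F' F H \<phi>) y)"
      unfolding hom_comma using ob f fD p by (simp add: hE hF X.D.assoc hom_comma)
  qed (auto simp: Obj_comma hom_comma hE hF hF' H.FArr_Comp_arr)
qed

text \<open>\<open>H\<close> preserves the pullback square that characterises \<open>a\<close>, and
  composing its structure arrows with the invertible components of \<phi> keeps it a
  pullback.\<close>

lemma induced_cartesian:
  assumes H: "cat_functor F' F H" and \<phi>: "nat_iso E F (H \<circ>\<^sub>F G') G \<phi>" and pb: "preserves_pullbacks F' F H"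
    and a: "cartesian_arr Y.X E comma_right a"
  shows "cartesian_arr X.X E comma_right (FArr (induced F' F H \<phi>) a)"
proof -
  interpret H: cat_functor F' F H by fact
  note p = nat_transD(3-5)[OF nat_isoD(1)[OF \<phi>]] and n = nat_transD(6)[OF nat_isoD(1)[OF \<phi>]] and i = nat_isoD(2)[OF \<phi>]
  interpret A: cat_functor Y.X X.X "induced F' F H \<phi>" by (rule cat_functor_induced[OF H nat_isoD(1)[OF \<phi>]])
  have aA: "a \<in> Arr Y.X" and pba: "pullback F' (FArr G' (snd (snd (snd a)))) (snd (snd (fst (snd a)))) (snd (snd (fst a))) (fst (snd (snd a)))"
    using a by (auto simp: Y.cartesian_comma_iff)
  note aD = aA[unfolded Arr_comma Obj_comma hE hF']
  have "pullback F (FArr H (FArr G' (snd (snd (snd a))))) (FArr H (snd (snd (fst (snd a)))))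
     (FArr H (snd (snd (fst a)))) (FArr H (fst (snd (snd a))))"
    using pb pba by (simp add: preserves_pullbacks_def)
  from pullback_iso_cospan[OF X.D.category_axioms this, of "\<phi> (fst (snd (fst a)))" "\<phi> (fst (snd (fst (snd a))))" "FArr G (snd (snd (snd a)))"]
  show ?thesis
    unfolding X.cartesian_comma_iff using A.FArr_arr(1)[OF aA] aD p i n[of "snd (snd (snd a))"] by simp
qed

text \<open>A limit in the slice over \<open>FObj G' e\<close> is a limit in \<open>F'\<close> of
  the diagram with this object adjoined as a terminal node, and such limits are preserved by
  \<open>H\<close>. A cone in the essential fibre may have its vertex over some d isomorphic to
  \<open>e\<close>; its structure arrow is moved along this isomorphism and the inverse of
  \<phi>.\<close>

lemma induced_preserves_fibre_limits:
  assumes H: "cat_functor F' F H" and \<phi>: "nat_iso E F (H \<circ>\<^sub>F G') G \<phi>" and lex: "preserves_finite_limits F' F H"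
    and e: "e \<in> Obj E"
  shows "preserves_finite_limits (fibre Y.X E comma_right e) (ess_fibre X.X E comma_right e)
    (fibre_fctr Y.X (induced F' F H \<phi>) (\<lambda>y\<in>Obj Y.X. Id E (fst (snd y))))"
    (is "preserves_finite_limits ?YF ?XF ?A")
  unfolding preserves_finite_limits_def
proof (intro allI impI; elim conjE)
  interpret H: cat_functor F' F H by fact
  note p = nat_transD(3-5)[OF nat_isoD(1)[OF \<phi>]] and n = nat_transD(6)[OF nat_isoD(1)[OF \<phi>]] and i = nat_isoD(2)[OF \<phi>]
  interpret A: cat_functor Y.X X.X "induced F' F H \<phi>" by (rule cat_functor_induced[OF H nat_isoD(1)[OF \<phi>]])
  let ?\<theta> = "\<lambda>y\<in>Obj Y.X. Id E (fst (snd y))"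
  have \<theta>: "nat_iso Y.X E (comma_right \<circ>\<^sub>F induced F' F H \<phi>) comma_right ?\<theta>"
    by (intro nat_isoI nat_transI cat_functor_comp[OF A.cat_functor_axioms X.cat_functor_right] Y.cat_functor_right)
      (auto simp: Obj_comma hE Arr_comma Y.C.iso_Id)
  note Afun = cat_functor_fibre_fctr[OF A.cat_functor_axioms Y.cat_functor_right X.cat_functor_right \<theta> e]
  fix I :: "(nat, nat) cat" and K v \<pi>
  assume fin: "finite (Obj I)" "finite (Arr I)" and L: "limit_cone I ?YF K v \<pi>"
  have K: "cat_functor I ?YF K" using L by (simp add: limit_cone_iff cone_iff)
  interpret K: cat_functor I ?YF K by fact
  have KO: "FObj K j \<in> Obj Y.X" "fst (snd (FObj K j)) = e" if "j \<in> Obj I" for j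
    using K.FObj_in[OF that] by (auto simp: Obj_fibre)
  have KO': "fst (FObj K j) \<in> Obj F'" "snd (snd (FObj K j)) \<in> Arr F'" "Dom F' (snd (snd (FObj K j))) = fst (FObj K j)"
    "Cod F' (snd (snd (FObj K j))) = FObj G' e" if "j \<in> Obj I" for j
    using KO[OF that] by (auto simp: Obj_comma hF')
  have KA: "FArr K a \<in> hom Y.X (FObj K (Dom I a)) (FObj K (Cod I a))" "snd (snd (snd (FArr K a))) = Id E e" if "a \<in> Arr I" for a
    using K.FArr_in_hom[of a "Dom I a" "Cod I a"] that by (auto simp: hom_fibre hom_iff[of _ I])
  have KA': "fst (snd (snd (FArr K a))) \<in> Arr F'" "Dom F' (fst (snd (snd (FArr K a)))) = fst (FObj K (Dom I a))"
    "Cod F' (fst (snd (snd (FArr K a)))) = fst (FObj K (Cod I a))"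
    "Comp F' (snd (snd (FObj K (Cod I a)))) (fst (snd (snd (FArr K a)))) = snd (snd (FObj K (Dom I a)))" if "a \<in> Arr I" for a
    using KA[OF that] KO'[of "Dom I a"] that e by (auto simp: hom_comma hF')
  have v: "v \<in> Obj Y.X" "fst (snd v) = e"
    and \<pi>: "\<And>j. j \<in> Obj I \<Longrightarrow> \<pi> j \<in> hom Y.X v (FObj K j)" "\<And>j. j \<in> Obj I \<Longrightarrow> snd (snd (snd (\<pi> j))) = Id E e"
    using L by (auto simp: limit_cone_iff cone_iff Obj_fibre hom_fibre)
  have v': "fst v \<in> Obj F'" "snd (snd v) \<in> Arr F'" "Dom F' (snd (snd v)) = fst v" "Cod F' (snd (snd v)) = FObj G' e"
    using v by (auto simp: Obj_comma hF')
  have \<pi>': "fst (snd (snd (\<pi> j))) \<in> Arr F'" "Dom F' (fst (snd (snd (\<pi> j)))) = fst v"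
    "Cod F' (fst (snd (snd (\<pi> j)))) = fst (FObj K j)" "Comp F' (snd (snd (FObj K j))) (fst (snd (snd (\<pi> j)))) = snd (snd v)"
     if "j \<in> Obj I" for j
    using \<pi>[OF that] v' e by (auto simp: hom_comma hF')
  let ?I = "with_terminal I"
  define K1 where "K1 = \<lparr>FObj = (\<lambda>j. fst (FObj K j)), FArr = (\<lambda>a. fst (snd (snd (FArr K a))))\<rparr>"
  have K1s: "FObj K1 j = fst (FObj K j)" "FArr K1 a = fst (snd (snd (FArr K a)))" for j a by (simp_all add: K1_def)
  have K1: "cat_functor I F' K1"
  proof (intro cat_functor.intro K.C.category_axioms Y.D.category_axioms cat_functor_axioms.intro)
    fix f g x y z assume "f \<in> hom I x y" "g \<in> hom I y z"
    then show "FArr K1 (Comp I g f) = Comp F' (FArr K1 g) (FArr K1 f)"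
      using K.FArr_Comp[of f x y g z] by (simp add: K1s)
  qed (use KO' KA' in \<open>auto simp: K1s hF' hom_iff[of _ I]\<close>)
  define l where "l j = snd (snd (FObj K j))" for j
  have l: "\<And>j. j \<in> Obj I \<Longrightarrow> l j \<in> hom F' (FObj K1 j) (FObj G' e)"
    "\<And>a. a \<in> Arr I \<Longrightarrow> Comp F' (l (Cod I a)) (FArr K1 a) = l (Dom I a)"
    using KO' KA' by (auto simp: l_def K1s hF')
  have Ge: "FObj G' e \<in> Obj F'" using e by simp
  define K2 where "K2 = with_terminal_fctr F' K1 (FObj G' e) l"
  have cone2: "cone ?I F' K2 w \<rho> \<longleftrightarrow>
    cone I F' K1 w (\<lambda>i. \<rho> (Suc i)) \<and> \<rho> 0 \<in> hom F' w (FObj G' e) \<and> (\<forall>i \<in> Obj I. Comp F' (l i) (\<rho> (Suc i)) = \<rho> 0)" for w \<rho>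
    unfolding K2_def by (rule cone_with_terminal_iff) (use K1 Ge l in auto)
  define \<pi>2 where "\<pi>2 j = (if j = 0 then snd (snd v) else fst (snd (snd (\<pi> (j - 1)))))" for j
  have L2: "limit_cone ?I F' K2 (fst v) \<pi>2"
    unfolding limit_cone_iff
  proof (intro conjI allI impI)
    have "Comp F' (FArr K1 a) (fst (snd (snd (\<pi> (Dom I a))))) = fst (snd (snd (\<pi> (Cod I a))))" if "a \<in> Arr I" for a
    proof -
      have "Comp Y.X (FArr K a) (\<pi> (Dom I a)) = \<pi> (Cod I a)" using L that by (auto simp: limit_cone_iff cone_iff)
      from this[symmetric] show ?thesis by (simp add: K1s)
    qed
    then show "cone ?I F' K2 (fst v) \<pi>2"
      unfolding cone2 unfolding cone_iff using K1 v' \<pi>' by (auto simp: \<pi>2_def hF' K1s l_def)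
    fix w \<rho> assume "cone ?I F' K2 w \<rho>"
    then have w: "w \<in> Obj F'" and r0: "\<rho> 0 \<in> Arr F'" "Dom F' (\<rho> 0) = w" "Cod F' (\<rho> 0) = FObj G' e"
      and r: "\<And>j. j \<in> Obj I \<Longrightarrow> \<rho> (Suc j) \<in> Arr F'" "\<And>j. j \<in> Obj I \<Longrightarrow> Dom F' (\<rho> (Suc j)) = w"
        "\<And>j. j \<in> Obj I \<Longrightarrow> Cod F' (\<rho> (Suc j)) = fst (FObj K j)" "\<And>j. j \<in> Obj I \<Longrightarrow> Comp F' (snd (snd (FObj K j))) (\<rho> (Suc j)) = \<rho> 0"
        "\<And>a. a \<in> Arr I \<Longrightarrow> Comp F' (FArr K1 a) (\<rho> (Suc (Dom I a))) = \<rho> (Suc (Cod I a))"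
      unfolding cone2 unfolding cone_iff by (auto simp: hF' K1s l_def)
    \<comment> \<open>A cone over the extended diagram is a cone in the fibre: its leg at the node 0
      is the structure arrow of the vertex.\<close>
    define W where "W = (w, e, \<rho> 0)"
    define \<sigma> where "\<sigma> j = (W, FObj K j, (\<rho> (Suc j), Id E e))" for j
    have W: "W \<in> Obj Y.X" using w r0 e by (simp add: W_def Obj_comma hF')
    have "cone I ?YF K W \<sigma>"
      unfolding cone_iff
    proof (intro conjI ballI K)
      show "W \<in> Obj ?YF" using W by (simp add: Obj_fibre) (simp add: W_def)
      show "\<sigma> j \<in> hom ?YF W (FObj K j)" if "j \<in> Obj I" for j
        using that W KO[OF that] r(1-4)[OF that] r0 e by (simp add: \<sigma>_def hom_fibre hom_comma hF' hE) (simp add: W_def)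
      show "Comp ?YF (FArr K a) (\<sigma> (Dom I a)) = \<sigma> (Cod I a)" if a: "a \<in> Arr I" for a
        using KA[OF a] r(5)[OF a] e by (simp add: \<sigma>_def K1s hom_comma)
    qed
    then have "\<exists>!h. h \<in> hom ?YF W v \<and> (\<forall>j \<in> Obj I. Comp ?YF (\<pi> j) h = \<sigma> j)"
      by (rule limit_cone.universal[OF L])
    then obtain h where hh: "h \<in> hom ?YF W v \<and> (\<forall>j \<in> Obj I. Comp ?YF (\<pi> j) h = \<sigma> j)"
      and uniq: "\<And>h'. h' \<in> hom ?YF W v \<and> (\<forall>j \<in> Obj I. Comp ?YF (\<pi> j) h' = \<sigma> j) \<Longrightarrow> h' = h"
      by (rule ex1_obtain) (rule that)
    have h: "h \<in> hom Y.X W v" "snd (snd (snd h)) = Id E e" "\<And>j. j \<in> Obj I \<Longrightarrow> Comp Y.X (\<pi> j) h = \<sigma> j"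
      using conjunct1[OF hh] conjunct2[OF hh] by (simp_all add: hom_fibre)
    show "\<exists>!h. h \<in> hom F' w (fst v) \<and> (\<forall>j\<in>Obj ?I. Comp F' (\<pi>2 j) h = \<rho> j)"
    proof (rule ex1I[of _ "fst (snd (snd h))"], intro conjI ballI)
      show "fst (snd (snd h)) \<in> hom F' w (fst v)" using h(1) by (auto simp: hom_comma W_def)
      fix j assume "j \<in> Obj ?I"
      then consider "j = 0" | j' where "j = Suc j'" "j' \<in> Obj I" by (auto simp: with_terminal_def)
      then show "Comp F' (\<pi>2 j) (fst (snd (snd h))) = \<rho> j"
      proof cases
        case 1
        then show ?thesis using h(1,2) r0 e by (simp add: hom_comma \<pi>2_def W_def)
      next
        case 2
        then show ?thesis using h(3)[OF 2(2)] by (simp add: \<pi>2_def \<sigma>_def)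
      qed
    next
      fix k assume k: "k \<in> hom F' w (fst v) \<and> (\<forall>j\<in>Obj ?I. Comp F' (\<pi>2 j) k = \<rho> j)"
      have k0: "Comp F' (snd (snd v)) k = \<rho> 0" using k by (auto simp: with_terminal_def \<pi>2_def)
      have kS: "Comp F' (fst (snd (snd (\<pi> j)))) k = \<rho> (Suc j)" if "j \<in> Obj I" for j
        using k that by (auto simp: with_terminal_def \<pi>2_def)
      have "(W, v, (k, Id E e)) = h"
      proof (rule uniq, intro conjI ballI)
        show "(W, v, (k, Id E e)) \<in> hom ?YF W v"
          using W v k k0 r0 e by (simp add: hom_fibre hom_comma hE) (simp add: W_def)
        show "Comp ?YF (\<pi> j) (W, v, (k, Id E e)) = \<sigma> j" if "j \<in> Obj I" for j
          using kS[OF that] \<pi>[OF that] e by (simp add: \<sigma>_def hom_comma)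
      qed
      then show "k = fst (snd (snd h))" by auto
    qed
  qed
  have fin2: "finite (Obj ?I)" "finite (Arr ?I)" using fin by (auto simp: with_terminal_def)
  have L3: "limit_cone ?I F (H \<circ>\<^sub>F K2) (FObj H (fst v)) (\<lambda>j. FArr H (\<pi>2 j))"
    using lex L2 fin2 unfolding preserves_finite_limits_def by blast
  have HK1: "cat_functor I F (H \<circ>\<^sub>F K1)" by (rule cat_functor_comp[OF K1 H])
  have Hl: "\<And>j. j \<in> Obj I \<Longrightarrow> FArr H (l j) \<in> hom F (FObj (H \<circ>\<^sub>F K1) j) (FObj H (FObj G' e))"
    "\<And>a. a \<in> Arr I \<Longrightarrow> Comp F (FArr H (l (Cod I a))) (FArr (H \<circ>\<^sub>F K1) a) = FArr H (l (Dom I a))"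
  proof -
    show "j \<in> Obj I \<Longrightarrow> FArr H (l j) \<in> hom F (FObj (H \<circ>\<^sub>F K1) j) (FObj H (FObj G' e))" for j
      using l(1)[of j] by (simp add: hF hF')
    fix a assume a: "a \<in> Arr I"
    have "FArr H (Comp F' (l (Cod I a)) (FArr K1 a)) = Comp F (FArr H (l (Cod I a))) (FArr H (FArr K1 a))"
      using l(1)[of "Cod I a"] KA'[OF a] a by (intro H.FArr_Comp_arr) (auto simp: K1s hF')
    then show "Comp F (FArr H (l (Cod I a))) (FArr (H \<circ>\<^sub>F K1) a) = FArr H (l (Dom I a))" using l(2)[OF a] by simp
  qed
  have HGe: "FObj H (FObj G' e) \<in> Obj F" using Ge by simp
  have HK2: "H \<circ>\<^sub>F K2 = with_terminal_fctr F (H \<circ>\<^sub>F K1) (FObj H (FObj G' e)) (\<lambda>j. FArr H (l j))"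
    unfolding K2_def by (rule with_terminal_fctr_comp[OF H Ge])
  have cone3: "cone ?I F (H \<circ>\<^sub>F K2) w \<rho> \<longleftrightarrow> cone I F (H \<circ>\<^sub>F K1) w (\<lambda>i. \<rho> (Suc i)) \<and>
    \<rho> 0 \<in> hom F w (FObj H (FObj G' e)) \<and> (\<forall>i \<in> Obj I. Comp F (FArr H (l i)) (\<rho> (Suc i)) = \<rho> 0)" for w \<rho>
    unfolding HK2 by (rule cone_with_terminal_iff) (use HK1 HGe Hl in auto)
  show "limit_cone I ?XF (?A \<circ>\<^sub>F K) (FObj ?A v) (\<lambda>j. FArr ?A (\<pi> j))"
    unfolding limit_cone_iff
  proof (intro conjI allI impI)
    interpret Af: cat_functor ?YF ?XF ?A by (rule Afun)
    have "cone I ?YF K v \<pi>" using L by (simp add: limit_cone_iff)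
    then show "cone I ?XF (?A \<circ>\<^sub>F K) (FObj ?A v) (\<lambda>j. FArr ?A (\<pi> j))"
      unfolding cone_iff[of _ ?XF] cone_iff[of _ ?YF]
    proof (elim conjE, intro conjI ballI)
      assume c: "v \<in> Obj ?YF" "\<forall>i\<in>Obj I. \<pi> i \<in> hom ?YF v (FObj K i)"
        "\<forall>a\<in>Arr I. Comp ?YF (FArr K a) (\<pi> (Dom I a)) = \<pi> (Cod I a)"
      show "cat_functor I ?XF (?A \<circ>\<^sub>F K)" by (rule cat_functor_comp[OF K Afun])
      show "FObj ?A v \<in> Obj ?XF" using Af.FObj_in[OF c(1)] .
      show "FArr ?A (\<pi> i) \<in> hom ?XF (FObj ?A v) (FObj (?A \<circ>\<^sub>F K) i)" if "i \<in> Obj I" for i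
        using Af.FArr_in_hom c(2) that by (simp only: FObj_comp)
      show "Comp ?XF (FArr (?A \<circ>\<^sub>F K) a) (FArr ?A (\<pi> (Dom I a))) = FArr ?A (\<pi> (Cod I a))" if a: "a \<in> Arr I" for a
        using Af.FArr_Comp[of "\<pi> (Dom I a)" v "FObj K (Dom I a)" "FArr K a" "FObj K (Cod I a)"] c a
          K.FArr_in_hom[of a "Dom I a" "Cod I a"] by (simp only: FArr_comp) (auto simp: hom_iff[of _ I])
    qed
  next
    fix w \<rho> assume cw: "cone I ?XF (?A \<circ>\<^sub>F K) w \<rho>"
    define z d \<gamma> i' where "z = fst (fst w)" and "d = fst (snd (fst w))" and "\<gamma> = snd (snd (fst w))" and "i' = snd w"
    have wO: "w \<in> Obj ?XF" using cw by (simp add: cone_iff)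
    then have z: "fst w \<in> Obj X.X" "z \<in> Obj F" "d \<in> Obj E" "\<gamma> \<in> Arr F" "Dom F \<gamma> = z" "Cod F \<gamma> = FObj G d"
      and i': "i' \<in> Arr E" "Dom E i' = d" "Cod E i' = e" "iso_arr E i'"
      by (auto simp: Obj_ess_fibre Obj_comma hE hF z_def d_def \<gamma>_def i'_def)
    define u where "u j = fst (snd (snd (snd (snd (\<rho> j)))))" for j
    have \<rho>h: "\<rho> j \<in> hom ?XF w (FObj ?A (FObj K j))" if "j \<in> Obj I" for j
      using cw that by (simp add: cone_iff)
    \<comment> \<open>The objects of the image diagram lie over \<open>e\<close> by the identity, so
      compatibility forces every leg to have \<open>i'\<close> as right part.\<close>
    have \<rho>r: "snd (snd (snd (snd (snd (\<rho> j))))) = i'" if "j \<in> Obj I" for j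
      using \<rho>h[OF that] KO[OF that] e by (auto simp: hom_ess_fibre hom_comma hE i'_def)
    have u: "u j \<in> Arr F" "Dom F (u j) = z" "Cod F (u j) = FObj H (fst (FObj K j))"
      "Comp F (\<phi> e) (Comp F (FArr H (l j)) (u j)) = Comp F (FArr G i') \<gamma>" if "j \<in> Obj I" for j
      using \<rho>h[OF that] \<rho>r[OF that] KO[OF that] KO'[OF that] e p[OF e]
      by (auto simp: hom_ess_fibre hom_comma hF u_def z_def \<gamma>_def l_def X.D.assoc)
    have \<rho>eq: "\<rho> j = (w, FObj ?A (FObj K j), (fst w, fst (FObj ?A (FObj K j)), (u j, i')))" if "j \<in> Obj I" for j
      using \<rho>h[OF that] \<rho>r[OF that] by (auto simp: hom_ess_fibre hom_comma u_def prod_eq_iff)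
    have un: "Comp F (FArr H (FArr K1 a)) (u (Dom I a)) = u (Cod I a)" if a: "a \<in> Arr I" for a
    proof -
      have "Comp ?XF (FArr (?A \<circ>\<^sub>F K) a) (\<rho> (Dom I a)) = \<rho> (Cod I a)" using cw a by (auto simp: cone_iff)
      then show ?thesis using \<rho>eq[of "Dom I a"] \<rho>eq[of "Cod I a"] a by (simp add: K1s)
    qed
    note ii = inverse_arr[OF i[OF e]]
    \<comment> \<open>The structure arrow \<gamma> ends in \<open>FObj G d\<close>; moved along
      \<open>i'\<close> and back through \<phi>, it becomes the leg at the adjoined node.\<close>
    define \<rho>2 where "\<rho>2 j = (if j = 0 then Comp F (inverse_arr F (\<phi> e)) (Comp F (FArr G i') \<gamma>) else u (j - 1))" for j
    have "Comp F (FArr H (l j)) (u j) = Comp F (inverse_arr F (\<phi> e)) (Comp F (FArr G i') \<gamma>)" if j: "j \<in> Obj I" for j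
      unfolding u(4)[OF j, symmetric] using u(1-3)[OF j] l(1)[OF j] p[OF e] i[OF e] by (simp add: hF' K1s X.D.Comp_inverse_cancel)
    then have "cone ?I F (H \<circ>\<^sub>F K2) z \<rho>2"
      unfolding cone3 unfolding cone_iff using HK1 z u un ii p[OF e] i' by (auto simp: \<rho>2_def hF K1s)
    then have ex: "\<exists>!h. h \<in> hom F z (FObj H (fst v)) \<and> (\<forall>j \<in> Obj ?I. Comp F (FArr H (\<pi>2 j)) h = \<rho>2 j)"
      using L3 by (simp add: limit_cone_iff)
    have char: "(\<forall>j \<in> Obj ?I. Comp F (FArr H (\<pi>2 j)) h = \<rho>2 j) \<longleftrightarrow>
      Comp F (Comp F (\<phi> e) (FArr H (snd (snd v)))) h = Comp F (FArr G i') \<gamma> \<and> (\<forall>j \<in> Obj I. Comp F (FArr H (fst (snd (snd (\<pi> j))))) h = u j)"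
      if h: "h \<in> hom F z (FObj H (fst v))" for h
    proof -
      have "Comp F (FArr H (snd (snd v))) h = Comp F (inverse_arr F (\<phi> e)) (Comp F (FArr G i') \<gamma>) \<longleftrightarrow>
        Comp F (Comp F (\<phi> e) (FArr H (snd (snd v)))) h = Comp F (FArr G i') \<gamma>"
        using h v' p[OF e] ii z i' X.D.Comp_inverse_cancel(1)[OF i[OF e], of "Comp F (FArr H (snd (snd v))) h"]
          X.D.Comp_inverse_cancel(2)[OF i[OF e], of "Comp F (FArr G i') \<gamma>"] by (auto simp: hF X.D.assoc)
      then show ?thesis by (auto simp: with_terminal_def \<pi>2_def \<rho>2_def)
    qed
    define vv where "vv = fst (FObj ?A v)"
    obtain h where h: "h \<in> hom F z (FObj H (fst v))" "Comp F (Comp F (\<phi> e) (FArr H (snd (snd v)))) h = Comp F (FArr G i') \<gamma>"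
      "\<And>j. j \<in> Obj I \<Longrightarrow> Comp F (FArr H (fst (snd (snd (\<pi> j))))) h = u j"
      and uniq: "\<And>h'. h' \<in> hom F z (FObj H (fst v)) \<Longrightarrow> Comp F (Comp F (\<phi> e) (FArr H (snd (snd v)))) h' = Comp F (FArr G i') \<gamma> \<Longrightarrow>
         (\<And>j. j \<in> Obj I \<Longrightarrow> Comp F (FArr H (fst (snd (snd (\<pi> j))))) h' = u j) \<Longrightarrow> h' = h"
      using ex by (rule ex1_obtain) (use char in blast)
    have vv: "FObj ?A v \<in> Obj ?XF" using cat_functor.FObj_in[OF Afun] v by (simp add: Obj_fibre)
    show "\<exists>!h. h \<in> hom ?XF w (FObj ?A v) \<and> (\<forall>j\<in>Obj I. Comp ?XF (FArr ?A (\<pi> j)) h = \<rho> j)"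
    proof (rule ex1I[of _ "(w, FObj ?A v, (fst w, vv, (h, i')))"])
      have "(w, FObj ?A v, (fst w, vv, (h, i'))) \<in> hom ?XF w (FObj ?A v)"
        unfolding hom_ess_fibre using wO vv z i' v e h A.FObj_in[OF v(1)]
        by (simp add: hom_comma hE vv_def) (simp add: z_def d_def \<gamma>_def i'_def)
      moreover have "Comp ?XF (FArr ?A (\<pi> j)) (w, FObj ?A v, (fst w, vv, (h, i'))) = \<rho> j" if "j \<in> Obj I" for j
        unfolding \<rho>eq[OF that] using h(3)[OF that] \<pi>[OF that] i' KO[OF that] v by (simp add: hom_comma hom_iff[of _ Y.X])
      ultimately show "(w, FObj ?A v, (fst w, vv, (h, i'))) \<in> hom ?XF w (FObj ?A v) \<and>
        (\<forall>j\<in>Obj I. Comp ?XF (FArr ?A (\<pi> j)) (w, FObj ?A v, (fst w, vv, (h, i'))) = \<rho> j)" by blast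
    next
      fix k assume k: "k \<in> hom ?XF w (FObj ?A v) \<and> (\<forall>j\<in>Obj I. Comp ?XF (FArr ?A (\<pi> j)) k = \<rho> j)"
      let ?k = "fst (snd (snd (snd (snd k))))"
      have kh: "fst k = w" "fst (snd k) = FObj ?A v" "fst (snd (snd k)) = fst w" "fst (snd (snd (snd k))) = vv"
        "?k \<in> hom F z (FObj H (fst v))" and kr: "snd (snd (snd (snd (snd k)))) = i'"
        and kc: "Comp F (Comp F (\<phi> e) (FArr H (snd (snd v)))) ?k = Comp F (FArr G i') \<gamma>"
        using k v e by (auto simp: vv_def hom_ess_fibre hom_comma hE z_def d_def \<gamma>_def i'_def)
      have "?k = h"
      proof (rule uniq[OF kh(5) kc])
        fix j assume j: "j \<in> Obj I"
        have "Comp ?XF (FArr ?A (\<pi> j)) k = \<rho> j" using k j by blast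
        then show "Comp F (FArr H (fst (snd (snd (\<pi> j))))) ?k = u j" using \<rho>eq[OF j] by simp
      qed
      then show "k = (w, FObj ?A v, (fst w, vv, (h, i')))" using kh kr by (auto simp: prod_eq_iff)
    qed
  qed
qed

text \<open>Covers are preserved because the left part of an image arrow is the inverse image of its
  left part, and inverse images preserve epimorphic families.\<close>

lemma induced_fib_cart_cov_obj:
  assumes g: "geometric_morphism F F' g" and f: "geometric_morphism F E f" and f': "geometric_morphism F' E f'"
    and G: "G = inv_im f" "G' = inv_im f'" and \<phi>: "nat_iso E F (inv_im g \<circ>\<^sub>F G') G \<phi>"
  shows "(induced F' F (inv_im g) \<phi>, \<lambda>y\<in>Obj Y.X. Id E (fst (snd y))) \<in>
    fib_cart_cov_obj E Y.X comma_right (relative_topology F' E f') X.X comma_right (relative_topology F E f)"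
proof -
  note H = geometric_morphismD(1,7)[OF g]
  interpret H: cat_functor F' F "inv_im g" by (rule H)
  interpret A: cat_functor Y.X X.X "induced F' F (inv_im g) \<phi>" by (rule cat_functor_induced[OF H(1) nat_isoD(1)[OF \<phi>]])
  have pb: "preserves_pullbacks F' F (inv_im g)"
    unfolding preserves_pullbacks_def using preserves_pullback[OF H(2,1)] by blast
  have \<theta>: "nat_iso Y.X E (comma_right \<circ>\<^sub>F induced F' F (inv_im g) \<phi>) comma_right (\<lambda>y\<in>Obj Y.X. Id E (fst (snd y)))"
    by (intro nat_isoI nat_transI cat_functor_comp[OF A.cat_functor_axioms X.cat_functor_right] Y.cat_functor_right)
      (auto simp: Obj_comma hE Arr_comma Y.C.iso_Id)
  have "fib_morphism E Y.X comma_right X.X comma_right (induced F' F (inv_im g) \<phi>) (\<lambda>y\<in>Obj Y.X. Id E (fst (snd y)))"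
    unfolding fib_morphism_def fib_morphism_axioms_def
    using A.cat_functor_axioms \<theta> X.cat_functor_right Y.cat_functor_right induced_cartesian[OF H(1) \<phi> pb] by blast
  moreover have "cover_preserving (relative_topology F' E f') (relative_topology F E f) (induced F' F (inv_im g) \<phi>)"
    unfolding cover_preserving_def
  proof (intro allI impI)
    fix y S assume "relative_topology F' E f' y S"
    then have y: "y \<in> Obj Y.X" and S: "S \<subseteq> {a \<in> Arr Y.X. fst (snd a) = y}"
      and epi: "epimorphic_family F' (fst y) (FArr comma_left ` S)"
      by (auto simp: relative_topology_def Let_def G)
    have "epimorphic_family F (FObj (inv_im g) (fst y)) (FArr (inv_im g) ` FArr comma_left ` S)"
      using geometric_morphism_preserves_epimorphic[OF g] epi by (simp add: preserves_epimorphic_def)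
    moreover have "FArr comma_left ` FArr (induced F' F (inv_im g) \<phi>) ` S = FArr (inv_im g) ` FArr comma_left ` S"
      by (simp add: image_image)
    ultimately show "relative_topology F E f (FObj (induced F' F (inv_im g) \<phi>) y) (FArr (induced F' F (inv_im g) \<phi>) ` S)"
      unfolding relative_topology_def Let_def G(1)[symmetric]
      using A.FObj_in[OF y] A.FArr_arr(1) S by (auto simp del: induced_simps) (auto simp: subset_iff)
  qed
  ultimately show ?thesis
    unfolding fib_cart_cov_obj_def using induced_preserves_fibre_limits[OF H(1) \<phi> H(2)] by blast
qed

end

section \<open>The comparison functor\<close>

lemma nat_trans_vcomp:
  assumes "nat_trans C D F G \<sigma>" "nat_trans C D G H \<tau>"
  shows "nat_trans C D F H (\<lambda>x\<in>Obj C. Comp D (\<tau> x) (\<sigma> x))"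
proof -
  have "category C" "category D" using nat_transD(1)[OF assms(1)] by (auto simp: cat_functor_def)
  then interpret category "functor_cat C D" by (rule category_functor_cat)
  have "Comp (functor_cat C D) (G, H, \<tau>) (F, G, \<sigma>) \<in> hom (functor_cat C D) F H"
    by (rule Comp_in_hom) (use assms in \<open>auto simp: functor_cat_def hom_iff\<close>)
  then show ?thesis by (simp add: functor_cat_def hom_iff)
qed

lemma nat_trans_Id:
  assumes "cat_functor C D F"
  shows "nat_trans C D F F (\<lambda>x\<in>Obj C. Id D (FObj F x))"
proof -
  interpret cat_functor C D F by fact
  show ?thesis by (intro nat_transI assms) (auto simp: hom_iff)
qed

lemma topos_slice_hom_simps [simp]: "Obj (topos_slice_hom F F' E f f') = slice_obj F F' E f f'"
  "Dom (topos_slice_hom F F' E f f') a = fst a" "Cod (topos_slice_hom F F' E f f') a = fst (snd a)"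
  "Id (topos_slice_hom F F' E f f') x = (x, x, \<lambda>c\<in>Obj F'. Id F (FObj (inv_im (fst x)) c))"
  "Comp (topos_slice_hom F F' E f f') b a =
     (fst a, fst (snd b), \<lambda>c\<in>Obj F'. Comp F (snd (snd b) c) (snd (snd a) c))"
  by (simp_all add: topos_slice_hom_def split_def)

lemma hom_topos_slice: "a \<in> hom (topos_slice_hom F F' E f f') x y \<longleftrightarrow>
  x \<in> slice_obj F F' E f f' \<and> y \<in> slice_obj F F' E f f' \<and> fst a = x \<and> fst (snd a) = y \<and>
  nat_trans F' F (inv_im (fst x)) (inv_im (fst y)) (snd (snd a)) \<and>
  (\<forall>e \<in> Obj E. Comp F (snd y e) (snd (snd a) (FObj (inv_im f') e)) = snd x e)"
  by (cases a; cases x; cases y) (auto simp: topos_slice_hom_def hom_iff geom_trans_def)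

lemma slice_obj_iff: "x \<in> slice_obj F F' E f f' \<longleftrightarrow>
  geometric_morphism F F' (fst x) \<and> nat_iso E F (inv_im (fst x) \<circ>\<^sub>F inv_im f') (inv_im f) (snd x)"
  by (cases x) (simp add: slice_obj_def geom_iso_def comp_geom_def)

lemma category_topos_slice_hom:
  assumes f': "cat_functor E F' (inv_im f')"
  shows "category (topos_slice_hom F F' E f f')" (is "category ?S")
proof -
  interpret f': cat_functor E F' "inv_im f'" by fact
  have Arr: "a \<in> Arr ?S \<longleftrightarrow> a \<in> hom ?S (fst a) (fst (snd a))" for a by (auto simp: hom_iff)
  show ?thesis
  proof
    fix x assume x: "x \<in> Obj ?S"
    then have G: "cat_functor F' F (inv_im (fst x))" and p: "nat_iso E F (inv_im (fst x) \<circ>\<^sub>F inv_im f') (inv_im f) (snd x)"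
      using geometric_morphismD(1) by (auto simp: slice_obj_iff)
    interpret G: cat_functor F' F "inv_im (fst x)" by fact
    show "Id ?S x \<in> hom ?S x x"
      using x nat_trans_Id[OF G] nat_transD(3,4)[OF nat_isoD(1)[OF p]] by (auto simp: hom_topos_slice)
  next
    fix a b x y z assume a: "a \<in> hom ?S x y" and b: "b \<in> hom ?S y z"
    have na: "nat_trans F' F (inv_im (fst x)) (inv_im (fst y)) (snd (snd a))"
      and nb: "nat_trans F' F (inv_im (fst y)) (inv_im (fst z)) (snd (snd b))"
      and z: "nat_iso E F (inv_im (fst z) \<circ>\<^sub>F inv_im f') (inv_im f) (snd z)"
      using a b by (auto simp: hom_topos_slice slice_obj_iff)
    interpret G: cat_functor F' F "inv_im (fst x)" using na by (rule nat_transD)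
    have "Comp F (snd z e) (Comp F (snd (snd b) (FObj (inv_im f') e)) (snd (snd a) (FObj (inv_im f') e))) = snd x e"
      if e: "e \<in> Obj E" for e
    proof -
      have "Comp F (Comp F (snd z e) (snd (snd b) (FObj (inv_im f') e))) (snd (snd a) (FObj (inv_im f') e)) = snd x e"
        using a b e by (simp add: hom_topos_slice)
      then show ?thesis
        using e nat_transD(3-5)[OF na, of "FObj (inv_im f') e"] nat_transD(3-5)[OF nb, of "FObj (inv_im f') e"]
          nat_transD(3,4)[OF nat_isoD(1)[OF z] e] by (simp add: G.D.assoc)
    qed
    then show "Comp ?S b a \<in> hom ?S x z"
      using a b nat_trans_vcomp[OF na nb] by (simp add: hom_topos_slice)
  next
    fix a x y assume a: "a \<in> hom ?S x y"
    have na: "nat_trans F' F (inv_im (fst x)) (inv_im (fst y)) (snd (snd a))" using a by (simp add: hom_topos_slice)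
    interpret G: cat_functor F' F "inv_im (fst x)" using na by (rule nat_transD)
    have "(\<lambda>c\<in>Obj F'. Comp F (snd (snd a) c) ((\<lambda>c\<in>Obj F'. Id F (FObj (inv_im (fst x)) c)) c)) = snd (snd a)"
      "(\<lambda>c\<in>Obj F'. Comp F ((\<lambda>c\<in>Obj F'. Id F (FObj (inv_im (fst y)) c)) c) (snd (snd a) c)) = snd (snd a)"
      by (rule extensionalityI[of _ "Obj F'"]; use nat_transD(3-5,7)[OF na] in simp)+
    then show "Comp ?S a (Id ?S x) = a" "Comp ?S (Id ?S y) a = a"
      using a by (simp_all add: hom_topos_slice prod_eq_iff)
  next
    fix a b c w x y z assume "a \<in> hom ?S w x" "b \<in> hom ?S x y" "c \<in> hom ?S y z"
    then have n: "nat_trans F' F (inv_im (fst w)) (inv_im (fst x)) (snd (snd a))"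
      "nat_trans F' F (inv_im (fst x)) (inv_im (fst y)) (snd (snd b))"
      "nat_trans F' F (inv_im (fst y)) (inv_im (fst z)) (snd (snd c))" by (auto simp: hom_topos_slice)
    interpret G: cat_functor F' F "inv_im (fst w)" using n(1) by (rule nat_transD)
    show "Comp ?S c (Comp ?S b a) = Comp ?S (Comp ?S c b) a"
      using nat_transD(3-5)[OF n(1)] nat_transD(3-5)[OF n(2)] nat_transD(3-5)[OF n(3)]
      by (auto simp: G.D.assoc intro!: restrict_ext)
  qed (auto simp: Arr hom_topos_slice)
qed

lemma fib_cart_cov_simps [simp]: "Obj (fib_cart_cov E Y q K X p J) = fib_cart_cov_obj E Y q K X p J"
  "Dom (fib_cart_cov E Y q K X p J) a = fst a" "Cod (fib_cart_cov E Y q K X p J) a = fst (snd a)"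
  "Id (fib_cart_cov E Y q K X p J) x = (x, x, \<lambda>y\<in>Obj Y. Id X (FObj (fst x) y))"
  "Comp (fib_cart_cov E Y q K X p J) b a = (fst a, fst (snd b), \<lambda>y\<in>Obj Y. Comp X (snd (snd b) y) (snd (snd a) y))"
  by (simp_all add: fib_cart_cov_def split_def)

lemma hom_fib_cart_cov: "a \<in> hom (fib_cart_cov E Y q K X p J) x y \<longleftrightarrow>
  x \<in> fib_cart_cov_obj E Y q K X p J \<and> y \<in> fib_cart_cov_obj E Y q K X p J \<and> fst a = x \<and> fst (snd a) = y \<and>
  nat_trans Y X (fst x) (fst y) (snd (snd a)) \<and>
  (\<forall>z \<in> Obj Y. Comp E (snd y z) (FArr p (snd (snd a) z)) = snd x z)"
  by (cases a; cases x; cases y) (auto simp: fib_cart_cov_def hom_iff)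

lemma fib_cart_cov_objD:
  assumes "x \<in> fib_cart_cov_obj E Y q K X p J"
  shows "cat_functor Y X (fst x)" "nat_iso Y E (p \<circ>\<^sub>F fst x) q (snd x)" "cat_functor X E p" "cat_functor Y E q"
    "\<And>a. cartesian_arr Y E q a \<Longrightarrow> cartesian_arr X E p (FArr (fst x) a)"
    "\<And>e. e \<in> Obj E \<Longrightarrow> preserves_finite_limits (fibre Y E q e) (ess_fibre X E p e) (fibre_fctr Y (fst x) (snd x))"
    "cover_preserving K J (fst x)"
  using assms by (cases x; auto simp: fib_cart_cov_obj_def fib_morphism_def fib_morphism_axioms_def)+

lemma category_fib_cart_cov: "category (fib_cart_cov E Y q K X p J)" (is "category ?S")
proof -
  have Arr: "a \<in> Arr ?S \<longleftrightarrow> a \<in> hom ?S (fst a) (fst (snd a))" for a by (auto simp: hom_iff)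
  show ?thesis
  proof
    fix x assume x: "x \<in> Obj ?S"
    then have x': "x \<in> fib_cart_cov_obj E Y q K X p J" by simp
    note d = fib_cart_cov_objD[OF x']
    interpret A: cat_functor Y X "fst x" by (rule d)
    interpret p: cat_functor X E p by (rule d)
    show "Id ?S x \<in> hom ?S x x"
      using x nat_trans_Id[OF d(1)] nat_transD(3,4)[OF nat_isoD(1)[OF d(2)]] by (auto simp: hom_fib_cart_cov)
  next
    fix a b x y z assume a: "a \<in> hom ?S x y" and b: "b \<in> hom ?S y z"
    have na: "nat_trans Y X (fst x) (fst y) (snd (snd a))" and nb: "nat_trans Y X (fst y) (fst z) (snd (snd b))"
      and z: "z \<in> fib_cart_cov_obj E Y q K X p J"
      using a b by (auto simp: hom_fib_cart_cov)
    interpret p: cat_functor X E p by (rule fib_cart_cov_objD[OF z])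
    have "Comp E (snd z e) (FArr p (Comp X (snd (snd b) e) (snd (snd a) e))) = snd x e" if e: "e \<in> Obj Y" for e
    proof -
      have "Comp E (Comp E (snd z e) (FArr p (snd (snd b) e))) (FArr p (snd (snd a) e)) = snd x e"
        using a b e by (simp add: hom_fib_cart_cov)
      then show ?thesis
        using nat_transD(3-5)[OF na e] nat_transD(3-5)[OF nb e] nat_transD(3,4)[OF nat_isoD(1)[OF fib_cart_cov_objD(2)[OF z]] e]
        by (simp add: p.FArr_Comp_arr p.D.assoc)
    qed
    then show "Comp ?S b a \<in> hom ?S x z"
      using a b nat_trans_vcomp[OF na nb] by (simp add: hom_fib_cart_cov)
  next
    fix a x y assume a: "a \<in> hom ?S x y"
    have na: "nat_trans Y X (fst x) (fst y) (snd (snd a))" using a by (simp add: hom_fib_cart_cov)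
    interpret G: cat_functor Y X "fst x" using na by (rule nat_transD)
    have "(\<lambda>c\<in>Obj Y. Comp X (snd (snd a) c) ((\<lambda>c\<in>Obj Y. Id X (FObj (fst x) c)) c)) = snd (snd a)"
      "(\<lambda>c\<in>Obj Y. Comp X ((\<lambda>c\<in>Obj Y. Id X (FObj (fst y) c)) c) (snd (snd a) c)) = snd (snd a)"
      by (rule extensionalityI[of _ "Obj Y"]; use nat_transD(3-5,7)[OF na] in simp)+
    then show "Comp ?S a (Id ?S x) = a" "Comp ?S (Id ?S y) a = a"
      using a by (simp_all add: hom_fib_cart_cov prod_eq_iff)
  next
    fix a b c w x y z assume "a \<in> hom ?S w x" "b \<in> hom ?S x y" "c \<in> hom ?S y z"
    then have n: "nat_trans Y X (fst w) (fst x) (snd (snd a))"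
      "nat_trans Y X (fst x) (fst y) (snd (snd b))"
      "nat_trans Y X (fst y) (fst z) (snd (snd c))" by (auto simp: hom_fib_cart_cov)
    interpret G: cat_functor Y X "fst w" using n(1) by (rule nat_transD)
    show "Comp ?S c (Comp ?S b a) = Comp ?S (Comp ?S c b) a"
      using nat_transD(3-5)[OF n(1)] nat_transD(3-5)[OF n(2)] nat_transD(3-5)[OF n(3)]
      by (auto simp: G.D.assoc intro!: restrict_ext)
  qed (auto simp: Arr hom_fib_cart_cov)
qed

section \<open>The functor from the slice to morphisms of fibrations\<close>

locale slice_comparison =
  fixes E :: "('oe, 'ae) cat" and F :: "('of, 'af) cat" and F' :: "('og, 'ag) cat"
    and f :: "('of, 'af, 'oe, 'ae) geom" and f' :: "('og, 'ag, 'oe, 'ae) geom"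
  assumes f: "geometric_morphism F E f" and f': "geometric_morphism F' E f'"

sublocale slice_comparison \<subseteq> two_commas E F' "inv_im f'" F "inv_im f"
  using geometric_morphismD(1)[OF f] geometric_morphismD(1)[OF f']
  by (simp add: two_commas_def comma_def)

context slice_comparison
begin

abbreviation Slice where "Slice \<equiv> topos_slice_hom F F' E f f'"

abbreviation Fib where "Fib \<equiv> fib_cart_cov E
      (comma_cat F' E (inv_im f')) comma_right (relative_topology F' E f')
      (comma_cat F E (inv_im f)) comma_right (relative_topology F E f)"

text \<open>The induced functor lies strictly over \<open>E\<close>, so the accompanying isomorphism
  consists of identities.\<close>

definition comparison_obj :: "('of, 'af, 'og, 'ag) geom \<times> ('oe \<Rightarrow> 'af) \<Rightarrow>
    (('og, 'ag, 'oe) comma_obj, ('og, 'ag, 'oe, 'ae) comma_arr,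
     ('of, 'af, 'oe) comma_obj, ('of, 'af, 'oe, 'ae) comma_arr) fctr \<times> (('og, 'ag, 'oe) comma_obj \<Rightarrow> 'ae)" where
  "comparison_obj x = (induced F' F (inv_im (fst x)) (snd x), \<lambda>y\<in>Obj Y.X. Id E (fst (snd y)))"

definition comparison where
  "comparison = \<lparr>FObj = comparison_obj,
     FArr = (\<lambda>a. (comparison_obj (fst a), comparison_obj (fst (snd a)),
       \<lambda>y\<in>Obj Y.X. (FObj (fst (comparison_obj (fst a))) y, FObj (fst (comparison_obj (fst (snd a)))) y,
          (snd (snd a) (fst y), Id E (fst (snd y))))))\<rparr>"

lemma comparison_simps: "FObj comparison x = comparison_obj x"
  "FArr comparison a = (comparison_obj (fst a), comparison_obj (fst (snd a)),
       \<lambda>y\<in>Obj Y.X. (FObj (fst (comparison_obj (fst a))) y, FObj (fst (comparison_obj (fst (snd a)))) y,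
          (snd (snd a) (fst y), Id E (fst (snd y)))))"
  by (simp_all add: comparison_def)

lemma comparison_obj_in: "x \<in> slice_obj F F' E f f' \<Longrightarrow> comparison_obj x \<in> Obj Fib"
  using induced_fib_cart_cov_obj[OF _ f f' refl refl, of "fst x" "snd x"]
  by (simp add: comparison_obj_def slice_obj_iff)

lemma slice_objD:
  assumes "x \<in> slice_obj F F' E f f'"
  shows "cat_functor F' F (inv_im (fst x))" 
    "\<And>e. e \<in> Obj E \<Longrightarrow> snd x e \<in> hom F (FObj (inv_im (fst x)) (FObj (inv_im f') e)) (FObj (inv_im f) e)"
  using assms geometric_morphismD(1)[of F F' "fst x"]
    nat_transD(3-5)[OF nat_isoD(1), of E F "inv_im (fst x) \<circ>\<^sub>F inv_im f'" "inv_im f" "snd x"]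
  by (auto simp: slice_obj_iff hF)

text \<open>A component respects structure arrows because the given transformation is natural along
  them and compatible with the 2-isomorphisms of \<open>x\<close> and \<open>y\<close>.\<close>

lemma comparison_nat_trans:
  assumes a: "a \<in> hom Slice x y"
  shows "nat_trans Y.X X.X (fst (comparison_obj x)) (fst (comparison_obj y)) (snd (snd (FArr comparison a)))"
proof (rule nat_transI)
  have x: "x \<in> slice_obj F F' E f f'" and y: "y \<in> slice_obj F F' E f f'" and fa: "fst a = x" "fst (snd a) = y"
    and n: "nat_trans F' F (inv_im (fst x)) (inv_im (fst y)) (snd (snd a))"
    and cmp: "\<And>e. e \<in> Obj E \<Longrightarrow> Comp F (snd y e) (snd (snd a) (FObj (inv_im f') e)) = snd x e"
    using a by (auto simp: hom_topos_slice)
  note nt = nat_transD(3-5)[OF n] and nn = nat_transD(6)[OF n]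
  note xO = comparison_obj_in[OF x, simplified] and yO = comparison_obj_in[OF y, simplified]
  show A: "cat_functor Y.X X.X (fst (comparison_obj x))" and B: "cat_functor Y.X X.X (fst (comparison_obj y))"
    using fib_cart_cov_objD(1)[OF xO] fib_cart_cov_objD(1)[OF yO] by auto
  interpret A: cat_functor Y.X X.X "fst (comparison_obj x)" by (rule A)
  interpret B: cat_functor Y.X X.X "fst (comparison_obj y)" by (rule B)
  interpret g: cat_functor F' F "inv_im (fst x)" by (rule slice_objD[OF x])
  interpret h: cat_functor F' F "inv_im (fst y)" by (rule slice_objD[OF y])
  show "snd (snd (FArr comparison a)) z \<in> hom X.X (FObj (fst (comparison_obj x)) z) (FObj (fst (comparison_obj y)) z)"
    if z: "z \<in> Obj Y.X" for z
  proof -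
    note zD = z[unfolded Obj_comma hF']
    let ?e = "fst (snd z)" and ?s = "snd (snd z)"
    note yD = slice_objD(2)[OF y, of ?e]
    have e: "FObj (inv_im f') ?e \<in> Obj F'" using zD by simp
    have "Comp F (Comp F (snd y ?e) (FArr (inv_im (fst y)) ?s)) (snd (snd a) (fst z)) =
      Comp F (snd y ?e) (Comp F (snd (snd a) (FObj (inv_im f') ?e)) (FArr (inv_im (fst x)) ?s))"
      using zD yD nn[of ?s] nt[of "fst z"] by (simp add: hF X.D.assoc)
    also have "\<dots> = Comp F (snd x ?e) (FArr (inv_im (fst x)) ?s)"
      using zD yD cmp[of ?e] nt[OF e] by (simp add: hF flip: X.D.assoc)
    finally have eq: "Comp F (Comp F (snd y ?e) (FArr (inv_im (fst y)) ?s)) (snd (snd a) (fst z)) =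
      Comp F (snd x ?e) (FArr (inv_im (fst x)) ?s)" .
    have "Comp F (snd x ?e) (FArr (inv_im (fst x)) ?s) \<in> hom F (FObj (inv_im (fst x)) (fst z)) (FObj (inv_im f) ?e)"
      using slice_objD(2)[OF x, of ?e] zD by (simp add: hF)
    then show ?thesis
      unfolding hom_comma using A.FObj_in[OF z] B.FObj_in[OF z] z zD nt[of "fst z"] eq
      by (simp add: comparison_simps fa hE hF comparison_obj_def)
  qed
  show "Comp X.X (snd (snd (FArr comparison a)) (Cod Y.X u)) (FArr (fst (comparison_obj x)) u) =
    Comp X.X (FArr (fst (comparison_obj y)) u) (snd (snd (FArr comparison a)) (Dom Y.X u))" if u: "u \<in> Arr Y.X" for u
    using u nn[of "fst (snd (snd u))"] u[unfolded Arr_comma hE hF']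
    by (simp add: comparison_simps fa comparison_obj_def)
  show "snd (snd (FArr comparison a)) \<in> extensional (Obj Y.X)" by (simp add: comparison_simps)
qed

lemma cat_functor_comparison: "cat_functor Slice Fib comparison"
proof (intro cat_functor.intro category_topos_slice_hom[OF Y.cat_functor_axioms] category_fib_cart_cov cat_functor_axioms.intro)
  fix x assume x: "x \<in> Obj Slice"
  then show "FObj comparison x \<in> Obj Fib" using comparison_obj_in by (simp add: comparison_simps)
  interpret g: cat_functor F' F "inv_im (fst x)" by (rule slice_objD[of x]) (use x in simp)
  show "FArr comparison (Id Slice x) = Id Fib (FObj comparison x)"
    by (auto simp: comparison_simps comparison_obj_def Obj_comma intro!: restrict_ext)
next
  fix a x y assume a: "a \<in> hom Slice x y"
  then have xy: "x \<in> slice_obj F F' E f f'" "y \<in> slice_obj F F' E f f'" and fa: "fst a = x" "fst (snd a) = y"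
    by (auto simp: hom_topos_slice)
  have "Comp E (snd (comparison_obj y) z) (FArr comma_right (snd (snd (FArr comparison a)) z)) = snd (comparison_obj x) z"
    if z: "z \<in> Obj Y.X" for z
    using z by (simp add: comparison_simps comparison_obj_def Obj_comma)
  then show "FArr comparison a \<in> hom Fib (FObj comparison x) (FObj comparison y)"
    unfolding hom_fib_cart_cov comparison_simps(1)
    using comparison_nat_trans[OF a] comparison_obj_in[OF xy(1)] comparison_obj_in[OF xy(2)]
    by (simp add: fa comparison_simps(2))
next
  fix a b x y z assume a: "a \<in> hom Slice x y" and b: "b \<in> hom Slice y z"
  then show "FArr comparison (Comp Slice b a) = Comp Fib (FArr comparison b) (FArr comparison a)"
    by (auto simp: comparison_simps comparison_obj_def Obj_comma hom_topos_slice intro!: restrict_ext)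
qed

lemma comparison_full_faithful:
  assumes t: "terminal E t"
  shows "\<And>x y b. x \<in> Obj Slice \<Longrightarrow> y \<in> Obj Slice \<Longrightarrow> b \<in> hom Fib (FObj comparison x) (FObj comparison y) \<Longrightarrow>
      \<exists>a \<in> hom Slice x y. FArr comparison a = b"
    and "\<And>x y. inj_on (FArr comparison) (hom Slice x y)"
proof -
  have t': "terminal F' (FObj (inv_im f') t)"
    by (rule preserves_terminal[OF geometric_morphismD(7)[OF f'] Y.C.category_axioms Y.D.category_axioms t])
  have tO: "t \<in> Obj E" using t by (simp add: terminal_def)
  have "\<forall>c \<in> Obj F'. \<exists>u. u \<in> hom F' c (FObj (inv_im f') t)" using terminal_ex[OF t'] by blast
  then obtain bang where bang: "\<And>c. c \<in> Obj F' \<Longrightarrow> bang c \<in> hom F' c (FObj (inv_im f') t)" by metis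
  define top where "top c = (c, t, bang c)" for c
  have top: "top c \<in> Obj Y.X" if "c \<in> Obj F'" for c
    using that tO bang[OF that] by (simp add: top_def Obj_comma)
  have top_s: "fst (top c) = c" "fst (snd (top c)) = t" for c by (simp_all add: top_def)
  show "inj_on (FArr comparison) (hom Slice x y)" for x y
  proof (rule inj_onI)
    fix a b assume a: "a \<in> hom Slice x y" and b: "b \<in> hom Slice x y" and eq: "FArr comparison a = FArr comparison b"
    have na: "nat_trans F' F (inv_im (fst x)) (inv_im (fst y)) (snd (snd a))"
      and nb: "nat_trans F' F (inv_im (fst x)) (inv_im (fst y)) (snd (snd b))" using a b by (auto simp: hom_topos_slice)
    have "snd (snd a) = snd (snd b)"
    proof (rule extensionalityI[of _ "Obj F'"])
      fix c assume c: "c \<in> Obj F'"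
      have "snd (snd (FArr comparison a)) (top c) = snd (snd (FArr comparison b)) (top c)" using eq by simp
      then show "snd (snd a) c = snd (snd b) c" using top[OF c] by (simp add: comparison_simps top_s)
    qed (use nat_transD(7)[OF na] nat_transD(7)[OF nb] in auto)
    then show "a = b" using a b by (auto simp: hom_topos_slice prod_eq_iff)
  qed
  fix x y b assume "x \<in> Obj Slice" "y \<in> Obj Slice" and b: "b \<in> hom Fib (FObj comparison x) (FObj comparison y)"
  then have x: "x \<in> slice_obj F F' E f f'" and y: "y \<in> slice_obj F F' E f f'" by auto
  define \<tau> where "\<tau> = snd (snd b)"
  have fb: "fst b = comparison_obj x" "fst (snd b) = comparison_obj y"
    and \<tau>: "nat_trans Y.X X.X (fst (comparison_obj x)) (fst (comparison_obj y)) \<tau>"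
    and cmp: "\<And>z. z \<in> Obj Y.X \<Longrightarrow> Comp E (Id E (fst (snd z))) (snd (snd (snd (\<tau> z)))) = Id E (fst (snd z))"
    using b by (auto simp: hom_fib_cart_cov comparison_simps \<tau>_def comparison_obj_def)
  interpret A: cat_functor Y.X X.X "fst (comparison_obj x)" by (rule nat_transD[OF \<tau>])
  interpret B: cat_functor Y.X X.X "fst (comparison_obj y)" by (rule nat_transD[OF \<tau>])
  interpret g: cat_functor F' F "inv_im (fst x)" by (rule slice_objD[OF x])
  interpret h: cat_functor F' F "inv_im (fst y)" by (rule slice_objD[OF y])
  have \<tau>h: "\<tau> z \<in> hom X.X (FObj (fst (comparison_obj x)) z) (FObj (fst (comparison_obj y)) z)" if "z \<in> Obj Y.X" for z
    using nat_transD(3-5)[OF \<tau> that] by (auto simp: hom_iff)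
  have \<tau>D: "fst (\<tau> z) = FObj (fst (comparison_obj x)) z" "fst (snd (\<tau> z)) = FObj (fst (comparison_obj y)) z"
    "fst (snd (snd (\<tau> z))) \<in> hom F (FObj (inv_im (fst x)) (fst z)) (FObj (inv_im (fst y)) (fst z))"
    "snd (snd (snd (\<tau> z))) \<in> hom E (fst (snd z)) (fst (snd z))"
    "Comp F (Comp F (snd y (fst (snd z))) (FArr (inv_im (fst y)) (snd (snd z)))) (fst (snd (snd (\<tau> z)))) =
     Comp F (FArr (inv_im f) (snd (snd (snd (\<tau> z))))) (Comp F (snd x (fst (snd z))) (FArr (inv_im (fst x)) (snd (snd z))))"
    if "z \<in> Obj Y.X" for z
    using \<tau>h[OF that] by (auto simp: hom_comma comparison_obj_def)
  \<comment> \<open>Both functors lie strictly over \<open>E\<close>, so a transformation over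
    \<open>E\<close> has identities as right parts.\<close>
  have \<tau>r: "snd (snd (snd (\<tau> z))) = Id E (fst (snd z))" if "z \<in> Obj Y.X" for z
    using cmp[OF that] \<tau>D(4)[OF that] by (simp add: hE)
  define \<alpha> where "\<alpha> = (\<lambda>c\<in>Obj F'. fst (snd (snd (\<tau> (top c)))))"
  have nat: "Comp F (fst (snd (snd (\<tau> (fst (snd u)))))) (FArr (inv_im (fst x)) (fst (snd (snd u)))) =
    Comp F (FArr (inv_im (fst y)) (fst (snd (snd u)))) (fst (snd (snd (\<tau> (fst u)))))" if u: "u \<in> Arr Y.X" for u
    using nat_transD(6)[OF \<tau> u] by (simp add: comparison_obj_def)
  \<comment> \<open>Naturality along the arrow to \<open>top (fst z)\<close> with identity left
    part: the left part of a component depends only on the left part of the object.\<close>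
  have \<tau>l: "fst (snd (snd (\<tau> z))) = \<alpha> (fst z)" if z: "z \<in> Obj Y.X" for z
  proof -
    note zD = z[unfolded Obj_comma hF']
    obtain v where v: "v \<in> hom E (fst (snd z)) t" using terminal_ex[OF t] zD by blast
    have "Comp F' (bang (fst z)) (Id F' (fst z)) = Comp F' (FArr (inv_im f') v) (snd (snd z))"
      using zD v bang[of "fst z"] by (intro terminal_unique[OF t']) (auto simp: hF' hE)
    then have "(z, top (fst z), (Id F' (fst z), v)) \<in> Arr Y.X"
      using z zD top[of "fst z"] v by (simp add: Arr_comma hF' top_s) (simp add: top_def)
    from nat[OF this] show ?thesis
      using zD \<tau>D(3)[OF z] \<tau>D(3)[OF top, of "fst z"] by (simp add: top_s hF \<alpha>_def)
  qed
  have \<alpha>: "nat_trans F' F (inv_im (fst x)) (inv_im (fst y)) \<alpha>"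
  proof (rule nat_transI[OF g.cat_functor_axioms h.cat_functor_axioms])
    show "\<alpha> c \<in> hom F (FObj (inv_im (fst x)) c) (FObj (inv_im (fst y)) c)" if "c \<in> Obj F'" for c
      using \<tau>D(3)[OF top[OF that]] that by (simp add: \<alpha>_def top_s)
    show "\<alpha> \<in> extensional (Obj F')" by (simp add: \<alpha>_def)
    fix u assume u: "u \<in> Arr F'"
    have o: "Dom F' u \<in> Obj F'" "Cod F' u \<in> Obj F'" using u by auto
    have "Comp F' (bang (Cod F' u)) u = Comp F' (FArr (inv_im f') (Id E t)) (bang (Dom F' u))"
      using u bang[OF o(1)] bang[OF o(2)] tO by (intro terminal_unique[OF t']) (auto simp: hF')
    then have "(top (Dom F' u), top (Cod F' u), (u, Id E t)) \<in> Arr Y.X"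
      using u o top tO by (simp add: Arr_comma hF' hE top_s) (simp add: top_def)
    from nat[OF this] show "Comp F (\<alpha> (Cod F' u)) (FArr (inv_im (fst x)) u) = Comp F (FArr (inv_im (fst y)) u) (\<alpha> (Dom F' u))"
      using u by (simp add: \<alpha>_def)
  qed
  have "Comp F (snd y e) (\<alpha> (FObj (inv_im f') e)) = snd x e" if e: "e \<in> Obj E" for e
  proof -
    \<comment> \<open>Compatibility with the 2-isomorphisms is the square of the component at the
      terminal object of the fibre over \<open>e\<close>, whose structure arrow is an
      identity.\<close>
    let ?z = "(FObj (inv_im f') e, e, Id F' (FObj (inv_im f') e))"
    have z: "?z \<in> Obj Y.X" using e by (simp add: Obj_comma hF')
    show ?thesis
      using \<tau>D(5)[OF z] \<tau>l[OF z] \<tau>r[OF z] e slice_objD(2)[OF x e] slice_objD(2)[OF y e] by (simp add: hF)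
  qed
  then have a: "(x, y, \<alpha>) \<in> hom Slice x y" using x y \<alpha> by (simp add: hom_topos_slice)
  have "FArr comparison (x, y, \<alpha>) = b"
  proof -
    have "snd (snd (FArr comparison (x, y, \<alpha>))) = \<tau>"
    proof (rule extensionalityI[of _ "Obj Y.X"])
      show "\<tau> \<in> extensional (Obj Y.X)" using nat_transD(7)[OF \<tau>] .
      show "snd (snd (FArr comparison (x, y, \<alpha>))) \<in> extensional (Obj Y.X)" by (simp add: comparison_simps)
      show "snd (snd (FArr comparison (x, y, \<alpha>))) z = \<tau> z" if z: "z \<in> Obj Y.X" for z
        by (rule comma_arr_eqI) (use z \<tau>D(1,2)[OF z] \<tau>l[OF z] \<tau>r[OF z] in \<open>auto simp: comparison_simps\<close>)
    qed
    then show ?thesis by (simp add: prod_eq_iff fb \<tau>_def) (simp add: comparison_simps)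
  qed
  then show "\<exists>a \<in> hom Slice x y. FArr comparison a = b" using a by blast
qed

end

section \<open>Essential surjectivity\<close>

lemma (in comma) iso_comma:
  assumes a: "a \<in> Arr X" and u: "iso_arr F (fst (snd (snd a)))" and v: "iso_arr E (snd (snd (snd a)))"
  shows "iso_arr X a"
proof -
  let ?u = "fst (snd (snd a))" and ?v = "snd (snd (snd a))"
  note iu = inverse_arr[OF u] and iv = inverse_arr[OF v] and aD = a[unfolded Arr_comma Obj_comma hE hF]
  let ?b = "(fst (snd a), fst a, (inverse_arr F ?u, inverse_arr E ?v))"
  have "Comp F (FArr G ?v) (Comp F (snd (snd (fst a))) (inverse_arr F ?u)) =
    Comp F (Comp F (snd (snd (fst (snd a)))) ?u) (inverse_arr F ?u)"
    using aD iu by (simp add: D.assoc)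
  also have "\<dots> = snd (snd (fst (snd a)))" by (rule D.Comp_inverse_cancel(3)[OF u]) (use aD in auto)
  finally have "Comp F (FArr G (inverse_arr E ?v)) (snd (snd (fst (snd a)))) =
     Comp F (FArr G (inverse_arr E ?v)) (Comp F (FArr G ?v) (Comp F (snd (snd (fst a))) (inverse_arr F ?u)))" by simp
  also have "\<dots> = Comp F (Comp F (FArr G (inverse_arr E ?v)) (FArr G ?v)) (Comp F (snd (snd (fst a))) (inverse_arr F ?u))"
    using aD iu iv by (simp add: D.assoc)
  also have "\<dots> = Comp F (snd (snd (fst a))) (inverse_arr F ?u)"
    using aD iu iso_FArr(2)[OF v] by simp
  finally have "?b \<in> hom X (fst (snd a)) (fst a)"
    using a aD iu iv by (auto simp: hom_comma Arr_comma hE hF)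
  then show ?thesis
    by (intro iso_arrI[where g = ?b and x = "fst a" and y = "fst (snd a)"])
      (use a aD iu iv in \<open>auto simp: hom_comma Arr_comma hE hF prod_eq_iff\<close>)
qed

lemma iso_fib_cart_cov:
  assumes a: "a \<in> hom (fib_cart_cov E Y q K X p J) x y"
    and i: "\<And>z. z \<in> Obj Y \<Longrightarrow> iso_arr X (snd (snd a) z)"
  shows "iso_arr (fib_cart_cov E Y q K X p J) a"
proof -
  have x: "x \<in> fib_cart_cov_obj E Y q K X p J" and y: "y \<in> fib_cart_cov_obj E Y q K X p J"
    and fa: "fst a = x" "fst (snd a) = y" and n: "nat_trans Y X (fst x) (fst y) (snd (snd a))"
    and c: "\<And>z. z \<in> Obj Y \<Longrightarrow> Comp E (snd y z) (FArr p (snd (snd a) z)) = snd x z"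
    using a by (auto simp: hom_fib_cart_cov)
  interpret p: cat_functor X E p by (rule fib_cart_cov_objD[OF x])
  note nt = nat_transD(3-5)[OF n] and inv = inverse_arr[OF i]
  let ?\<tau> = "\<lambda>z\<in>Obj Y. inverse_arr X (snd (snd a) z)"
  have n': "nat_trans Y X (fst y) (fst x) ?\<tau>" using nat_isoD(1)[OF nat_iso_inverse[OF nat_isoI[OF n i]]] .
  have "Comp E (snd x z) (FArr p (inverse_arr X (snd (snd a) z))) = snd y z" if z: "z \<in> Obj Y" for z
  proof -
    have "Comp E (snd x z) (FArr p (inverse_arr X (snd (snd a) z))) =
      Comp E (snd y z) (Comp E (FArr p (snd (snd a) z)) (FArr p (inverse_arr X (snd (snd a) z))))"
      unfolding c[OF z, symmetric]
      using z nt inv nat_transD(3-5)[OF nat_isoD(1)[OF fib_cart_cov_objD(2)[OF y]] z] by (simp add: p.D.assoc)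
    then show ?thesis
      using z nt p.iso_FArr(3)[OF i[OF z]] nat_transD(3-5)[OF nat_isoD(1)[OF fib_cart_cov_objD(2)[OF y]] z] by simp
  qed
  then have b: "(y, x, ?\<tau>) \<in> hom (fib_cart_cov E Y q K X p J) y x"
    using x y n' by (simp add: hom_fib_cart_cov)
  show ?thesis
    by (rule iso_arrI[OF a b]) (use nt inv fa in \<open>auto intro!: restrict_ext\<close>)
qed

lemma (in category) epimorphic_Id: "x \<in> Obj C \<Longrightarrow> epimorphic_family C x {Id C x}"
  unfolding epimorphic_family_def by (simp add: hom_iff) (metis Comp_Id_arr)

lemma terminal_iso:
  assumes "category C" "terminal C t" "i \<in> hom C d t" "iso_arr C i"
  shows "terminal C d"
proof -
  interpret category C by fact
  note j = inverse_arr[OF assms(4)]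
  have i: "i \<in> Arr C" "Dom C i = d" "Cod C i = t" using assms(3) by (auto simp: hom_iff)
  show ?thesis
    unfolding terminal_def
  proof (intro conjI ballI)
    show "d \<in> Obj C" using i by auto
    fix x assume x: "x \<in> Obj C"
    obtain u where u: "u \<in> hom C x t" using terminal_ex[OF assms(2) x] by blast
    show "\<exists>!u. u \<in> hom C x d"
    proof (rule ex1I[of _ "Comp C (inverse_arr C i) u"])
      show "Comp C (inverse_arr C i) u \<in> hom C x d" using u i j by (simp add: hom_iff)
      fix v assume v: "v \<in> hom C x d"
      have "Comp C i v = u" using u v i x by (intro terminal_unique[OF assms(2)]) (auto simp: hom_iff)
      then show "v = Comp C (inverse_arr C i) u" using v i assms(4) by (auto simp: hom_iff Comp_inverse_cancel)
    qed
  qed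
qed

text \<open>Fixes one object of the target of the comparison functor; the exactness of the toposes
  is recorded in the last four assumptions.\<close>

locale fib_object = slice_comparison E F F' f f'
  for E :: "('oe, 'ae) cat" and F :: "('of, 'af) cat" and F' :: "('og, 'ag) cat"
    and f :: "('of, 'af, 'oe, 'ae) geom" and f' :: "('og, 'ag, 'oe, 'ae) geom" +
  fixes A :: "(('og, 'ag, 'oe) comma_obj, ('og, 'ag, 'oe, 'ae) comma_arr,
     ('of, 'af, 'oe) comma_obj, ('of, 'af, 'oe, 'ae) comma_arr) fctr"
    and \<theta> :: "('og, 'ag, 'oe) comma_obj \<Rightarrow> 'ae" and t :: 'oe
  assumes obj: "(A, \<theta>) \<in> fib_cart_cov_obj E (comma_cat F' E (inv_im f')) comma_right (relative_topology F' E f')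
      (comma_cat F E (inv_im f)) comma_right (relative_topology F E f)"
    and t: "terminal E t" and pbE: "has_pullbacks E" and pbF': "has_pullbacks F'"
    and eff: "effective_families F"
begin

abbreviation lf :: "'x \<times> 'y \<times> 'a \<times> 'b \<Rightarrow> 'a" where "lf a \<equiv> fst (snd (snd a))"
abbreviation rg :: "'x \<times> 'y \<times> 'a \<times> 'b \<Rightarrow> 'b" where "rg a \<equiv> snd (snd (snd a))"
abbreviation f_inv where "f_inv \<equiv> inv_im f"
abbreviation f'_inv where "f'_inv \<equiv> inv_im f'"

lemmas objD = fib_cart_cov_objD[OF obj, simplified]

sublocale A: cat_functor Y.X X.X A by (rule objD)

lemma \<theta>: "y \<in> Obj Y.X \<Longrightarrow> \<theta> y \<in> Arr E" "y \<in> Obj Y.X \<Longrightarrow> Dom E (\<theta> y) = fst (snd (FObj A y))"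
  "y \<in> Obj Y.X \<Longrightarrow> Cod E (\<theta> y) = fst (snd y)" "y \<in> Obj Y.X \<Longrightarrow> iso_arr E (\<theta> y)"
  using nat_transD(3-5)[OF nat_isoD(1)[OF objD(2)]] nat_isoD(2)[OF objD(2)] by auto

lemma \<theta>_nat: "k \<in> Arr Y.X \<Longrightarrow> Comp E (\<theta> (fst (snd k))) (rg (FArr A k)) = Comp E (rg k) (\<theta> (fst k))"
  using nat_transD(6)[OF nat_isoD(1)[OF objD(2)], of k] by simp

lemma AO:
  assumes "y \<in> Obj Y.X"
  shows "fst (FObj A y) \<in> Obj F" "fst (snd (FObj A y)) \<in> Obj E" "snd (snd (FObj A y)) \<in> Arr F"
    "Dom F (snd (snd (FObj A y))) = fst (FObj A y)" "Cod F (snd (snd (FObj A y))) = FObj f_inv (fst (snd (FObj A y)))"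
  using A.FObj_in[OF assms] by (auto simp: Obj_comma hF)

lemma YO:
  assumes "y \<in> Obj Y.X"
  shows "fst y \<in> Obj F'" "fst (snd y) \<in> Obj E" "snd (snd y) \<in> Arr F'"
    "Dom F' (snd (snd y)) = fst y" "Cod F' (snd (snd y)) = FObj f'_inv (fst (snd y))"
  using assms by (auto simp: Obj_comma hF')

lemma YA:
  assumes "k \<in> Arr Y.X"
  shows "fst k \<in> Obj Y.X" "fst (snd k) \<in> Obj Y.X" "lf k \<in> Arr F'" "Dom F' (lf k) = fst (fst k)"
    "Cod F' (lf k) = fst (fst (snd k))" "rg k \<in> Arr E" "Dom E (rg k) = fst (snd (fst k))"
    "Cod E (rg k) = fst (snd (fst (snd k)))"
    "Comp F' (snd (snd (fst (snd k)))) (lf k) = Comp F' (FArr f'_inv (rg k)) (snd (snd (fst k)))"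
  using assms by (auto simp: Arr_comma hF' hE)

lemma AA:
  assumes "k \<in> Arr Y.X"
  shows "FArr A k \<in> Arr X.X" "fst (FArr A k) = FObj A (fst k)" "fst (snd (FArr A k)) = FObj A (fst (snd k))"
    "lf (FArr A k) \<in> Arr F" "Dom F (lf (FArr A k)) = fst (FObj A (fst k))" "Cod F (lf (FArr A k)) = fst (FObj A (fst (snd k)))"
    "rg (FArr A k) \<in> Arr E" "Dom E (rg (FArr A k)) = fst (snd (FObj A (fst k)))"
    "Cod E (rg (FArr A k)) = fst (snd (FObj A (fst (snd k))))"
    "Comp F (snd (snd (FObj A (fst (snd k))))) (lf (FArr A k)) = Comp F (FArr f_inv (rg (FArr A k))) (snd (snd (FObj A (fst k))))"
proof -
  show 1: "FArr A k \<in> Arr X.X" "fst (FArr A k) = FObj A (fst k)" "fst (snd (FArr A k)) = FObj A (fst (snd k))"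
    using A.FArr_arr[OF assms] by auto
  show "lf (FArr A k) \<in> Arr F" "Dom F (lf (FArr A k)) = fst (FObj A (fst k))" "Cod F (lf (FArr A k)) = fst (FObj A (fst (snd k)))"
    "rg (FArr A k) \<in> Arr E" "Dom E (rg (FArr A k)) = fst (snd (FObj A (fst k)))"
    "Cod E (rg (FArr A k)) = fst (snd (FObj A (fst (snd k))))"
    "Comp F (snd (snd (FObj A (fst (snd k))))) (lf (FArr A k)) = Comp F (FArr f_inv (rg (FArr A k))) (snd (snd (FObj A (fst k))))"
    using 1(1)[unfolded Arr_comma] 1(2,3) by (auto simp: hF hE)
qed

lemma A_Comp:
  assumes "j \<in> Arr Y.X" "k \<in> Arr Y.X" "fst (snd j) = fst k" "Comp Y.X k j = l"
  shows "FArr A l = Comp X.X (FArr A k) (FArr A j)" "lf (FArr A l) = Comp F (lf (FArr A k)) (lf (FArr A j))"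
proof -
  show 1: "FArr A l = Comp X.X (FArr A k) (FArr A j)"
    unfolding assms(4)[symmetric] by (rule A.FArr_Comp_arr) (use assms in auto)
  show "lf (FArr A l) = Comp F (lf (FArr A k)) (lf (FArr A j))" unfolding 1 by simp
qed

lemma A_square:
  assumes "j \<in> Arr Y.X" "k \<in> Arr Y.X" "fst (snd j) = fst k" "j' \<in> Arr Y.X" "k' \<in> Arr Y.X" "fst (snd j') = fst k'"
    "Comp Y.X k j = Comp Y.X k' j'"
  shows "Comp F (lf (FArr A k)) (lf (FArr A j)) = Comp F (lf (FArr A k')) (lf (FArr A j'))"
  using A_Comp(2)[OF assms(1-3) assms(7)] A_Comp(2)[OF assms(4-6) refl] by simp

lemma tO: "t \<in> Obj E" using t by (simp add: terminal_def)

lemma term_F': "terminal F' (FObj f'_inv t)"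
  by (rule preserves_terminal[OF geometric_morphismD(7)[OF f'] Y.C.category_axioms Y.D.category_axioms t])

lemma term_F: "terminal E s \<Longrightarrow> terminal F (FObj f_inv s)"
  by (rule preserves_terminal[OF geometric_morphismD(7)[OF f] Y.C.category_axioms X.D.category_axioms])

definition bang where "bang c = (SOME u. u \<in> hom F' c (FObj f'_inv t))"
definition bangE where "bangE e = (SOME u. u \<in> hom E e t)"
definition top where "top c = (c, t, bang c)"
definition toparr where "toparr u = (top (Dom F' u), top (Cod F' u), (u, Id E t))"

lemma bang: "c \<in> Obj F' \<Longrightarrow> bang c \<in> Arr F'" "c \<in> Obj F' \<Longrightarrow> Dom F' (bang c) = c"
  "c \<in> Obj F' \<Longrightarrow> Cod F' (bang c) = FObj f'_inv t"
  using someI_ex[OF terminal_ex[OF term_F', of c]] by (auto simp: bang_def hF')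

lemma bangE: "c \<in> Obj E \<Longrightarrow> bangE c \<in> Arr E" "c \<in> Obj E \<Longrightarrow> Dom E (bangE c) = c" "c \<in> Obj E \<Longrightarrow> Cod E (bangE c) = t"
  using someI_ex[OF terminal_ex[OF t, of c]] by (auto simp: bangE_def hE)

lemma bang_unique: "u \<in> Arr F' \<Longrightarrow> v \<in> Arr F' \<Longrightarrow> Dom F' u = Dom F' v \<Longrightarrow> Cod F' u = FObj f'_inv t \<Longrightarrow>
  Cod F' v = FObj f'_inv t \<Longrightarrow> u = v"
  by (rule terminal_unique[OF term_F']) auto

lemma bangE_unique: "u \<in> Arr E \<Longrightarrow> v \<in> Arr E \<Longrightarrow> Dom E u = Dom E v \<Longrightarrow> Cod E u = t \<Longrightarrow> Cod E v = t \<Longrightarrow> u = v"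
  by (rule terminal_unique[OF t]) auto

lemma top_simps [simp]: "fst (top c) = c" "fst (snd (top c)) = t" "snd (snd (top c)) = bang c"
  by (simp_all add: top_def)

lemma toparr_simps [simp]: "fst (toparr u) = top (Dom F' u)" "fst (snd (toparr u)) = top (Cod F' u)"
  "lf (toparr u) = u" "rg (toparr u) = Id E t"
  by (simp_all add: toparr_def)

lemma top: "c \<in> Obj F' \<Longrightarrow> top c \<in> Obj Y.X"
  using tO bang by (simp add: Obj_comma hF')

lemma toparr: "u \<in> Arr F' \<Longrightarrow> toparr u \<in> Arr Y.X"
  using top tO bang bang_unique[of "Comp F' (bang (Cod F' u)) u" "bang (Dom F' u)"] by (simp add: Arr_comma hF' hE)

section \<open>Restriction to the fibre over the terminal object\<close>

definition into_fibre where "into_fibre = \<lparr>FObj = top, FArr = toparr\<rparr>"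

definition from_ess_fibre where
  "from_ess_fibre = \<lparr>FObj = (\<lambda>x. fst (fst x)), FArr = (\<lambda>a. lf (snd (snd a)))\<rparr>"

lemma into_fibre_simps [simp]: "FObj into_fibre = top" "FArr into_fibre = toparr"
  by (simp_all add: into_fibre_def)

lemma from_ess_fibre_simps [simp]: "FObj from_ess_fibre x = fst (fst x)" "FArr from_ess_fibre a = lf (snd (snd a))"
  by (simp_all add: from_ess_fibre_def)

text \<open>As \<open>f'_inv\<close> preserves the terminal object, the slice over its value at
  \<open>t\<close> is a copy of \<open>F'\<close>, and every object of the fibre is even equal to
  some \<open>top c\<close>.\<close>

lemma into_fibre: "weak_equivalence F' (fibre Y.X E comma_right t) into_fibre"
  unfolding weak_equivalence_def
proof (intro conjI ballI allI)
  let ?Y = "fibre Y.X E comma_right t"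
  show "cat_functor F' ?Y into_fibre"
    by (intro cat_functor.intro Y.D.category_axioms category_fibre[OF Y.cat_functor_right tO] cat_functor_axioms.intro)
      (use top toparr tO in \<open>auto simp: Obj_fibre hom_fibre hF' hom_iff[of _ Y.X] prod_eq_iff\<close>)
  show "inj_on (FArr into_fibre) (hom F' x y)" for x y
    by (rule inj_onI) (auto simp: toparr_def)
  show "\<exists>u \<in> hom F' x y. FArr into_fibre u = b" if "x \<in> Obj F'" "y \<in> Obj F'" "b \<in> hom ?Y (FObj into_fibre x) (FObj into_fibre y)" for x y b
    using that by (intro bexI[of _ "lf b"] comma_arr_eqI) (auto simp: hom_fibre hom_comma hF')
  show "\<exists>c \<in> Obj F'. \<exists>i \<in> hom ?Y (FObj into_fibre c) d. iso_arr ?Y i" if d: "d \<in> Obj ?Y" for d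
  proof (intro bexI)
    interpret Y': category ?Y by (rule category_fibre[OF Y.cat_functor_right tO])
    have dY: "d \<in> Obj Y.X" "fst (snd d) = t" using d by (auto simp: Obj_fibre)
    note dD = YO[OF dY(1)]
    have "snd (snd d) = bang (fst d)" using dD dY bang by (intro bang_unique) auto
    then have eq: "FObj into_fibre (fst d) = d" using dY(2) by (simp add: prod_eq_iff)
    show "fst d \<in> Obj F'" by fact
    show "iso_arr ?Y (Id ?Y d)" by (rule Y'.iso_Id[OF d])
    show "Id ?Y d \<in> hom ?Y (FObj into_fibre (fst d)) d" unfolding eq by (rule Y'.Id_in_hom[OF d])
  qed
qed

text \<open>An object over \<open>t\<close> up to isomorphism lies over a terminal object, whose
  inverse image is terminal too; its structure arrow and the right parts of arrows into it are
  therefore uniquely determined.\<close>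

lemma from_ess_fibre: "weak_equivalence (ess_fibre X.X E comma_right t) F from_ess_fibre"
  unfolding weak_equivalence_def
proof (intro conjI ballI allI)
  let ?X = "ess_fibre X.X E comma_right t"
  have Arr: "a \<in> Arr ?X \<longleftrightarrow> a \<in> hom ?X (fst a) (fst (snd a))" for a by (rule Arr_ess_fibre)
  show "cat_functor ?X F from_ess_fibre"
    by (intro cat_functor.intro X.D.category_axioms category_ess_fibre[OF X.cat_functor_right] cat_functor_axioms.intro)
      (auto simp: Obj_ess_fibre hom_ess_fibre hom_comma Obj_comma)
  have tm: "terminal E (fst (snd (fst x)))" if "x \<in> Obj ?X" for x
    using that by (intro terminal_iso[OF Y.C.category_axioms t]) (auto simp: Obj_ess_fibre)
  show "inj_on (FArr from_ess_fibre) (hom ?X x y)" for x y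
  proof (rule inj_onI)
    fix a b assume a: "a \<in> hom ?X x y" and b: "b \<in> hom ?X x y" and eq: "FArr from_ess_fibre a = FArr from_ess_fibre b"
    have y: "y \<in> Obj ?X" using a by (auto simp: hom_ess_fibre)
    have "rg (snd (snd a)) = rg (snd (snd b))"
      using a b by (intro terminal_unique[OF tm[OF y]]) (auto simp: hom_ess_fibre hom_comma hE Obj_comma)
    then show "a = b" using a b eq by (auto simp: hom_ess_fibre hom_comma prod_eq_iff)
  qed
  show "\<exists>a \<in> hom ?X x y. FArr from_ess_fibre a = b"
    if x: "x \<in> Obj ?X" and y: "y \<in> Obj ?X" and b: "b \<in> hom F (FObj from_ess_fibre x) (FObj from_ess_fibre y)" for x y b
  proof -
    have xD: "fst x \<in> Obj X.X" "snd x \<in> hom E (fst (snd (fst x))) t" and yD: "fst y \<in> Obj X.X" "snd y \<in> hom E (fst (snd (fst y))) t"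
      using x y by (auto simp: Obj_ess_fibre)
    obtain v where v: "v \<in> hom E (fst (snd (fst x))) (fst (snd (fst y)))"
      using terminal_ex[OF tm[OF y], of "fst (snd (fst x))"] xD by (auto simp: Obj_comma)
    have "Comp F (snd (snd (fst y))) b = Comp F (FArr f_inv v) (snd (snd (fst x)))"
      using xD yD b v by (intro terminal_unique[OF term_F[OF tm[OF y]]]) (auto simp: Obj_comma hF hE)
    moreover have "Comp E (snd y) v = snd x"
      using xD yD v by (intro bangE_unique) (auto simp: hE)
    ultimately have "(x, y, (fst x, fst y, (b, v))) \<in> hom ?X x y"
      using x y xD yD b v by (simp add: hom_ess_fibre hom_comma)
    then show ?thesis by (rule bexI[rotated]) simp
  qed
  show "\<exists>c \<in> Obj ?X. \<exists>i \<in> hom F (FObj from_ess_fibre c) d. iso_arr F i" if d: "d \<in> Obj F" for d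
  proof -
    obtain u where u: "u \<in> hom F d (FObj f_inv t)" using terminal_ex[OF term_F[OF t] d] by blast
    have "((d, t, u), Id E t) \<in> Obj ?X" using u d tO by (simp add: Obj_ess_fibre Obj_comma hE Y.C.iso_Id)
    then show ?thesis by (rule bexI[rotated]) (use d X.D.iso_Id[OF d] X.D.Id_in_hom[OF d] in auto)
  qed
qed

text \<open>Written as a composite through the fibres over \<open>t\<close>, so that left exactness
  follows from the left exactness of the three factors.\<close>

definition G where "G = from_ess_fibre \<circ>\<^sub>F (fibre_fctr Y.X A \<theta> \<circ>\<^sub>F into_fibre)"

lemma G_simps [simp]: "FObj G c = fst (FObj A (top c))" "FArr G u = lf (FArr A (toparr u))"
  by (simp_all add: G_def)

lemma cat_functor_fibre_A: "e \<in> Obj E \<Longrightarrow>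
  cat_functor (fibre Y.X E comma_right e) (ess_fibre X.X E comma_right e) (fibre_fctr Y.X A \<theta>)"
  by (rule cat_functor_fibre_fctr[OF A.cat_functor_axioms Y.cat_functor_right X.cat_functor_right objD(2)])

lemma cat_functor_G: "cat_functor F' F G"
  unfolding G_def
  by (rule cat_functor_comp[OF cat_functor_comp[OF weak_equivalenceD(1)[OF into_fibre] cat_functor_fibre_A[OF tO]]
     weak_equivalenceD(1)[OF from_ess_fibre]])

sublocale G: cat_functor F' F G by (rule cat_functor_G)

lemma G_lex: "preserves_finite_limits F' F G"
  unfolding G_def
  by (rule preserves_finite_limits_comp[OF preserves_finite_limits_comp[OF
        weak_equivalence_preserves_finite_limits[OF into_fibre] objD(6)[OF tO]]
      weak_equivalence_preserves_finite_limits[OF from_ess_fibre]])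

text \<open>Cover preservation read on left parts, the form in which it is applied below.\<close>

lemma A_epimorphic:
  assumes y: "y \<in> Obj Y.X" and S: "\<And>k. k \<in> S \<Longrightarrow> k \<in> Arr Y.X" "\<And>k. k \<in> S \<Longrightarrow> fst (snd k) = y"
    and epi: "epimorphic_family F' (fst y) (lf ` S)"
  shows "epimorphic_family F (fst (FObj A y)) ((\<lambda>k. lf (FArr A k)) ` S)"
proof -
  have im: "FArr comma_left ` S = lf ` S" for S :: "('og, 'ag, 'oe, 'ae) comma_arr set" by auto
  have im': "FArr comma_left ` S = lf ` S" for S :: "('of, 'af, 'oe, 'ae) comma_arr set" by auto
  have "relative_topology F' E f' y S"
    using y S epi by (auto simp: relative_topology_def Let_def im)
  then have "relative_topology F E f (FObj A y) (FArr A ` S)"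
    using objD(7) unfolding cover_preserving_def by blast
  then show ?thesis by (simp add: relative_topology_def Let_def image_image)
qed

lemma G_epimorphic: "preserves_epimorphic F' F G"
  unfolding preserves_epimorphic_def
proof (intro allI impI)
  fix c S assume epi: "epimorphic_family F' c S"
  then have c: "c \<in> Obj F'" and S: "\<And>u. u \<in> S \<Longrightarrow> u \<in> Arr F'" "\<And>u. u \<in> S \<Longrightarrow> Cod F' u = c"
    by (auto simp: epimorphic_family_def)
  have "epimorphic_family F (fst (FObj A (top c))) ((\<lambda>k. lf (FArr A k)) ` toparr ` S)"
    by (rule A_epimorphic) (use c S epi top toparr in \<open>auto simp: image_image\<close>)
  then show "epimorphic_family F (FObj G c) (FArr G ` S)" by (simp add: image_image)
qed

section \<open>Comparison of the left part of \<open>A\<close> with \<open>G\<close>\<close>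

definition bar where "bar y = (y, top (fst y), (Id F' (fst y), bangE (fst (snd y))))"

lemma bar_simps [simp]: "fst (bar y) = y" "fst (snd (bar y)) = top (fst y)" "lf (bar y) = Id F' (fst y)"
  "rg (bar y) = bangE (fst (snd y))"
  by (simp_all add: bar_def)

lemma bar: "y \<in> Obj Y.X \<Longrightarrow> bar y \<in> Arr Y.X"
  using top[of "fst y"] YO[of y] bang[of "fst y"] bangE[of "fst (snd y)"]
    bang_unique[of "bang (fst y)" "Comp F' (FArr f'_inv (bangE (fst (snd y)))) (snd (snd y))"]
  by (simp add: Arr_comma hF' hE)

text \<open>The arrow from the left part of \<open>FObj A y\<close> to the value of \<open>G\<close>
  at the left part of \<open>y\<close>. Its invertibility will say that, up to isomorphism, the left
  part of \<open>FObj A y\<close> depends only on the left part of \<open>y\<close>.\<close>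

definition m where "m y = lf (FArr A (bar y))"

lemma m: "y \<in> Obj Y.X \<Longrightarrow> m y \<in> Arr F" "y \<in> Obj Y.X \<Longrightarrow> Dom F (m y) = fst (FObj A y)"
  "y \<in> Obj Y.X \<Longrightarrow> Cod F (m y) = FObj G (fst y)"
  using AA[OF bar] by (auto simp: m_def)

text \<open>The arrows \<open>bar\<close> form commuting squares already before applying
  \<open>A\<close>: both composites have the same left part, and their right parts agree because
  they end in the terminal object.\<close>

lemma m_natural:
  assumes k: "k \<in> Arr Y.X"
  shows "Comp F (m (fst (snd k))) (lf (FArr A k)) = Comp F (FArr G (lf k)) (m (fst k))"
  unfolding m_def G_simps
proof (rule A_square)
  note kD = YA[OF k]
  show "Comp Y.X (bar (fst (snd k))) k = Comp Y.X (toparr (lf k)) (bar (fst k))"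
    using kD YO[OF kD(1)] YO[OF kD(2)] bangE tO
    by (auto simp: prod_eq_iff intro!: bangE_unique)
qed (use YA[OF k] k bar toparr in auto)

lemma m_epi:
  assumes y: "y \<in> Obj Y.X"
  shows "epimorphic_family F (FObj G (fst y)) {m y}"
proof -
  have "epimorphic_family F' (fst y) {Id F' (fst y)}"
    by (rule Y.D.epimorphic_Id[OF YO(1)[OF y]])
  then have "epimorphic_family F (fst (FObj A (top (fst y)))) ((\<lambda>k. lf (FArr A k)) ` {bar y})"
    by (intro A_epimorphic) (use YO[OF y] top bar[OF y] in auto)
  then show ?thesis by (simp add: m_def)
qed

end

section \<open>Monicity of the comparison arrow\<close>

context fib_object begin

text \<open>An arrow whose square is a pullback is cartesian, hence so is its image under
  \<open>A\<close>. Existence and uniqueness of factorisations are separated because they are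
  applied to different arrows.\<close>

lemma A_cartesian:
  assumes k: "k \<in> Arr Y.X" and pb: "pullback F' (FArr f'_inv (rg k)) (snd (snd (fst (snd k)))) (snd (snd (fst k))) (lf k)"
    and b: "b \<in> hom X.X z (FObj A (fst (snd k)))" and e: "e \<in> hom E (fst (snd z)) (fst (snd (FObj A (fst k))))"
    and eq: "Comp E (rg (FArr A k)) e = rg b"
  shows "\<exists>c \<in> hom X.X z (FObj A (fst k)). Comp X.X (FArr A k) c = b \<and> rg c = e"
    and "\<And>c c'. c \<in> hom X.X z (FObj A (fst k)) \<Longrightarrow> c' \<in> hom X.X z (FObj A (fst k)) \<Longrightarrow>
      Comp X.X (FArr A k) c = b \<Longrightarrow> Comp X.X (FArr A k) c' = b \<Longrightarrow> rg c = e \<Longrightarrow> rg c' = e \<Longrightarrow> c = c'"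
proof -
  have "cartesian_arr Y.X E comma_right k" using k pb by (simp add: Y.cartesian_comma_iff)
  then have c: "cartesian_arr X.X E comma_right (FArr A k)" by (rule objD(5))
  have bA: "b \<in> Arr X.X" "fst b = z" "fst (snd b) = FObj A (fst (snd k))" using b by (auto simp: hom_iff[of _ X.X])
  have "\<exists>!c. c \<in> hom X.X (Dom X.X b) (Dom X.X (FArr A k)) \<and> Comp X.X (FArr A k) c = b \<and> FArr comma_right c = e"
    by (rule c[unfolded cartesian_arr_def, THEN conjunct2, rule_format])
      (intro conjI; use bA AA[OF k] e eq in simp)
  then have ex: "\<exists>!c. c \<in> hom X.X z (FObj A (fst k)) \<and> Comp X.X (FArr A k) c = b \<and> rg c = e"
    using bA AA[OF k] by simp
  then obtain c where c: "c \<in> hom X.X z (FObj A (fst k)) \<and> Comp X.X (FArr A k) c = b \<and> rg c = e"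
    and u: "\<And>c'. c' \<in> hom X.X z (FObj A (fst k)) \<and> Comp X.X (FArr A k) c' = b \<and> rg c' = e \<Longrightarrow> c' = c"
    by (rule ex1_obtain) (rule that)
  show "\<exists>c \<in> hom X.X z (FObj A (fst k)). Comp X.X (FArr A k) c = b \<and> rg c = e" using c by blast
  show "\<And>c c'. c \<in> hom X.X z (FObj A (fst k)) \<Longrightarrow> c' \<in> hom X.X z (FObj A (fst k)) \<Longrightarrow>
      Comp X.X (FArr A k) c = b \<Longrightarrow> Comp X.X (FArr A k) c' = b \<Longrightarrow> rg c = e \<Longrightarrow> rg c' = e \<Longrightarrow> c = c'"
    using u by metis
qed

text \<open>The square with vertex \<open>W = (x, e \<times> e, (\<alpha>, \<alpha>))\<close> below is the pullback of \<open>(x, e, \<alpha>)\<close> with itself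
  over \<open>(x, 1, !)\<close>.  Pulling everything back to \<open>e \<times> e\<close>, it lies in a fibre, so \<open>A\<close> preserves
  it.  As the diagonal of \<open>(x, e, \<alpha>)\<close> into \<open>W\<close> is covering, the two projections from \<open>W\<close> have the
  same left component after applying \<open>A\<close>.\<close>

lemma m_mono:
  assumes y: "y \<in> Obj Y.X" and a: "a \<in> Arr F" "Dom F a = z" "Cod F a = fst (FObj A y)"
    and b: "b \<in> Arr F" "Dom F b = z" "Cod F b = fst (FObj A y)" and ab: "Comp F (m y) a = Comp F (m y) b"
  shows "a = b"
proof -
  note yD = YO[OF y]
  define x e \<alpha> where "x = fst y" and "e = fst (snd y)" and "\<alpha> = snd (snd y)"
  have x: "x \<in> Obj F'" and e: "e \<in> Obj E" and \<alpha>: "\<alpha> \<in> Arr F'" "Dom F' \<alpha> = x" "Cod F' \<alpha> = FObj f'_inv e"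
    using yD by (auto simp: x_def e_def \<alpha>_def)
  have ys: "fst y = x" "fst (snd y) = e" "snd (snd y) = \<alpha>" by (simp_all add: x_def e_def \<alpha>_def)
  \<comment> \<open>As \<open>t\<close> is terminal, this pullback is the product of
    \<open>e\<close> with itself.\<close>
  obtain p1 p2 where pp: "pullback E (bangE e) (bangE e) p1 p2"
    using pbE bangE[OF e] unfolding has_pullbacks_def by blast
  note pD = pullbackD[OF pp]
  define e2 where "e2 = Dom E p1"
  have p: "p1 \<in> Arr E" "Dom E p1 = e2" "Cod E p1 = e" "p2 \<in> Arr E" "Dom E p2 = e2" "Cod E p2 = e"
    using pD bangE[OF e] by (auto simp: e2_def)
  have e2: "e2 \<in> Obj E" using p by auto
  have f'pp: "pullback F' (FArr f'_inv (bangE e)) (FArr f'_inv (bangE e)) (FArr f'_inv p1) (FArr f'_inv p2)"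
    by (rule preserves_pullback[OF geometric_morphismD(7,1)[OF f'] pp])
  have fpp: "pullback F (FArr f_inv (bangE e)) (FArr f_inv (bangE e)) (FArr f_inv p1) (FArr f_inv p2)"
    by (rule preserves_pullback[OF geometric_morphismD(7,1)[OF f] pp])
  have monic2: "u = v" if "u \<in> Arr F'" "v \<in> Arr F'" "Dom F' u = Dom F' v" "Cod F' u = FObj f'_inv e2" "Cod F' v = FObj f'_inv e2"
    "Comp F' (FArr f'_inv p1) u = Comp F' (FArr f'_inv p1) v" "Comp F' (FArr f'_inv p2) u = Comp F' (FArr f'_inv p2) v" for u v
    by (rule pullback_jointly_monic[OF Y.D.category_axioms f'pp]) (use that p in auto)
  have bb: "Comp E (bangE e) p1 = bangE e2" "Comp E (bangE e) p2 = bangE e2"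
    using p bangE[OF e] bangE[OF e2] by (auto intro!: bangE_unique)
  \<comment> \<open>Cartesian lifts of \<open>y\<close> along \<open>p1\<close> and
    \<open>p2\<close>, and of \<open>top x\<close> along the arrow from \<open>e2\<close> to
    \<open>t\<close>: they bring the two copies of \<open>y\<close> and \<open>top x\<close> into
    the fibre over \<open>e2\<close>.\<close>
  obtain s1 u1 where pb1: "pullback F' (FArr f'_inv p1) \<alpha> s1 u1"
    using pbF' p \<alpha> unfolding has_pullbacks_def by (metis Y.FArr_arr(1,3))
  obtain s2 u2 where pb2: "pullback F' (FArr f'_inv p2) \<alpha> s2 u2"
    using pbF' p \<alpha> unfolding has_pullbacks_def by (metis Y.FArr_arr(1,3))
  obtain \<mu> um where pbm: "pullback F' (FArr f'_inv (bangE e2)) (bang x) \<mu> um"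
    using pbF' bangE[OF e2] bang[OF x] unfolding has_pullbacks_def by (metis Y.FArr_arr(1,3))
  define x1 x2 xm where "x1 = Dom F' s1" and "x2 = Dom F' s2" and "xm = Dom F' \<mu>"
  have l1: "s1 \<in> Arr F'" "Dom F' s1 = x1" "Cod F' s1 = FObj f'_inv e2" "u1 \<in> Arr F'" "Dom F' u1 = x1" "Cod F' u1 = x"
      "Comp F' (FArr f'_inv p1) s1 = Comp F' \<alpha> u1"
    using pullbackD[OF pb1] p \<alpha> by (auto simp: x1_def)
  have l2: "s2 \<in> Arr F'" "Dom F' s2 = x2" "Cod F' s2 = FObj f'_inv e2" "u2 \<in> Arr F'" "Dom F' u2 = x2" "Cod F' u2 = x"
      "Comp F' (FArr f'_inv p2) s2 = Comp F' \<alpha> u2"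
    using pullbackD[OF pb2] p \<alpha> by (auto simp: x2_def)
  have lm: "\<mu> \<in> Arr F'" "Dom F' \<mu> = xm" "Cod F' \<mu> = FObj f'_inv e2" "um \<in> Arr F'" "Dom F' um = xm" "Cod F' um = x"
      "Comp F' (FArr f'_inv (bangE e2)) \<mu> = Comp F' (bang x) um"
    using pullbackD[OF pbm] bangE[OF e2] bang[OF x] by (auto simp: xm_def)
  have xs: "x1 \<in> Obj F'" "x2 \<in> Obj F'" "xm \<in> Obj F'" using l1 l2 lm by auto
  have exn: "\<exists>n. n \<in> Arr F' \<and> Dom F' n = Dom F' s' \<and> Cod F' n = xm \<and> Comp F' \<mu> n = s' \<and> Comp F' um n = u'"
    if h: "s' \<in> Arr F'" "Cod F' s' = FObj f'_inv e2" "u' \<in> Arr F'" "Dom F' u' = Dom F' s'" "Cod F' u' = x" for s' u'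
  proof -
    have "Comp F' (FArr f'_inv (bangE e2)) s' = Comp F' (bang x) u'"
      using h bangE[OF e2] bang[OF x] by (intro bang_unique) auto
    then have "\<exists>!n. n \<in> hom F' (Dom F' s') (Dom F' \<mu>) \<and> Comp F' \<mu> n = s' \<and> Comp F' um n = u'"
      using h bangE[OF e2] bang[OF x] by (intro pullback_ex1[OF pbm]) auto
    then show ?thesis using lm(2) by (auto simp: hF')
  qed
  \<comment> \<open>The left parts of the vertical arrows from the two lifts of \<open>y\<close> to
    the lift of \<open>top x\<close>.\<close>
  obtain n1 where n1: "n1 \<in> Arr F'" "Dom F' n1 = x1" "Cod F' n1 = xm" "Comp F' \<mu> n1 = s1" "Comp F' um n1 = u1"
    using exn[of s1 u1] l1 by auto
  obtain n2 where n2: "n2 \<in> Arr F'" "Dom F' n2 = x2" "Cod F' n2 = xm" "Comp F' \<mu> n2 = s2" "Comp F' um n2 = u2"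
    using exn[of s2 u2] l2 by auto
  \<comment> \<open>The pairing \<delta> of \<alpha> with itself is the structure arrow of
    \<open>W\<close>; then \<open>w1\<close> and \<open>w2\<close> are the left parts of the
    vertical arrows from \<open>W\<close> to the two lifts of \<open>y\<close>.\<close>
  have "\<exists>!h. h \<in> hom F' (Dom F' \<alpha>) (Dom F' (FArr f'_inv p1)) \<and> Comp F' (FArr f'_inv p1) h = \<alpha> \<and> Comp F' (FArr f'_inv p2) h = \<alpha>"
    using \<alpha> bangE[OF e] by (intro pullback_ex1[OF f'pp]) auto
  then obtain \<delta> where \<delta>: "\<delta> \<in> Arr F'" "Dom F' \<delta> = x" "Cod F' \<delta> = FObj f'_inv e2"
    "Comp F' (FArr f'_inv p1) \<delta> = \<alpha>" "Comp F' (FArr f'_inv p2) \<delta> = \<alpha>"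
    using \<alpha> p by (auto simp: hF')
  have "\<exists>!h. h \<in> hom F' (Dom F' \<delta>) (Dom F' s1) \<and> Comp F' s1 h = \<delta> \<and> Comp F' u1 h = Id F' x"
    using \<delta> \<alpha> x p by (intro pullback_ex1[OF pb1]) auto
  then obtain w1 where w1: "w1 \<in> Arr F'" "Dom F' w1 = x" "Cod F' w1 = x1" "Comp F' s1 w1 = \<delta>" "Comp F' u1 w1 = Id F' x"
    using \<delta> l1 by (auto simp: hF')
  have "\<exists>!h. h \<in> hom F' (Dom F' \<delta>) (Dom F' s2) \<and> Comp F' s2 h = \<delta> \<and> Comp F' u2 h = Id F' x"
    using \<delta> \<alpha> x p by (intro pullback_ex1[OF pb2]) auto
  then obtain w2 where w2: "w2 \<in> Arr F'" "Dom F' w2 = x" "Cod F' w2 = x2" "Comp F' s2 w2 = \<delta>" "Comp F' u2 w2 = Id F' x"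
    using \<delta> l2 by (auto simp: hF')
  define L1 L2 M W where "L1 = (x1, e2, s1)" and "L2 = (x2, e2, s2)" and "M = (xm, e2, \<mu>)" and "W = (x, e2, \<delta>)"
  have Ls: "fst L1 = x1" "fst (snd L1) = e2" "snd (snd L1) = s1" "fst L2 = x2" "fst (snd L2) = e2" "snd (snd L2) = s2"
    "fst M = xm" "fst (snd M) = e2" "snd (snd M) = \<mu>" "fst W = x" "fst (snd W) = e2" "snd (snd W) = \<delta>"
    by (simp_all add: L1_def L2_def M_def W_def)
  have LO: "L1 \<in> Obj Y.X" "L2 \<in> Obj Y.X" "M \<in> Obj Y.X" "W \<in> Obj Y.X"
    using l1 l2 lm \<delta> x xs e2 by (auto simp: Obj_comma Ls hF')
  \<comment> \<open>Here \<open>c1\<close>, \<open>c2\<close> and \<open>cM\<close> are cartesian,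
    \<open>N1\<close>, \<open>N2\<close>, \<open>W1\<close> and \<open>W2\<close> are vertical over
    \<open>e2\<close>, \<open>q1\<close> and \<open>q2\<close> are the projections from
    \<open>W\<close> to \<open>y\<close>, and \<open>D\<close> is the diagonal once \<open>d\<close>
    is the diagonal of \<open>e\<close>.\<close>
  define c1 c2 cM N1 N2 W1 W2 q1 q2 D where "c1 = (L1, y, (u1, p1))" and "c2 = (L2, y, (u2, p2))" and "cM = (M, top x, (um, bangE e2))"
    and "N1 = (L1, M, (n1, Id E e2))" and "N2 = (L2, M, (n2, Id E e2))" and "W1 = (W, L1, (w1, Id E e2))" and "W2 = (W, L2, (w2, Id E e2))"
    and "q1 = (W, y, (Id F' x, p1))" and "q2 = (W, y, (Id F' x, p2))"
    and "D = (\<lambda>d :: 'ae. (y, W, (Id F' x, d)))"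
  note defs = c1_def c2_def cM_def N1_def N2_def W1_def W2_def q1_def q2_def
  have cs: "c1 \<in> Arr Y.X" "c2 \<in> Arr Y.X" "cM \<in> Arr Y.X" "N1 \<in> Arr Y.X" "N2 \<in> Arr Y.X" "W1 \<in> Arr Y.X" "W2 \<in> Arr Y.X"
    "q1 \<in> Arr Y.X" "q2 \<in> Arr Y.X"
    unfolding defs Arr_comma
    using LO y top[OF x] l1 l2 lm n1 n2 w1 w2 \<delta> p e2 x \<alpha> bangE[OF e2]
    by (simp_all add: ys Ls hF' hE)
  have "\<exists>!d. d \<in> hom E (Dom E (Id E e)) (Dom E p1) \<and> Comp E p1 d = Id E e \<and> Comp E p2 d = Id E e"
    using e bangE[OF e] by (intro pullback_ex1[OF pp]) auto
  then obtain d where d: "d \<in> Arr E" "Dom E d = e" "Cod E d = e2" "Comp E p1 d = Id E e" "Comp E p2 d = Id E e"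
    using e p by (auto simp: hE)
  have f'd: "Comp F' (FArr f'_inv p1) (FArr f'_inv d) = Id F' (FObj f'_inv e)" "Comp F' (FArr f'_inv p2) (FArr f'_inv d) = Id F' (FObj f'_inv e)"
    using d p e Y.FArr_Comp_arr[of d p1] Y.FArr_Comp_arr[of d p2] by simp_all
  have "\<delta> = Comp F' (FArr f'_inv d) \<alpha>"
    using \<delta> d \<alpha> p f'd by - (rule monic2, simp_all flip: Y.D.assoc)
  then have D: "D d \<in> Arr Y.X"
    unfolding D_def Arr_comma using LO y d x \<delta> \<alpha> by (simp add: ys Ls hF' hE)
  have DD: "fst (D d) = y" "fst (snd (D d)) = W" "lf (D d) = Id F' x" by (simp_all add: D_def)
  have Depi: "epimorphic_family F (fst (FObj A W)) {lf (FArr A (D d))}"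
  proof -
    have "epimorphic_family F' x {Id F' x}"
      by (rule Y.D.epimorphic_Id[OF x])
    then have "epimorphic_family F (fst (FObj A W)) ((\<lambda>k. lf (FArr A k)) ` {D d})"
      by (intro A_epimorphic) (use LO D in \<open>auto simp: DD Ls\<close>)
    then show ?thesis by simp
  qed
  have "Comp Y.X q1 (D d) = Comp Y.X (Id Y.X y) (Id Y.X y)" "Comp Y.X q2 (D d) = Comp Y.X (Id Y.X y) (Id Y.X y)"
    unfolding q1_def q2_def D_def using x e d by (simp_all add: ys)
  then have "Comp Y.X q1 (D d) = Comp Y.X q2 (D d)" by simp
  then have "Comp F (lf (FArr A q1)) (lf (FArr A (D d))) = Comp F (lf (FArr A q2)) (lf (FArr A (D d)))"
    by (intro A_square) (use cs D in \<open>auto simp: DD q1_def q2_def\<close>)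
  then have q: "lf (FArr A q1) = lf (FArr A q2)"
    using Depi AA(4-6)[OF cs(8)] AA(4-6)[OF cs(9)]
    by - (rule epimorphic_cancel[of F "fst (FObj A W)" id "{lf (FArr A (D d))}" _ "fst (FObj A y)"], auto simp: hF q1_def q2_def)
  have WW: "pullback (fibre Y.X E comma_right e2) N1 N2 W1 W2"
    unfolding pullback_def
  proof (intro conjI allI impI; (elim conjE)?)
    show "{N1, N2, W1, W2} \<subseteq> Arr (fibre Y.X E comma_right e2)"
      using cs by (auto simp: Arr_fibre N1_def N2_def W1_def W2_def Ls)
    have "Comp F' n1 w1 = Comp F' n2 w2"
    proof (rule pullback_jointly_monic[OF Y.D.category_axioms pbm])
      have "Comp F' (Comp F' \<mu> n1) w1 = Comp F' (Comp F' \<mu> n2) w2" "Comp F' (Comp F' um n1) w1 = Comp F' (Comp F' um n2) w2"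
        using n1(4,5) n2(4,5) w1(4,5) w2(4,5) by simp_all
      then show "Comp F' \<mu> (Comp F' n1 w1) = Comp F' \<mu> (Comp F' n2 w2)" "Comp F' um (Comp F' n1 w1) = Comp F' um (Comp F' n2 w2)"
        using n1(1-3) n2(1-3) w1(1-3) w2(1-3) lm(1-6) by (simp_all add: Y.D.assoc)
    qed (use n1(1-3) n2(1-3) w1(1-3) w2(1-3) lm in auto)
    then show "Comp (fibre Y.X E comma_right e2) N1 W1 = Comp (fibre Y.X E comma_right e2) N2 W2"
      using e2 by (simp add: N1_def N2_def W1_def W2_def)
  next
    let ?Y = "fibre Y.X E comma_right e2"
    fix g1 g2 assume g: "g1 \<in> Arr ?Y" "g2 \<in> Arr ?Y" "Dom ?Y g1 = Dom ?Y g2" "Cod ?Y g1 = Dom ?Y N1" "Cod ?Y g2 = Dom ?Y N2"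
      and eq: "Comp ?Y N1 g1 = Comp ?Y N2 g2"
    define V where "V = fst g1"
    have g1: "g1 \<in> Arr Y.X" "fst g1 = V" "fst (snd g1) = L1" "rg g1 = Id E e2" and g2: "g2 \<in> Arr Y.X" "fst g2 = V" "fst (snd g2) = L2" "rg g2 = Id E e2"
      using g by (auto simp: Arr_fibre V_def N1_def N2_def)
    have V: "V \<in> Obj Y.X" "fst (snd V) = e2" using g1 g YA(1)[OF g1(1)] by (auto simp: Arr_fibre)
    define \<nu> where "\<nu> = snd (snd V)"
    have \<nu>: "\<nu> \<in> Arr F'" "Dom F' \<nu> = fst V" "Cod F' \<nu> = FObj f'_inv e2" using YO[OF V(1)] V(2) by (auto simp: \<nu>_def)
    have g1': "lf g1 \<in> Arr F'" "Dom F' (lf g1) = fst V" "Cod F' (lf g1) = x1" "Comp F' s1 (lf g1) = \<nu>"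
      using YA[OF g1(1)] g1 e2 \<nu> by (auto simp: Ls simp flip: \<nu>_def)
    have g2': "lf g2 \<in> Arr F'" "Dom F' (lf g2) = fst V" "Cod F' (lf g2) = x2" "Comp F' s2 (lf g2) = \<nu>"
      using YA[OF g2(1)] g2 e2 \<nu> by (auto simp: Ls simp flip: \<nu>_def)
    have ng: "Comp F' n1 (lf g1) = Comp F' n2 (lf g2)" using eq by (simp add: N1_def N2_def)
    \<comment> \<open>Equality after \<open>N1\<close> and \<open>N2\<close> makes \<open>u1\<close>
      and \<open>u2\<close> agree on the pair; their common value, an arrow to \<open>x\<close>, is
      the left part of the mediating arrow.\<close>
    define k where "k = Comp F' u1 (lf g1)"
    have k: "k \<in> Arr F'" "Dom F' k = fst V" "Cod F' k = x" using g1' l1 by (auto simp: k_def)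
    have k2: "k = Comp F' u2 (lf g2)"
    proof -
      have "Comp F' u1 (lf g1) = Comp F' um (Comp F' n1 (lf g1))"
        unfolding n1(5)[symmetric] using n1(1-3) lm(4-6) g1' by (simp add: Y.D.assoc)
      also have "\<dots> = Comp F' u2 (lf g2)"
        unfolding ng n2(5)[symmetric] using n2(1-3) lm(4-6) g2' by (simp add: Y.D.assoc)
      finally show ?thesis by (simp add: k_def)
    qed
    have \<delta>k: "Comp F' \<delta> k = \<nu>"
    proof (rule monic2)
      have "Comp F' (FArr f'_inv p1) (Comp F' \<delta> k) = Comp F' (Comp F' (FArr f'_inv p1) \<delta>) k"
        using k \<delta>(1-3) p by (simp add: Y.D.assoc)
      also have "\<dots> = Comp F' (Comp F' \<alpha> u1) (lf g1)" unfolding \<delta>(4) k_def using \<alpha> l1(4-6) g1'(1-3) by (simp add: Y.D.assoc)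
      also have "\<dots> = Comp F' (FArr f'_inv p1) (Comp F' s1 (lf g1))"
        unfolding l1(7)[symmetric] using p l1(1-3) g1'(1-3) by (simp add: Y.D.assoc)
      finally show "Comp F' (FArr f'_inv p1) (Comp F' \<delta> k) = Comp F' (FArr f'_inv p1) \<nu>" unfolding g1'(4) .
      have "Comp F' (FArr f'_inv p2) (Comp F' \<delta> k) = Comp F' (Comp F' (FArr f'_inv p2) \<delta>) k"
        using k \<delta>(1-3) p by (simp add: Y.D.assoc)
      also have "\<dots> = Comp F' (Comp F' \<alpha> u2) (lf g2)" unfolding \<delta>(5) k2 using \<alpha> l2(4-6) g2'(1-3) by (simp add: Y.D.assoc)
      also have "\<dots> = Comp F' (FArr f'_inv p2) (Comp F' s2 (lf g2))"
        unfolding l2(7)[symmetric] using p l2(1-3) g2'(1-3) by (simp add: Y.D.assoc)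
      finally show "Comp F' (FArr f'_inv p2) (Comp F' \<delta> k) = Comp F' (FArr f'_inv p2) \<nu>" unfolding g2'(4) .
    qed (use k \<delta> \<nu> in auto)
    have wk1: "Comp F' w1 k = lf g1"
    proof (rule pullback_jointly_monic[OF Y.D.category_axioms pb1])
      have "Comp F' (Comp F' s1 w1) k = Comp F' s1 (lf g1)" "Comp F' (Comp F' u1 w1) k = Comp F' u1 (lf g1)"
        using w1(4,5) \<delta>k g1'(4) k k_def by simp_all
      then show "Comp F' s1 (Comp F' w1 k) = Comp F' s1 (lf g1)" "Comp F' u1 (Comp F' w1 k) = Comp F' u1 (lf g1)"
        using w1(1-3) k l1(1-6) by (simp_all add: Y.D.assoc)
    qed (use w1(1-3) k g1' l1 in auto)
    have wk2: "Comp F' w2 k = lf g2"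
    proof (rule pullback_jointly_monic[OF Y.D.category_axioms pb2])
      have "Comp F' (Comp F' s2 w2) k = Comp F' s2 (lf g2)" "Comp F' (Comp F' u2 w2) k = Comp F' u2 (lf g2)"
        using w2(4,5) \<delta>k g2'(4) k k2 by simp_all
      then show "Comp F' s2 (Comp F' w2 k) = Comp F' s2 (lf g2)" "Comp F' u2 (Comp F' w2 k) = Comp F' u2 (lf g2)"
        using w2(1-3) k l2(1-6) by (simp_all add: Y.D.assoc)
    qed (use w2(1-3) k g2' l2 in auto)
    show "\<exists>!h. h \<in> hom ?Y (Dom ?Y g1) (Dom ?Y W1) \<and> Comp ?Y W1 h = g1 \<and> Comp ?Y W2 h = g2"
    proof (rule ex1I[of _ "(V, W, (k, Id E e2))"])
      have "(V, W, (k, Id E e2)) \<in> hom ?Y (Dom ?Y g1) (Dom ?Y W1)"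
        using g1 V LO k \<delta>k e2 \<nu> by (simp add: hom_fibre hom_comma W1_def Ls hF' hE flip: \<nu>_def)
      moreover have "Comp ?Y W1 (V, W, (k, Id E e2)) = g1"
        by (rule comma_arr_eqI) (use g1 e2 wk1 in \<open>simp_all add: W1_def\<close>)
      moreover have "Comp ?Y W2 (V, W, (k, Id E e2)) = g2"
        by (rule comma_arr_eqI) (use g2 e2 wk2 in \<open>simp_all add: W2_def\<close>)
      ultimately show "(V, W, (k, Id E e2)) \<in> hom ?Y (Dom ?Y g1) (Dom ?Y W1) \<and> Comp ?Y W1 (V, W, (k, Id E e2)) = g1 \<and>
        Comp ?Y W2 (V, W, (k, Id E e2)) = g2" by blast
      fix h assume h: "h \<in> hom ?Y (Dom ?Y g1) (Dom ?Y W1) \<and> Comp ?Y W1 h = g1 \<and> Comp ?Y W2 h = g2"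
      then have hh: "fst h = V" "fst (snd h) = W" "rg h = Id E e2" "lf h \<in> hom F' (fst V) x"
        using g1 by (auto simp: hom_fibre hom_comma W1_def Ls)
      have "lf (Comp ?Y W1 h) = lf g1" using h by simp
      then have hw: "Comp F' w1 (lf h) = lf g1" by (simp add: W1_def)
      have "Comp F' (Comp F' u1 w1) (lf h) = k"
        unfolding k_def hw[symmetric] using hh(4) w1(1-3) l1(4-6) by (simp add: hF' Y.D.assoc)
      then have "lf h = k" using hh(4) w1(5) by (simp add: hF')
      then show "h = (V, W, (k, Id E e2))" using hh by (simp add: prod_eq_iff)
    qed
  qed (auto simp: N1_def N2_def W1_def W2_def)
  let ?X = "ess_fibre X.X E comma_right e2" and ?A = "fibre_fctr Y.X A \<theta>"
  have XX: "pullback ?X (FArr ?A N1) (FArr ?A N2) (FArr ?A W1) (FArr ?A W2)"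
    by (rule preserves_pullback[OF objD(6)[OF e2] cat_functor_fibre_A[OF e2] WW])
  have zO: "z \<in> Obj F" using a by auto
  define iy where "iy = inverse_arr E (\<theta> y)"
  note th = \<theta>[OF y]
  have iy: "iy \<in> Arr E" "Dom E iy = e" "Cod E iy = fst (snd (FObj A y))" "Comp E iy (\<theta> y) = Id E (fst (snd (FObj A y)))"
    using inverse_arr[OF th(4)] th by (auto simp: iy_def ys)
  have fiy: "Comp F (FArr f_inv iy) (FArr f_inv (\<theta> y)) = Id F (FObj f_inv (fst (snd (FObj A y))))"
    using X.FArr_Comp_arr[of "\<theta> y" iy] iy th AO[OF y] by (simp add: ys)
  \<comment> \<open>The structure arrow of \<open>FObj A y\<close> ends over the base object of
    \<open>FObj A y\<close>; the image of \<open>\<theta> y\<close> moves it over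
    \<open>e\<close>.\<close>
  define ua where "ua c = Comp F (FArr f_inv (\<theta> y)) (Comp F (snd (snd (FObj A y))) c)" for c
  have ua: "ua c \<in> Arr F" "Dom F (ua c) = z" "Cod F (ua c) = FObj f_inv e" "Comp F (FArr f_inv iy) (ua c) = Comp F (snd (snd (FObj A y))) c"
    if c: "c \<in> Arr F" "Dom F c = z" "Cod F c = fst (FObj A y)" for c
    using c AO[OF y] th iy(1-3) fiy by (simp_all add: ua_def ys flip: X.D.assoc)
  have "Comp F (FArr f_inv (bangE e)) (ua a) = Comp F (FArr f_inv (bangE e)) (ua b)"
    using ua[OF a] ua[OF b] bangE[OF e] zO by (intro terminal_unique[OF term_F[OF t]]) auto
  \<comment> \<open>The two arrows \<open>ua a\<close> and \<open>ua b\<close> combine to an arrow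
    into the inverse image of the product \<open>e2\<close>. It makes \<open>z\<close> an object
    \<open>Z\<close> over \<open>e2\<close>, from which both \<open>a\<close> and \<open>b\<close>
    can be lifted.\<close>
  then have "\<exists>!h. h \<in> hom F (Dom F (ua a)) (Dom F (FArr f_inv p1)) \<and> Comp F (FArr f_inv p1) h = ua a \<and> Comp F (FArr f_inv p2) h = ua b"
    using ua[OF a] ua[OF b] bangE[OF e] by (intro pullback_ex1[OF fpp]) auto
  then obtain \<xi> where \<xi>: "\<xi> \<in> Arr F" "Dom F \<xi> = z" "Cod F \<xi> = FObj f_inv e2" "Comp F (FArr f_inv p1) \<xi> = ua a" "Comp F (FArr f_inv p2) \<xi> = ua b"
    using ua[OF a] p by (auto simp: hF)
  define Z where "Z = (z, e2, \<xi>)"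
  have Zs: "fst Z = z" "fst (snd Z) = e2" "snd (snd Z) = \<xi>" by (simp_all add: Z_def)
  have Z: "Z \<in> Obj X.X" using zO e2 \<xi> by (simp add: Obj_comma Zs hF)
  \<comment> \<open>The images of \<open>c1\<close> and \<open>c2\<close> are cartesian, so
    \<open>a\<close> and \<open>b\<close> lift to arrows from \<open>Z\<close> to the images of the
    two lifts of \<open>y\<close>. The right parts are prescribed so that these arrows belong to the
    essential fibre over \<open>e2\<close>.\<close>
  have lift: "\<exists>r \<in> hom X.X Z (FObj A L). Comp F (lf (FArr A c)) (lf r) = v \<and> rg r = inverse_arr E (\<theta> L)"
    if c: "c \<in> Arr Y.X" "fst c = L" "fst (snd c) = y" "rg c = pp" and L: "L \<in> Obj Y.X" "fst (snd L) = e2"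
      and pb: "pullback F' (FArr f'_inv pp) \<alpha> (snd (snd L)) (lf c)"
      and pp: "pp \<in> Arr E" "Dom E pp = e2" "Cod E pp = e" "Comp F (FArr f_inv pp) \<xi> = ua v"
      and v: "v \<in> Arr F" "Dom F v = z" "Cod F v = fst (FObj A y)" for L c pp v
  proof -
    note iL = inverse_arr[OF \<theta>(4)[OF L(1)]] and tL = \<theta>[OF L(1)]
    have "Comp E (Comp E (\<theta> y) (rg (FArr A c))) (inverse_arr E (\<theta> L)) = Comp E (Comp E pp (\<theta> L)) (inverse_arr E (\<theta> L))"
      using \<theta>_nat[OF c(1)] c by simp
    also have "\<dots> = pp" using pp L by (intro Y.C.Comp_inverse_cancel(3) tL) (auto simp: tL)
    finally have "Comp E iy (Comp E (Comp E (\<theta> y) (rg (FArr A c))) (inverse_arr E (\<theta> L))) = Comp E iy pp" by simp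
    then have 1: "Comp E (rg (FArr A c)) (inverse_arr E (\<theta> L)) = Comp E iy pp"
      unfolding iy_def using AA[OF c(1)] c iL tL th by (simp add: Y.C.assoc Y.C.Comp_inverse_cancel)
    let ?B = "(Z, FObj A y, (v, Comp E iy pp))"
    have "Comp F (FArr f_inv (Comp E iy pp)) \<xi> = Comp F (FArr f_inv iy) (ua v)"
      unfolding pp(4)[symmetric] using pp(1-3) iy \<xi>(1-3) by (simp add: X.FArr_Comp_arr X.D.assoc)
    then have B: "?B \<in> hom X.X Z (FObj A (fst (snd c)))"
      using Z A.FObj_in[OF y] v iy pp ua(4)[OF v] c by (simp add: hom_comma Zs hF hE)
    obtain r where r: "r \<in> hom X.X Z (FObj A L)" "Comp X.X (FArr A c) r = ?B" "rg r = inverse_arr E (\<theta> L)"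
      using A_cartesian(1)[OF c(1) _ B, of "inverse_arr E (\<theta> L)"] pb c 1 iL tL L by (auto simp: ys Zs hE)
    have "Comp F (lf (FArr A c)) (lf r) = v" using r(2) by simp
    then show ?thesis using r by blast
  qed
  obtain r1 where r1: "r1 \<in> hom X.X Z (FObj A L1)" "Comp F (lf (FArr A c1)) (lf r1) = a" "rg r1 = inverse_arr E (\<theta> L1)"
    using lift[OF cs(1), of L1 p1 a] LO(1) pb1 p a \<xi> by (auto simp: Ls c1_def)
  obtain r2 where r2: "r2 \<in> hom X.X Z (FObj A L2)" "Comp F (lf (FArr A c2)) (lf r2) = b" "rg r2 = inverse_arr E (\<theta> L2)"
    using lift[OF cs(2), of L2 p2 b] LO(2) pb2 p b \<xi> by (auto simp: Ls c2_def)
  have rgN: "Comp E (rg (FArr A N)) (inverse_arr E (\<theta> L)) = inverse_arr E (\<theta> M)"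
    if N: "N \<in> Arr Y.X" "fst N = L" "fst (snd N) = M" "rg N = Id E e2" "L \<in> Obj Y.X" "fst (snd L) = e2" for N L
  proof -
    note iL = inverse_arr[OF \<theta>(4)[OF N(5)]] and tL = \<theta>[OF N(5)] and iM = inverse_arr[OF \<theta>(4)[OF LO(3)]] and tM = \<theta>[OF LO(3)]
    have "Comp E (\<theta> M) (rg (FArr A N)) = \<theta> L" using \<theta>_nat[OF N(1)] N tL by simp
    then have "Comp E (\<theta> M) (Comp E (rg (FArr A N)) (inverse_arr E (\<theta> L))) = Comp E (\<theta> M) (inverse_arr E (\<theta> M))"
      using AA[OF N(1)] N tM tL iL iM by (simp add: Ls flip: Y.C.assoc)
    then show ?thesis
      using AA[OF N(1)] N tM tL iL iM by - (rule Y.C.iso_cancel_left[OF tM(4)], auto simp: Ls)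
  qed
  have N1r: "Comp X.X (FArr A N1) r1 \<in> hom X.X Z (FObj A M)"
    by (rule X.X.Comp_in_hom[OF r1(1)]) (use AA(1-3)[OF cs(4)] in \<open>auto simp: hom_iff[of _ X.X] N1_def\<close>)
  have N2r: "Comp X.X (FArr A N2) r2 \<in> hom X.X Z (FObj A M)"
    by (rule X.X.Comp_in_hom[OF r2(1)]) (use AA(1-3)[OF cs(5)] in \<open>auto simp: hom_iff[of _ X.X] N2_def\<close>)
  have sq1: "Comp F (lf (FArr A cM)) (lf (FArr A N1)) = Comp F (m y) (lf (FArr A c1))"
    unfolding m_def using cs bar[OF y] n1(5) l1 bb p(1-3) bangE[OF e2]
    by (intro A_square) (auto simp: cM_def N1_def c1_def ys)
  have sq2: "Comp F (lf (FArr A cM)) (lf (FArr A N2)) = Comp F (m y) (lf (FArr A c2))"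
    unfolding m_def using cs bar[OF y] n2(5) l2 bb p(4-6) bangE[OF e2]
    by (intro A_square) (auto simp: cM_def N2_def c2_def ys)
  have r1D: "lf r1 \<in> Arr F" "Dom F (lf r1) = z" "Cod F (lf r1) = fst (FObj A L1)" "fst r1 = Z"
    and r2D: "lf r2 \<in> Arr F" "Dom F (lf r2) = z" "Cod F (lf r2) = fst (FObj A L2)" "fst r2 = Z"
    using r1(1) r2(1) by (auto simp: hom_comma hF Zs)
  have l3: "Comp F (lf (FArr A cM)) (Comp F (lf (FArr A N1)) (lf r1)) = Comp F (m y) a"
    unfolding r1(2)[symmetric] using sq1 AA(4-6)[OF cs(3)] AA(4-6)[OF cs(4)] AA(4-6)[OF cs(1)] m[OF y] r1D
    by (simp add: cM_def N1_def c1_def flip: X.D.assoc)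
  have l4: "Comp F (lf (FArr A cM)) (Comp F (lf (FArr A N2)) (lf r2)) = Comp F (m y) b"
    unfolding r2(2)[symmetric] using sq2 AA(4-6)[OF cs(3)] AA(4-6)[OF cs(5)] AA(4-6)[OF cs(2)] m[OF y] r2D
    by (simp add: cM_def N2_def c2_def flip: X.D.assoc)
  have rgr: "rg (Comp X.X (FArr A N1) r1) = inverse_arr E (\<theta> M)" "rg (Comp X.X (FArr A N2) r2) = inverse_arr E (\<theta> M)"
    using rgN[OF cs(4), of L1] rgN[OF cs(5), of L2] r1(3) r2(3) LO by (auto simp: N1_def N2_def Ls)
  have cMf: "fst cM = M" "fst (snd cM) = top x" by (simp_all add: cM_def)
  \<comment> \<open>This is where \<open>ab\<close> enters: the composites to the image of
    \<open>M\<close> agree after the image of the cartesian arrow \<open>cM\<close>, and they have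
    the same right part, hence they agree.\<close>
  have eqc: "Comp X.X (FArr A cM) (Comp X.X (FArr A N2) r2) = Comp X.X (FArr A cM) (Comp X.X (FArr A N1) r1)"
    by (rule comma_arr_eqI) (use r1D r2D l3 l4 ab rgr in auto)
  have "Comp X.X (FArr A N1) r1 = Comp X.X (FArr A N2) r2"
  proof (rule A_cartesian(2)[OF cs(3) _ _ _ _ _ _ refl eqc])
    show "pullback F' (FArr f'_inv (rg cM)) (snd (snd (fst (snd cM)))) (snd (snd (fst cM))) (lf cM)"
      using pbm by (simp add: cM_def Ls)
    show "Comp X.X (FArr A cM) (Comp X.X (FArr A N1) r1) \<in> hom X.X Z (FObj A (fst (snd cM)))"
      by (rule X.X.Comp_in_hom[OF N1r]) (use AA(1-3)[OF cs(3)] in \<open>auto simp: hom_iff[of _ X.X] cMf\<close>)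
    show "rg (Comp X.X (FArr A N1) r1) \<in> hom E (fst (snd Z)) (fst (snd (FObj A (fst cM))))"
      using N1r by (simp only: hom_comma cMf)
  qed (use N1r N2r rgr in \<open>simp_all only: cMf\<close>, simp)
  then have NN: "Comp X.X (FArr A N1) r1 = Comp X.X (FArr A N2) r2" .
  define R1 R2 where "R1 = ((Z, Id E e2), (FObj A L1, \<theta> L1), r1)" and "R2 = ((Z, Id E e2), (FObj A L2, \<theta> L2), r2)"
  have Ro: "(Z, Id E e2) \<in> Obj ?X" using Z e2 by (simp add: Obj_ess_fibre Zs hE Y.C.iso_Id)
  have AL: "(FObj A L, \<theta> L) \<in> Obj ?X" if "L \<in> Obj Y.X" "fst (snd L) = e2" for L
    using A.FObj_in[OF that(1)] \<theta>[OF that(1)] that(2) by (simp add: Obj_ess_fibre hE)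
  have R1: "R1 \<in> hom ?X (Z, Id E e2) (FObj A L1, \<theta> L1)" and R2: "R2 \<in> hom ?X (Z, Id E e2) (FObj A L2, \<theta> L2)"
    using Ro AL[OF LO(1)] AL[OF LO(2)] r1 r2 inverse_arr(6)[OF \<theta>(4)[OF LO(1)]] inverse_arr(6)[OF \<theta>(4)[OF LO(2)]]
      \<theta>(3)[OF LO(1)] \<theta>(3)[OF LO(2)]
    by (auto simp: R1_def R2_def hom_ess_fibre Ls)
  \<comment> \<open>The preserved pullback yields one arrow from \<open>Z\<close> to the image of
    \<open>W\<close> through which both lifts factor. Thus \<open>a\<close> and \<open>b\<close> are
    the images of \<open>q1\<close> and \<open>q2\<close>, on left parts, after the same
    arrow.\<close>
  have "\<exists>!h. h \<in> hom ?X (Dom ?X R1) (Dom ?X (FArr ?A W1)) \<and> Comp ?X (FArr ?A W1) h = R1 \<and> Comp ?X (FArr ?A W2) h = R2"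
  proof (rule pullback_ex1[OF XX])
    show "R1 \<in> Arr ?X" "R2 \<in> Arr ?X" using R1 R2 by (simp_all only: hom_iff[of _ ?X])
    show "Comp ?X (FArr ?A N1) R1 = Comp ?X (FArr ?A N2) R2"
      using NN by (simp add: R1_def R2_def) (simp add: N1_def N2_def)
  qed (simp_all add: R1_def R2_def N1_def N2_def)
  then obtain h where h: "h \<in> hom ?X (Dom ?X R1) (Dom ?X (FArr ?A W1))" "Comp ?X (FArr ?A W1) h = R1" "Comp ?X (FArr ?A W2) h = R2" by blast
  define r where "r = lf (snd (snd h))"
  have r: "r \<in> Arr F" "Dom F r = z" "Cod F r = fst (FObj A W)"
    using h(1) by (auto simp: hom_ess_fibre hom_comma hF r_def R1_def W1_def Zs)
  have Wr: "Comp F (lf (FArr A W1)) r = lf r1" "Comp F (lf (FArr A W2)) r = lf r2"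
    using h(2,3) by (auto simp: R1_def R2_def r_def)
  have cW: "lf (FArr A q1) = Comp F (lf (FArr A c1)) (lf (FArr A W1))" "lf (FArr A q2) = Comp F (lf (FArr A c2)) (lf (FArr A W2))"
    using cs w1(5) w2(5) p by (auto intro!: A_Comp(2) simp: c1_def W1_def c2_def W2_def q1_def q2_def)
  have "a = Comp F (lf (FArr A q1)) r"
    unfolding cW r1(2)[symmetric] Wr(1)[symmetric] using AA(4-6)[OF cs(1)] AA(4-6)[OF cs(6)] r
    by (simp add: c1_def W1_def X.D.assoc)
  also have "\<dots> = Comp F (lf (FArr A q2)) r" by (simp add: q)
  also have "\<dots> = b"
    unfolding cW r2(2)[symmetric] Wr(2)[symmetric] using AA(4-6)[OF cs(2)] AA(4-6)[OF cs(7)] r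
    by (simp add: c2_def W2_def X.D.assoc)
  finally show "a = b" .
qed

end

section \<open>The 2-isomorphism and essential surjectivity\<close>

context fib_object begin

lemma m_iso:
  assumes y: "y \<in> Obj Y.X"
  shows "iso_arr F (m y)"
  by (rule effective_mono_epi_iso[OF X.D.category_axioms eff])
    (use m[OF y] m_epi[OF y] m_mono[OF y] in auto)

text \<open>The terminal object of the fibre over \<open>e\<close>.\<close>

definition tot where "tot e = (FObj f'_inv e, e, Id F' (FObj f'_inv e))"

lemma tot_simps [simp]: "fst (tot e) = FObj f'_inv e" "fst (snd (tot e)) = e" "snd (snd (tot e)) = Id F' (FObj f'_inv e)"
  by (simp_all add: tot_def)

lemma tot: "e \<in> Obj E \<Longrightarrow> tot e \<in> Obj Y.X"
  by (simp add: Obj_comma hF')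

text \<open>Since \<open>tot e\<close> is terminal in its fibre, so is its image; but \<open>(f* d, d, 1)\<close> is another
  terminal object of that fibre.\<close>

lemma struct_iso:
  assumes e: "e \<in> Obj E"
  shows "iso_arr F (snd (snd (FObj A (tot e))))"
proof -
  let ?T = "tot e" and ?X = "ess_fibre X.X E comma_right e"
  let ?d = "fst (snd (FObj A ?T))" and ?g = "snd (snd (FObj A ?T))"
  note To = tot[OF e] and tD = AO[OF tot[OF e]]
  have "terminal (fibre Y.X E comma_right e) ?T"
    unfolding terminal_def
  proof (intro conjI ballI)
    show "?T \<in> Obj (fibre Y.X E comma_right e)" using To by (simp add: Obj_fibre)
    fix y assume "y \<in> Obj (fibre Y.X E comma_right e)"
    then have y: "y \<in> Obj Y.X" "fst (snd y) = e" by (auto simp: Obj_fibre)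
    note yD = YO[OF y(1)]
    show "\<exists>!u. u \<in> hom (fibre Y.X E comma_right e) y ?T"
    proof (rule ex1I[of _ "(y, ?T, (snd (snd y), Id E e))"])
      show "(y, ?T, (snd (snd y), Id E e)) \<in> hom (fibre Y.X E comma_right e) y ?T"
        using yD y To e by (simp add: hom_fibre hom_comma hF' hE)
      fix u assume u: "u \<in> hom (fibre Y.X E comma_right e) y ?T"
      show "u = (y, ?T, (snd (snd y), Id E e))"
        by (rule comma_arr_eqI) (use u yD y e in \<open>auto simp: hom_fibre hom_comma hF'\<close>)
    qed
  qed
  then have "terminal ?X (FObj (fibre_fctr Y.X A \<theta>) ?T)"
    by (rule preserves_terminal[OF objD(6)[OF e] category_fibre[OF Y.cat_functor_right e] category_ess_fibre[OF X.cat_functor_right]])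
  then have AT: "terminal ?X (FObj A ?T, \<theta> ?T)" by simp
  then have ATo: "(FObj A ?T, \<theta> ?T) \<in> Obj ?X" by (simp add: terminal_def)
  let ?S = "(FObj f_inv ?d, ?d, Id F (FObj f_inv ?d))"
  have S: "?S \<in> Obj X.X" using tD by (simp add: Obj_comma hF)
  have "(?S, \<theta> ?T) \<in> Obj ?X" using S ATo by (simp add: Obj_ess_fibre)
  then obtain w where w: "w \<in> hom ?X (?S, \<theta> ?T) (FObj A ?T, \<theta> ?T)" using terminal_ex[OF AT] by blast
  let ?w = "lf (snd (snd w))"
  have "Comp E (\<theta> ?T) (rg (snd (snd w))) = Comp E (\<theta> ?T) (Id E ?d)" "rg (snd (snd w)) \<in> hom E ?d ?d"
    using w \<theta>[OF To] by (auto simp: hom_ess_fibre hom_comma)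
  then have rw: "rg (snd (snd w)) = Id E ?d"
    using \<theta>[OF To] tD by - (rule Y.C.iso_cancel_left[OF \<theta>(4)[OF To]], auto simp: hE)
  have wh: "?w \<in> Arr F" "Dom F ?w = FObj f_inv ?d" "Cod F ?w = fst (FObj A ?T)" "Comp F ?g ?w = Id F (FObj f_inv ?d)"
    using w rw tD by (auto simp: hom_ess_fibre hom_comma hF)
  \<comment> \<open>The arrow \<open>w\<close> provides a right inverse of the structure arrow. That
    it is also a left inverse is read from two endomorphisms of the terminal object, which have to
    coincide.\<close>
  have gwg: "Comp F ?g (Comp F ?w ?g) = ?g"
    using wh tD X.D.assoc[of ?g ?w ?g] by simp
  have "((FObj A ?T, \<theta> ?T), (FObj A ?T, \<theta> ?T), (FObj A ?T, FObj A ?T, (Comp F ?w ?g, Id E ?d))) \<in> hom ?X (FObj A ?T, \<theta> ?T) (FObj A ?T, \<theta> ?T)"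
    using ATo wh(1-3) tD gwg \<theta>[OF To] A.FObj_in[OF To] by (simp add: hom_ess_fibre hom_comma hF hE)
  moreover have "((FObj A ?T, \<theta> ?T), (FObj A ?T, \<theta> ?T), (FObj A ?T, FObj A ?T, (Id F (fst (FObj A ?T)), Id E ?d))) \<in> hom ?X (FObj A ?T, \<theta> ?T) (FObj A ?T, \<theta> ?T)"
    using ATo tD \<theta>[OF To] A.FObj_in[OF To] by (simp add: hom_ess_fibre hom_comma hF hE)
  ultimately have "((FObj A ?T, \<theta> ?T), (FObj A ?T, \<theta> ?T), (FObj A ?T, FObj A ?T, (Comp F ?w ?g, Id E ?d))) =
    ((FObj A ?T, \<theta> ?T), (FObj A ?T, \<theta> ?T), (FObj A ?T, FObj A ?T, (Id F (fst (FObj A ?T)), Id E ?d)))"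
    using AT ATo unfolding terminal_def by blast
  then have "Comp F ?w ?g = Id F (fst (FObj A ?T))" by simp
  then show ?thesis
    using wh tD by (intro iso_arrI[of ?g F "fst (FObj A ?T)" "FObj f_inv ?d" ?w]) (auto simp: hF)
qed

text \<open>Forced by the requirement that the pairs of \<open>m\<close> and \<open>\<theta>\<close>
  form an arrow from \<open>A\<close> to the induced functor: the structure arrow of the induced
  object at \<open>tot e\<close> is the 2-isomorphism itself.\<close>

definition phi where
  "phi e = Comp F (Comp F (FArr f_inv (\<theta> (tot e))) (snd (snd (FObj A (tot e))))) (inverse_arr F (m (tot e)))"

lemma phi:
  assumes e: "e \<in> Obj E"
  shows "phi e \<in> Arr F" "Dom F (phi e) = FObj G (FObj f'_inv e)" "Cod F (phi e) = FObj f_inv e" "iso_arr F (phi e)"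
    "Comp F (phi e) (m (tot e)) = Comp F (FArr f_inv (\<theta> (tot e))) (snd (snd (FObj A (tot e))))"
proof -
  note To = tot[OF e]
  note d = AO[OF To] m[OF To] \<theta>[OF To] inverse_arr[OF m_iso[OF To]]
  show "phi e \<in> Arr F" "Dom F (phi e) = FObj G (FObj f'_inv e)" "Cod F (phi e) = FObj f_inv e"
    unfolding phi_def using d by simp_all
  show "Comp F (phi e) (m (tot e)) = Comp F (FArr f_inv (\<theta> (tot e))) (snd (snd (FObj A (tot e))))"
    unfolding phi_def by (rule X.D.Comp_inverse_cancel(4)[OF m_iso[OF To]]) (use d in simp_all)
  show "iso_arr F (phi e)"
    unfolding phi_def
    by (intro X.D.iso_Comp iso_inverse_arr m_iso[OF To] struct_iso[OF e] X.iso_FArr(1)) (use d in simp_all)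
qed

text \<open>One computation with two uses: arrows between terminal objects of fibres give naturality
  of \<open>phi\<close>, and vertical arrows from any \<open>y\<close> to the terminal object of its
  fibre show that \<open>m\<close> respects structure arrows.\<close>

lemma phi_m:
  assumes k: "k \<in> Arr Y.X" and e: "e \<in> Obj E" and cod: "fst (snd k) = tot e"
  shows "Comp F (Comp F (phi e) (FArr G (lf k))) (m (fst k)) =
    Comp F (FArr f_inv (rg k)) (Comp F (FArr f_inv (\<theta> (fst k))) (snd (snd (FObj A (fst k)))))"
proof -
  note To = tot[OF e] and kD = YA[OF k] and aD = AA[OF k] and p = phi[OF e]
  note yD = AO[OF kD(1)] and tD = AO[OF To]
  have "Comp F (Comp F (phi e) (FArr G (lf k))) (m (fst k)) = Comp F (phi e) (Comp F (m (tot e)) (lf (FArr A k)))"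
    using m_natural[OF k] kD(1-5) p(1-3) m[OF kD(1)] cod G.FArr_arr[OF kD(3)] by (simp add: X.D.assoc del: G_simps(2))
  also have "\<dots> = Comp F (Comp F (FArr f_inv (\<theta> (tot e))) (snd (snd (FObj A (tot e))))) (lf (FArr A k))"
    using p(1-3) m[OF To] aD(4-6) cod by (simp flip: p(5) add: X.D.assoc)
  also have "\<dots> = Comp F (Comp F (FArr f_inv (\<theta> (tot e))) (FArr f_inv (rg (FArr A k)))) (snd (snd (FObj A (fst k))))"
    using aD(4-10) tD \<theta>[OF To] cod yD by (simp add: X.D.assoc)
  also have "Comp F (FArr f_inv (\<theta> (tot e))) (FArr f_inv (rg (FArr A k))) = FArr f_inv (Comp E (\<theta> (tot e)) (rg (FArr A k)))"
    using aD(7-9) \<theta>[OF To] cod by (intro X.FArr_Comp_arr[symmetric]) auto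
  also have "\<dots> = Comp F (FArr f_inv (rg k)) (FArr f_inv (\<theta> (fst k)))"
    using \<theta>_nat[OF k] cod \<theta>[OF kD(1)] kD(6-8) by (simp add: X.FArr_Comp_arr)
  finally show ?thesis using \<theta>[OF kD(1)] kD(6-8) yD by (simp add: X.D.assoc)
qed

lemma phi_nat_iso: "nat_iso E F (G \<circ>\<^sub>F f'_inv) f_inv (\<lambda>e\<in>Obj E. phi e)"
proof (intro nat_isoI nat_transI cat_functor_comp[OF Y.cat_functor_axioms G.cat_functor_axioms] X.cat_functor_axioms)
  fix v assume v: "v \<in> Arr E"
  let ?e = "Dom E v" and ?d = "Cod E v"
  let ?k = "(tot ?e, tot ?d, (FArr f'_inv v, v))"
  have o: "?e \<in> Obj E" "?d \<in> Obj E" using v by auto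
  note To = tot[OF o(1)]
  have k: "?k \<in> Arr Y.X" using v tot[OF o(1)] tot[OF o(2)] by (simp add: Arr_comma hF' hE)
  have "Comp F (Comp F (phi ?d) (FArr G (FArr f'_inv v))) (m (tot ?e)) = Comp F (FArr f_inv v) (Comp F (phi ?e) (m (tot ?e)))"
    using phi_m[OF k o(2)] phi(5)[OF o(1)] by (simp del: G_simps)
  also have "\<dots> = Comp F (Comp F (FArr f_inv v) (phi ?e)) (m (tot ?e))"
    using v phi(1-3)[OF o(1)] m[OF To] by (simp add: X.D.assoc)
  finally have "Comp F (phi ?d) (FArr G (FArr f'_inv v)) = Comp F (FArr f_inv v) (phi ?e)"
    using v phi(1-3)[OF o(1)] phi(1-3)[OF o(2)] m[OF To] G.FArr_arr[of "FArr f'_inv v"]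
    by - (rule X.D.iso_cancel_right[OF m_iso[OF To]], simp_all del: G_simps(2))
  then show "Comp F ((\<lambda>e\<in>Obj E. phi e) (Cod E v)) (FArr (G \<circ>\<^sub>F f'_inv) v) = Comp F (FArr f_inv v) ((\<lambda>e\<in>Obj E. phi e) (Dom E v))"
    using o by (simp del: G_simps)
qed (use phi in \<open>auto simp: hF simp del: G_simps\<close>)

lemma comparison_essentially_surjective:
  assumes g: "geometric_morphism F F' g" and gG: "inv_im g = G"
  shows "\<exists>c \<in> Obj Slice. \<exists>i \<in> hom Fib (FObj comparison c) (A, \<theta>). iso_arr Fib i"
proof -
  define c where "c = (g, \<lambda>e\<in>Obj E. phi e)"
  have c: "c \<in> slice_obj F F' E f f'" using g phi_nat_iso by (simp add: c_def slice_obj_iff gG)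
  have co: "comparison_obj c \<in> Obj Fib" by (rule comparison_obj_in[OF c])
  note coD = fib_cart_cov_objD[OF co[simplified]]
  interpret B: cat_functor Y.X X.X "fst (comparison_obj c)" by (rule coD)
  \<comment> \<open>The transformation from \<open>A\<close> to the induced functor; since
    \<open>m\<close> and \<open>\<theta>\<close> are invertible, its inverse is the isomorphism
    asked for.\<close>
  define \<tau> where "\<tau> = (\<lambda>y\<in>Obj Y.X. (FObj A y, FObj (fst (comparison_obj c)) y, (m y, \<theta> y)))"
  have tau: "(FObj A y, FObj (fst (comparison_obj c)) y, (m y, \<theta> y)) \<in> hom X.X (FObj A y) (FObj (fst (comparison_obj c)) y)"
    if y: "y \<in> Obj Y.X" for y
  proof -
    note yD = YO[OF y]
    \<comment> \<open>The arrow from \<open>y\<close> to the terminal object of its fibre, whose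
      left part is the structure arrow of \<open>y\<close>.\<close>
    let ?k = "(y, tot (fst (snd y)), (snd (snd y), Id E (fst (snd y))))"
    have "?k \<in> Arr Y.X" using y yD tot[OF yD(2)] by (simp add: Arr_comma hF' hE)
    from phi_m[OF this yD(2)]
    have "Comp F (Comp F (phi (fst (snd y))) (FArr G (snd (snd y)))) (m y) = Comp F (FArr f_inv (\<theta> y)) (snd (snd (FObj A y)))"
      using yD \<theta>[OF y] AO[OF y] by (simp del: G_simps)
    then show ?thesis
      using y yD A.FObj_in[OF y] B.FObj_in[OF y] m[OF y] \<theta>[OF y]
      by (simp add: hom_comma hF hE comparison_obj_def c_def gG del: G_simps)
  qed
  have "nat_trans Y.X X.X A (fst (comparison_obj c)) \<tau>"
  proof (rule nat_transI[OF A.cat_functor_axioms B.cat_functor_axioms])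
    show "\<tau> y \<in> hom X.X (FObj A y) (FObj (fst (comparison_obj c)) y)" if "y \<in> Obj Y.X" for y
      using tau[OF that] that by (simp add: \<tau>_def)
    show "\<tau> \<in> extensional (Obj Y.X)" by (simp add: \<tau>_def)
    fix k assume k: "k \<in> Arr Y.X"
    note kD = YA[OF k] and aD = AA[OF k]
    show "Comp X.X (\<tau> (Cod Y.X k)) (FArr A k) = Comp X.X (FArr (fst (comparison_obj c)) k) (\<tau> (Dom Y.X k))"
      by (rule comma_arr_eqI)
        (use kD aD m_natural[OF k] \<theta>_nat[OF k] in \<open>simp_all add: \<tau>_def comparison_obj_def c_def gG del: G_simps\<close>)
  qed
  moreover have "Comp E (snd (comparison_obj c) y) (FArr comma_right (\<tau> y)) = \<theta> y" if y: "y \<in> Obj Y.X" for y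
    using \<theta>[OF y] y by (simp add: \<tau>_def comparison_obj_def)
  ultimately have b: "((A, \<theta>), comparison_obj c, \<tau>) \<in> hom Fib (A, \<theta>) (comparison_obj c)"
    using obj co by (simp add: hom_fib_cart_cov)
  have "iso_arr X.X (\<tau> y)" if y: "y \<in> Obj Y.X" for y
  proof (rule X.iso_comma)
    show "\<tau> y \<in> Arr X.X" using tau[OF y] y by (simp add: \<tau>_def hom_iff[of _ X.X])
  qed (use y m_iso[OF y] \<theta>(4)[OF y] in \<open>simp_all add: \<tau>_def\<close>)
  then have iso: "iso_arr Fib ((A, \<theta>), comparison_obj c, \<tau>)"
    by (intro iso_fib_cart_cov[OF b]) simp
  show ?thesis
  proof (intro bexI)
    show "iso_arr Fib (inverse_arr Fib ((A, \<theta>), comparison_obj c, \<tau>))" by (rule iso_inverse_arr[OF iso])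
    show "inverse_arr Fib ((A, \<theta>), comparison_obj c, \<tau>) \<in> hom Fib (FObj comparison c) (A, \<theta>)"
      using inverse_arr[OF iso] by (simp add: hom_iff[of _ Fib] comparison_simps)
    show "c \<in> Obj Slice" using c by simp
  qed
qed

end

theorem corollary3p4:
  fixes E :: "('oe, 'ae) cat" and F :: "('of, 'af) cat" and F' :: "('og, 'ag) cat"
    and f :: "('of, 'af, 'oe, 'ae) geom" and f' :: "('og, 'ag, 'oe, 'ae) geom"
  assumes "universe TYPE('u)"
    and "grothendieck_topos TYPE('u) E"
    and "grothendieck_topos TYPE('u) F"
    and "grothendieck_topos TYPE('u) F'"
    and "geometric_morphism F E f"
    and "geometric_morphism F' E f'"
  shows "equivalent_cats
    (topos_slice_hom F F' E f f')
    (fib_cart_cov E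
      (comma_cat F' E (inv_im f')) comma_right (relative_topology F' E f')
      (comma_cat F E (inv_im f)) comma_right (relative_topology F E f))"
proof -
  note eE = grothendieck_topos_exact[OF assms(1,2)] and eF = grothendieck_topos_exact[OF assms(1,3)]
    and eF' = grothendieck_topos_exact[OF assms(1,4)]
  interpret slice_comparison E F F' f f' by (rule slice_comparison.intro[OF assms(5,6)])
  obtain t where t: "terminal E t" using eE(2) by blast
  have "\<exists>c \<in> Obj Slice. \<exists>i \<in> hom Fib (FObj comparison c) x. iso_arr Fib i" if x: "x \<in> Obj Fib" for x
  proof -
    obtain A \<theta> where Ax: "x = (A, \<theta>)" by (cases x)
    interpret fib_object E F F' f f' A \<theta> t
      by unfold_locales (use x t eE(3) eF(4) eF'(3) in \<open>simp_all add: Ax\<close>)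
    \<comment> \<open>Only the right adjoint is chosen here; the inverse image is equal to
      \<open>G\<close> and not merely isomorphic to it, so \<open>phi\<close> applies to it
      directly.\<close>
    obtain g where "geometric_morphism F F' g" "inv_im g = G"
      using geometric_morphism_from_universal_arrows[OF cat_functor_G G_lex
          grothendieck_topos_universal_arrows[OF assms(1,4,3) cat_functor_G G_lex G_epimorphic]] by blast
    then show ?thesis unfolding Ax by (rule comparison_essentially_surjective)
  qed
  then have "weak_equivalence Slice Fib comparison"
    unfolding weak_equivalence_def
    using cat_functor_comparison comparison_full_faithful[OF t] by blast
  then show ?thesis by (rule weak_equivalence_equivalent_cats)
qed

end
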